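(* Let $m\geq2$ and assume that the non-empty open set $\Omega\subseteq\mathbb{R}^m$ satisfies the $(p,1)$-Poincaré inequality for some $1<p\leq1^*=\frac{m}{m-1}$. Then the bounded linear operator $$\mathbf{div}:C_0(\Omega;\mathbb{R}^m)\to SCH_{0,\mathcal{W},p}(\Omega),\qquad\langle[u],\mathbf{div}\,v\rangle=-\sum_{i=1}^m\int_\Omega v_i\,d(D_iu),$$ is surjective. Furthermore, for every $\varepsilon>0$ there exists a (non-linear) map $\mathbf{I}:SCH_{0,\mathcal{W},p}(\Omega)\to C_0(\Omega;\mathbb{R}^m)$ such that (a) $(\mathbf{div}\circ\mathbf{I})(F)=F$ for all $F\in SCH_{0,\mathcal{W},p}(\Omega)$; (b) $\mathbf{I}$ is positively homogeneous of degree $1$; (c) $\mathbf{I}$ is continuous; (d) $\|\mathbf{I}(F)\|_\infty\leq(1+\varepsilon)\cdot|||F|||$ for all $F\in SCH_{0,\mathcal{W},p}(\Omega)$.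
   Context: $\mathcal{L}^m$ is Lebesgue measure; $q$ is the Hölder conjugate of $p$. $BV_p(\Omega)$ is the space of $u\in L_p(\Omega)$ whose distributional partial derivatives are finite signed Borel measures $D_1u,\dots,D_mu$; $\|Du\|(\Omega)=\sup\{\int_\Omega u\,\mathrm{div}\,v\,d\mathcal{L}^m:v\in C_c^\infty(\Omega;\mathbb{R}^m),\|v\|_\infty\leq1\}$, $\|v\|_\infty=\sup_x|v(x)|_2$. $BV_{p,\mathrm{cst}}(\Omega)$ is the quotient of $BV_p(\Omega)$ by its subspace of a.e. constant functions (so it is $BV_p(\Omega)$ if $\mathcal{L}^m(\Omega)=\infty$), with elements $[u]$. $L_{q,\#}(\Omega)=\{f\in L_q(\Omega):\int_\Omega f=0\}$ if $\mathcal{L}^m(\Omega)<\infty$, and $L_{q,\#}(\Omega)=L_q(\Omega)$ otherwise. $C_0(\Omega;\mathbb{R}^m)$: continuous vector fields on $\Omega$ vanishing at infinity, with norm $\|\cdot\|_\infty$. $\Omega$ satisfies the $(p,1)$-Poincaré inequality if there is $c>0$ such that for every $u\in C^\infty(\Omega)\cap L_p(\Omega)$ there is $y\in\mathbb{R}$ with $\|u-y\mathbf{1}_\Omega\|_{L_p(\Omega)}\leq c\|\nabla u\|_{L_1(\Omega)}$. $SCH_{0,\mathcal{W},p}(\Omega)=BV_{p,\mathrm{cst}}(\Omega)[\mathcal{W}_{p,TV}]^*$ is the dual for the localized locally convex topology $\mathcal{W}_{p,TV}$ associated with the weak topology induced by $L_{q,\#}(\Omega)$ and the sets $\{[u]:\|Du\|(\Omega)\leq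 k\}$, $k\in\mathbb{N}$; it is exactly the space of linear forms $F$ on $BV_{p,\mathrm{cst}}(\Omega)$ such that for every $\varepsilon>0$ there are a finite non-empty $E\subset L_{q,\#}(\Omega)$ consisting of functions of $L_q$-norm $1$ and $\theta>0$ with $|\langle[u],F\rangle|\leq\theta\max_{f\in E}|\int_\Omega uf\,d\mathcal{L}^m|+\varepsilon\|Du\|(\Omega)$ for all $[u]$ (this can be taken as the definition). It is a Banach space with norm $|||F|||=\sup\{|\langle[u],F\rangle|:\|Du\|(\Omega)\leq1\}$. *)

theory Defs
  imports "HOL-Analysis.Analysis"
begin

section \<open>Smooth functions and test functions\<close>

definition partial_deriv :: "'n::finite \<Rightarrow> (real^'n \<Rightarrow> 'b::real_normed_vector) \<Rightarrow> real^'n \<Rightarrow> 'b"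
  where "partial_deriv i f x = frechet_derivative f (at x) (axis i 1)"

definition gradient :: "(real^'n::finite \<Rightarrow> real) \<Rightarrow> real^'n \<Rightarrow> real^'n"
  where "gradient f x = (\<chi> i. partial_deriv i f x)"

definition divergence :: "(real^'n::finite \<Rightarrow> real^'n) \<Rightarrow> real^'n \<Rightarrow> real"
  where "divergence v x = (\<Sum>i\<in>UNIV. partial_deriv i (\<lambda>y. v y $ i) x)"

text \<open>Meant for open \<open>U\<close>: the derivatives are taken in the ambient space.\<close>

primrec Ck_on :: "nat \<Rightarrow> (real^'n::finite) set \<Rightarrow> (real^'n \<Rightarrow> 'b::real_normed_vector) \<Rightarrow> bool"
  where
    "Ck_on 0 U f \<longleftrightarrow> continuous_on U f"
  | "Ck_on (Suc k) U f \<longleftrightarrow>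
       (\<forall>x\<in>U. f differentiable (at x)) \<and> (\<forall>i. Ck_on k U (partial_deriv i f))"

definition smooth_on :: "(real^'n::finite) set \<Rightarrow> (real^'n \<Rightarrow> 'b::real_normed_vector) \<Rightarrow> bool"
  where "smooth_on U f \<longleftrightarrow> (\<forall>k. Ck_on k U f)"

text \<open>Elements of \<open>C\<^sub>c\<^sup>\<infinity>(\<Omega>)\<close> are extended by zero to the whole space.\<close>

definition test_functions :: "(real^'n::finite) set \<Rightarrow> (real^'n \<Rightarrow> 'b::real_normed_vector) set"
  where "test_functions \<Omega> =
    {\<phi>. smooth_on UNIV \<phi> \<and> compact (closure {x. \<phi> x \<noteq> 0}) \<and> closure {x. \<phi> x \<noteq> 0} \<subseteq> \<Omega>}"


section \<open>Continuous vector fields vanishing at infinity\<close>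

definition sup_norm :: "(real^'n::finite) set \<Rightarrow> (real^'n \<Rightarrow> real^'n) \<Rightarrow> real"
  where "sup_norm \<Omega> v = (SUP x\<in>\<Omega>. norm (v x))"

text \<open>
  The fields are defined on \<open>\<Omega>\<close> only; the convention that they are \<open>0\<close> off \<open>\<Omega>\<close> makes
  HOL equality coincide with equality on \<open>\<Omega>\<close>.
\<close>

definition C0_fields :: "(real^'n::finite) set \<Rightarrow> (real^'n \<Rightarrow> real^'n) set"
  where "C0_fields \<Omega> =
    {v. continuous_on \<Omega> v \<and>
        (\<forall>e>0. \<exists>K. compact K \<and> K \<subseteq> \<Omega> \<and> (\<forall>x\<in>\<Omega> - K. norm (v x) < e)) \<and>
        (\<forall>x. x \<notin> \<Omega> \<longrightarrow> v x = 0)}"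


section \<open>Lebesgue spaces and the Poincare inequality\<close>

definition Lp_norm :: "(real^'n::finite) set \<Rightarrow> real \<Rightarrow> (real^'n \<Rightarrow> real) \<Rightarrow> ennreal"
  where "Lp_norm \<Omega> p f =
    (let N = \<integral>\<^sup>+x. ennreal (\<bar>f x\<bar> powr p) \<partial>lebesgue_on \<Omega>
     in if N = top then top else ennreal (enn2real N powr (1 / p)))"

text \<open>Elements are functions, not classes; their values off \<open>\<Omega>\<close> are irrelevant.\<close>

definition Lp_space :: "(real^'n::finite) set \<Rightarrow> real \<Rightarrow> (real^'n \<Rightarrow> real) set"
  where "Lp_space \<Omega> p = {f \<in> borel_measurable (lebesgue_on \<Omega>). Lp_norm \<Omega> p f < top}"

definition Lp_sharp :: "(real^'n::finite) set \<Rightarrow> real \<Rightarrow> (real^'n \<Rightarrow> real) set"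
  where "Lp_sharp \<Omega> p =
    {f \<in> Lp_space \<Omega> p. emeasure lebesgue \<Omega> < top \<longrightarrow> (\<integral>x. f x \<partial>lebesgue_on \<Omega>) = 0}"

definition poincare :: "(real^'n::finite) set \<Rightarrow> real \<Rightarrow> bool"
  where "poincare \<Omega> p \<longleftrightarrow>
    (\<exists>c>0. \<forall>u. smooth_on \<Omega> u \<and> u \<in> Lp_space \<Omega> p \<longrightarrow>
       (\<exists>y. Lp_norm \<Omega> p (\<lambda>x. u x - y)
              \<le> ennreal c * (\<integral>\<^sup>+x. ennreal (norm (gradient u x)) \<partial>lebesgue_on \<Omega>)))"


section \<open>Finite signed Borel measures\<close>

text \<open>
  A finite signed Borel measure on \<open>\<Omega>\<close> is a countably additive real set function on the Borel
  subsets of \<open>\<Omega>\<close>, set to \<open>0\<close> on all other sets.  The empty set has measure \<open>0\<close> by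
  applying additivity to the constant empty sequence.
\<close>

definition signed_borel_measure :: "(real^'n::finite) set \<Rightarrow> ((real^'n) set \<Rightarrow> real) \<Rightarrow> bool"
  where "signed_borel_measure \<Omega> \<mu> \<longleftrightarrow>
    (\<forall>A :: nat \<Rightarrow> (real^'n) set.
       range A \<subseteq> sets (restrict_space borel \<Omega>) \<and> disjoint_family A \<longrightarrow>
       (\<lambda>k. \<mu> (A k)) sums \<mu> (\<Union>k. A k)) \<and>
    (\<forall>A. A \<notin> sets (restrict_space borel \<Omega>) \<longrightarrow> \<mu> A = 0)"

text \<open>Positive part in the Jordan decomposition; the negative part is that of \<open>- \<mu>\<close>.\<close>

definition pos_variation :: "(real^'n::finite) set \<Rightarrow> ((real^'n) set \<Rightarrow> real) \<Rightarrow> (real^'n) measure"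
  where "pos_variation \<Omega> \<mu> =
    measure_of \<Omega> (sets (restrict_space borel \<Omega>))
      (\<lambda>A. ennreal (SUP B\<in>{B \<in> sets (restrict_space borel \<Omega>). B \<subseteq> A}. \<mu> B))"

definition signed_integral ::
    "(real^'n::finite) set \<Rightarrow> ((real^'n) set \<Rightarrow> real) \<Rightarrow> (real^'n \<Rightarrow> real) \<Rightarrow> real"
  where "signed_integral \<Omega> \<mu> f =
    (\<integral>x. f x \<partial>pos_variation \<Omega> \<mu>) - (\<integral>x. f x \<partial>pos_variation \<Omega> (\<lambda>A. - \<mu> A))"


section \<open>Functions of bounded variation\<close>

definition is_weak_deriv ::
    "(real^'n::finite) set \<Rightarrow> 'n \<Rightarrow> (real^'n \<Rightarrow> real) \<Rightarrow> ((real^'n) set \<Rightarrow> real) \<Rightarrow> bool"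
  where "is_weak_deriv \<Omega> i u \<mu> \<longleftrightarrow>
    signed_borel_measure \<Omega> \<mu> \<and>
    (\<forall>\<phi>\<in>test_functions \<Omega>.
       (\<integral>x. u x * partial_deriv i \<phi> x \<partial>lebesgue_on \<Omega>) = - signed_integral \<Omega> \<mu> \<phi>)"

definition weak_deriv ::
    "(real^'n::finite) set \<Rightarrow> 'n \<Rightarrow> (real^'n \<Rightarrow> real) \<Rightarrow> (real^'n) set \<Rightarrow> real"
  where "weak_deriv \<Omega> i u = (THE \<mu>. is_weak_deriv \<Omega> i u \<mu>)"

definition BV :: "(real^'n::finite) set \<Rightarrow> real \<Rightarrow> (real^'n \<Rightarrow> real) set"
  where "BV \<Omega> p = {u \<in> Lp_space \<Omega> p. \<forall>i. \<exists>\<mu>. is_weak_deriv \<Omega> i u \<mu>}"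

text \<open>Only used for \<open>u \<in> BV \<Omega> p\<close>, where the supremum is over a bounded set.\<close>

definition total_variation :: "(real^'n::finite) set \<Rightarrow> (real^'n \<Rightarrow> real) \<Rightarrow> real"
  where "total_variation \<Omega> u =
    (SUP v\<in>{v \<in> test_functions \<Omega>. sup_norm \<Omega> v \<le> 1}. \<integral>x. u x * divergence v x \<partial>lebesgue_on \<Omega>)"

text \<open>
  Dividing out the a.e. constant functions also identifies functions that agree a.e. on \<open>\<Omega>\<close>.
  If \<open>\<Omega>\<close> has infinite measure, a constant in \<open>L\<^sub>p\<close> is \<open>0\<close>, so nothing else is
  identified.
\<close>

definition cst_rel :: "(real^'n::finite) set \<Rightarrow> real \<Rightarrow> ((real^'n \<Rightarrow> real) \<times> (real^'n \<Rightarrow> real)) set"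
  where "cst_rel \<Omega> p =
    {(u, w). u \<in> BV \<Omega> p \<and> w \<in> BV \<Omega> p \<and> (\<exists>c. AE x in lebesgue_on \<Omega>. u x - w x = c)}"

definition BV_class :: "(real^'n::finite) set \<Rightarrow> real \<Rightarrow> (real^'n \<Rightarrow> real) \<Rightarrow> (real^'n \<Rightarrow> real) set"
  where "BV_class \<Omega> p u = cst_rel \<Omega> p `` {u}"

definition BV_cst :: "(real^'n::finite) set \<Rightarrow> real \<Rightarrow> (real^'n \<Rightarrow> real) set set"
  where "BV_cst \<Omega> p = BV \<Omega> p // cst_rel \<Omega> p"


section \<open>Strong charges and the divergence operator\<close>

text \<open>
  Linear forms on the quotient, with the convention that they are \<open>0\<close> off the quotient, so that
  HOL equality coincides with equality on it.
\<close>

definition linear_forms :: "(real^'n::finite) set \<Rightarrow> real \<Rightarrow> ((real^'n \<Rightarrow> real) set \<Rightarrow> real) set"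
  where "linear_forms \<Omega> p =
    {F. (\<forall>u\<in>BV \<Omega> p. \<forall>w\<in>BV \<Omega> p.
           F (BV_class \<Omega> p (\<lambda>x. u x + w x)) = F (BV_class \<Omega> p u) + F (BV_class \<Omega> p w)) \<and>
        (\<forall>a. \<forall>u\<in>BV \<Omega> p. F (BV_class \<Omega> p (\<lambda>x. a * u x)) = a * F (BV_class \<Omega> p u)) \<and>
        (\<forall>X. X \<notin> BV_cst \<Omega> p \<longrightarrow> F X = 0)}"

text \<open>The Hoelder conjugate of \<open>p\<close> is \<open>p / (p - 1)\<close>.\<close>

definition SCH :: "(real^'n::finite) set \<Rightarrow> real \<Rightarrow> ((real^'n \<Rightarrow> real) set \<Rightarrow> real) set"
  where "SCH \<Omega> p =
    {F \<in> linear_forms \<Omega> p.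
       \<forall>\<epsilon>>0. \<exists>E \<theta>. finite E \<and> E \<noteq> {} \<and>
         (\<forall>f\<in>E. f \<in> Lp_sharp \<Omega> (p / (p - 1)) \<and> Lp_norm \<Omega> (p / (p - 1)) f = 1) \<and> \<theta> > 0 \<and>
         (\<forall>u\<in>BV \<Omega> p. \<bar>F (BV_class \<Omega> p u)\<bar>
            \<le> \<theta> * Max ((\<lambda>f. \<bar>\<integral>x. u x * f x \<partial>lebesgue_on \<Omega>\<bar>) ` E) + \<epsilon> * total_variation \<Omega> u)}"

text \<open>
  Only used for \<open>F \<in> SCH \<Omega> p\<close>, where the Poincare inequality makes the supremum one over a
  bounded set.
\<close>

definition SCH_norm ::
    "(real^'n::finite) set \<Rightarrow> real \<Rightarrow> ((real^'n \<Rightarrow> real) set \<Rightarrow> real) \<Rightarrow> real"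
  where "SCH_norm \<Omega> p F =
    (SUP u\<in>{u \<in> BV \<Omega> p. total_variation \<Omega> u \<le> 1}. \<bar>F (BV_class \<Omega> p u)\<bar>)"

text \<open>
  The weak derivatives do not depend on the representative chosen, since
  the integral of \<open>\<partial>\<^sub>i\<phi>\<close> vanishes for every test function \<open>\<phi>\<close>.
\<close>

definition div_op ::
    "(real^'n::finite) set \<Rightarrow> real \<Rightarrow> (real^'n \<Rightarrow> real^'n) \<Rightarrow> (real^'n \<Rightarrow> real) set \<Rightarrow> real"
  where "div_op \<Omega> p v X =
    (if X \<in> BV_cst \<Omega> p
     then - (\<Sum>i\<in>UNIV. signed_integral \<Omega> (weak_deriv \<Omega> i (SOME u. u \<in> X)) (\<lambda>x. v x $ i))
     else 0)"

end

theory Submission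
  imports Defs "HOL-Probability.Probability"
begin

text \<open>
  A finite-dimensional Hahn-Banach argument shows that the charges are exactly the linear forms that
  are limits, in the norm given by the total variation, of forms \<open>u \<mapsto> \<integral>\<^sub>\<Omega> u g\<close> with
  \<open>g \<in> L\<^sub>q\<^sub>,\<^sub>#\<close>.  By duality, a function \<open>g \<in> L\<^sub>q\<close> with \<open>|\<integral>\<^sub>\<Omega> u g| \<le> r \<parallel>Du\<parallel>\<close> for all
  \<open>u \<in> BV\<^sub>p\<close> is an \<open>L\<^sub>q\<close>-limit of divergences of test fields bounded by \<open>r\<close>.  The Poincare
  inequality, extended to \<open>BV\<^sub>p\<close> by smooth approximation in variation, turns
  \<open>L\<^sub>q\<close>-approximation into approximation of charges, so every charge \<open>F\<close> is, up to \<open>\<delta>\<close>, the divergence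
  of a field of norm at most \<open>|||F||| + \<delta>\<close>.  Since \<open>C\<^sub>0(\<Omega>; \<real>\<^sup>m)\<close> is separable, such approximate
  liftings can be averaged continuously over the unit sphere, extended homogeneously, and iterated
  on the residual, which gives the right inverse as a uniformly convergent series.  The condition
  \<open>p \<le> m / (m - 1)\<close> only enters through \<open>p \<le> 2\<close>, that is, \<open>q \<ge> 2\<close>, for which the uniform
  convexity of \<open>L\<^sub>q\<close> is elementary.
\<close>

section \<open>Smooth functions\<close>

text \<open>The main obstacle is that membership in \<open>BV\<close> asks for measures. The
  separating functional \<open>sgn l |l|^(q - 1)\<close> is only an element of L_p whose pairings
  with divergences of unit test fields are bounded, and turning that bound into measures would take
  a Riesz representation theorem. It is therefore never shown to lie in \<open>BV\<close>: every
  estimate for it passes through smooth approximants, whose gradients are integrable and so are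
  densities of their weak derivatives. Hence the approximation theorem is stated for functions with
  bounded pairings, not for \<open>BV\<close>. Uniform convexity serves to produce a nearest point
  from a minimising sequence, so that neither an abstract separation theorem nor the duality of L_p
  and L_q has to be invoked: the functional is explicit. In the iteration every step leaves a
  relative error \<delta> and costs a factor 1 + \<delta>, so the fields sum to at most (1 +
  \<delta>) / (1 - \<delta>) times the norm of the charge; \<delta> = \<epsilon> / (2 + \<epsilon>)
  makes this 1 + \<epsilon>.\<close>

lemma Ck_on_imp_continuous_on: "Ck_on k U f \<Longrightarrow> continuous_on U f"
proof (cases k)
  case (Suc j)
  assume "Ck_on k U f"
  then show ?thesis
    using Suc by (auto simp: continuous_on_eq_continuous_within intro: differentiable_imp_continuous_within
        differentiable_at_withinI)
qed simp

lemma Ck_on_Suc_imp: "Ck_on (Suc k) U f \<Longrightarrow> Ck_on k U f"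
proof (induction k arbitrary: f)
  case 0
  then show ?case using Ck_on_imp_continuous_on[of "Suc 0" U f] by simp
next
  case (Suc k)
  then show ?case by (metis Ck_on.simps(2))
qed

lemma partial_deriv_cong_open:
  assumes "open U" "x \<in> U" "\<And>y. y \<in> U \<Longrightarrow> f y = g y"
  shows "partial_deriv i f x = partial_deriv i g x"
proof -
  have "(f has_derivative D) (at x) \<longleftrightarrow> (g has_derivative D) (at x)" for D
    using assms has_derivative_transform_within_open[of f D x UNIV U g]
      has_derivative_transform_within_open[of g D x UNIV U f] by auto
  then show ?thesis
    by (simp add: partial_deriv_def frechet_derivative_def)
qed

lemma differentiable_cong_open:
  assumes "open U" "x \<in> U" "\<And>y. y \<in> U \<Longrightarrow> f y = g y" "f differentiable (at x)"
  shows "g differentiable (at x)"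
  using assms has_derivative_transform_within_open[of f _ x UNIV U g] unfolding differentiable_def by blast

lemma Ck_on_cong:
  assumes "open U" "\<And>y. y \<in> U \<Longrightarrow> f y = g y" "Ck_on k U f"
  shows "Ck_on k U g"
  using assms(2,3)
proof (induction k arbitrary: f g)
  case 0
  then show ?case using continuous_on_cong by fastforce
next
  case (Suc k)
  have "g differentiable (at x)" if "x \<in> U" for x
    using differentiable_cong_open[OF assms(1) that, of f g] Suc.prems that by simp
  moreover have "Ck_on k U (partial_deriv i g)" for i
    by (rule Suc.IH[of "partial_deriv i f"])
      (use Suc.prems partial_deriv_cong_open[OF assms(1)] in \<open>auto intro!: partial_deriv_cong_open[OF assms(1)]\<close>)
  ultimately show ?case by simp
qed

lemma Ck_on_subset: "Ck_on k U f \<Longrightarrow> W \<subseteq> U \<Longrightarrow> Ck_on k W f"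
  by (induction k arbitrary: f) (auto intro: continuous_on_subset)

text \<open>Continuity and differentiability are local, so the neighbourhood may vary with the
  point. This handles locally finite sums and products extended by zero, which agree with a visibly
  smooth function only near each point.\<close>

lemma Ck_on_local:
  assumes "\<And>x. x \<in> U \<Longrightarrow> \<exists>W. open W \<and> x \<in> W \<and> Ck_on k W f"
  shows "Ck_on k U f"
  using assms
proof (induction k arbitrary: f)
  case 0
  show ?case
    unfolding Ck_on.simps continuous_on_eq_continuous_within
  proof
    fix x assume "x \<in> U"
    then obtain W where "open W" "x \<in> W" "continuous_on W f" using 0 by auto
    then show "continuous (at x within U) f"
      by (simp add: continuous_on_eq_continuous_at continuous_at_imp_continuous_at_within)
  qed
next
  case (Suc k)
  have "f differentiable (at x)" if "x \<in> U" for x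
    using Suc.prems[OF that] by auto
  moreover have "Ck_on k U (partial_deriv i f)" for i
    using Suc.prems by (intro Suc.IH) (meson Ck_on.simps(2))
  ultimately show ?case by simp
qed

lemma partial_deriv_eqI:
  "(f has_derivative D) (at x) \<Longrightarrow> partial_deriv i f x = D (axis i 1)"
  by (metis frechet_derivative_at partial_deriv_def)

text \<open>A linear map is determined by its values on the coordinate vectors. The explicit form
  later converts bounds on partial derivatives into bounds on the operator norm.\<close>

lemma partial_deriv_has_derivative:
  "f differentiable (at x) \<Longrightarrow> (f has_derivative (\<lambda>h. \<Sum>i\<in>UNIV. h $ i *\<^sub>R partial_deriv i f x)) (at x)"
proof -
  assume d: "f differentiable (at x)"
  let ?D = "frechet_derivative f (at x)"
  have D: "(f has_derivative ?D) (at x)" using d frechet_derivative_works by blast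
  interpret bounded_linear ?D using D has_derivative_bounded_linear by blast
  have "?D h = (\<Sum>i\<in>UNIV. h $ i *\<^sub>R partial_deriv i f x)" for h
  proof -
    have "h = (\<Sum>i\<in>UNIV. h $ i *\<^sub>R axis i 1)"
      by (metis basis_expansion scalar_mult_eq_scaleR)
    then have "?D h = ?D (\<Sum>i\<in>UNIV. h $ i *\<^sub>R axis i 1)" by simp
    also have "\<dots> = (\<Sum>i\<in>UNIV. h $ i *\<^sub>R partial_deriv i f x)"
      by (simp add: sum scaleR partial_deriv_def)
    finally show ?thesis .
  qed
  then have "?D = (\<lambda>h. \<Sum>i\<in>UNIV. h $ i *\<^sub>R partial_deriv i f x)" by (rule ext)
  then show ?thesis using D by simp
qed

lemma partial_deriv_const [simp]: "partial_deriv i (\<lambda>x. c) = (\<lambda>x. 0)"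
  by (rule ext, subst partial_deriv_eqI[of _ "\<lambda>h. 0"]) auto

lemma partial_deriv_bounded_linear:
  assumes "bounded_linear L"
  shows "partial_deriv i L = (\<lambda>x. L (axis i 1))"
  by (rule ext, rule partial_deriv_eqI) (rule bounded_linear_imp_has_derivative[OF assms])

lemma partial_deriv_add:
  assumes "f differentiable (at x)" "g differentiable (at x)"
  shows "partial_deriv i (\<lambda>x. f x + g x) x = partial_deriv i f x + partial_deriv i g x"
  unfolding partial_deriv_def
  using assms by (subst frechet_derivative_at[symmetric, OF has_derivative_add[of f "frechet_derivative f (at x)"]])
    (auto simp: frechet_derivative_works)

lemma partial_deriv_compose_linear:
  assumes "bounded_linear L" "f differentiable (at x)"
  shows "partial_deriv i (\<lambda>x. L (f x)) x = L (partial_deriv i f x)"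
  unfolding partial_deriv_def
  using assms by (subst frechet_derivative_at[symmetric, OF bounded_linear.has_derivative[of L f "frechet_derivative f (at x)"]])
    (auto simp: frechet_derivative_works)

lemma partial_deriv_scaleR:
  fixes f :: "real^'n::finite \<Rightarrow> real"
  assumes "f differentiable (at x)" "g differentiable (at x)"
  shows "partial_deriv i (\<lambda>x. f x *\<^sub>R g x) x = f x *\<^sub>R partial_deriv i g x + partial_deriv i f x *\<^sub>R g x"
  unfolding partial_deriv_def
  using assms by (subst frechet_derivative_at[symmetric,
        OF has_derivative_scaleR[of f "frechet_derivative f (at x)" x UNIV g "frechet_derivative g (at x)"]])
    (auto simp: frechet_derivative_works)

lemma partial_deriv_compose_real:
  fixes f :: "real^'n::finite \<Rightarrow> real"
  assumes "f differentiable (at x)" "(h has_real_derivative h') (at (f x))"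
  shows "partial_deriv i (\<lambda>x. h (f x)) x = h' * partial_deriv i f x"
  using assms
  by (subst partial_deriv_eqI[of _ "\<lambda>t. h' * frechet_derivative f (at x) t"])
    (auto simp: frechet_derivative_works partial_deriv_def has_field_derivative_def
       intro: has_derivative_compose[of f _ x UNIV h "(*) h'", unfolded o_def])

lemma Ck_on_const: "Ck_on k U (\<lambda>x. c)"
  by (induction k arbitrary: c) auto

lemma Ck_on_bounded_linear:
  assumes "bounded_linear L"
  shows "Ck_on k U L"
proof (cases k)
  case 0
  then show ?thesis using assms by (simp add: linear_continuous_on)
next
  case (Suc j)
  then show ?thesis using assms
    by (simp add: partial_deriv_bounded_linear Ck_on_const bounded_linear_imp_differentiable)
qed

lemma Ck_on_add:
  assumes "open U" "Ck_on k U f" "Ck_on k U g"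
  shows "Ck_on k U (\<lambda>x. f x + g x)"
  using assms(2,3)
proof (induction k arbitrary: f g)
  case 0
  then show ?case by (simp add: continuous_on_add)
next
  case (Suc k)
  have "Ck_on k U (partial_deriv i (\<lambda>x. f x + g x))" for i
    by (rule Ck_on_cong[OF assms(1), of "\<lambda>x. partial_deriv i f x + partial_deriv i g x"])
      (use Suc in \<open>auto simp: partial_deriv_add\<close>)
  then show ?case using Suc.prems by simp
qed

lemma Ck_on_compose_linear:
  assumes "open U" "Ck_on k U f" "bounded_linear L"
  shows "Ck_on k U (\<lambda>x. L (f x))"
  using assms(2)
proof (induction k arbitrary: f)
  case 0
  then show ?case using assms(3) by (simp add: bounded_linear.continuous_on)
next
  case (Suc k)
  have "Ck_on k U (partial_deriv i (\<lambda>x. L (f x)))" for i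
    by (rule Ck_on_cong[OF assms(1), of "\<lambda>x. L (partial_deriv i f x)"])
      (use Suc assms in \<open>auto simp: partial_deriv_compose_linear\<close>)
  moreover have "(\<lambda>x. L (f x)) differentiable (at x)" if "x \<in> U" for x
    using Suc.prems that bounded_linear.has_derivative[OF assms(3)] unfolding differentiable_def Ck_on.simps by metis
  ultimately show ?case by simp
qed

lemma Ck_on_scaleR:
  fixes f :: "real^'n::finite \<Rightarrow> real"
  assumes "open U" "Ck_on k U f" "Ck_on k U g"
  shows "Ck_on k U (\<lambda>x. f x *\<^sub>R g x)"
  using assms(2,3)
proof (induction k arbitrary: f g)
  case 0
  then show ?case by (simp add: continuous_on_scaleR)
next
  case (Suc k)
  have "Ck_on k U (partial_deriv i (\<lambda>x. f x *\<^sub>R g x))" for i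
  proof (rule Ck_on_cong[OF assms(1), of "\<lambda>x. f x *\<^sub>R partial_deriv i g x + partial_deriv i f x *\<^sub>R g x"])
    show "Ck_on k U (\<lambda>x. f x *\<^sub>R partial_deriv i g x + partial_deriv i f x *\<^sub>R g x)"
      using Suc.prems by (intro Ck_on_add assms(1) Suc.IH) (auto intro: Ck_on_Suc_imp)
  qed (use Suc.prems in \<open>auto simp: partial_deriv_scaleR\<close>)
  then show ?case using Suc.prems by (auto intro: differentiable_scaleR)
qed

text \<open>\<open>H\<close> lists the successive derivatives of the outer function
  \<open>H 0\<close>. By the chain rule a partial derivative of \<open>H j (f x)\<close> is
  \<open>H (Suc j) (f x)\<close> times one of \<open>f\<close>, so the induction on \<open>k\<close>
  has to treat all \<open>j\<close> at once. \<open>S\<close> confines the values of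
  \<open>f\<close> to where these derivatives exist.\<close>

lemma Ck_on_compose_real:
  fixes f :: "real^'n::finite \<Rightarrow> real" and H :: "nat \<Rightarrow> real \<Rightarrow> real"
  assumes "open U" "Ck_on k U f" "\<And>x. x \<in> U \<Longrightarrow> f x \<in> S"
    and "\<And>j t. t \<in> S \<Longrightarrow> (H j has_real_derivative H (Suc j) t) (at t)"
  shows "Ck_on k U (\<lambda>x. H j (f x))"
  using assms(2)
proof (induction k arbitrary: j)
  case 0
  have "continuous_on S (H j)"
    using assms(4) by (meson DERIV_isCont continuous_at_imp_continuous_on)
  then show ?case using 0 assms(3) by (auto intro: continuous_on_compose2[of S])
next
  case (Suc k)
  have "Ck_on k U (partial_deriv i (\<lambda>x. H j (f x)))" for i
  proof (rule Ck_on_cong[OF assms(1), of "\<lambda>x. H (Suc j) (f x) *\<^sub>R partial_deriv i f x"])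
    show "Ck_on k U (\<lambda>x. H (Suc j) (f x) *\<^sub>R partial_deriv i f x)"
      using Suc Ck_on_Suc_imp[OF Suc.prems] by (intro Ck_on_scaleR assms(1)) auto
    show "H (Suc j) (f x) *\<^sub>R partial_deriv i f x = partial_deriv i (\<lambda>x. H j (f x)) x" if "x \<in> U" for x
      using partial_deriv_compose_real[of f x "H j" "H (Suc j) (f x)" i] assms(4)[OF assms(3)[OF that]] Suc.prems that by simp
  qed
  moreover have "(\<lambda>x. H j (f x)) differentiable (at x)" if x: "x \<in> U" for x
  proof -
    obtain D where D: "(f has_derivative D) (at x)"
      using Suc.prems x unfolding Ck_on.simps differentiable_def by blast
    have "(H j has_derivative (*) (H (Suc j) (f x))) (at (f x))"
      using assms(4)[OF assms(3)[OF x]] by (simp add: has_field_derivative_def)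
    from has_derivative_compose[OF D this] show ?thesis
      unfolding differentiable_def by blast
  qed
  ultimately show ?case by simp
qed

lemma Ck_on_sum:
  assumes "open U" "\<And>i. i \<in> I \<Longrightarrow> Ck_on k U (f i)"
  shows "Ck_on k U (\<lambda>x. \<Sum>i\<in>I. f i x)"
  using assms(2)
proof (induction I rule: infinite_finite_induct)
  case (insert x F)
  then show ?case using Ck_on_add[OF assms(1), of k "f x"] by simp
qed (auto simp: Ck_on_const)

lemma Ck_on_vec:
  assumes "open U" "\<And>i. Ck_on k U (\<lambda>x. f x $ i)"
  shows "Ck_on k U (f :: real^'n::finite \<Rightarrow> real^'m::finite)"
proof (rule Ck_on_cong[OF assms(1), of "\<lambda>x. \<Sum>i\<in>UNIV. (f x $ i) *\<^sub>R axis i 1"])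
  show "Ck_on k U (\<lambda>x. \<Sum>i\<in>UNIV. (f x $ i) *\<^sub>R axis i 1)"
    by (intro Ck_on_sum Ck_on_scaleR assms Ck_on_const)
  show "(\<Sum>i\<in>UNIV. (f x $ i) *\<^sub>R axis i 1) = f x" for x
    by (metis basis_expansion scalar_mult_eq_scaleR)
qed

lemma smooth_on_const: "smooth_on U (\<lambda>x. c)"
  by (simp add: smooth_on_def Ck_on_const)

lemma smooth_on_add: "open U \<Longrightarrow> smooth_on U f \<Longrightarrow> smooth_on U g \<Longrightarrow> smooth_on U (\<lambda>x. f x + g x)"
  by (simp add: smooth_on_def Ck_on_add)

lemma smooth_on_scaleR:
  fixes f :: "real^'n::finite \<Rightarrow> real"
  shows "open U \<Longrightarrow> smooth_on U f \<Longrightarrow> smooth_on U g \<Longrightarrow> smooth_on U (\<lambda>x. f x *\<^sub>R g x)"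
  by (simp add: smooth_on_def Ck_on_scaleR)

lemma smooth_on_mult:
  fixes f g :: "real^'n::finite \<Rightarrow> real"
  shows "open U \<Longrightarrow> smooth_on U f \<Longrightarrow> smooth_on U g \<Longrightarrow> smooth_on U (\<lambda>x. f x * g x)"
  using smooth_on_scaleR[of U f g] by simp

lemma smooth_on_sum: "open U \<Longrightarrow> (\<And>i. i \<in> I \<Longrightarrow> smooth_on U (f i)) \<Longrightarrow> smooth_on U (\<lambda>x. \<Sum>i\<in>I. f i x)"
  by (simp add: smooth_on_def Ck_on_sum)

lemma smooth_on_bounded_linear: "bounded_linear L \<Longrightarrow> smooth_on U L"
  by (simp add: smooth_on_def Ck_on_bounded_linear)

lemma smooth_on_compose_linear:
  "open U \<Longrightarrow> smooth_on U f \<Longrightarrow> bounded_linear L \<Longrightarrow> smooth_on U (\<lambda>x. L (f x))"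
  by (simp add: smooth_on_def Ck_on_compose_linear)

lemma smooth_on_vec:
  fixes f :: "real^'n::finite \<Rightarrow> real^'m::finite"
  shows "open U \<Longrightarrow> (\<And>i. smooth_on U (\<lambda>x. f x $ i)) \<Longrightarrow> smooth_on U f"
  by (simp add: smooth_on_def Ck_on_vec)

lemma smooth_on_component:
  fixes f :: "real^'n::finite \<Rightarrow> real^'m::finite"
  shows "open U \<Longrightarrow> smooth_on U f \<Longrightarrow> smooth_on U (\<lambda>x. f x $ i)"
  using smooth_on_compose_linear[OF _ _ bounded_linear_vec_nth[of i], of U f] by simp

lemma smooth_on_partial_deriv: "smooth_on U f \<Longrightarrow> smooth_on U (partial_deriv i f)"
  unfolding smooth_on_def using Ck_on.simps(2) by blast

lemma smooth_on_imp_differentiable: "smooth_on U f \<Longrightarrow> x \<in> U \<Longrightarrow> f differentiable (at x)"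
  unfolding smooth_on_def using Ck_on.simps(2) by blast

lemma smooth_on_imp_continuous_on: "smooth_on U f \<Longrightarrow> continuous_on U f"
  unfolding smooth_on_def using Ck_on_imp_continuous_on by blast

lemma smooth_on_subset: "smooth_on U f \<Longrightarrow> W \<subseteq> U \<Longrightarrow> smooth_on W f"
  unfolding smooth_on_def using Ck_on_subset by blast

lemma smooth_on_cong: "open U \<Longrightarrow> (\<And>y. y \<in> U \<Longrightarrow> f y = g y) \<Longrightarrow> smooth_on U f \<Longrightarrow> smooth_on U g"
  unfolding smooth_on_def using Ck_on_cong by metis

lemma smooth_on_local:
  assumes "\<And>x. x \<in> U \<Longrightarrow> \<exists>W. open W \<and> x \<in> W \<and> smooth_on W f"
  shows "smooth_on U f"
  using assms unfolding smooth_on_def by (meson Ck_on_local)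

lemma smooth_on_compose_real:
  fixes f :: "real^'n::finite \<Rightarrow> real" and H :: "nat \<Rightarrow> real \<Rightarrow> real"
  assumes "open U" "smooth_on U f" "\<And>x. x \<in> U \<Longrightarrow> f x \<in> S"
    and "\<And>j t. t \<in> S \<Longrightarrow> (H j has_real_derivative H (Suc j) t) (at t)"
  shows "smooth_on U (\<lambda>x. H j (f x))"
  using assms Ck_on_compose_real[of U _ f S H] unfolding smooth_on_def by blast

lemma smooth_on_powr:
  fixes f :: "real^'n::finite \<Rightarrow> real"
  assumes "open U" "smooth_on U f" "\<And>x. x \<in> U \<Longrightarrow> f x > 0"
  shows "smooth_on U (\<lambda>x. f x powr a)"
proof -
  \<comment> \<open>The j-th derivative of t^a: a falling factorial times t^(a - j).\<close>
  define H where "H = (\<lambda>(j::nat) t. (\<Prod>i<j. a - real i) * t powr (a - real j))"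
  have "smooth_on U (\<lambda>x. H 0 (f x))"
  proof (rule smooth_on_compose_real[OF assms(1,2), of "{0<..}"])
    fix j :: nat and t :: real assume "t \<in> {0<..}"
    then show "(H j has_real_derivative H (Suc j) t) (at t)"
      unfolding H_def by (auto intro!: derivative_eq_intros simp: algebra_simps)
  qed (use assms(3) in auto)
  then show ?thesis by (simp add: H_def)
qed

lemma smooth_on_norm_sq: "smooth_on U (\<lambda>x::real^'n::finite. (norm (x - c))\<^sup>2)"
proof -
  have "smooth_on UNIV (\<lambda>x. \<Sum>i\<in>UNIV. (x $ i + (- c $ i)) * (x $ i + (- c $ i)))"
    by (intro smooth_on_sum smooth_on_mult smooth_on_add smooth_on_const smooth_on_bounded_linear
        bounded_linear_vec_nth open_UNIV)
  moreover have "(\<lambda>x. \<Sum>i\<in>UNIV. (x $ i + (- c $ i)) * (x $ i + (- c $ i))) = (\<lambda>x. (norm (x - c))\<^sup>2)"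
    unfolding power2_norm_eq_inner inner_vec_def by auto
  ultimately show ?thesis using smooth_on_subset by fastforce
qed

section \<open>A flat function: exp(-1/t) for positive t, continued by zero\<close>

definition exp_recip :: "real poly \<Rightarrow> real \<Rightarrow> real"
  where "exp_recip P t = (if t > 0 then poly P (1 / t) * exp (- (1 / t)) else 0)"

lemma poly_exp_tendsto_0: "((\<lambda>s::real. poly P s * exp (- s)) \<longlongrightarrow> 0) at_top"
proof -
  have "((\<lambda>s. \<Sum>i\<le>degree P. coeff P i * (s ^ i / exp s)) \<longlongrightarrow> (\<Sum>i\<le>degree P. coeff P i * 0)) at_top"
    by (intro tendsto_sum tendsto_mult tendsto_const tendsto_power_div_exp_0)
  moreover have "(\<lambda>s. \<Sum>i\<le>degree P. coeff P i * (s ^ i / exp s)) = (\<lambda>s. poly P s * exp (- s))"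
    by (auto simp: poly_altdef exp_minus sum_distrib_right divide_inverse mult.assoc)
  ultimately show ?thesis by simp
qed

lemma exp_recip_tendsto_0: "(exp_recip P \<longlongrightarrow> 0) (at 0)"
proof -
  have "(exp_recip P \<longlongrightarrow> 0) (at_left 0)"
    by (rule Lim_transform_eventually[OF tendsto_const])
      (auto simp: exp_recip_def eventually_at_filter)
  moreover have "((\<lambda>t. poly P (inverse t) * exp (- (inverse t))) \<longlongrightarrow> 0) (at_right 0)"
    using filterlim_compose[OF poly_exp_tendsto_0 filterlim_inverse_at_top_right] by simp
  then have "(exp_recip P \<longlongrightarrow> 0) (at_right 0)"
    by (rule Lim_transform_eventually)
      (auto simp: exp_recip_def eventually_at_filter inverse_eq_divide)
  ultimately show ?thesis by (simp add: filterlim_split_at)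
qed

text \<open>For t > 0 the derivative of P(1/t) exp(-1/t) is (1/t)^2 (P - P')(1/t) exp(-1/t). The
  polynomial factor is carried along because it makes the family closed under differentiation, so
  that one formula covers all orders.\<close>

lemma exp_recip_has_derivative:
  "(exp_recip P has_real_derivative exp_recip ([:0, 0, 1:] * (P - pderiv P)) t) (at t)"
proof -
  consider "t < 0" | "t > 0" | "t = 0" by linarith
  then show ?thesis
  proof cases
    case 1
    have "(exp_recip P has_real_derivative 0) (at t)"
      by (rule has_field_derivative_transform_within_open[of "\<lambda>_. 0" _ _ "{..<0}"])
        (use 1 in \<open>auto simp: exp_recip_def\<close>)
    then show ?thesis using 1 by (simp add: exp_recip_def)
  next
    case 2
    have "((\<lambda>t. poly P (1 / t) * exp (- (1 / t))) has_real_derivative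
       exp_recip ([:0, 0, 1:] * (P - pderiv P)) t) (at t)"
      using 2 by (auto intro!: derivative_eq_intros DERIV_chain2[OF poly_DERIV]
          simp: exp_recip_def field_simps power2_eq_square)
    then show ?thesis
      by (rule has_field_derivative_transform_within_open[of _ _ _ "{0<..}"])
        (use 2 in \<open>auto simp: exp_recip_def\<close>)
  next
    case 3
    \<comment> \<open>Dividing by s multiplies P by the variable, so the difference quotient at 0 is
      again a member of the family and tends to 0.\<close>
    have "((\<lambda>s. (exp_recip P s - exp_recip P 0) / (s - 0)) \<longlongrightarrow> 0) (at 0)"
      by (rule Lim_transform_eventually[OF exp_recip_tendsto_0[of "[:0,1:] * P"]])
        (auto simp: exp_recip_def eventually_at_filter)
    then show ?thesis using 3 by (simp add: has_field_derivative_iff exp_recip_def)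
  qed
qed

lemma smooth_on_exp_recip:
  fixes f :: "real^'n::finite \<Rightarrow> real"
  assumes "open U" "smooth_on U f"
  shows "smooth_on U (\<lambda>x. exp_recip 1 (f x))"
proof -
  define H where "H = (\<lambda>j. exp_recip (((\<lambda>P. [:0, 0, 1:] * (P - pderiv P)) ^^ j) 1))"
  have "smooth_on U (\<lambda>x. H 0 (f x))"
    by (rule smooth_on_compose_real[OF assms, of UNIV])
      (auto simp: H_def simp del: mult_pCons_left intro: exp_recip_has_derivative)
  then show ?thesis by (simp add: H_def)
qed

section \<open>Test functions and mollification\<close>

lemma integral_lborel_translate:
  fixes f :: "'a::euclidean_space \<Rightarrow> 'b::{banach, second_countable_topology}"
  assumes [measurable]: "f \<in> borel_measurable borel"
  shows "(\<integral>x. f (c + x) \<partial>lborel) = (\<integral>x. f x \<partial>lborel)"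
  using integral_distr[of "(+) c" lborel borel f] by (simp add: lborel_distr_plus)

lemma integrable_lborel_translate:
  fixes f :: "'a::euclidean_space \<Rightarrow> 'b::{banach, second_countable_topology}"
  assumes "integrable lborel f"
  shows "integrable lborel (\<lambda>x. f (c + x))"
  using integrable_distr_eq[of "(+) c" lborel borel f] assms by (simp add: lborel_distr_plus)

lemma test_functionsI:
  assumes "smooth_on UNIV \<phi>" "compact K" "K \<subseteq> \<Omega>" "\<And>x. x \<notin> K \<Longrightarrow> \<phi> x = 0"
  shows "\<phi> \<in> test_functions \<Omega>"
proof -
  have "closure {x. \<phi> x \<noteq> 0} \<subseteq> K"
    using assms by (intro closure_minimal compact_imp_closed) auto
  then show ?thesis
    using assms(1-3) compact_Int_closed[OF assms(2) closed_closure, of "{x. \<phi> x \<noteq> 0}"]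
    by (auto simp: test_functions_def Int_absorb1)
qed

lemma test_functionsE:
  assumes "\<phi> \<in> test_functions \<Omega>"
  obtains K where "compact K" "K \<subseteq> \<Omega>" "\<And>x. x \<notin> K \<Longrightarrow> \<phi> x = 0"
  using assms closure_subset[of "{x. \<phi> x \<noteq> 0}"]
  by (intro that[of "closure {x. \<phi> x \<noteq> 0}"]) (auto simp: test_functions_def)

lemma test_smooth: "\<phi> \<in> test_functions \<Omega> \<Longrightarrow> smooth_on UNIV \<phi>"
  by (simp add: test_functions_def)

lemma test_mono: "\<phi> \<in> test_functions A \<Longrightarrow> A \<subseteq> B \<Longrightarrow> \<phi> \<in> test_functions B"
  unfolding test_functions_def by blast

lemma test_continuous_on: "\<phi> \<in> test_functions \<Omega> \<Longrightarrow> continuous_on U \<phi>"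
  by (meson continuous_on_subset smooth_on_imp_continuous_on subset_UNIV test_smooth)

lemma test_borel:
  "\<phi> \<in> test_functions \<Omega> \<Longrightarrow> (\<phi> :: real^'n::finite \<Rightarrow> 'b::real_normed_vector) \<in> borel_measurable borel"
  by (intro borel_measurable_continuous_onI test_continuous_on)

lemma test_differentiable: "\<phi> \<in> test_functions \<Omega> \<Longrightarrow> \<phi> differentiable (at x)"
  using smooth_on_imp_differentiable[OF test_smooth] by blast

lemma test_zero: "(\<lambda>x. 0) \<in> test_functions \<Omega>"
  by (rule test_functionsI[of _ "{}"]) (auto simp: smooth_on_const)

lemma test_add:
  assumes "f \<in> test_functions \<Omega>" "g \<in> test_functions \<Omega>"
  shows "(\<lambda>x. f x + g x) \<in> test_functions \<Omega>"
proof -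
  obtain K L where "compact K" "K \<subseteq> \<Omega>" "\<And>x. x \<notin> K \<Longrightarrow> f x = 0" "compact L" "L \<subseteq> \<Omega>" "\<And>x. x \<notin> L \<Longrightarrow> g x = 0"
    using assms by (metis test_functionsE)
  then show ?thesis
    by (intro test_functionsI[of _ "K \<union> L"] smooth_on_add test_smooth[OF assms(1)] test_smooth[OF assms(2)]) auto
qed

lemma test_sum:
  assumes "\<And>i. i \<in> I \<Longrightarrow> f i \<in> test_functions \<Omega>"
  shows "(\<lambda>x. \<Sum>i\<in>I. f i x) \<in> test_functions \<Omega>"
  using assms by (induction I rule: infinite_finite_induct) (auto simp: test_zero test_add)

lemma test_smooth_scaleR:
  fixes f :: "real^'n::finite \<Rightarrow> real"
  assumes "f \<in> test_functions \<Omega>" "smooth_on UNIV g"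
  shows "(\<lambda>x. f x *\<^sub>R g x) \<in> test_functions \<Omega>"
proof -
  obtain K where "compact K" "K \<subseteq> \<Omega>" "\<And>x. x \<notin> K \<Longrightarrow> f x = 0"
    using assms by (metis test_functionsE)
  then show ?thesis
    by (intro test_functionsI[of _ K] smooth_on_scaleR test_smooth[OF assms(1)] assms) auto
qed

lemma smooth_test_scaleR:
  fixes f :: "real^'n::finite \<Rightarrow> real"
  assumes "smooth_on UNIV f" "g \<in> test_functions \<Omega>"
  shows "(\<lambda>x. f x *\<^sub>R g x) \<in> test_functions \<Omega>"
proof -
  obtain K where "compact K" "K \<subseteq> \<Omega>" "\<And>x. x \<notin> K \<Longrightarrow> g x = 0"
    using assms by (metis test_functionsE)
  then show ?thesis
    by (intro test_functionsI[of _ K] smooth_on_scaleR test_smooth[OF assms(2)] assms) auto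
qed

lemma test_cmult:
  "g \<in> test_functions \<Omega> \<Longrightarrow> (\<lambda>x. c *\<^sub>R g x) \<in> test_functions \<Omega>"
  by (rule smooth_test_scaleR[OF smooth_on_const])

text \<open>Here \<open>g\<close> is smooth on \<Omega> only and may be arbitrary elsewhere. Near a
  point outside \<Omega> the product vanishes identically, because the support of \<open>f\<close>
  is compact in \<Omega> and its complement is an open neighbourhood.\<close>

lemma test_smooth_on_scaleR:
  fixes f :: "real^'n::finite \<Rightarrow> real"
  assumes "open \<Omega>" "f \<in> test_functions \<Omega>" "smooth_on \<Omega> g"
  shows "(\<lambda>x. f x *\<^sub>R g x) \<in> test_functions \<Omega>"
proof -
  obtain K where K: "compact K" "K \<subseteq> \<Omega>" "\<And>x. x \<notin> K \<Longrightarrow> f x = 0"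
    using assms by (metis test_functionsE)
  have "smooth_on UNIV (\<lambda>x. f x *\<^sub>R g x)"
  proof (rule smooth_on_local)
    fix x :: "real^'n"
    show "\<exists>W. open W \<and> x \<in> W \<and> smooth_on W (\<lambda>x. f x *\<^sub>R g x)"
    proof (cases "x \<in> \<Omega>")
      case True
      then show ?thesis using assms test_smooth[OF assms(2)]
        by (intro exI[of _ \<Omega>]) (auto intro!: smooth_on_scaleR intro: smooth_on_subset)
    next
      case False
      have "open (- K)" using K(1) by (simp add: compact_imp_closed open_Compl)
      moreover have "smooth_on (- K) (\<lambda>x. f x *\<^sub>R g x)"
        by (rule smooth_on_cong[OF \<open>open (- K)\<close> _ smooth_on_const[of _ 0]]) (use K in auto)
      ultimately show ?thesis using False K by blast
    qed
  qed
  then show ?thesis using K by (intro test_functionsI[of _ K]) auto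
qed

lemma test_component:
  fixes f :: "real^'n::finite \<Rightarrow> real^'m::finite"
  assumes "f \<in> test_functions \<Omega>"
  shows "(\<lambda>x. f x $ i) \<in> test_functions \<Omega>"
proof -
  obtain K where "compact K" "K \<subseteq> \<Omega>" "\<And>x. x \<notin> K \<Longrightarrow> f x = 0"
    using assms by (metis test_functionsE)
  then show ?thesis
    by (intro test_functionsI[of _ K] smooth_on_component test_smooth[OF assms]) auto
qed

lemma partial_deriv_eq_0_outside:
  assumes "closed K" "\<And>x. x \<notin> K \<Longrightarrow> \<phi> x = 0" "x \<notin> K"
  shows "partial_deriv i \<phi> x = 0"
proof -
  have "partial_deriv i \<phi> x = partial_deriv i (\<lambda>x. 0) x"
    by (rule partial_deriv_cong_open[of "- K"]) (use assms in auto)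
  then show ?thesis by simp
qed

lemma test_partial_deriv:
  assumes "\<phi> \<in> test_functions \<Omega>"
  shows "partial_deriv i \<phi> \<in> test_functions \<Omega>"
proof -
  obtain K where "compact K" "K \<subseteq> \<Omega>" "\<And>x. x \<notin> K \<Longrightarrow> \<phi> x = 0"
    using assms by (metis test_functionsE)
  then show ?thesis
    by (intro test_functionsI[of _ K] smooth_on_partial_deriv test_smooth[OF assms])
      (auto intro: partial_deriv_eq_0_outside compact_imp_closed)
qed

lemma compact_support_bounded:
  fixes f :: "'a::metric_space \<Rightarrow> 'b::real_normed_vector"
  assumes "compact K" "continuous_on K f" "\<And>x. x \<notin> K \<Longrightarrow> f x = 0"
  obtains B where "B > 0" "\<And>x. norm (f x) \<le> B"
proof -
  have "bounded (f ` K)"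
    using assms by (intro compact_imp_bounded compact_continuous_image)
  then obtain B where "\<And>x. x \<in> K \<Longrightarrow> norm (f x) \<le> B" unfolding bounded_iff by auto
  then have "norm (f x) \<le> max B 1" for x
    using assms(3)[of x] by (cases "x \<in> K") (auto simp: le_max_iff_disj)
  then show ?thesis by (intro that[of "max B 1"]) auto
qed

lemma test_bounded:
  assumes "\<phi> \<in> test_functions \<Omega>"
  obtains B where "B > 0" "\<And>x. norm (\<phi> x) \<le> B"
  using assms test_functionsE[OF assms] compact_support_bounded[of _ \<phi>] test_continuous_on[OF assms] by metis

lemma compact_support_integrable:
  fixes f :: "'a::euclidean_space \<Rightarrow> 'b::{banach, second_countable_topology}"
  assumes "f \<in> borel_measurable borel" "compact K" "\<And>x. x \<notin> K \<Longrightarrow> f x = 0" "\<And>x. norm (f x) \<le> B"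
  shows "integrable lborel f"
proof (rule Bochner_Integration.integrable_bound)
  have "emeasure lborel K < \<infinity>" using assms(2) emeasure_compact_finite by blast
  then show "integrable lborel (\<lambda>x. B * indicator K x :: real)"
    using assms(2) by (intro integrable_mult_right) (auto simp: borel_compact intro!: integrable_real_indicator)
  show "AE x in lborel. norm (f x) \<le> norm (B * indicator K x)"
    using assms(3,4) by (auto simp: indicator_def intro: order_trans[OF _ abs_ge_self])
qed (use assms in auto)

lemma test_integrable:
  fixes \<phi> :: "real^'n::finite \<Rightarrow> 'b::{banach, second_countable_topology}"
  assumes "\<phi> \<in> test_functions \<Omega>"
  shows "integrable lborel \<phi>"
proof -
  obtain K where K: "compact K" "\<And>x. x \<notin> K \<Longrightarrow> \<phi> x = 0" using test_functionsE[OF assms] by metis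
  obtain B where B: "\<And>x. norm (\<phi> x) \<le> B" using test_bounded[OF assms] by metis
  show ?thesis by (rule compact_support_integrable[OF test_borel[OF assms] K B])
qed

lemma onorm_sum_component_le:
  fixes a :: "'n::finite \<Rightarrow> 'b::real_normed_vector"
  shows "onorm (\<lambda>h::real^'n. \<Sum>i\<in>UNIV. h $ i *\<^sub>R a i) \<le> (\<Sum>i\<in>UNIV. norm (a i))"
proof (rule onorm_le)
  fix h :: "real^'n"
  have "norm (\<Sum>i\<in>UNIV. h $ i *\<^sub>R a i) \<le> (\<Sum>i\<in>UNIV. norm (h $ i *\<^sub>R a i))" by (rule norm_sum)
  also have "\<dots> \<le> (\<Sum>i\<in>UNIV. norm h * norm (a i))"
    by (intro sum_mono) (auto intro!: mult_right_mono component_le_norm_cart)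
  finally show "norm (\<Sum>i\<in>UNIV. h $ i *\<^sub>R a i) \<le> (\<Sum>i\<in>UNIV. norm (a i)) * norm h"
    by (simp add: sum_distrib_left mult.commute)
qed

lemma test_lipschitz:
  assumes "\<phi> \<in> test_functions \<Omega>"
  obtains B where "B > 0" "\<And>x y. norm (\<phi> x - \<phi> y) \<le> B * norm (x - y)"
proof -
  have "\<exists>B>0. \<forall>x. norm (partial_deriv i \<phi> x) \<le> B" for i
    using test_bounded[OF test_partial_deriv[OF assms]] by metis
  then obtain B where B: "\<And>i. B i > 0" "\<And>i x. norm (partial_deriv i \<phi> x) \<le> B i" by metis
  have "norm (\<phi> x - \<phi> y) \<le> (\<Sum>i\<in>UNIV. B i) * norm (x - y)" for x y
  proof (rule differentiable_bound[of UNIV])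
    fix x
    show "(\<phi> has_derivative (\<lambda>h. \<Sum>i\<in>UNIV. h $ i *\<^sub>R partial_deriv i \<phi> x)) (at x within UNIV)"
      using partial_deriv_has_derivative[OF test_differentiable[OF assms]] by simp
    show "onorm (\<lambda>h. \<Sum>i\<in>UNIV. h $ i *\<^sub>R partial_deriv i \<phi> x) \<le> (\<Sum>i\<in>UNIV. B i)"
      by (rule order_trans[OF onorm_sum_component_le]) (intro sum_mono B)
  qed auto
  then show ?thesis by (intro that[of "\<Sum>i\<in>UNIV. B i"]) (auto intro: sum_pos B)
qed

text \<open>The partial derivatives are Lipschitz, so the first-order Taylor remainder is quadratic
  with a constant that does not depend on the point. This uniformity replaces dominated convergence
  when differentiating under an integral.\<close>

lemma test_quadratic:
  assumes "\<phi> \<in> test_functions \<Omega>"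
  obtains C where "C > 0"
    "\<And>x h. norm (\<phi> (x + h) - \<phi> x - (\<Sum>i\<in>UNIV. h $ i *\<^sub>R partial_deriv i \<phi> x)) \<le> C * (norm h)\<^sup>2"
proof -
  have "\<exists>B>0. \<forall>x y. norm (partial_deriv i \<phi> x - partial_deriv i \<phi> y) \<le> B * norm (x - y)" for i
    using test_lipschitz[OF test_partial_deriv[OF assms]] by metis
  then obtain B where B: "\<And>i. B i > 0"
    "\<And>i x y. norm (partial_deriv i \<phi> x - partial_deriv i \<phi> y) \<le> B i * norm (x - y)" by metis
  let ?D = "\<lambda>x h. \<Sum>i\<in>UNIV. h $ i *\<^sub>R partial_deriv i \<phi> x"
  have "norm (\<phi> (x + h) - \<phi> x - (\<Sum>i\<in>UNIV. h $ i *\<^sub>R partial_deriv i \<phi> x)) \<le> (\<Sum>i\<in>UNIV. B i) * (norm h)\<^sup>2" for x h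
  proof -
    have "norm (\<phi> (x + h) - \<phi> x - ?D x (x + h - x)) \<le> norm (x + h - x) * ((\<Sum>i\<in>UNIV. B i) * norm h)"
    proof (rule differentiable_bound_linearization[of _ _ "cball x (norm h)"])
      fix t :: real assume "t \<in> {0..1}"
      then show "x + t *\<^sub>R (x + h - x) \<in> cball x (norm h)"
        by (auto simp: dist_norm mult_left_le_one_le)
    next
      fix y assume y: "y \<in> cball x (norm h)"
      show "(\<phi> has_derivative ?D y) (at y within cball x (norm h))"
        using partial_deriv_has_derivative[OF test_differentiable[OF assms]] has_derivative_at_withinI by blast
      have "?D y - ?D x = (\<lambda>h. \<Sum>i\<in>UNIV. h $ i *\<^sub>R (partial_deriv i \<phi> y - partial_deriv i \<phi> x))"
        by (auto simp: fun_eq_iff scaleR_diff_right sum_subtractf)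
      then have "onorm (?D y - ?D x) \<le> (\<Sum>i\<in>UNIV. norm (partial_deriv i \<phi> y - partial_deriv i \<phi> x))"
        by (simp only: onorm_sum_component_le)
      also have "\<dots> \<le> (\<Sum>i\<in>UNIV. B i * norm h)"
      proof (rule sum_mono)
        fix i
        have "B i * norm (y - x) \<le> B i * norm h"
          using y B(1)[of i] by (intro mult_left_mono) (auto simp: dist_norm norm_minus_commute)
        then show "norm (partial_deriv i \<phi> y - partial_deriv i \<phi> x) \<le> B i * norm h"
          using B(2)[of i y x] by linarith
      qed
      finally show "onorm (?D y - ?D x) \<le> (\<Sum>i\<in>UNIV. B i) * norm h" by (simp add: sum_distrib_right)
    qed auto
    then show ?thesis by (simp add: power2_eq_square mult_ac)
  qed
  then show ?thesis by (intro that[of "\<Sum>i\<in>UNIV. B i"]) (auto intro: sum_pos B)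
qed

text \<open>By translation invariance the integral of \<phi>(x + t e_i) - \<phi>(x) is 0. The
  quadratic Taylor bound, integrated over a fixed ball, then gives t |J| <= C t^2 M for the integral
  J of the derivative and all small t, so J = 0. No iterated integration over coordinates is
  involved.\<close>

lemma integral_partial_deriv_test:
  fixes \<phi> :: "real^'n::finite \<Rightarrow> real"
  assumes "\<phi> \<in> test_functions \<Omega>"
  shows "(\<integral>x. partial_deriv i \<phi> x \<partial>lborel) = 0"
proof -
  obtain K where K: "compact K" "\<And>x. x \<notin> K \<Longrightarrow> \<phi> x = 0" using test_functionsE[OF assms] by metis
  obtain R where R: "R > 0" "K \<subseteq> ball 0 R" using compact_imp_bounded[OF K(1)] bounded_subset_ballD[of K 0] by auto
  obtain C where C: "C > 0" "\<And>x h. norm (\<phi> (x + h) - \<phi> x - (\<Sum>i\<in>UNIV. h $ i *\<^sub>R partial_deriv i \<phi> x)) \<le> C * (norm h)\<^sup>2"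
    using test_quadratic[OF assms] by metis
  define J where "J = (\<integral>x. partial_deriv i \<phi> x \<partial>lborel)"
  \<comment> \<open>The radius \<open>R + 1\<close> covers the support of \<phi> and of its
    translates by vectors of length at most 1.\<close>
  define M where "M = measure lborel (cball (0::real^'n) (R + 1))"
  have fin: "emeasure lborel (cball (0::real^'n) (R + 1)) < \<infinity>" using emeasure_compact_finite[OF compact_cball] by blast
  have "\<bar>J\<bar> \<le> C * M * t" if t: "0 < t" "t \<le> 1" for t
  proof -
    let ?h = "axis i t :: real^'n"
    have nh: "norm ?h = t" using t by (simp add: axis_def norm_vec_def L2_set_def if_distrib[of "\<lambda>a. a\<^sup>2"] if_distrib[of norm] cong: if_cong)
    have q: "norm (\<phi> (x + ?h) - \<phi> x - t * partial_deriv i \<phi> x) \<le> C * t\<^sup>2" for x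
      using C(2)[of x ?h] nh by (simp add: axis_def if_distrib[of "\<lambda>a. a * _"] cong: if_cong)
    have int1: "integrable lborel \<phi>" "integrable lborel (partial_deriv i \<phi>)"
      using assms by (auto intro: test_integrable test_partial_deriv)
    have int2: "integrable lborel (\<lambda>x. \<phi> (?h + x))" by (rule integrable_lborel_translate[OF int1(1)])
    have "(\<integral>x. \<phi> (?h + x) - \<phi> x - t * partial_deriv i \<phi> x \<partial>lborel) = - t * J"
      using int1 int2 integral_lborel_translate[OF test_borel[OF assms], of ?h] by (simp add: J_def)
    moreover have "norm (\<integral>x. \<phi> (?h + x) - \<phi> x - t * partial_deriv i \<phi> x \<partial>lborel) \<le>
      (\<integral>x. C * t\<^sup>2 * indicator (cball (0::real^'n) (R+1)) x \<partial>lborel)"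
    proof (rule Bochner_Integration.integral_norm_bound_integral)
      show "integrable lborel (\<lambda>x. \<phi> (?h + x) - \<phi> x - t * partial_deriv i \<phi> x)" using int1 int2 by auto
      show "integrable lborel (\<lambda>x. C * t\<^sup>2 * indicator (cball (0::real^'n) (R + 1)) x :: real)"
        using fin by (intro integrable_mult_right integrable_real_indicator) auto
      fix x :: "real^'n"
      show "norm (\<phi> (?h + x) - \<phi> x - t * partial_deriv i \<phi> x) \<le> C * t\<^sup>2 * indicator (cball 0 (R+1)) x"
      proof (cases "x \<in> cball 0 (R+1)")
        case True
        then show ?thesis using q[of x] by (simp add: add.commute)
      next
        case False
        then have "norm x > R + 1" by simp
        moreover have "norm x \<le> norm (?h + x) + norm ?h" by (metis norm_triangle_sub add.commute add_diff_cancel_left' norm_minus_commute)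
        ultimately have "norm (?h + x) > R" "norm x > R" using nh t by linarith+
        then have "?h + x \<notin> K" "x \<notin> K" using R by auto
        then show ?thesis using K partial_deriv_eq_0_outside[of K \<phi> x i] C t by (simp add: compact_imp_closed)
      qed
    qed
    ultimately have "t * \<bar>J\<bar> \<le> C * t\<^sup>2 * M" using t by (simp add: M_def abs_mult)
    then have "t * \<bar>J\<bar> \<le> t * (C * M * t)" by (simp add: power2_eq_square mult_ac)
    then show ?thesis using t by (simp only: mult_le_cancel_left_pos)
  qed
  moreover have M0: "M \<ge> 0" by (simp add: M_def)
  ultimately have "\<bar>J\<bar> \<le> e" if "e > 0" for e
  proof -
    \<comment> \<open>The summand 1 in the denominator makes it positive knowing only
      \<open>M \<ge> 0\<close>.\<close>
    let ?t = "min 1 (e / (C * M + 1))"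
    have p: "C * M + 1 > 0" using C M0 by (simp add: add_nonneg_pos)
    have t: "0 < ?t" "?t \<le> 1" using that p by auto
    have "\<bar>J\<bar> \<le> C * M * ?t" using \<open>\<And>t. \<lbrakk>0 < t; t \<le> 1\<rbrakk> \<Longrightarrow> \<bar>J\<bar> \<le> C * M * t\<close> t by blast
    also have "\<dots> \<le> (C * M + 1) * ?t" using t by (intro mult_right_mono) auto
    also have "\<dots> \<le> (C * M + 1) * (e / (C * M + 1))" using p by (intro mult_left_mono) auto
    finally show ?thesis using p by simp
  qed
  then have "\<bar>J\<bar> \<le> 0" by (rule field_le_epsilon) auto
  then show ?thesis by (simp add: J_def)
qed

section \<open>Convolution with a test function\<close>

definition conv :: "(real^'n::finite \<Rightarrow> real) \<Rightarrow> (real^'n \<Rightarrow> 'b) \<Rightarrow> real^'n \<Rightarrow> 'b::{banach, second_countable_topology}"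
  where "conv \<phi> f x = (\<integral>y. \<phi> (x - y) *\<^sub>R f y \<partial>lborel)"

lemma conv_integrable:
  fixes f :: "real^'n::finite \<Rightarrow> 'b::{banach, second_countable_topology}"
  assumes "\<phi> \<in> test_functions UNIV" "integrable lborel f"
  shows "integrable lborel (\<lambda>y. \<phi> (x - y) *\<^sub>R f y)"
proof -
  obtain B where B: "B > 0" "\<And>x. norm (\<phi> x) \<le> B" using test_bounded[OF assms(1)] by metis
  have [measurable]: "\<phi> \<in> borel_measurable borel" using test_borel[OF assms(1)] .
  have [measurable]: "f \<in> borel_measurable borel" using assms(2) by auto
  have i: "integrable lborel (\<lambda>y. B * norm (f y))"
    using assms(2) by (intro integrable_mult_right integrable_norm)
  show ?thesis
    by (rule Bochner_Integration.integrable_bound[OF i])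
      (use B in \<open>auto intro!: mult_right_mono simp: less_imp_le\<close>)
qed

text \<open>The quadratic Taylor bound for \<phi> holds uniformly in x - y. Integrated against |f|
  it bounds the remainder of the convolution by C |h|^2 times the L_1 norm of f.\<close>

lemma conv_has_derivative:
  assumes \<phi>: "\<phi> \<in> test_functions UNIV" and f: "integrable lborel f"
  shows "(conv \<phi> f has_derivative (\<lambda>h. \<Sum>i\<in>UNIV. h $ i *\<^sub>R conv (partial_deriv i \<phi>) f x)) (at x)"
proof -
  obtain C where C: "C > 0" "\<And>x h. norm (\<phi> (x + h) - \<phi> x - (\<Sum>i\<in>UNIV. h $ i *\<^sub>R partial_deriv i \<phi> x)) \<le> C * (norm h)\<^sup>2"
    using test_quadratic[OF \<phi>] by metis
  let ?L = "\<lambda>h. \<Sum>i\<in>UNIV. h $ i *\<^sub>R conv (partial_deriv i \<phi>) f x"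
  define J where "J = (\<integral>y. norm (f y) \<partial>lborel)"
  have J0: "J \<ge> 0" by (simp add: J_def)
  note int = conv_integrable[OF \<phi> f] conv_integrable[OF test_partial_deriv[OF \<phi>] f]
  have main: "norm (conv \<phi> f (x + h) - conv \<phi> f x - ?L h) \<le> C * J * (norm h)\<^sup>2" for h
  proof -
    have "?L h = (\<integral>y. (\<Sum>i\<in>UNIV. h $ i *\<^sub>R (partial_deriv i \<phi> (x - y) *\<^sub>R f y)) \<partial>lborel)"
      unfolding conv_def using int(2) by (subst Bochner_Integration.integral_sum) (simp_all only: integrable_scaleR_right integral_scaleR_right)
    moreover have "integrable lborel (\<lambda>y. (\<Sum>i\<in>UNIV. h $ i *\<^sub>R (partial_deriv i \<phi> (x - y) *\<^sub>R f y)))"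
      using int(2) by (intro Bochner_Integration.integrable_sum integrable_scaleR_right)
    ultimately have "conv \<phi> f (x + h) - conv \<phi> f x - ?L h =
      (\<integral>y. \<phi> (x + h - y) *\<^sub>R f y - \<phi> (x - y) *\<^sub>R f y - (\<Sum>i\<in>UNIV. h $ i *\<^sub>R (partial_deriv i \<phi> (x - y) *\<^sub>R f y)) \<partial>lborel)"
      unfolding conv_def using int(1) by (simp only: Bochner_Integration.integral_diff Bochner_Integration.integrable_diff)
    also have "\<dots> = (\<integral>y. (\<phi> ((x - y) + h) - \<phi> (x - y) - (\<Sum>i\<in>UNIV. h $ i *\<^sub>R (partial_deriv i \<phi> (x - y)))) *\<^sub>R f y \<partial>lborel)"
      by (rule Bochner_Integration.integral_cong) (auto simp: algebra_simps scaleR_sum_left)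
    also have "norm \<dots> \<le> (\<integral>y. C * (norm h)\<^sup>2 * norm (f y) \<partial>lborel)"
    proof (rule Bochner_Integration.integral_norm_bound_integral)
      have "integrable lborel (\<lambda>y. \<phi> (x + h - y) *\<^sub>R f y - \<phi> (x - y) *\<^sub>R f y - (\<Sum>i\<in>UNIV. h $ i *\<^sub>R (partial_deriv i \<phi> (x - y) *\<^sub>R f y)))"
        using int by (intro Bochner_Integration.integrable_diff Bochner_Integration.integrable_sum integrable_scaleR_right)
      then show "integrable lborel (\<lambda>y. (\<phi> ((x - y) + h) - \<phi> (x - y) - (\<Sum>i\<in>UNIV. h $ i *\<^sub>R (partial_deriv i \<phi> (x - y)))) *\<^sub>R f y)"
        by (rule Bochner_Integration.integrable_cong[THEN iffD1, rotated 2]) (auto simp: algebra_simps scaleR_sum_left)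
      show "integrable lborel (\<lambda>y. C * (norm h)\<^sup>2 * norm (f y))" using f by auto
    qed (use C in \<open>auto intro!: mult_right_mono\<close>)
    also have "\<dots> = C * J * (norm h)\<^sup>2" by (simp add: J_def)
    finally show ?thesis .
  qed
  show ?thesis
    unfolding has_derivative_at
  proof
    show "bounded_linear ?L"
      by (intro bounded_linear_sum bounded_linear_scaleR_const bounded_linear_vec_nth)
    show "(\<lambda>h. norm (conv \<phi> f (x + h) - conv \<phi> f x - ?L h) / norm h) \<midarrow>0\<rightarrow> 0"
    proof (rule Lim_null_comparison)
      show "\<forall>\<^sub>F h in at 0. norm (norm (conv \<phi> f (x + h) - conv \<phi> f x - ?L h) / norm h) \<le> C * J * norm h"
        using main by (auto intro!: always_eventually simp: divide_le_eq power2_eq_square mult_ac)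
      show "((\<lambda>h::real^'a. C * J * norm h) \<longlongrightarrow> 0) (at 0)"
        by (intro tendsto_eq_intros) auto
    qed
  qed
qed

lemma partial_deriv_conv:
  assumes "\<phi> \<in> test_functions UNIV" "integrable lborel f"
  shows "partial_deriv i (conv \<phi> f) = conv (partial_deriv i \<phi>) f"
proof
  fix x
  show "partial_deriv i (conv \<phi> f) x = conv (partial_deriv i \<phi>) f x"
    by (subst partial_deriv_eqI[OF conv_has_derivative[OF assms]])
      (simp add: axis_def if_distrib[of "\<lambda>a. a *\<^sub>R _"] cong: if_cong)
qed

text \<open>A partial derivative of the convolution is the convolution with a partial derivative of
  \<phi>, which is a test function again; hence the induction over all \<phi> for fixed
  \<open>f\<close>.\<close>

lemma conv_smooth:
  assumes "\<phi> \<in> test_functions UNIV" "integrable lborel f"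
  shows "smooth_on UNIV (conv \<phi> f)"
proof -
  have "Ck_on k UNIV (conv \<phi> f)" for k
    using assms(1)
  proof (induction k arbitrary: \<phi>)
    case 0
    then show ?case
      using has_derivative_continuous[OF conv_has_derivative[OF 0 assms(2)]]
      by (simp add: continuous_on_eq_continuous_within)
  next
    case (Suc k)
    then show ?case
      using conv_has_derivative[OF Suc.prems assms(2)] test_partial_deriv[OF Suc.prems]
      by (auto simp: partial_deriv_conv[OF Suc.prems assms(2)] differentiable_def)
  qed
  then show ?thesis by (simp add: smooth_on_def)
qed

lemma conv_eq_0:
  assumes "\<And>z. z \<in> A \<Longrightarrow> \<phi> (x - z) = 0" "\<And>y. y \<notin> A \<Longrightarrow> f y = 0"
  shows "conv \<phi> f x = 0"
proof -
  have "(\<lambda>y. \<phi> (x - y) *\<^sub>R f y) = (\<lambda>y. 0)" using assms by (metis scaleR_eq_0_iff)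
  then show ?thesis by (simp add: conv_def)
qed

lemma conv_component:
  fixes f :: "real^'n::finite \<Rightarrow> real^'m::finite"
  assumes "\<phi> \<in> test_functions UNIV" "integrable lborel f"
  shows "conv \<phi> f x $ i = conv \<phi> (\<lambda>y. f y $ i) x"
  unfolding conv_def
  using integral_bounded_linear[OF bounded_linear_vec_nth[of i] conv_integrable[OF assms, of x]] by simp

text \<open>A weighted average does not exceed the bound. The symmetry of \<phi> is used to write y
  \<mapsto> \<phi>(x - y) as a translate of \<phi>, whose integral is 1.\<close>

lemma conv_norm_le:
  fixes f :: "real^'n::finite \<Rightarrow> 'b::{banach, second_countable_topology}"
  assumes \<phi>: "\<phi> \<in> test_functions UNIV" "\<And>x. \<phi> x \<ge> 0" "(\<integral>x. \<phi> x \<partial>lborel) = 1" "\<And>x. \<phi> (- x) = \<phi> x"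
    and f: "integrable lborel f" "\<And>x. norm (f x) \<le> B"
  shows "norm (conv \<phi> f x) \<le> B"
proof -
  have e: "\<phi> (x - y) = \<phi> (- x + y)" for y using \<phi>(4)[of "x - y"] by simp
  have i: "integrable lborel (\<lambda>y. \<phi> (- x + y))" 
    by (rule integrable_lborel_translate[OF test_integrable[OF \<phi>(1)]])
  have "norm (conv \<phi> f x) \<le> (\<integral>y. \<phi> (- x + y) * B \<partial>lborel)"
    unfolding conv_def
    by (rule Bochner_Integration.integral_norm_bound_integral[OF conv_integrable[OF \<phi>(1) f(1)]])
      (use i \<phi>(2) f(2) in \<open>auto simp: e intro!: mult_left_mono\<close>)
  also have "\<dots> = B" using integral_lborel_translate[OF test_borel[OF \<phi>(1)], of "- x"] \<phi>(3) by simp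
  finally show ?thesis .
qed

lemma conv_adjoint_integrable:
  fixes f g :: "real^'n::finite \<Rightarrow> real"
  assumes \<phi>: "\<phi> \<in> test_functions UNIV" and f: "integrable lborel f" and g: "integrable lborel g"
  shows "integrable (lborel \<Otimes>\<^sub>M lborel) (\<lambda>(x, y). \<phi> (x - y) * f y * g x)"
proof -
  obtain B where B: "B > 0" "\<And>x. norm (\<phi> x) \<le> B" using test_bounded[OF \<phi>] by metis
  have [measurable]: "\<phi> \<in> borel_measurable borel" "f \<in> borel_measurable borel" "g \<in> borel_measurable borel"
    using test_borel[OF \<phi>] f g by auto
  have "integrable (lborel \<Otimes>\<^sub>M lborel) (\<lambda>(x, y). f y * g x)"
  proof (rule lborel_pair.Fubini_integrable)
    show "integrable lborel (\<lambda>x. \<integral>y. norm (case (x, y) of (x, y) \<Rightarrow> f y * g x) \<partial>lborel)"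
      using f g by (simp add: abs_mult)
    show "AE x in lborel. integrable lborel (\<lambda>y. case (x, y) of (x, y) \<Rightarrow> f y * g x)"
      using f by simp
  qed simp
  then have i: "integrable (lborel \<Otimes>\<^sub>M lborel) (\<lambda>z. B * norm (case z of (x, y) \<Rightarrow> f y * g x))" by auto
  show ?thesis
  proof (rule Bochner_Integration.integrable_bound[OF i])
    show "AE z in lborel \<Otimes>\<^sub>M lborel. norm (case z of (x, y) \<Rightarrow> \<phi> (x - y) * f y * g x)
      \<le> norm (B * norm (case z of (x, y) \<Rightarrow> f y * g x))"
    proof (rule AE_I2)
      fix z :: "(real^'n) \<times> (real^'n)"
      obtain x y where z: "z = (x, y)" by fastforce
      have "\<bar>\<phi> (x - y)\<bar> * \<bar>f y * g x\<bar> \<le> B * \<bar>f y * g x\<bar>" using B by (intro mult_right_mono) auto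
      then show "norm (case z of (x, y) \<Rightarrow> \<phi> (x - y) * f y * g x)
        \<le> norm (B * norm (case z of (x, y) \<Rightarrow> f y * g x))" using B by (simp add: z abs_mult mult_ac)
    qed
  qed simp
qed

text \<open>Fubini, together with \<phi>(x - y) = \<phi>(y - x). Self-adjointness is what moves the
  mollification from a rough function to the test field it is paired with.\<close>

lemma conv_adjoint:
  fixes f g :: "real^'n::finite \<Rightarrow> real"
  assumes \<phi>: "\<phi> \<in> test_functions UNIV" "\<And>x. \<phi> (- x) = \<phi> x"
    and f: "integrable lborel f" and g: "integrable lborel g"
  shows "(\<integral>x. conv \<phi> f x * g x \<partial>lborel) = (\<integral>y. f y * conv \<phi> g y \<partial>lborel)"
    and "integrable lborel (\<lambda>x. conv \<phi> f x * g x)"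
proof -
  note I = conv_adjoint_integrable[OF \<phi>(1) f g]
  have 1: "(\<integral>y. \<phi> (x - y) * f y * g x \<partial>lborel) = conv \<phi> f x * g x" for x
    by (simp add: conv_def)
  have 2: "(\<integral>x. \<phi> (x - y) * f y * g x \<partial>lborel) = f y * conv \<phi> g y" for y
  proof -
    have e: "\<phi> (x - y) * f y * g x = f y * (\<phi> (y - x) * g x)" for x using \<phi>(2)[of "x - y"] by (simp add: mult_ac)
    show ?thesis by (simp only: e integral_mult_right_zero conv_def real_scaleR_def)
  qed
  show "(\<integral>x. conv \<phi> f x * g x \<partial>lborel) = (\<integral>y. f y * conv \<phi> g y \<partial>lborel)"
    using lborel_pair.Fubini_integral[OF I] unfolding 1 2 by simp
  show "integrable lborel (\<lambda>x. conv \<phi> f x * g x)"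
    using lborel_pair.integrable_fst[OF I] unfolding 1 .
qed

lemma test_reflect:
  assumes "\<phi> \<in> test_functions UNIV"
  shows "((\<lambda>y. \<phi> (x - y)) has_derivative (\<lambda>h. - (\<Sum>i\<in>UNIV. h $ i *\<^sub>R partial_deriv i \<phi> (x - y)))) (at y)"
proof -
  have "((\<lambda>y. x - y) has_derivative (\<lambda>h. - h)) (at y)" by (auto intro!: derivative_eq_intros)
  from has_derivative_compose[OF this partial_deriv_has_derivative[OF test_differentiable[OF assms]]]
  show ?thesis by (simp add: sum_negf)
qed

lemma Ck_reflect:
  assumes "\<phi> \<in> test_functions UNIV"
  shows "Ck_on k UNIV (\<lambda>y. \<phi> (x - y))"
  using assms
proof (induction k arbitrary: \<phi>)
  case 0
  then show ?case using test_continuous_on[OF 0, of UNIV]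
    by (auto intro!: continuous_on_compose2[of UNIV \<phi>] continuous_intros)
next
  case (Suc k)
  have "partial_deriv i (\<lambda>y. \<phi> (x - y)) = (\<lambda>y. - 1 *\<^sub>R partial_deriv i \<phi> (x - y))" for i
    by (rule ext, subst partial_deriv_eqI[OF test_reflect[OF Suc.prems]])
      (simp add: axis_def if_distrib[of "\<lambda>a. a *\<^sub>R _"] cong: if_cong)
  moreover have "Ck_on k UNIV (\<lambda>y. - 1 *\<^sub>R partial_deriv i \<phi> (x - y))" for i
    by (intro Ck_on_scaleR Suc.IH test_partial_deriv Suc.prems Ck_on_const open_UNIV)
  moreover have "(\<lambda>y. \<phi> (x - y)) differentiable (at y)" for y
    using test_reflect[OF Suc.prems] unfolding differentiable_def by blast
  ultimately show ?case by simp
qed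

lemma partial_deriv_reflect:
  assumes "\<phi> \<in> test_functions UNIV"
  shows "partial_deriv i (\<lambda>y. \<phi> (x - y)) y = - partial_deriv i \<phi> (x - y)"
  by (subst partial_deriv_eqI[OF test_reflect[OF assms]])
    (simp add: axis_def if_distrib[of "\<lambda>a. a *\<^sub>R _"] cong: if_cong)

text \<open>\<open>partial_deriv_conv\<close> puts the derivative on \<phi>; here it is carried over
  to \<open>g\<close>. The product y \<mapsto> \<phi>(x - y) g(y) is a test function, so the
  integral of its partial derivative vanishes, and the sign from the reflection cancels the one from
  the integration by parts.\<close>

lemma conv_partial_deriv:
  fixes g :: "real^'n::finite \<Rightarrow> real"
  assumes \<phi>: "\<phi> \<in> test_functions UNIV" and g: "g \<in> test_functions \<Omega>"
  shows "partial_deriv i (conv \<phi> g) x = conv \<phi> (partial_deriv i g) x"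
proof -
  have sm: "smooth_on UNIV (\<lambda>y. \<phi> (x - y))" using Ck_reflect[OF \<phi>] by (simp add: smooth_on_def)
  have t: "(\<lambda>y. \<phi> (x - y) *\<^sub>R g y) \<in> test_functions \<Omega>" by (rule smooth_test_scaleR[OF sm g])
  have e: "partial_deriv i (\<lambda>y. \<phi> (x - y) *\<^sub>R g y) y = \<phi> (x - y) *\<^sub>R partial_deriv i g y - partial_deriv i \<phi> (x - y) *\<^sub>R g y" for y
    using partial_deriv_scaleR[of "\<lambda>y. \<phi> (x - y)" y g i] smooth_on_imp_differentiable[OF sm, of y] test_differentiable[OF g, of y]
      partial_deriv_reflect[OF \<phi>, of i x y] by simp
  have "(\<integral>y. \<phi> (x - y) *\<^sub>R partial_deriv i g y - partial_deriv i \<phi> (x - y) *\<^sub>R g y \<partial>lborel) = 0"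
    using integral_partial_deriv_test[OF t, of i] by (simp only: e)
  then have "conv \<phi> (partial_deriv i g) x = conv (partial_deriv i \<phi>) g x"
    using conv_integrable[OF \<phi> test_integrable[OF test_partial_deriv[OF g, of i]], of x]
      conv_integrable[OF test_partial_deriv[OF \<phi>, of i] test_integrable[OF g], of x]
    by (simp add: conv_def)
  then show ?thesis by (simp add: partial_deriv_conv[OF \<phi> test_integrable[OF g]])
qed

section \<open>Mollifiers, obtained by normalising exp(-1 / (e^2 - |x|^2))\<close>

definition bump :: "real \<Rightarrow> real^'n::finite \<Rightarrow> real"
  where "bump e x = exp_recip 1 (e\<^sup>2 - (norm x)\<^sup>2)"

definition mollifier :: "real \<Rightarrow> real^'n::finite \<Rightarrow> real"
  where "mollifier e x = bump e x / (\<integral>y. bump e (y :: real^'n) \<partial>lborel)"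

lemma bump_nonneg: "bump e x \<ge> 0"
  by (simp add: bump_def exp_recip_def)

lemma bump_pos_iff: "e > 0 \<Longrightarrow> bump e x > 0 \<longleftrightarrow> norm x < e"
  by (auto simp: bump_def exp_recip_def intro: power2_less_imp_less power_strict_mono)

lemma bump_test: 
  assumes "e > 0" shows "bump e \<in> test_functions (UNIV :: (real^'n::finite) set)"
proof (rule test_functionsI[of _ "cball 0 e"])
  have "smooth_on UNIV (\<lambda>x::real^'n. exp_recip 1 (e\<^sup>2 + (- 1) * (norm (x - 0))\<^sup>2))"
    by (intro smooth_on_exp_recip smooth_on_add smooth_on_const open_UNIV smooth_on_mult smooth_on_norm_sq)
  moreover have "(\<lambda>x::real^'n. exp_recip 1 (e\<^sup>2 + (- 1) * (norm (x - 0))\<^sup>2)) = bump e"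
    by (simp add: bump_def fun_eq_iff)
  ultimately show "smooth_on UNIV (bump e :: real^'n \<Rightarrow> real)" by simp
  show "bump e x = 0" if "x \<notin> cball 0 e" for x :: "real^'n"
    using that bump_pos_iff[OF assms, of x] bump_nonneg[of e x] by auto
qed auto

lemma bump_integral_pos: 
  assumes "e > 0" shows "(\<integral>x. bump e (x::real^'n::finite) \<partial>lborel) > 0"
proof -
  have "(\<integral>x. bump e (x::real^'n) \<partial>lborel) \<noteq> 0"
  proof
    assume "(\<integral>x. bump e (x::real^'n) \<partial>lborel) = 0"
    then have "AE x in lborel. bump e (x::real^'n) = 0"
      using integral_nonneg_eq_0_iff_AE[OF test_integrable[OF bump_test[OF assms]]] bump_nonneg by auto
    then have "AE x in lborel. (x::real^'n) \<notin> ball 0 e"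
      by eventually_elim (metis bump_pos_iff[OF assms] less_irrefl mem_ball_0)
    then have "emeasure lborel (ball (0::real^'n) e) = 0"
      by (subst (asm) AE_iff_measurable[of "ball 0 e"]) auto
    then show False
      using emeasure_ball[of e "0::real^'n"] assms unit_ball_vol_pos[of "real DIM(real^'n)"]
      by (simp add: ennreal_mult[symmetric])
  qed
  then show ?thesis by (simp add: bump_nonneg less_le)
qed

lemma mollifier:
  assumes "e > 0"
  shows "mollifier e \<in> test_functions (UNIV :: (real^'n::finite) set)"
    and "mollifier e (x::real^'n) \<ge> 0" and "mollifier e (- x) = mollifier e x"
    and "(\<integral>x. mollifier e (x::real^'n) \<partial>lborel) = 1"
    and "norm x \<ge> e \<Longrightarrow> mollifier e x = 0"
proof -
  have "mollifier e = (\<lambda>x::real^'n. (1 / (\<integral>y. bump e (y::real^'n) \<partial>lborel)) *\<^sub>R bump e x)"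
    by (auto simp: mollifier_def fun_eq_iff)
  then show "mollifier e \<in> test_functions (UNIV :: (real^'n) set)"
    using test_cmult[OF bump_test[OF assms]] by metis
  show "mollifier e x \<ge> 0"
    using bump_integral_pos[OF assms] bump_nonneg by (auto simp: mollifier_def intro!: divide_nonneg_pos)
  show "mollifier e (- x) = mollifier e x" by (simp add: mollifier_def bump_def)
  show "(\<integral>x. mollifier e (x::real^'n) \<partial>lborel) = 1"
    using bump_integral_pos[OF assms, where ?'n='n] by (simp add: mollifier_def)
  show "norm x \<ge> e \<Longrightarrow> mollifier e x = 0"
    using bump_pos_iff[OF assms, of x] bump_nonneg[of e x] by (simp add: mollifier_def)
qed

section \<open>Mollification in Lebesgue spaces\<close>

text \<open>A crude substitute for Minkowski's inequality. The constant is harmless wherever only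
  smallness of p-th power integrals matters.\<close>

lemma powr_add_le:
  fixes a b :: real
  assumes "p \<ge> 0"
  shows "\<bar>a + b\<bar> powr p \<le> 2 powr p * (\<bar>a\<bar> powr p + \<bar>b\<bar> powr p)"
proof -
  have "\<bar>a + b\<bar> powr p \<le> (2 * max \<bar>a\<bar> \<bar>b\<bar>) powr p" by (rule powr_mono2) (use assms in auto)
  also have "\<dots> = 2 powr p * max \<bar>a\<bar> \<bar>b\<bar> powr p" by (rule powr_mult)
  also have "\<dots> \<le> 2 powr p * (\<bar>a\<bar> powr p + \<bar>b\<bar> powr p)"
    by (intro mult_left_mono) (auto simp: max_def)
  finally show ?thesis .
qed

text \<open>The graph of the convex function t \<mapsto> |t|^p lies above its tangent at b. After
  reduction to absolute values this is Young's inequality with exponents p and p / (p - 1). Jensen's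
  inequality, midpoint convexity and the variational inequality for nearest points all rest on
  it.\<close>

lemma powr_tangent:
  fixes a b :: real
  assumes "p \<ge> 1"
  shows "\<bar>b\<bar> powr p + p * (sgn b * \<bar>b\<bar> powr (p - 1)) * (a - b) \<le> \<bar>a\<bar> powr p"
proof (cases "b = 0")
  case False
  have bb: "\<bar>b\<bar> powr (p - 1) * \<bar>b\<bar> = \<bar>b\<bar> powr p" using False by (simp add: powr_mult_base mult.commute)
  have key: "p * \<bar>b\<bar> powr (p - 1) * \<bar>a\<bar> \<le> \<bar>a\<bar> powr p + (p - 1) * \<bar>b\<bar> powr p"
  proof (cases "p = 1")
    case True
    then show ?thesis using False by simp
  next
    case False
    then have p: "p > 1" using assms by simp
    have "\<bar>a\<bar> * \<bar>b\<bar> powr (p - 1) \<le> \<bar>a\<bar> powr p / p + (\<bar>b\<bar> powr (p - 1)) powr (p / (p - 1)) / (p / (p - 1))"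
      by (rule Youngs_inequality) (use p in \<open>auto simp: field_simps\<close>)
    then have "\<bar>a\<bar> * \<bar>b\<bar> powr (p - 1) \<le> (\<bar>a\<bar> powr p + (p - 1) * \<bar>b\<bar> powr p) / p"
    proof -
      have "(p - 1) * (p / (p - 1)) = p" using p by simp
      then have "(\<bar>b\<bar> powr (p - 1)) powr (p / (p - 1)) = \<bar>b\<bar> powr p" by (simp only: powr_powr)
      with \<open>\<bar>a\<bar> * \<bar>b\<bar> powr (p - 1) \<le> _\<close> show ?thesis using p by (simp add: field_simps)
    qed
    then show ?thesis using p by (simp add: pos_le_divide_eq mult_ac)
  qed
  have "sgn b * (a - b) = sgn b * a - \<bar>b\<bar>" by (simp add: algebra_simps abs_sgn)
  also have "\<dots> \<le> \<bar>a\<bar> - \<bar>b\<bar>" by (auto simp: sgn_if)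
  finally have "(p * \<bar>b\<bar> powr (p - 1)) * (sgn b * (a - b)) \<le> (p * \<bar>b\<bar> powr (p - 1)) * (\<bar>a\<bar> - \<bar>b\<bar>)"
    using assms by (intro mult_left_mono) auto
  also have "\<dots> = p * \<bar>b\<bar> powr (p - 1) * \<bar>a\<bar> - p * \<bar>b\<bar> powr p" using bb by (simp add: algebra_simps)
  also have "\<dots> \<le> \<bar>a\<bar> powr p - \<bar>b\<bar> powr p" using key by (simp add: algebra_simps)
  finally show ?thesis by (simp add: mult_ac)
qed simp

lemma powr_integrable_add:
  fixes f g :: "'a \<Rightarrow> real"
  assumes "p \<ge> 0" "f \<in> borel_measurable M" "g \<in> borel_measurable M"
    "integrable M (\<lambda>x. \<bar>f x\<bar> powr p)" "integrable M (\<lambda>x. \<bar>g x\<bar> powr p)"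
  shows "integrable M (\<lambda>x. \<bar>f x + g x\<bar> powr p)"
proof (rule Bochner_Integration.integrable_bound)
  show "integrable M (\<lambda>x. 2 powr p * (\<bar>f x\<bar> powr p + \<bar>g x\<bar> powr p))" using assms by auto
  show "AE x in M. norm (\<bar>f x + g x\<bar> powr p) \<le> norm (2 powr p * (\<bar>f x\<bar> powr p + \<bar>g x\<bar> powr p))"
    using powr_add_le[OF assms(1)] by (auto intro!: AE_I2)
qed (use assms in measurable)

lemma powr_integrable_diff:
  fixes f g :: "'a \<Rightarrow> real"
  assumes "p \<ge> 0" "f \<in> borel_measurable M" "g \<in> borel_measurable M"
    "integrable M (\<lambda>x. \<bar>f x\<bar> powr p)" "integrable M (\<lambda>x. \<bar>g x\<bar> powr p)"
  shows "integrable M (\<lambda>x. \<bar>f x - g x\<bar> powr p)"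
  using powr_integrable_add[of p f M "\<lambda>x. - g x"] assms by simp

lemma powr_integral_add_le:
  fixes f g :: "'a \<Rightarrow> real"
  assumes "p \<ge> 0" "f \<in> borel_measurable M" "g \<in> borel_measurable M"
    "integrable M (\<lambda>x. \<bar>f x\<bar> powr p)" "integrable M (\<lambda>x. \<bar>g x\<bar> powr p)"
  shows "(\<integral>x. \<bar>f x + g x\<bar> powr p \<partial>M) \<le> 2 powr p * ((\<integral>x. \<bar>f x\<bar> powr p \<partial>M) + (\<integral>x. \<bar>g x\<bar> powr p \<partial>M))"
proof -
  have "(\<integral>x. \<bar>f x + g x\<bar> powr p \<partial>M) \<le> (\<integral>x. 2 powr p * (\<bar>f x\<bar> powr p + \<bar>g x\<bar> powr p) \<partial>M)"
    by (intro integral_mono powr_integrable_add powr_add_le) (use assms in auto)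
  then show ?thesis using assms by simp
qed

text \<open>On its support, |f| is at most 1 or at most |f|^p, according to whether |f| exceeds 1;
  so |f| is dominated by the indicator of the support plus |f|^p.\<close>

lemma compact_support_powr_integrable_imp_integrable:
  fixes f :: "'a::euclidean_space \<Rightarrow> real"
  assumes "p \<ge> 1" "f \<in> borel_measurable borel" "compact K" "\<And>x. x \<notin> K \<Longrightarrow> f x = 0"
    "integrable lborel (\<lambda>x. \<bar>f x\<bar> powr p)"
  shows "integrable lborel f"
proof (rule Bochner_Integration.integrable_bound)
  have "emeasure lborel K < \<infinity>" using assms(3) emeasure_compact_finite by blast
  then show "integrable lborel (\<lambda>x. indicator K x + \<bar>f x\<bar> powr p)"
    using assms by (intro Bochner_Integration.integrable_add integrable_real_indicator) (auto simp: borel_compact)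
  have "\<bar>f x\<bar> \<le> indicator K x + \<bar>f x\<bar> powr p" for x
  proof (cases "\<bar>f x\<bar> \<le> 1")
    case True
    then show ?thesis using assms(4)[of x] by (cases "x \<in> K") (auto intro: add_increasing2)
  next
    case False
    then have "\<bar>f x\<bar> powr 1 \<le> \<bar>f x\<bar> powr p" using assms(1) by (intro powr_mono) auto
    then have "\<bar>f x\<bar> \<le> \<bar>f x\<bar> powr p" using False by simp
    then show ?thesis by (auto simp: indicator_def)
  qed
  then show "AE x in lborel. norm (f x) \<le> norm (indicator K x + \<bar>f x\<bar> powr p)"
    by (intro AE_I2) (auto intro: order_trans[OF _ abs_ge_self])
qed (use assms in simp)

lemma conv_integral:
  fixes F :: "real^'n::finite \<Rightarrow> real"
  assumes \<phi>: "\<phi> \<in> test_functions UNIV" "\<And>x. \<phi> x \<ge> 0" "(\<integral>x. \<phi> x \<partial>lborel) = 1"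
    and F: "integrable lborel F"
  shows "integrable lborel (conv \<phi> F)" "(\<integral>x. conv \<phi> F x \<partial>lborel) = (\<integral>x. F x \<partial>lborel)"
proof -
  have [measurable]: "\<phi> \<in> borel_measurable borel" "F \<in> borel_measurable borel"
    using test_borel[OF \<phi>(1)] F by auto
  have e: "\<phi> (x - y) = \<phi> (- y + x)" for x y by simp
  have i: "integrable lborel (\<lambda>x. \<phi> (x - y))" for y
    unfolding e by (rule integrable_lborel_translate[OF test_integrable[OF \<phi>(1)]])
  have v: "(\<integral>x. \<phi> (x - y) \<partial>lborel) = 1" for y
    unfolding e using integral_lborel_translate[OF test_borel[OF \<phi>(1)], of "- y"] \<phi>(3) by simp
  have v': "(\<integral>x. \<bar>\<phi> (x - y)\<bar> \<partial>lborel) = 1" for y using v[of y] \<phi>(2) by simp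
  have I: "integrable (lborel \<Otimes>\<^sub>M lborel) (\<lambda>(y, x). \<phi> (x - y) * F y)"
    by (rule lborel_pair.Fubini_integrable) (use i F in \<open>auto simp: abs_mult v'\<close>)
  have J: "integrable (lborel \<Otimes>\<^sub>M lborel) (\<lambda>(x, y). \<phi> (x - y) * F y)"
    using lborel_pair.integrable_product_swap[OF I] by (simp add: case_prod_beta')
  show "integrable lborel (conv \<phi> F)"
    using lborel_pair.integrable_fst[OF J] by (simp add: conv_def[abs_def])
  show "(\<integral>x. conv \<phi> F x \<partial>lborel) = (\<integral>x. F x \<partial>lborel)"
    using lborel_pair.Fubini_integral[OF J] by (simp add: conv_def v)
qed

text \<open>Jensen's inequality for the probability weight y \<mapsto> \<phi>(x - y): the tangent
  inequality at the mean value \<open>t\<close> is integrated, and its linear term averages to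
  zero.\<close>

lemma conv_jensen:
  fixes f :: "real^'n::finite \<Rightarrow> real"
  assumes p: "p \<ge> 1"
    and \<phi>: "\<phi> \<in> test_functions UNIV" "\<And>x. \<phi> x \<ge> 0" "(\<integral>x. \<phi> x \<partial>lborel) = 1" "\<And>x. \<phi> (- x) = \<phi> x"
    and f: "integrable lborel f" "integrable lborel (\<lambda>x. \<bar>f x\<bar> powr p)"
  shows "\<bar>conv \<phi> f x\<bar> powr p \<le> conv \<phi> (\<lambda>y. \<bar>f y\<bar> powr p) x"
proof -
  define t where "t = conv \<phi> f x"
  define c where "c = p * (sgn t * \<bar>t\<bar> powr (p - 1))"
  have e: "\<phi> (x - y) = \<phi> (- x + y)" for y using \<phi>(4)[of "x - y"] by simp
  have i: "integrable lborel (\<lambda>y. \<phi> (x - y))"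
    unfolding e by (rule integrable_lborel_translate[OF test_integrable[OF \<phi>(1)]])
  have v: "(\<integral>y. \<phi> (x - y) \<partial>lborel) = 1"
    unfolding e using integral_lborel_translate[OF test_borel[OF \<phi>(1)], of "- x"] \<phi>(3) by simp
  have i2: "integrable lborel (\<lambda>y. \<phi> (x - y) * f y)" using conv_integrable[OF \<phi>(1) f(1)] by simp
  have i3: "integrable lborel (\<lambda>y. \<phi> (x - y) * \<bar>f y\<bar> powr p)" using conv_integrable[OF \<phi>(1) f(2)] by simp
  have "(\<integral>y. (\<bar>t\<bar> powr p - c * t) * \<phi> (x - y) + c * (\<phi> (x - y) * f y) \<partial>lborel) \<le> (\<integral>y. \<phi> (x - y) * \<bar>f y\<bar> powr p \<partial>lborel)"
  proof (rule integral_mono)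
    fix y
    have "\<phi> (x - y) * (\<bar>t\<bar> powr p + c * (f y - t)) \<le> \<phi> (x - y) * \<bar>f y\<bar> powr p"
      unfolding c_def by (intro mult_left_mono powr_tangent p \<phi>(2))
    then show "(\<bar>t\<bar> powr p - c * t) * \<phi> (x - y) + c * (\<phi> (x - y) * f y) \<le> \<phi> (x - y) * \<bar>f y\<bar> powr p"
      by (simp add: algebra_simps)
  qed (use i i2 i3 in auto)
  moreover have "(\<integral>y. (\<bar>t\<bar> powr p - c * t) * \<phi> (x - y) + c * (\<phi> (x - y) * f y) \<partial>lborel) = \<bar>t\<bar> powr p"
    using i i2 v by (simp add: conv_def t_def)
  ultimately show ?thesis by (simp add: conv_def t_def)
qed

lemma conv_Lp_le:
  fixes f :: "real^'n::finite \<Rightarrow> real"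
  assumes p: "p \<ge> 1"
    and \<phi>: "\<phi> \<in> test_functions UNIV" "\<And>x. \<phi> x \<ge> 0" "(\<integral>x. \<phi> x \<partial>lborel) = 1" "\<And>x. \<phi> (- x) = \<phi> x"
    and f: "integrable lborel f" "integrable lborel (\<lambda>x. \<bar>f x\<bar> powr p)"
  shows "integrable lborel (\<lambda>x. \<bar>conv \<phi> f x\<bar> powr p)"
    "(\<integral>x. \<bar>conv \<phi> f x\<bar> powr p \<partial>lborel) \<le> (\<integral>x. \<bar>f x\<bar> powr p \<partial>lborel)"
proof -
  have [measurable]: "conv \<phi> f \<in> borel_measurable borel"
    by (intro borel_measurable_continuous_onI smooth_on_imp_continuous_on conv_smooth \<phi> f)
  note J = conv_jensen[OF p \<phi> f] and C = conv_integral[OF \<phi>(1-3) f(2)]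
  show i: "integrable lborel (\<lambda>x. \<bar>conv \<phi> f x\<bar> powr p)"
    by (rule Bochner_Integration.integrable_bound[OF C(1)])
      (use J in \<open>auto intro: order_trans[OF _ abs_ge_self]\<close>)
  have "(\<integral>x. \<bar>conv \<phi> f x\<bar> powr p \<partial>lborel) \<le> (\<integral>x. conv \<phi> (\<lambda>y. \<bar>f y\<bar> powr p) x \<partial>lborel)"
    by (rule integral_mono[OF i C(1)]) (rule J)
  then show "(\<integral>x. \<bar>conv \<phi> f x\<bar> powr p \<partial>lborel) \<le> (\<integral>x. \<bar>f x\<bar> powr p \<partial>lborel)"
    using C(2) by simp
qed

lemma conv_diff:
  assumes "\<phi> \<in> test_functions UNIV" "integrable lborel f" "integrable lborel g"
  shows "conv \<phi> (\<lambda>x. f x - g x) x = conv \<phi> f x - conv \<phi> g x"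
  unfolding conv_def
  using conv_integrable[OF assms(1,2)] conv_integrable[OF assms(1,3)] by (simp add: scaleR_diff_right)

lemma compact_support_continuous_integrable:
  fixes g :: "'a::euclidean_space \<Rightarrow> 'b::{banach, second_countable_topology}"
  assumes "continuous_on UNIV g" "compact K" "\<And>x. x \<notin> K \<Longrightarrow> g x = 0"
  shows "integrable lborel g"
proof -
  obtain B where "\<And>x. norm (g x) \<le> B"
    using compact_support_bounded[OF assms(2) continuous_on_subset[OF assms(1)] assms(3)] by blast
  then show ?thesis
    using compact_support_integrable[of g K B] assms borel_measurable_continuous_onI[OF assms(1)] by blast
qed

lemma compact_support_continuous_powr_integrable:
  fixes g :: "'a::euclidean_space \<Rightarrow> real"
  assumes "p > 0" "continuous_on UNIV g" "compact K" "\<And>x. x \<notin> K \<Longrightarrow> g x = 0"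
  shows "integrable lborel (\<lambda>x. \<bar>g x\<bar> powr p)"
  by (rule compact_support_continuous_integrable[OF _ assms(3)])
    (use assms in \<open>auto intro!: continuous_on_powr' continuous_on_rabs continuous_on_const\<close>)

section \<open>Convergence of mollifications in L_p\<close>

lemma mollify_uniform:
  fixes g :: "real^'n::finite \<Rightarrow> real"
  assumes g: "integrable lborel g" and r: "r > 0" and w: "\<And>y. dist y x < r \<Longrightarrow> \<bar>g y - g x\<bar> \<le> e"
  shows "\<bar>conv (mollifier r) g x - g x\<bar> \<le> e"
proof -
  note m = mollifier[OF r, where ?'n = 'n]
  have ee: "mollifier r (x - y) = mollifier r (- x + y)" for y using m(3)[of "x - y"] by simp
  have i: "integrable lborel (\<lambda>y. mollifier r (x - y))"
    unfolding ee by (rule integrable_lborel_translate[OF test_integrable[OF m(1)]])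
  have v: "(\<integral>y. mollifier r (x - y) \<partial>lborel) = 1"
    unfolding ee using integral_lborel_translate[OF test_borel[OF m(1)], of "- x"] m(4) by simp
  have i2: "integrable lborel (\<lambda>y. mollifier r (x - y) * g y)" using conv_integrable[OF m(1) g] by simp
  have "conv (mollifier r) g x - g x = (\<integral>y. mollifier r (x - y) * g y - g x * mollifier r (x - y) \<partial>lborel)"
    using i i2 v by (simp add: conv_def)
  also have "norm \<dots> \<le> (\<integral>y. e * mollifier r (x - y) \<partial>lborel)"
  proof (rule Bochner_Integration.integral_norm_bound_integral)
    fix y
    have "mollifier r (x - y) * \<bar>g y - g x\<bar> \<le> mollifier r (x - y) * e"
    proof (cases "dist y x < r")
      case True
      then show ?thesis using w m(2) by (intro mult_left_mono) auto
    next
      case False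
      then show ?thesis using m(5)[of "x - y"] by (simp add: dist_norm norm_minus_commute)
    qed
    moreover have "mollifier r (x - y) * g y - g x * mollifier r (x - y) = mollifier r (x - y) * (g y - g x)"
      by (simp add: algebra_simps)
    ultimately show "norm (mollifier r (x - y) * g y - g x * mollifier r (x - y)) \<le> e * mollifier r (x - y)"
      using m(2)[of "x - y"] by (simp add: abs_mult mult.commute)
  qed (use i i2 in auto)
  also have "\<dots> = e" using v by simp
  finally show ?thesis by simp
qed

lemma mollify_Lp_continuous:
  fixes g :: "real^'n::finite \<Rightarrow> real"
  assumes p: "p > 0" and g: "continuous_on UNIV g" "compact K" "\<And>x. x \<notin> K \<Longrightarrow> g x = 0" and e: "e > 0"
  shows "\<exists>d>0. \<forall>r. 0 < r \<and> r < d \<longrightarrow> (\<integral>x. \<bar>conv (mollifier r) g x - g x\<bar> powr p \<partial>lborel) \<le> e"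
proof -
  obtain R where R: "R > 0" "K \<subseteq> ball 0 R" using compact_imp_bounded[OF g(2)] bounded_subset_ballD[of K 0] by auto
  define V where "V = measure lborel (cball (0::real^'n) (R + 1))"
  have fin: "emeasure lborel (cball (0::real^'n) (R + 1)) < \<infinity>" using emeasure_compact_finite[OF compact_cball] by blast
  have V: "V \<ge> 0" by (simp add: V_def)
  \<comment> \<open>A pointwise error of at most c on a ball of volume V contributes c^p V = e V /
    (V + 1), which is at most e.\<close>
  define c where "c = (e / (V + 1)) powr (1 / p)"
  have c: "c > 0" using e V by (simp add: c_def add_nonneg_pos)
  have gi: "integrable lborel g" by (rule compact_support_continuous_integrable[OF g])
  have "uniformly_continuous_on (cball 0 (R + 2)) g"
    by (intro compact_uniformly_continuous continuous_on_subset[OF g(1)]) auto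
  then obtain d where d: "d > 0" "\<And>x y. x \<in> cball 0 (R+2) \<Longrightarrow> y \<in> cball 0 (R+2) \<Longrightarrow> dist y x < d \<Longrightarrow> dist (g y) (g x) < c"
    unfolding uniformly_continuous_on_def using c by meson
  show ?thesis
  proof (intro exI[of _ "min d 1"] conjI allI impI)
    fix r assume r: "0 < r \<and> r < min d 1"
    have b: "\<bar>conv (mollifier r) g x - g x\<bar> powr p \<le> c powr p * indicator (cball 0 (R+1)) x" for x
    proof (cases "x \<in> cball 0 (R + 1)")
      case True
      have "\<bar>conv (mollifier r) g x - g x\<bar> \<le> c"
      proof (rule mollify_uniform[OF gi])
        fix y assume y: "dist y x < r"
        have "norm y \<le> norm x + dist y x" by (simp add: dist_norm norm_triangle_sub)
        then show "\<bar>g y - g x\<bar> \<le> c" using d(2)[of x y] True y r by (auto simp: dist_real_def)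
      qed (use r in auto)
      then show ?thesis using True p by (auto intro: powr_mono2)
    next
      case False
      then have "x \<notin> K" using R by force
      then have "g x = 0" by (rule g(3))
      have "conv (mollifier r) g x = 0"
      proof (rule conv_eq_0[of K])
        fix z assume "z \<in> K"
        then have "norm z < R" using R by auto
        moreover have "norm x \<le> norm (x - z) + norm z" by (metis diff_add_cancel norm_triangle_ineq)
        ultimately have "r \<le> norm (x - z)" using False r by auto
        then show "mollifier r (x - z) = 0" using mollifier(5)[of r "x - z"] r by simp
      qed (rule g(3))
      then show ?thesis using \<open>g x = 0\<close> False by simp
    qed
    have "(\<integral>x. \<bar>conv (mollifier r) g x - g x\<bar> powr p \<partial>lborel) \<le> (\<integral>x. c powr p * indicator (cball (0::real^'n) (R+1)) x \<partial>lborel)"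
      by (rule integral_mono'[OF _ b]) (use fin in auto)
    also have "\<dots> = c powr p * V" by (simp add: V_def)
    also have "\<dots> = e / (V + 1) * V" using p e V by (simp add: c_def powr_powr)
    also have "\<dots> \<le> e" using e V by (simp add: field_simps)
    finally show "(\<integral>x. \<bar>conv (mollifier r) g x - g x\<bar> powr p \<partial>lborel) \<le> e" .
  qed (use d in auto)
qed

lemma compact_cutoff_continuous:
  fixes K :: "'a::euclidean_space set"
  assumes "compact K"
  obtains \<kappa> :: "'a \<Rightarrow> real" and L where "continuous_on UNIV \<kappa>" "compact L" "\<And>x. x \<notin> L \<Longrightarrow> \<kappa> x = 0"
    "\<And>x. x \<in> K \<Longrightarrow> \<kappa> x = 1" "\<And>x. 0 \<le> \<kappa> x" "\<And>x. \<kappa> x \<le> 1"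
proof (cases "K = {}")
  case True
  then show ?thesis using that[of "\<lambda>x. 0" "{}"] by auto
next
  case False
  obtain R where R: "R > 0" "K \<subseteq> ball 0 R" using compact_imp_bounded[OF assms] bounded_subset_ballD[of K 0] by auto
  show ?thesis
  proof (rule that[of "\<lambda>x. max 0 (1 - infdist x K)" "cball 0 (R + 1)"])
    fix x :: 'a assume x: "x \<notin> cball 0 (R + 1)"
    obtain y where y: "y \<in> K" "infdist x K = dist x y"
      using infdist_attains_inf[OF compact_imp_closed[OF assms] False] by metis
    have "norm x \<le> dist x y + norm y" by (metis diff_add_cancel dist_norm norm_triangle_ineq)
    moreover have "norm y < R" using y R by auto
    ultimately show "max 0 (1 - infdist x K) = 0" using x y by auto
  qed (auto intro!: continuous_intros simp: infdist_nonneg)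
qed

lemma Lp_approx_bounded:
  fixes f :: "'a::euclidean_space \<Rightarrow> real"
  assumes p: "p > 0" and f: "f \<in> borel_measurable borel" "integrable lborel (\<lambda>x. \<bar>f x\<bar> powr p)" and e: "e > 0"
  obtains N :: nat where "(\<integral>x. \<bar>f x - max (- real N) (min (real N) (f x))\<bar> powr p \<partial>lborel) < e"
    "integrable lborel (\<lambda>x. \<bar>f x - max (- real N) (min (real N) (f x))\<bar> powr p)"
proof -
  have [measurable]: "f \<in> borel_measurable borel" by fact
  let ?s = "\<lambda>N x. \<bar>f x - max (- real N) (min (real N) (f x))\<bar> powr p"
  have b: "?s N x \<le> \<bar>f x\<bar> powr p" for N x using p by (intro powr_mono2) auto
  have "(\<lambda>N. \<integral>x. ?s N x \<partial>lborel) \<longlonglongrightarrow> (\<integral>x. 0 \<partial>(lborel::'a measure))"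
  proof (rule integral_dominated_convergence[OF _ _ f(2)])
    show "AE x in lborel. (\<lambda>N. ?s N x) \<longlonglongrightarrow> 0"
    proof (rule AE_I2)
      fix x
      obtain M :: nat where M: "\<bar>f x\<bar> \<le> real M" using real_arch_simple by blast
      have "\<forall>\<^sub>F N in sequentially. ?s N x = 0"
        using eventually_ge_at_top[of M] by eventually_elim (use M in \<open>auto simp: min_def max_def\<close>)
      then show "(\<lambda>N. ?s N x) \<longlonglongrightarrow> 0" by (rule tendsto_eventually)
    qed
  qed (use b in auto)
  then have "\<forall>\<^sub>F N in sequentially. (\<integral>x. ?s N x \<partial>lborel) < e" using e by (auto dest: order_tendstoD(2)[where a = e])
  then obtain N where N: "(\<integral>x. ?s N x \<partial>lborel) < e" by (auto simp: eventually_sequentially)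
  have "integrable lborel (?s N)"
    by (rule Bochner_Integration.integrable_bound[OF f(2)]) (use b in auto)
  with N show ?thesis using that by blast
qed

text \<open>A measurable function is almost everywhere a limit of continuous functions. Clamping
  these to [-B, B] and multiplying by a cut-off that is 1 on the support of f keeps the limit and
  provides a dominating function, so that the convergence holds in L_p as well.\<close>

lemma Lp_approx_continuous_bounded:
  fixes f :: "'a::euclidean_space \<Rightarrow> real"
  assumes p: "p > 0" and f: "f \<in> borel_measurable borel" "compact K" "\<And>x. x \<notin> K \<Longrightarrow> f x = 0" "\<And>x. \<bar>f x\<bar> \<le> B"
    and e: "e > 0"
  obtains g L where "continuous_on UNIV g" "compact L" "\<And>x. x \<notin> L \<Longrightarrow> g x = 0"
    "(\<integral>x. \<bar>f x - g x\<bar> powr p \<partial>lborel) < e" "integrable lborel (\<lambda>x. \<bar>f x - g x\<bar> powr p)"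
proof -
  have [measurable]: "f \<in> borel_measurable borel" by fact
  have "f measurable_on UNIV"
    by (rule lebesgue_measurable_imp_measurable_on_real) (use f in \<open>auto intro: measurable_completion\<close>)
  then obtain N g where N: "negligible N" and g: "\<And>n. continuous_on UNIV (g n)" "\<And>x. x \<notin> N \<Longrightarrow> (\<lambda>n. g n x) \<longlonglongrightarrow> f x"
    unfolding measurable_on_def by auto
  obtain \<kappa> :: "'a \<Rightarrow> real" and L where \<kappa>: "continuous_on UNIV \<kappa>" "compact L" "\<And>x. x \<notin> L \<Longrightarrow> \<kappa> x = 0"
    "\<And>x. x \<in> K \<Longrightarrow> \<kappa> x = 1" "\<And>x. 0 \<le> \<kappa> x" "\<And>x. \<kappa> x \<le> 1"
    using compact_cutoff_continuous[OF f(2)] by blast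
  have B: "B \<ge> 0" using f(4)[of 0] by simp
  define h where "h n x = \<kappa> x * max (- B) (min B (g n x))" for n x
  have hc: "continuous_on UNIV (h n)" for n
    unfolding h_def by (intro continuous_intros g \<kappa>)
  have h0: "x \<notin> L \<Longrightarrow> h n x = 0" for n x by (simp add: h_def \<kappa>)
  have KL: "K \<subseteq> L" using \<kappa>(3,4) by force
  have [measurable]: "h n \<in> borel_measurable borel" for n
    by (rule borel_measurable_continuous_onI[OF hc])
  have hb: "\<bar>h n x\<bar> \<le> B" for n x
  proof -
    have "\<bar>max (- B) (min B (g n x))\<bar> \<le> B" using B by auto
    then have "\<bar>h n x\<bar> \<le> 1 * B" unfolding h_def abs_mult using \<kappa>(5,6)[of x] by (intro mult_mono) auto
    then show ?thesis by simp
  qed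
  have dom: "\<bar>f x - h n x\<bar> powr p \<le> (2 * B) powr p * indicator L x" for n x
  proof (cases "x \<in> L")
    case True
    then show ?thesis using f(4)[of x] hb[of n x] p by (auto intro!: powr_mono2)
  next
    case False
    then show ?thesis using h0[OF False] f(3)[of x] KL by auto
  qed
  have "emeasure lborel L < \<infinity>" using \<kappa>(2) emeasure_compact_finite by blast
  then have wi: "integrable lborel (\<lambda>x. (2 * B) powr p * indicator L x)"
    using \<kappa>(2) by (intro integrable_mult_right integrable_real_indicator) (auto simp: borel_compact)
  have fi: "integrable lborel (\<lambda>x. \<bar>f x - h n x\<bar> powr p)" for n
    by (rule Bochner_Integration.integrable_bound[OF wi])
      (use dom in \<open>auto intro: order_trans[OF _ abs_ge_self]\<close>)
  have "AE x in lebesgue. x \<notin> N" using N by (simp add: AE_not_in negligible_iff_null_sets)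
  then have AEN: "AE x in lborel. x \<notin> N" by (simp add: AE_completion_iff)
  have "(\<lambda>n. \<integral>x. \<bar>f x - h n x\<bar> powr p \<partial>lborel) \<longlonglongrightarrow> (\<integral>x. 0 \<partial>(lborel::'a measure))"
  proof (rule integral_dominated_convergence[OF _ _ wi])
    show "AE x in lborel. (\<lambda>n. \<bar>f x - h n x\<bar> powr p) \<longlonglongrightarrow> 0"
      using AEN
    proof eventually_elim
      case (elim x)
      have "(\<lambda>n. h n x) \<longlonglongrightarrow> \<kappa> x * max (- B) (min B (f x))"
        unfolding h_def by (intro tendsto_intros g elim)
      moreover have "\<kappa> x * max (- B) (min B (f x)) = f x"
        using f(3,4)[of x] \<kappa>(4)[of x] by (cases "x \<in> K") (auto simp: abs_le_iff min_def max_def)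
      ultimately have "(\<lambda>n. \<bar>f x - h n x\<bar>) \<longlonglongrightarrow> \<bar>f x - f x\<bar>" by (intro tendsto_intros) simp
      then have "(\<lambda>n. \<bar>f x - h n x\<bar>) \<longlonglongrightarrow> 0" by simp
      from tendsto_zero_powrI[OF this tendsto_const] show ?case using p by auto
    qed
  qed (use dom in auto)
  then have "\<forall>\<^sub>F n in sequentially. (\<integral>x. \<bar>f x - h n x\<bar> powr p \<partial>lborel) < e" using e by (auto dest: order_tendstoD(2)[where a = e])
  then obtain n where "(\<integral>x. \<bar>f x - h n x\<bar> powr p \<partial>lborel) < e" by (auto simp: eventually_sequentially)
  then show ?thesis using that[OF hc \<kappa>(2) h0 _ fi] by blast
qed

lemma Lp_approx_continuous:
  fixes f :: "'a::euclidean_space \<Rightarrow> real"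
  assumes p: "p > 0" and f: "f \<in> borel_measurable borel" "compact K" "\<And>x. x \<notin> K \<Longrightarrow> f x = 0"
    "integrable lborel (\<lambda>x. \<bar>f x\<bar> powr p)"
    and e: "e > 0"
  obtains g L where "continuous_on UNIV g" "compact L" "\<And>x. x \<notin> L \<Longrightarrow> g x = 0"
    "(\<integral>x. \<bar>f x - g x\<bar> powr p \<partial>lborel) < e" "integrable lborel (\<lambda>x. \<bar>f x - g x\<bar> powr p)"
proof -
  have [measurable]: "f \<in> borel_measurable borel" by fact
  define d where "d = e / (2 * 2 powr p)"
  have d: "d > 0" using e by (simp add: d_def)
  obtain N :: nat where N: "(\<integral>x. \<bar>f x - max (- real N) (min (real N) (f x))\<bar> powr p \<partial>lborel) < d"
    "integrable lborel (\<lambda>x. \<bar>f x - max (- real N) (min (real N) (f x))\<bar> powr p)"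
    using Lp_approx_bounded[OF p f(1,4) d] by blast
  define h where "h x = max (- real N) (min (real N) (f x))" for x
  have hm[measurable]: "h \<in> borel_measurable borel" unfolding h_def by measurable
  obtain g L where g: "continuous_on UNIV g" "compact L" "\<And>x. x \<notin> L \<Longrightarrow> g x = 0"
    "(\<integral>x. \<bar>h x - g x\<bar> powr p \<partial>lborel) < d" "integrable lborel (\<lambda>x. \<bar>h x - g x\<bar> powr p)"
  proof -
    have "h x = 0" if "x \<notin> K" for x using f(3)[OF that] by (simp add: h_def)
    moreover have "\<bar>h x\<bar> \<le> real N" for x by (auto simp: h_def)
    ultimately show ?thesis using Lp_approx_continuous_bounded[OF p hm f(2) _ _ d] that by blast
  qed
  have [measurable]: "g \<in> borel_measurable borel" by (rule borel_measurable_continuous_onI[OF g(1)])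
  have N': "(\<integral>x. \<bar>f x - h x\<bar> powr p \<partial>lborel) < d" "integrable lborel (\<lambda>x. \<bar>f x - h x\<bar> powr p)"
    using N by (auto simp: h_def)
  have s: "(f x - h x) + (h x - g x) = f x - g x" for x by simp
  have "integrable lborel (\<lambda>x. \<bar>f x - g x\<bar> powr p)"
    using powr_integrable_add[of p "\<lambda>x. f x - h x" lborel "\<lambda>x. h x - g x"] p N' g(5) by (simp add: s)
  moreover have "(\<integral>x. \<bar>f x - g x\<bar> powr p \<partial>lborel) < e"
  proof -
    have "(\<integral>x. \<bar>f x - g x\<bar> powr p \<partial>lborel) \<le>
      2 powr p * ((\<integral>x. \<bar>f x - h x\<bar> powr p \<partial>lborel) + (\<integral>x. \<bar>h x - g x\<bar> powr p \<partial>lborel))"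
      using powr_integral_add_le[of p "\<lambda>x. f x - h x" lborel "\<lambda>x. h x - g x"] p N' g(5) by (simp add: s)
    also have "\<dots> < 2 powr p * (d + d)" using N' g(4) by (intro mult_strict_left_mono) auto
    also have "\<dots> = e" by (simp add: d_def)
    finally show ?thesis .
  qed
  ultimately show ?thesis using that g by blast
qed

lemma mollify_Lp_integrable:
  fixes f :: "real^'n::finite \<Rightarrow> real"
  assumes p: "p \<ge> 1" and f: "integrable lborel f" "integrable lborel (\<lambda>x. \<bar>f x\<bar> powr p)" and r: "r > 0"
  shows "integrable lborel (\<lambda>x. \<bar>conv (mollifier r) f x - f x\<bar> powr p)"
proof -
  note m = mollifier[OF r, where ?'n = 'n]
  have "conv (mollifier r) f \<in> borel_measurable lborel"
    by (simp, intro borel_measurable_continuous_onI smooth_on_imp_continuous_on conv_smooth m f)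
  then show ?thesis
    using conv_Lp_le(1)[OF p m(1,2,4,3) f] f p by (intro powr_integrable_diff) auto
qed

text \<open>Mollification contracts the p-th power integral, so the convergence known for continuous
  functions of compact support extends to their closure.\<close>

lemma mollify_Lp:
  fixes f :: "real^'n::finite \<Rightarrow> real"
  assumes p: "p \<ge> 1" and f: "f \<in> borel_measurable borel" "compact K" "\<And>x. x \<notin> K \<Longrightarrow> f x = 0"
    "integrable lborel (\<lambda>x. \<bar>f x\<bar> powr p)" and e: "e > 0"
  shows "\<exists>d>0. \<forall>r. 0 < r \<and> r < d \<longrightarrow> (\<integral>x. \<bar>conv (mollifier r) f x - f x\<bar> powr p \<partial>lborel) \<le> e"
proof -
  \<comment> \<open>Splitting into three terms uses \<open>powr_add_le\<close> twice and gives 2^p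
    (c + 2^p (c + c)), which this choice makes equal to e.\<close>
  define c where "c = e / (2 powr p * (1 + 2 powr p * 2))"
  have c: "c > 0" using e by (simp add: c_def add_pos_pos)
  have p0: "p > 0" using p by simp
  have fi: "integrable lborel f" by (rule compact_support_powr_integrable_imp_integrable[OF p f])
  obtain g L where g: "continuous_on UNIV g" "compact L" "\<And>x. x \<notin> L \<Longrightarrow> g x = 0"
    "(\<integral>x. \<bar>f x - g x\<bar> powr p \<partial>lborel) < c" "integrable lborel (\<lambda>x. \<bar>f x - g x\<bar> powr p)"
    using Lp_approx_continuous[OF p0 f c] by blast
  have gi: "integrable lborel g" by (rule compact_support_continuous_integrable[OF g(1-3)])
  have gp: "integrable lborel (\<lambda>x. \<bar>g x\<bar> powr p)" by (rule compact_support_continuous_powr_integrable[OF p0 g(1-3)])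
  obtain d where d: "d > 0" "\<And>r. 0 < r \<Longrightarrow> r < d \<Longrightarrow> (\<integral>x. \<bar>conv (mollifier r) g x - g x\<bar> powr p \<partial>lborel) \<le> c"
    using mollify_Lp_continuous[OF p0 g(1-3) c] by blast
  have "(\<integral>x. \<bar>conv (mollifier r) f x - f x\<bar> powr p \<partial>lborel) \<le> e" if r: "0 < r" "r < d" for r
  proof -
    note m = mollifier[OF r(1), where ?'n = 'n]
    let ?a = "\<lambda>x. conv (mollifier r) (\<lambda>x. f x - g x) x"
    let ?b = "\<lambda>x. conv (mollifier r) g x - g x"
    let ?c = "\<lambda>x. - (f x - g x)"
    have dec: "conv (mollifier r) f x - f x = ?a x + (?b x + ?c x)" for x
      by (simp add: conv_diff[OF m(1) fi gi])
    have fgi: "integrable lborel (\<lambda>x. f x - g x)" using fi gi by simp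
    have mm: "?a \<in> borel_measurable lborel" "?b \<in> borel_measurable lborel" "?c \<in> borel_measurable lborel"
      using gi fi borel_measurable_continuous_onI[OF smooth_on_imp_continuous_on[OF conv_smooth[OF m(1) gi]]]
        borel_measurable_continuous_onI[OF smooth_on_imp_continuous_on[OF conv_smooth[OF m(1) fgi]]] by auto
    have ia: "integrable lborel (\<lambda>x. \<bar>?a x\<bar> powr p)" and
      a: "(\<integral>x. \<bar>?a x\<bar> powr p \<partial>lborel) \<le> c"
      using conv_Lp_le[OF p m(1,2,4,3) fgi g(5)] g(4) by auto
    have ib: "integrable lborel (\<lambda>x. \<bar>?b x\<bar> powr p)" by (rule mollify_Lp_integrable[OF p gi gp r(1)])
    have ic: "integrable lborel (\<lambda>x. \<bar>?c x\<bar> powr p)" using g(5) by (simp only: abs_minus_cancel)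
    have c': "(\<integral>x. \<bar>?c x\<bar> powr p \<partial>lborel) \<le> c" using g(4) by (simp only: abs_minus_cancel)
    have ibc: "integrable lborel (\<lambda>x. \<bar>?b x + ?c x\<bar> powr p)" using p0 mm ib ic by (intro powr_integrable_add) auto
    have "(\<integral>x. \<bar>?b x + ?c x\<bar> powr p \<partial>lborel) \<le> 2 powr p * ((\<integral>x. \<bar>?b x\<bar> powr p \<partial>lborel) + (\<integral>x. \<bar>?c x\<bar> powr p \<partial>lborel))"
      by (rule powr_integral_add_le) (use p0 mm ib ic in auto)
    also have "\<dots> \<le> 2 powr p * (c + c)" using d(2)[OF r] c' by (intro mult_left_mono add_mono) auto
    finally have bc: "(\<integral>x. \<bar>?b x + ?c x\<bar> powr p \<partial>lborel) \<le> 2 powr p * (c + c)" .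
    have "(\<integral>x. \<bar>conv (mollifier r) f x - f x\<bar> powr p \<partial>lborel) \<le>
       2 powr p * ((\<integral>x. \<bar>?a x\<bar> powr p \<partial>lborel) + (\<integral>x. \<bar>?b x + ?c x\<bar> powr p \<partial>lborel))"
      unfolding dec by (rule powr_integral_add_le[OF _ mm(1) borel_measurable_add[OF mm(2,3)] ia ibc]) (use p0 in simp)
    also have "\<dots> \<le> 2 powr p * (c + 2 powr p * (c + c))" using a bc by (intro mult_left_mono add_mono) auto
    also have "\<dots> = (2 powr p * (1 + 2 powr p * 2)) * c" by (simp add: algebra_simps)
    also have "\<dots> = e" by (simp add: c_def add_pos_pos less_imp_neq[symmetric])
    finally show ?thesis .
  qed
  then show ?thesis using d(1) by blast
qed

section \<open>Smooth approximation in variation\<close>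

lemma partial_deriv_sum:
  assumes "\<And>k. k \<in> I \<Longrightarrow> f k differentiable (at x)"
  shows "partial_deriv i (\<lambda>x. \<Sum>k\<in>I. f k x) x = (\<Sum>k\<in>I. partial_deriv i (f k) x)"
  using assms
proof (induction I rule: infinite_finite_induct)
  case (insert k F)
  have "(\<lambda>x. \<Sum>k\<in>F. f k x) differentiable (at x)"
    by (intro differentiable_sum) (use insert in auto)
  then show ?case using insert by (simp add: partial_deriv_add)
qed auto

lemma divergence_sum:
  assumes "\<And>k. k \<in> I \<Longrightarrow> v k \<in> test_functions \<Omega>"
  shows "divergence (\<lambda>x. \<Sum>k\<in>I. v k x) x = (\<Sum>k\<in>I. divergence (v k) x)"
proof -
  have "partial_deriv i (\<lambda>x. \<Sum>k\<in>I. v k x $ i) x = (\<Sum>k\<in>I. partial_deriv i (\<lambda>x. v k x $ i) x)" for i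
    using test_differentiable[OF test_component[OF assms]] by (intro partial_deriv_sum) blast
  then have "divergence (\<lambda>x. \<Sum>k\<in>I. v k x) x = (\<Sum>i\<in>UNIV. \<Sum>k\<in>I. partial_deriv i (\<lambda>x. v k x $ i) x)"
    by (simp add: divergence_def)
  also have "\<dots> = (\<Sum>k\<in>I. divergence (v k) x)" unfolding divergence_def by (rule sum.swap)
  finally show ?thesis .
qed

lemma test_divergence:
  fixes v :: "real^'n::finite \<Rightarrow> real^'n"
  assumes "v \<in> test_functions \<Omega>" shows "divergence v \<in> test_functions \<Omega>"
  unfolding divergence_def[abs_def] by (intro test_sum test_partial_deriv test_component assms)

lemma test_times_Lp:
  fixes \<phi> u :: "real^'n::finite \<Rightarrow> real"
  assumes p: "p \<ge> 1" and u: "u \<in> borel_measurable borel" "integrable lborel (\<lambda>x. \<bar>u x\<bar> powr p)"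
    and \<phi>: "\<phi> \<in> test_functions \<Omega>"
  shows "integrable lborel (\<lambda>x. u x * \<phi> x)" "integrable lborel (\<lambda>x. \<bar>u x * \<phi> x\<bar> powr p)"
proof -
  have [measurable]: "u \<in> borel_measurable borel" "\<phi> \<in> borel_measurable borel"
    using u test_borel[OF \<phi>] by auto
  obtain B where B: "B > 0" "\<And>x. norm (\<phi> x) \<le> B" using test_bounded[OF \<phi>] by metis
  obtain K where K: "compact K" "\<And>x. x \<notin> K \<Longrightarrow> \<phi> x = 0" using test_functionsE[OF \<phi>] by metis
  have i: "integrable lborel (\<lambda>x. B powr p * \<bar>u x\<bar> powr p)" using u by simp
  show ip: "integrable lborel (\<lambda>x. \<bar>u x * \<phi> x\<bar> powr p)"
  proof (rule Bochner_Integration.integrable_bound[OF i])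
    have "\<bar>u x * \<phi> x\<bar> powr p \<le> B powr p * \<bar>u x\<bar> powr p" for x
    proof -
      have "\<bar>u x * \<phi> x\<bar> powr p = \<bar>\<phi> x\<bar> powr p * \<bar>u x\<bar> powr p" by (simp add: abs_mult powr_mult)
      also have "\<dots> \<le> B powr p * \<bar>u x\<bar> powr p" using B p by (intro mult_right_mono powr_mono2) auto
      finally show ?thesis .
    qed
    then show "AE x in lborel. norm (\<bar>u x * \<phi> x\<bar> powr p) \<le> norm (B powr p * \<bar>u x\<bar> powr p)" by auto
  qed measurable
  show "integrable lborel (\<lambda>x. u x * \<phi> x)"
    by (rule compact_support_powr_integrable_imp_integrable[OF p _ K(1) _ ip]) (use K in auto)
qed

lemma mollify_Lp_eventually:
  fixes f :: "real^'n::finite \<Rightarrow> real"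
  assumes p: "p \<ge> 1" and f: "f \<in> borel_measurable borel" "compact K" "\<And>x. x \<notin> K \<Longrightarrow> f x = 0"
    "integrable lborel (\<lambda>x. \<bar>f x\<bar> powr p)" and e: "e > 0"
  shows "\<forall>\<^sub>F r in at_right 0. (\<integral>x. \<bar>conv (mollifier r) f x - f x\<bar> powr p \<partial>lborel) \<le> e"
  using mollify_Lp[OF assms] unfolding eventually_at_right_field by (auto simp: greaterThan_iff)

text \<open>The indicator of the d-neighbourhood of K is mollified at scale d, where 2 d = e. At
  points of K the mollifier sees only the value 1; at points further than e from K it sees only
  0.\<close>

lemma smooth_cutoff:
  fixes K :: "(real^'n::finite) set"
  assumes "compact K" "open U" "K \<subseteq> U"
  obtains \<kappa> :: "real^'n \<Rightarrow> real" where "\<kappa> \<in> test_functions U" "\<And>x. 0 \<le> \<kappa> x" "\<And>x. \<kappa> x \<le> 1" "\<And>x. x \<in> K \<Longrightarrow> \<kappa> x = 1"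
proof (cases "K = {}")
  case True
  then show ?thesis using that[of "\<lambda>x. 0"] test_zero by auto
next
  case False
  obtain e where e: "e > 0" "{x. infdist x K \<le> e} \<subseteq> U" using compact_in_open_separated[OF False assms(1-3)] by metis
  define d where "d = e / 2"
  have d: "d > 0" using e by (simp add: d_def)
  define A where "A = {x. infdist x K \<le> d}"
  have A: "compact A" unfolding A_def by (rule compact_infdist_le[OF False assms(1) d])
  have B: "compact {x. infdist x K \<le> e}" by (rule compact_infdist_le[OF False assms(1) e(1)])
  define f where "f = (indicator A :: real^'n \<Rightarrow> real)"
  have fi: "integrable lborel f"
    unfolding f_def using A emeasure_compact_finite[OF A] by (intro integrable_real_indicator) (auto simp: borel_compact)
  note m = mollifier[OF d, where ?'n='n]
  show ?thesis
  proof (rule that[of "conv (mollifier d) f"])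
    show "conv (mollifier d) f \<in> test_functions U"
    proof (rule test_functionsI[OF conv_smooth[OF m(1) fi] B e(2)])
      fix x assume x: "x \<notin> {x. infdist x K \<le> e}"
      show "conv (mollifier d) f x = 0"
      proof (rule conv_eq_0[of A])
        fix z assume "z \<in> A"
        then have "infdist z K \<le> d" by (simp add: A_def)
        moreover have "infdist x K \<le> infdist z K + dist x z" by (rule infdist_triangle)
        ultimately have "d \<le> norm (x - z)" using x by (simp add: d_def dist_norm)
        then show "mollifier d (x - z) = 0" by (rule m(5))
      qed (simp add: f_def)
    qed
    show "0 \<le> conv (mollifier d) f x" for x
      unfolding conv_def by (intro Bochner_Integration.integral_nonneg) (auto simp: f_def m(2))
    show "conv (mollifier d) f x \<le> 1" for x
      using conv_norm_le[OF m(1,2,4,3) fi, of 1 x] by (simp add: f_def)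
    show "conv (mollifier d) f x = 1" if "x \<in> K" for x
    proof -
      have "x \<in> A" using that d by (simp add: A_def)
      have "\<bar>conv (mollifier d) f x - f x\<bar> \<le> 0"
      proof (rule mollify_uniform[OF fi d])
        fix y assume "dist y x < d"
        then have "y \<in> A" using infdist_le[OF that, of y] by (simp add: A_def)
        then show "\<bar>f y - f x\<bar> \<le> 0" using \<open>x \<in> A\<close> by (simp add: f_def)
      qed
      then show ?thesis using \<open>x \<in> A\<close> by (simp add: f_def)
    qed
  qed
qed

text \<open>Since each cut-off is supported in the interior of the next compact set, differences of
  consecutive cut-offs meet only their immediate neighbours; and the cut-offs converge boundedly to
  the indicator of the open set.\<close>

lemma exhaustion_cutoffs:
  fixes \<Omega> :: "(real^'n::finite) set"
  assumes "open \<Omega>"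
  obtains K :: "nat \<Rightarrow> (real^'n) set" and \<kappa> :: "nat \<Rightarrow> real^'n \<Rightarrow> real" where
    "\<And>n. compact (K n)" "\<And>n. K n \<subseteq> \<Omega>" "\<And>n. K n \<subseteq> interior (K (Suc n))"
    "\<And>L. compact L \<Longrightarrow> L \<subseteq> \<Omega> \<Longrightarrow> \<exists>N. \<forall>n\<ge>N. L \<subseteq> K n"
    "\<And>n. \<kappa> n \<in> test_functions (interior (K (Suc n)))" "\<And>n x. 0 \<le> \<kappa> n x" "\<And>n x. \<kappa> n x \<le> 1"
    "\<And>n x. x \<in> K n \<Longrightarrow> \<kappa> n x = 1"
proof -
  obtain K where K: "\<And>n. compact (K n)" "\<And>n. K n \<subseteq> \<Omega>" "\<And>n. K n \<subseteq> interior (K (Suc n))"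
    "\<And>L. compact L \<Longrightarrow> L \<subseteq> \<Omega> \<Longrightarrow> \<exists>N. \<forall>n\<ge>N. L \<subseteq> K n"
    using open_Union_compact_subsets[OF assms] by metis
  have "\<exists>\<kappa>. \<kappa> \<in> test_functions (interior (K (Suc n))) \<and> (\<forall>x. 0 \<le> \<kappa> x \<and> \<kappa> x \<le> 1) \<and> (\<forall>x\<in>K n. \<kappa> x = (1::real))" for n
    using smooth_cutoff[OF K(1)[of n] open_interior K(3)[of n]] by metis
  then obtain \<kappa> where "\<And>n. \<kappa> n \<in> test_functions (interior (K (Suc n))) \<and> (\<forall>x. 0 \<le> \<kappa> n x \<and> \<kappa> n x \<le> 1) \<and> (\<forall>x\<in>K n. \<kappa> n x = (1::real))"
    by metis
  then show ?thesis using that[of K \<kappa>] K by blast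
qed

text \<open>Iterating \<open>powr_add_le\<close> costs a factor 2^p per summand. The weights grow
  geometrically, but do not depend on the number of summands; they are compensated later by choosing
  the k-th error small enough.\<close>

lemma powr_sum_le:
  fixes a :: "nat \<Rightarrow> real"
  assumes "p \<ge> 0"
  shows "\<bar>\<Sum>k<M. a k\<bar> powr p \<le> (\<Sum>k<M. (2 powr p) ^ Suc k * \<bar>a k\<bar> powr p)"
proof (induction M arbitrary: a)
  case (Suc M)
  have "\<bar>\<Sum>k<Suc M. a k\<bar> powr p = \<bar>a 0 + (\<Sum>k<M. a (Suc k))\<bar> powr p" by (simp only: sum.lessThan_Suc_shift)
  also have "\<dots> \<le> 2 powr p * (\<bar>a 0\<bar> powr p + \<bar>\<Sum>k<M. a (Suc k)\<bar> powr p)" by (rule powr_add_le[OF assms])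
  also have "\<dots> \<le> 2 powr p * (\<bar>a 0\<bar> powr p + (\<Sum>k<M. (2 powr p) ^ Suc k * \<bar>a (Suc k)\<bar> powr p))"
    by (intro mult_left_mono add_left_mono Suc) auto
  also have "\<dots> = (\<Sum>k<Suc M. (2 powr p) ^ Suc k * \<bar>a k\<bar> powr p)"
    by (simp only: sum.lessThan_Suc_shift) (simp add: algebra_simps sum_distrib_left)
  finally show ?case .
qed simp

lemma compact_ball_eventually:
  fixes K :: "'a::metric_space set"
  assumes "compact K" "open U" "K \<subseteq> U"
  shows "\<forall>\<^sub>F r in at_right 0. \<forall>x\<in>K. ball x r \<subseteq> U"
proof -
  obtain d where d: "d > 0" "(\<Union>x\<in>K. ball x d) \<subseteq> U" using compact_subset_open_imp_ball_epsilon_subset[OF assms] by metis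
  have "\<forall>x\<in>K. ball x r \<subseteq> U" if "r < d" for r
    using d(2) subset_ball[of r d] that by fastforce
  then show ?thesis using d(1) unfolding eventually_at_right_field by blast
qed

lemma divergence_test_scaleR:
  fixes \<phi> :: "real^'n::finite \<Rightarrow> real" and V :: "real^'n \<Rightarrow> real^'n"
  assumes "\<phi> \<in> test_functions \<Omega>" "smooth_on UNIV V"
  shows "divergence (\<lambda>x. \<phi> x *\<^sub>R V x) x = \<phi> x * divergence V x + (\<Sum>i\<in>UNIV. partial_deriv i \<phi> x * V x $ i)"
proof -
  have "partial_deriv i (\<lambda>x. \<phi> x * V x $ i) x = \<phi> x * partial_deriv i (\<lambda>x. V x $ i) x + partial_deriv i \<phi> x * V x $ i" for i
    using partial_deriv_scaleR[OF test_differentiable[OF assms(1)] smooth_on_imp_differentiable[OF smooth_on_component[OF open_UNIV assms(2)]], of x i i]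
    by simp
  then show ?thesis by (simp add: divergence_def sum.distrib sum_distrib_left)
qed

text \<open>The construction of Meyers and Serrin: u is cut into pieces by a smooth partition of
  unity and each piece is mollified at its own scale, fine enough not to leave \<Omega>. For the
  variation, the mollifications are moved to the test field v. Cutting the mollified fields again
  yields one admissible field, which accounts for V. What remains pairs v with mollifications of u
  times the derivatives of the partition functions; unmollified these terms cancel, so only
  mollification errors are left.\<close>

theorem smooth_approximation:
  fixes \<Omega> :: "(real^'n::finite) set" and u :: "real^'n \<Rightarrow> real"
  assumes \<Omega>: "open \<Omega>" and p: "p \<ge> 1"
    and u: "u \<in> borel_measurable borel" "\<And>x. x \<notin> \<Omega> \<Longrightarrow> u x = 0" "integrable lborel (\<lambda>x. \<bar>u x\<bar> powr p)"
    and V: "\<And>v. v \<in> test_functions \<Omega> \<Longrightarrow> (\<And>x. norm (v x) \<le> 1) \<Longrightarrow> (\<integral>x. u x * divergence v x \<partial>lborel) \<le> V"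
    and e: "e > 0"
  obtains w where "smooth_on \<Omega> w" "\<And>x. x \<notin> \<Omega> \<Longrightarrow> w x = 0" "w \<in> borel_measurable borel"
    "integrable lborel (\<lambda>x. \<bar>w x - u x\<bar> powr p)" "(\<integral>x. \<bar>w x - u x\<bar> powr p \<partial>lborel) \<le> e"
    "\<And>v. v \<in> test_functions \<Omega> \<Longrightarrow> (\<And>x. norm (v x) \<le> 1) \<Longrightarrow> (\<integral>x. w x * divergence v x \<partial>lborel) \<le> V + e"
proof -
  have [measurable]: "u \<in> borel_measurable borel" by fact
  obtain K :: "nat \<Rightarrow> (real^'n) set" and \<kappa> :: "nat \<Rightarrow> real^'n \<Rightarrow> real" where
    K: "\<And>n. compact (K n)" "\<And>n. K n \<subseteq> \<Omega>" "\<And>n. K n \<subseteq> interior (K (Suc n))"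
    "\<And>L. compact L \<Longrightarrow> L \<subseteq> \<Omega> \<Longrightarrow> \<exists>N. \<forall>n\<ge>N. L \<subseteq> K n"
    and \<kappa>: "\<And>n. \<kappa> n \<in> test_functions (interior (K (Suc n)))" "\<And>n x. 0 \<le> \<kappa> n x" "\<And>n x. \<kappa> n x \<le> 1"
    "\<And>n x. x \<in> K n \<Longrightarrow> \<kappa> n x = 1"
    by (rule exhaustion_cutoffs[OF \<Omega>]) (erule that)
  have Kmono: "K m \<subseteq> K n" if "m \<le> n" for m n
  proof -
    have "K n \<subseteq> K (Suc n)" for n using K(3) interior_subset by blast
    then show ?thesis using lift_Suc_mono_le[of K m n] that by blast
  qed
  \<comment> \<open>A partition of unity by telescoping: \<open>\<zeta> k\<close> vanishes on
    \<open>K (k - 1)\<close> and outside \<open>K (k + 1)\<close>.\<close>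
  define \<zeta> where "\<zeta> k x = \<kappa> k x - (if k = 0 then 0 else \<kappa> (k - 1) x)" for k x
  have \<kappa>0: "\<kappa> n x = 0" if "x \<notin> K (Suc n)" for n x
    using \<kappa>(1)[of n] that interior_subset[of "K (Suc n)"] by (metis subsetD test_functionsE)
  have \<kappa>\<Omega>: "\<kappa> n \<in> test_functions \<Omega>" for n
    using test_mono[OF \<kappa>(1)] interior_subset K(2) by (meson order_trans)
  have \<zeta>t: "\<zeta> k \<in> test_functions \<Omega>" for k
  proof (cases k)
    case 0
    then show ?thesis using \<kappa>\<Omega>[of 0] by (simp add: \<zeta>_def[abs_def])
  next
    case (Suc j)
    then have "\<zeta> k = (\<lambda>x. \<kappa> k x + (- 1) *\<^sub>R \<kappa> j x)" by (simp add: \<zeta>_def[abs_def])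
    then show ?thesis using test_add[OF \<kappa>\<Omega>[of k] test_cmult[OF \<kappa>\<Omega>[of j], of "- 1"]] by simp
  qed
  have \<zeta>0: "\<zeta> k x \<ge> 0" for k x
  proof (cases k)
    case 0
    then show ?thesis using \<kappa>(2) by (simp add: \<zeta>_def)
  next
    case (Suc j)
    then show ?thesis using \<kappa>(3)[of j x] \<kappa>(2)[of k x] \<kappa>(4)[of x k] \<kappa>0[of x j] by (cases "x \<in> K k") (auto simp: \<zeta>_def)
  qed
  have \<zeta>sum: "(\<Sum>k<Suc n. \<zeta> k x) = \<kappa> n x" for n x
    by (induction n) (auto simp: \<zeta>_def)
  have \<zeta>out: "\<zeta> k x = 0" if "x \<notin> K (Suc k)" for k x
    using that \<kappa>0[of x k] \<kappa>0[of x "k - 1"] Kmono[of k "Suc k"] by (cases k) (auto simp: \<zeta>_def)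
  have \<zeta>in: "\<zeta> k x = 0" if "x \<in> K j" "j < k" for k j x
  proof -
    have "j \<le> k - 1" "j \<le> k" using that by auto
    then have "x \<in> K (k - 1)" "x \<in> K k" using that Kmono by blast+
    then show ?thesis using that(2) \<kappa>(4)[of x k] \<kappa>(4)[of x "k - 1"] by (auto simp: \<zeta>_def)
  qed
  define a where "a k x = u x * \<zeta> k x" for k x
  define b where "b k i x = u x * partial_deriv i (\<zeta> k) x" for k i x
  have am[measurable]: "a k \<in> borel_measurable borel" for k unfolding a_def using test_borel[OF \<zeta>t] by simp
  have bm[measurable]: "b k i \<in> borel_measurable borel" for k i
    unfolding b_def using test_borel[OF test_partial_deriv[OF \<zeta>t]] by simp
  have a0: "a k x = 0" if "x \<notin> K (Suc k)" for k x by (simp add: a_def \<zeta>out[OF that])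
  have b0: "b k i x = 0" if "x \<notin> K (Suc k)" for k i x
    using partial_deriv_eq_0_outside[OF compact_imp_closed[OF K(1)], of "Suc k" "\<zeta> k" x i] that \<zeta>out by (simp add: b_def)
  have ai: "integrable lborel (a k)" "integrable lborel (\<lambda>x. \<bar>a k x\<bar> powr p)" for k
    unfolding a_def by (rule test_times_Lp[OF p u(1,3) \<zeta>t])+
  have bi: "integrable lborel (b k i)" for k i
    unfolding b_def by (rule test_times_Lp[OF p u(1,3) test_partial_deriv[OF \<zeta>t]])+
  \<comment> \<open>The divisor in \<open>e1\<close> cancels the weight of the k-th term in
    \<open>powr_sum_le\<close>; the one in \<open>e2\<close> distributes the error over the
    coordinates. The powers of 1/2 sum to 1.\<close>
  define e1 where "e1 k = e * (1/2) ^ Suc k / (2 powr p) ^ Suc k" for k :: nat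
  define e2 where "e2 k = e * (1/2) ^ Suc k / real CARD('n)" for k :: nat
  have e12: "e1 k > 0" "e2 k > 0" for k using e by (auto simp: e1_def e2_def)
  \<comment> \<open>Besides the two error bounds, the radius has to be so small that mollifying the
    k-th piece moves points of the first k + 1 compact sets by at most one layer.\<close>
  define Q where "Q k r \<longleftrightarrow> r > 0 \<and> (\<forall>j\<le>Suc k. \<forall>x\<in>K j. ball x r \<subseteq> interior (K (Suc j))) \<and>
     (\<integral>x. \<bar>conv (mollifier r) (a k) x - a k x\<bar> powr p \<partial>lborel) \<le> e1 k \<and>
     (\<forall>i. (\<integral>x. \<bar>conv (mollifier r) (b k i) x - b k i x\<bar> powr 1 \<partial>lborel) \<le> e2 k)" for k r
  have "\<exists>r. Q k r" for k
  proof -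
    have "\<forall>\<^sub>F r in at_right (0::real). r > 0"
      by (simp add: eventually_at_right_less)
    moreover have "\<forall>\<^sub>F r in at_right 0. \<forall>j\<in>{..Suc k}. \<forall>x\<in>K j. ball x r \<subseteq> interior (K (Suc j))"
      by (intro eventually_ball_finite ballI compact_ball_eventually K open_interior) auto
    moreover have "\<forall>\<^sub>F r in at_right 0. (\<integral>x. \<bar>conv (mollifier r) (a k) x - a k x\<bar> powr p \<partial>lborel) \<le> e1 k"
      by (rule mollify_Lp_eventually[OF p am K(1) a0 ai(2) e12(1)])
    moreover have "\<forall>\<^sub>F r in at_right 0. \<forall>i\<in>UNIV. (\<integral>x. \<bar>conv (mollifier r) (b k i) x - b k i x\<bar> powr 1 \<partial>lborel) \<le> e2 k"
      by (intro eventually_ball_finite ballI finite_UNIV mollify_Lp_eventually[OF _ bm K(1) b0 _ e12(2)]) (use bi in auto)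
    ultimately have "\<forall>\<^sub>F r in at_right 0. r > 0 \<and> (\<forall>j\<in>{..Suc k}. \<forall>x\<in>K j. ball x r \<subseteq> interior (K (Suc j))) \<and>
     (\<integral>x. \<bar>conv (mollifier r) (a k) x - a k x\<bar> powr p \<partial>lborel) \<le> e1 k \<and>
     (\<forall>i\<in>UNIV. (\<integral>x. \<bar>conv (mollifier r) (b k i) x - b k i x\<bar> powr 1 \<partial>lborel) \<le> e2 k)"
      by (intro eventually_conj)
    from eventually_happens[OF this] show ?thesis by (auto simp: Q_def trivial_limit_at_right_real)
  qed
  then obtain r where Qr: "\<And>k. Q k (r k)" by metis
  have r: "\<And>k. r k > 0" "\<And>k j x. j \<le> Suc k \<Longrightarrow> x \<in> K j \<Longrightarrow> ball x (r k) \<subseteq> interior (K (Suc j))"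
     "\<And>k. (\<integral>x. \<bar>conv (mollifier (r k)) (a k) x - a k x\<bar> powr p \<partial>lborel) \<le> e1 k"
     "\<And>k i. (\<integral>x. \<bar>conv (mollifier (r k)) (b k i) x - b k i x\<bar> powr 1 \<partial>lborel) \<le> e2 k"
    using Qr by (auto simp: Q_def)
  let ?\<eta> = "\<lambda>k. mollifier (r k) :: real^'n \<Rightarrow> real"
  note m = mollifier[OF r(1), where ?'n='n]
  define W where "W k = conv (?\<eta> k) (a k)" for k
  define w where "w x = (\<Sum>k. W k x)" for x
  have Wsm: "smooth_on UNIV (W k)" for k unfolding W_def by (rule conv_smooth[OF m(1) ai(1)])
  have [measurable]: "W k \<in> borel_measurable borel" for k
    by (intro borel_measurable_continuous_onI smooth_on_imp_continuous_on Wsm)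
  \<comment> \<open>Why two layers: mollification around a point of \<open>K N\<close> looks at most
    into \<open>K (N + 1)\<close>, and there \<open>\<zeta> k\<close> is zero as soon as
    \<open>k \<ge> N + 2\<close>.\<close>
  have Win: "W k x = 0" if x: "x \<in> K N" and k: "N + 2 \<le> k" for k N x
    unfolding W_def
  proof (rule conv_eq_0[of "{z. \<zeta> k z \<noteq> 0}"])
    fix z assume z: "z \<in> {z. \<zeta> k z \<noteq> 0}"
    have "z \<notin> ball x (r k)"
    proof
      assume "z \<in> ball x (r k)"
      then have "z \<in> K (Suc N)" using r(2)[of N k x] x k interior_subset by fastforce
      then show False using \<zeta>in[of z "Suc N" k] k z by auto
    qed
    then show "?\<eta> k (x - z) = 0" by (intro m(5)) (simp add: dist_norm)
  qed (simp add: a_def)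
  have Wout: "W k x = 0" if "x \<notin> \<Omega>" for k x
    unfolding W_def
  proof (rule conv_eq_0[of "K (Suc k)"])
    fix z assume z: "z \<in> K (Suc k)"
    have "x \<notin> ball z (r k)" using r(2)[of "Suc k" k z] z that K(2)[of "Suc (Suc k)"] interior_subset by blast
    then show "?\<eta> k (x - z) = 0" by (intro m(5)) (simp add: dist_norm norm_minus_commute)
  qed (rule a0)
  have wsum: "w x = (\<Sum>k<N + 2. W k x)" if "x \<in> K N" for x N
    unfolding w_def by (rule suminf_finite) (use Win[OF that] in auto)
  have in_K: "\<exists>N. x \<in> K N" if "x \<in> \<Omega>" for x
    using K(4)[of "{x}"] that by auto
  have wsm: "smooth_on \<Omega> w"
  proof (rule smooth_on_local)
    fix x assume "x \<in> \<Omega>"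
    then obtain N where "x \<in> K N" using in_K by auto
    then have x: "x \<in> interior (K (Suc N))" using K(3) by auto
    have "smooth_on (interior (K (Suc N))) (\<lambda>x. \<Sum>k<Suc N + 2. W k x)"
      by (intro smooth_on_sum open_interior smooth_on_subset[OF Wsm]) auto
    then have "smooth_on (interior (K (Suc N))) w"
      by (rule smooth_on_cong[OF open_interior, rotated]) (metis wsum interior_subset subsetD)
    then show "\<exists>S. open S \<and> x \<in> S \<and> smooth_on S w" using x open_interior by blast
  qed
  have w0: "w x = 0" if "x \<notin> \<Omega>" for x using Wout[OF that] by (simp add: w_def)
  have wm[measurable]: "w \<in> borel_measurable borel" unfolding w_def by measurable
  define D where "D k x = \<bar>W k x - a k x\<bar> powr p" for k x
  have Di: "integrable lborel (D k)" for k
    unfolding D_def W_def by (rule mollify_Lp_integrable[OF p ai r(1)])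
  have usum: "u x = (\<Sum>k<N + 2. a k x)" if "x \<in> K N" for x N
    using \<zeta>sum[of x "Suc N"] \<kappa>(4)[of x "Suc N"] Kmono[of N "Suc N"] that
    by (auto simp: a_def sum_distrib_left[symmetric])
  \<comment> \<open>At each point only finitely many terms occur, but their number depends on the
    point; the full series is a bound that can be integrated termwise.\<close>
  have point: "ennreal (\<bar>w x - u x\<bar> powr p) \<le> (\<Sum>k. ennreal ((2 powr p) ^ Suc k * D k x))" for x
  proof (cases "x \<in> \<Omega>")
    case True
    then obtain N where N: "x \<in> K N" using in_K by auto
    have "\<bar>w x - u x\<bar> powr p = \<bar>\<Sum>k<N + 2. W k x - a k x\<bar> powr p"
      by (simp only: wsum[OF N] usum[OF N] sum_subtractf)
    also have "\<dots> \<le> (\<Sum>k<N + 2. (2 powr p) ^ Suc k * D k x)"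
      unfolding D_def by (rule powr_sum_le) (use p in auto)
    finally have "ennreal (\<bar>w x - u x\<bar> powr p) \<le> ennreal (\<Sum>k<N + 2. (2 powr p) ^ Suc k * D k x)" by (rule ennreal_leI)
    also have "\<dots> = (\<Sum>k<N + 2. ennreal ((2 powr p) ^ Suc k * D k x))"
      by (subst sum_ennreal) (auto simp: D_def)
    also have "\<dots> \<le> (\<Sum>k. ennreal ((2 powr p) ^ Suc k * D k x))" by (rule sum_le_suminf) auto
    finally show ?thesis .
  qed (simp add: w0 u(2))
  have "(\<integral>\<^sup>+x. ennreal (\<bar>w x - u x\<bar> powr p) \<partial>lborel) \<le> (\<integral>\<^sup>+x. (\<Sum>k. ennreal ((2 powr p) ^ Suc k * D k x)) \<partial>lborel)"
    by (intro nn_integral_mono point)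
  also have "\<dots> = (\<Sum>k. \<integral>\<^sup>+x. ennreal ((2 powr p) ^ Suc k * D k x) \<partial>lborel)"
    by (rule nn_integral_suminf) (auto simp: D_def)
  also have "\<dots> \<le> (\<Sum>k. ennreal (e * (1/2) ^ Suc k))"
  proof (rule suminf_le)
    fix k
    have "(\<integral>\<^sup>+x. ennreal ((2 powr p) ^ Suc k * D k x) \<partial>lborel) = ennreal (\<integral>x. (2 powr p) ^ Suc k * D k x \<partial>lborel)"
      by (rule nn_integral_eq_integral[OF integrable_mult_right[OF Di]]) (simp add: D_def)
    also have "\<dots> \<le> ennreal ((2 powr p) ^ Suc k * e1 k)"
      using r(3)[of k] by (intro ennreal_leI) (auto simp: D_def W_def intro!: mult_left_mono)
    also have "\<dots> = ennreal (e * (1/2) ^ Suc k)" by (simp add: e1_def)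
    finally show "(\<integral>\<^sup>+x. ennreal ((2 powr p) ^ Suc k * D k x) \<partial>lborel) \<le> ennreal (e * (1/2) ^ Suc k)" .
  qed auto
  also have "\<dots> = ennreal e"
    using sums_mult[OF power_half_series, of e] e by (intro suminf_ennreal_eq) auto
  finally have nn: "(\<integral>\<^sup>+x. ennreal (\<bar>w x - u x\<bar> powr p) \<partial>lborel) \<le> ennreal e" .
  have wi: "integrable lborel (\<lambda>x. \<bar>w x - u x\<bar> powr p)"
    by (rule integrableI_bounded) (use nn in \<open>auto simp: le_less_trans\<close>)
  have wle: "(\<integral>x. \<bar>w x - u x\<bar> powr p \<partial>lborel) \<le> e"
    using nn nn_integral_eq_integral[OF wi] e by (simp add: ennreal_le_iff)
  have wV: "(\<integral>x. w x * divergence v x \<partial>lborel) \<le> V + e"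
    if v: "v \<in> test_functions \<Omega>" "\<And>x. norm (v x) \<le> 1" for v
  proof -
    obtain L where L: "compact L" "L \<subseteq> \<Omega>" "\<And>x. x \<notin> L \<Longrightarrow> v x = 0" using test_functionsE[OF v(1)] by metis
    obtain N where N: "L \<subseteq> K N" using K(4)[OF L(1,2)] by auto
    \<comment> \<open>On \<open>K N\<close>, which contains the support of v, exactly the pieces
      with index below N + 2 can contribute, and the partition functions with these indices sum to
      1.\<close>
    define M where "M = N + 2"
    note vi = test_integrable[OF v(1)]
    note vti = test_component[OF v(1)]
    have div0: "divergence v x = 0" if "x \<notin> K N" for x
    proof -
      have "partial_deriv i (\<lambda>x. v x $ i) x = 0" for i
        by (rule partial_deriv_eq_0_outside[of L]) (use L that N in \<open>auto simp: compact_imp_closed\<close>)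
      then show ?thesis by (simp add: divergence_def)
    qed
    define X where "X k = conv (?\<eta> k) v" for k
    have Xsm: "smooth_on UNIV (X k)" for k unfolding X_def by (rule conv_smooth[OF m(1) vi])
    have Xc: "X k x $ i = conv (?\<eta> k) (\<lambda>y. v y $ i) x" for k x i
      unfolding X_def by (rule conv_component[OF m(1) vi])
    have Xn: "norm (X k x) \<le> 1" for k x unfolding X_def by (rule conv_norm_le[OF m(1,2,4,3) vi v(2)])
    have Xdiv: "divergence (X k) x = conv (?\<eta> k) (divergence v) x" for k x
    proof -
      have "divergence (X k) x = (\<Sum>i\<in>UNIV. conv (?\<eta> k) (partial_deriv i (\<lambda>y. v y $ i)) x)"
        unfolding divergence_def Xc using conv_partial_deriv[OF m(1) vti] by simp
      also have "\<dots> = conv (?\<eta> k) (divergence v) x"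
        unfolding conv_def divergence_def[abs_def] scaleR_sum_right
        by (rule Bochner_Integration.integral_sum[symmetric])
          (rule conv_integrable[OF m(1) test_integrable[OF test_partial_deriv[OF vti]]])
      finally show ?thesis .
    qed
    \<comment> \<open>The pieces of the mollified fields recombine to the single test field
      \<open>Z\<close>. Its norm is at most 1 because the partition functions are nonnegative with
      sum at most 1.\<close>
    define Y where "Y k x = \<zeta> k x *\<^sub>R X k x" for k x
    have Yt: "Y k \<in> test_functions \<Omega>" for k unfolding Y_def by (rule test_smooth_scaleR[OF \<zeta>t Xsm])
    define Z where "Z x = (\<Sum>k<M. Y k x)" for x
    have Zt: "Z \<in> test_functions \<Omega>" unfolding Z_def by (rule test_sum[OF Yt])
    have Zn: "norm (Z x) \<le> 1" for x
    proof -
      have "norm (Z x) \<le> (\<Sum>k<M. \<zeta> k x * norm (X k x))"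
        unfolding Z_def Y_def by (rule order_trans[OF norm_sum]) (simp add: \<zeta>0)
      also have "\<dots> \<le> (\<Sum>k<M. \<zeta> k x * 1)" by (intro sum_mono mult_left_mono Xn \<zeta>0)
      also have "\<dots> = \<kappa> (Suc N) x" using \<zeta>sum[of x "Suc N"] by (simp add: M_def)
      also have "\<dots> \<le> 1" by (rule \<kappa>(3))
      finally show ?thesis .
    qed
    have divi: "integrable lborel (divergence v)" by (rule test_integrable[OF test_divergence[OF v(1)]])
    have "w x * divergence v x = (\<Sum>k<M. W k x * divergence v x)" for x
      using wsum[of x N] div0[of x] by (cases "x \<in> K N") (auto simp: M_def sum_distrib_right distrib_right)
    then have "(\<integral>x. w x * divergence v x \<partial>lborel) = (\<integral>x. (\<Sum>k<M. W k x * divergence v x) \<partial>lborel)" by simp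
    also have "\<dots> = (\<Sum>k<M. \<integral>x. W k x * divergence v x \<partial>lborel)"
      unfolding W_def by (rule Bochner_Integration.integral_sum) (rule conv_adjoint(2)[OF m(1,3) ai(1) divi])
    also have "\<dots> = (\<Sum>k<M. \<integral>x. a k x * divergence (X k) x \<partial>lborel)"
      unfolding W_def Xdiv by (intro sum.cong refl conv_adjoint(1)[OF m(1,3) ai(1) divi])
    also have "\<dots> = (\<Sum>k<M. (\<integral>x. u x * divergence (Y k) x \<partial>lborel) - (\<Sum>i\<in>UNIV. \<integral>x. b k i x * X k x $ i \<partial>lborel))"
    proof (rule sum.cong[OF refl])
      fix k
      \<comment> \<open>The product rule for \<open>\<zeta> k\<close> times \<open>X k\<close>,
        solved for the term without derivatives of the partition function.\<close>
      have e: "a k x * divergence (X k) x = u x * divergence (Y k) x - (\<Sum>i\<in>UNIV. b k i x * X k x $ i)" for x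
        unfolding Y_def divergence_test_scaleR[OF \<zeta>t Xsm]
        by (simp add: a_def b_def distrib_left sum_distrib_left mult.assoc)
      have i1: "integrable lborel (\<lambda>x. u x * divergence (Y k) x)"
        by (rule test_times_Lp(1)[OF p u(1,3) test_divergence[OF Yt]])
      have i2: "integrable lborel (\<lambda>x. b k i x * X k x $ i)" for i
      proof -
        have "(\<lambda>x. partial_deriv i (\<zeta> k) x *\<^sub>R X k x $ i) \<in> test_functions \<Omega>"
          by (rule test_smooth_scaleR[OF test_partial_deriv[OF \<zeta>t] smooth_on_component[OF open_UNIV Xsm]])
        from test_times_Lp(1)[OF p u(1,3) this] show ?thesis by (simp add: b_def mult.assoc)
      qed
      show "(\<integral>x. a k x * divergence (X k) x \<partial>lborel) =
        (\<integral>x. u x * divergence (Y k) x \<partial>lborel) - (\<Sum>i\<in>UNIV. \<integral>x. b k i x * X k x $ i \<partial>lborel)"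
        unfolding e using i1 i2 by (subst Bochner_Integration.integral_diff) auto
    qed
    also have "\<dots> = (\<Sum>k<M. \<integral>x. u x * divergence (Y k) x \<partial>lborel) - (\<Sum>k<M. \<Sum>i\<in>UNIV. \<integral>x. b k i x * X k x $ i \<partial>lborel)"
      by (rule sum_subtractf)
    also have "(\<Sum>k<M. \<integral>x. u x * divergence (Y k) x \<partial>lborel) = (\<integral>x. u x * divergence Z x \<partial>lborel)"
    proof -
      have "(\<Sum>k<M. \<integral>x. u x * divergence (Y k) x \<partial>lborel) = (\<integral>x. (\<Sum>k<M. u x * divergence (Y k) x) \<partial>lborel)"
        by (rule Bochner_Integration.integral_sum[symmetric]) (rule test_times_Lp(1)[OF p u(1,3) test_divergence[OF Yt]])
      then show ?thesis unfolding Z_def divergence_sum[OF Yt] by (simp add: sum_distrib_left)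
    qed
    also have "(\<Sum>k<M. \<Sum>i\<in>UNIV. \<integral>x. b k i x * X k x $ i \<partial>lborel) =
       (\<Sum>k<M. \<Sum>i\<in>UNIV. (\<integral>x. (conv (?\<eta> k) (b k i) x - b k i x) * v x $ i \<partial>lborel))"
    proof -
      have vib: "integrable lborel (\<lambda>x. b k i x * v x $ i)" for k i
      proof -
        have "(\<lambda>x. partial_deriv i (\<zeta> k) x *\<^sub>R v x $ i) \<in> test_functions \<Omega>"
          by (rule test_smooth_scaleR[OF test_partial_deriv[OF \<zeta>t] test_smooth[OF vti]])
        from test_times_Lp(1)[OF p u(1,3) this] show ?thesis by (simp add: b_def mult.assoc)
      qed
      have "(\<integral>x. (conv (?\<eta> k) (b k i) x - b k i x) * v x $ i \<partial>lborel) = (\<integral>x. b k i x * X k x $ i \<partial>lborel) - (\<integral>x. b k i x * v x $ i \<partial>lborel)" for k i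
        unfolding Xc left_diff_distrib
        using conv_adjoint[OF m(1,3) bi[of k i] test_integrable[OF vti[of i]], of k] vib[of k i] by simp
      \<comment> \<open>On the support of v the first M partition functions add up to 1, so their
        derivatives add up to 0. This is the cancellation that reduces the remainder to pure
        mollification errors.\<close>
      moreover have "(\<Sum>k<M. \<Sum>i\<in>UNIV. (\<integral>x. b k i x * v x $ i \<partial>lborel)) = 0"
      proof -
        have zero: "(\<Sum>k<M. b k i x * v x $ i) = 0" for i x
        proof (cases "x \<in> K N")
          case True
          have "(\<Sum>k<M. b k i x) = u x * (\<Sum>k<M. partial_deriv i (\<zeta> k) x)" by (simp add: b_def sum_distrib_left)
          also have "(\<Sum>k<M. partial_deriv i (\<zeta> k) x) = partial_deriv i (\<lambda>x. \<Sum>k<M. \<zeta> k x) x"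
            by (rule partial_deriv_sum[symmetric]) (rule test_differentiable[OF \<zeta>t])
          also have "\<dots> = partial_deriv i (\<lambda>x. 1) x"
          proof (rule partial_deriv_cong_open[of "interior (K (Suc N))"])
            show "x \<in> interior (K (Suc N))" using True K(3) by auto
            fix y assume "y \<in> interior (K (Suc N))"
            then have "y \<in> K (Suc N)" using interior_subset by blast
            then show "(\<Sum>k<M. \<zeta> k y) = 1" using \<zeta>sum[of y "Suc N"] \<kappa>(4)[of y "Suc N"] by (simp add: M_def)
          qed simp
          finally show ?thesis by (simp add: sum_distrib_right[symmetric])
        next
          case False
          then have "x \<notin> L" using N by auto
          then show ?thesis using L(3) by simp
        qed
        have "(\<Sum>k<M. \<Sum>i\<in>UNIV. (\<integral>x. b k i x * v x $ i \<partial>lborel)) = (\<Sum>i\<in>UNIV. \<Sum>k<M. (\<integral>x. b k i x * v x $ i \<partial>lborel))"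
          by (rule sum.swap)
        also have "\<dots> = (\<Sum>i\<in>UNIV. (\<integral>x. (\<Sum>k<M. b k i x * v x $ i) \<partial>lborel))"
          using vib by simp
        also have "\<dots> = 0" unfolding zero by simp
        finally show ?thesis .
      qed
      ultimately show ?thesis by (simp add: sum_subtractf)
    qed
    finally have eq: "(\<integral>x. w x * divergence v x \<partial>lborel) = (\<integral>x. u x * divergence Z x \<partial>lborel) -
       (\<Sum>k<M. \<Sum>i\<in>UNIV. (\<integral>x. (conv (?\<eta> k) (b k i) x - b k i x) * v x $ i \<partial>lborel))" .
    have small: "\<bar>\<integral>x. (conv (?\<eta> k) (b k i) x - b k i x) * v x $ i \<partial>lborel\<bar> \<le> e2 k" for k i
    proof -
      have i1: "integrable lborel (\<lambda>x. \<bar>conv (?\<eta> k) (b k i) x - b k i x\<bar>)"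
        using mollify_Lp_integrable[of 1 "b k i" "r k"] bi[of k i] r(1)[of k] by simp
      have "conv (?\<eta> k) (b k i) \<in> borel_measurable borel"
        by (intro borel_measurable_continuous_onI smooth_on_imp_continuous_on conv_smooth m bi)
      then have meas: "(\<lambda>x. (conv (?\<eta> k) (b k i) x - b k i x) * v x $ i) \<in> borel_measurable lborel"
        using test_borel[OF vti[of i]] by simp
      have vle: "\<bar>v x $ i\<bar> \<le> 1" for x using component_le_norm_cart[of "v x" i] v(2)[of x] by linarith
      have ple: "\<bar>(conv (?\<eta> k) (b k i) x - b k i x) * v x $ i\<bar> \<le> \<bar>conv (?\<eta> k) (b k i) x - b k i x\<bar>" for x
        unfolding abs_mult using mult_left_mono[OF vle, of "\<bar>conv (?\<eta> k) (b k i) x - b k i x\<bar>" x] by simp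
      have "norm (\<integral>x. (conv (?\<eta> k) (b k i) x - b k i x) * v x $ i \<partial>lborel) \<le> (\<integral>x. \<bar>conv (?\<eta> k) (b k i) x - b k i x\<bar> \<partial>lborel)"
        by (rule Bochner_Integration.integral_norm_bound_integral[OF Bochner_Integration.integrable_bound[OF i1 meas] i1])
          (use ple in auto)
      also have "\<dots> \<le> e2 k" using r(4)[of k i] by simp
      finally show ?thesis by simp
    qed
    have "- (\<Sum>k<M. \<Sum>i\<in>UNIV. (\<integral>x. (conv (?\<eta> k) (b k i) x - b k i x) * v x $ i \<partial>lborel))
      \<le> (\<Sum>k<M. \<Sum>i\<in>(UNIV :: 'n set). e2 k)"
      unfolding sum_negf[symmetric] by (intro sum_mono) (use small in \<open>auto simp: abs_le_iff\<close>)
    also have "\<dots> = (\<Sum>k<M. e * (1/2) ^ Suc k)" by (simp add: e2_def)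
    also have "\<dots> \<le> (\<Sum>k. e * (1/2) ^ Suc k)"
      by (rule sum_le_suminf) (use e sums_mult[OF power_half_series, of e] in \<open>auto simp: sums_iff\<close>)
    also have "\<dots> = e" using sums_mult[OF power_half_series, of e] by (simp add: sums_iff)
    finally show ?thesis using eq V[OF Zt Zn] by linarith
  qed
  show ?thesis by (rule that[OF wsm w0 wm wi wle wV])
qed

section \<open>Integration by parts and the L_1 norm of a gradient\<close>

lemma partial_deriv_test_mult:
  fixes \<phi> w :: "real^'n::finite \<Rightarrow> real"
  assumes "open \<Omega>" "smooth_on \<Omega> w" "\<phi> \<in> test_functions \<Omega>"
  shows "partial_deriv i (\<lambda>x. \<phi> x * w x) x = \<phi> x * partial_deriv i w x + partial_deriv i \<phi> x * w x"
proof (cases "x \<in> \<Omega>")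
  case True
  then show ?thesis
    using partial_deriv_scaleR[OF test_differentiable[OF assms(3)] smooth_on_imp_differentiable[OF assms(2) True], of i] by simp
next
  case False
  obtain K where K: "compact K" "K \<subseteq> \<Omega>" "\<And>x. x \<notin> K \<Longrightarrow> \<phi> x = 0" using test_functionsE[OF assms(3)] by metis
  then have "x \<notin> K" using False by auto
  have "partial_deriv i (\<lambda>x. \<phi> x * w x) x = 0" "partial_deriv i \<phi> x = 0"
    by (rule partial_deriv_eq_0_outside[of K]; use K \<open>x \<notin> K\<close> in \<open>auto simp: compact_imp_closed\<close>)+
  then show ?thesis using K(3)[OF \<open>x \<notin> K\<close>] by simp
qed

lemma integration_by_parts:
  fixes \<phi> w :: "real^'n::finite \<Rightarrow> real"
  assumes "open \<Omega>" "smooth_on \<Omega> w" "\<phi> \<in> test_functions \<Omega>"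
  shows "(\<integral>x. w x * partial_deriv i \<phi> x \<partial>lborel) = - (\<integral>x. partial_deriv i w x * \<phi> x \<partial>lborel)"
    and "integrable lborel (\<lambda>x. w x * partial_deriv i \<phi> x)" "integrable lborel (\<lambda>x. partial_deriv i w x * \<phi> x)"
proof -
  have t: "(\<lambda>x. \<phi> x * w x) \<in> test_functions \<Omega>" using test_smooth_on_scaleR[OF assms(1,3,2)] by simp
  have t1: "(\<lambda>x. partial_deriv i \<phi> x * w x) \<in> test_functions \<Omega>"
    using test_smooth_on_scaleR[OF assms(1) test_partial_deriv[OF assms(3)] assms(2)] by simp
  have t2: "(\<lambda>x. \<phi> x * partial_deriv i w x) \<in> test_functions \<Omega>"
    using test_smooth_on_scaleR[OF assms(1,3) smooth_on_partial_deriv[OF assms(2)]] by simp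
  show i1: "integrable lborel (\<lambda>x. w x * partial_deriv i \<phi> x)" using test_integrable[OF t1] by (simp add: mult.commute)
  show i2: "integrable lborel (\<lambda>x. partial_deriv i w x * \<phi> x)" using test_integrable[OF t2] by (simp add: mult.commute)
  have "(\<integral>x. partial_deriv i w x * \<phi> x + w x * partial_deriv i \<phi> x \<partial>lborel) = 0"
    using integral_partial_deriv_test[OF t, of i] partial_deriv_test_mult[OF assms, of i] by (simp add: mult.commute)
  then show "(\<integral>x. w x * partial_deriv i \<phi> x \<partial>lborel) = - (\<integral>x. partial_deriv i w x * \<phi> x \<partial>lborel)"
    using i1 i2 by simp
qed

lemma smooth_on_gradient:
  fixes w :: "real^'n::finite \<Rightarrow> real"
  assumes "open \<Omega>" "smooth_on \<Omega> w" shows "smooth_on \<Omega> (gradient w)"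
  by (rule smooth_on_vec[OF assms(1)]) (simp add: gradient_def smooth_on_partial_deriv[OF assms(2)])

lemma borel_on_open:
  fixes f :: "'a::euclidean_space \<Rightarrow> 'b::{real_normed_vector, second_countable_topology}"
  assumes "open \<Omega>" "continuous_on \<Omega> f"
  shows "(\<lambda>x. indicator \<Omega> x *\<^sub>R f x) \<in> borel_measurable borel"
  using assms by (intro borel_measurable_continuous_on_indicator) auto

text \<open>Testing against regularisations of \<open>- \<nabla>w / |\<nabla>w|\<close>.\<close>

lemma gradient_L1_le:
  fixes w :: "real^'n::finite \<Rightarrow> real"
  assumes \<Omega>: "open \<Omega>" and w: "smooth_on \<Omega> w"
    and A: "\<And>v. v \<in> test_functions \<Omega> \<Longrightarrow> (\<And>x. norm (v x) \<le> 1) \<Longrightarrow> (\<integral>x. w x * divergence v x \<partial>lborel) \<le> A"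
  shows "(\<integral>\<^sup>+x. ennreal (indicator \<Omega> x * norm (gradient w x)) \<partial>lborel) \<le> ennreal A"
proof -
  obtain K :: "nat \<Rightarrow> (real^'n) set" and \<kappa> :: "nat \<Rightarrow> real^'n \<Rightarrow> real" where
    K: "\<And>n. compact (K n)" "\<And>n. K n \<subseteq> \<Omega>" "\<And>n. K n \<subseteq> interior (K (Suc n))"
    "\<And>L. compact L \<Longrightarrow> L \<subseteq> \<Omega> \<Longrightarrow> \<exists>N. \<forall>n\<ge>N. L \<subseteq> K n"
    and \<kappa>: "\<And>n. \<kappa> n \<in> test_functions (interior (K (Suc n)))" "\<And>n x. 0 \<le> \<kappa> n x" "\<And>n x. \<kappa> n x \<le> 1"
    "\<And>n x. x \<in> K n \<Longrightarrow> \<kappa> n x = 1"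
    by (rule exhaustion_cutoffs[OF \<Omega>]) (erule that)
  have \<kappa>\<Omega>: "\<kappa> n \<in> test_functions \<Omega>" for n
    using test_mono[OF \<kappa>(1)] interior_subset K(2) by (meson order_trans)
  let ?g = "gradient w"
  define d where "d n = 1 / real (Suc n)" for n
  have d: "d n > 0" for n by (simp add: d_def)
  \<comment> \<open>A smooth substitute for 1 / |\<nabla>w|: the positive summand \<open>d n\<close>
    keeps the base of the power away from 0 at critical points of w.\<close>
  define h where "h n x = ((norm (?g x))\<^sup>2 + d n) powr (- (1/2))" for n x
  have gs: "smooth_on \<Omega> ?g" by (rule smooth_on_gradient[OF \<Omega> w])
  have ns: "smooth_on \<Omega> (\<lambda>x. (norm (?g x))\<^sup>2)"
  proof -
    have "smooth_on \<Omega> (\<lambda>x. \<Sum>i\<in>UNIV. ?g x $ i * ?g x $ i)"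
      by (intro smooth_on_sum smooth_on_mult smooth_on_component gs \<Omega>)
    then show ?thesis by (simp add: power2_norm_eq_inner inner_vec_def)
  qed
  have hs: "smooth_on \<Omega> (h n)" for n
    unfolding h_def by (intro smooth_on_powr smooth_on_add smooth_on_const ns \<Omega> add_nonneg_pos d zero_le_power2)
  have hle: "h n x * norm (?g x) \<le> 1" and hnn: "h n x \<ge> 0" and hpos: "h n x > 0" for n x
  proof -
    have s: "h n x = 1 / sqrt ((norm (?g x))\<^sup>2 + d n)"
      unfolding h_def using d[of n] by (simp add: powr_minus powr_half_sqrt add_nonneg_pos inverse_eq_divide)
    have "norm (?g x) \<le> sqrt ((norm (?g x))\<^sup>2 + d n)" using d[of n] by (intro real_le_rsqrt) simp
    moreover have "sqrt ((norm (?g x))\<^sup>2 + d n) > 0" using d[of n] by (simp add: add_nonneg_pos)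
    ultimately show "h n x * norm (?g x) \<le> 1" "h n x \<ge> 0" "h n x > 0" by (auto simp: s)
  qed
  define v where "v n x = \<kappa> n x *\<^sub>R ((- h n x) *\<^sub>R ?g x)" for n x
  have vt: "v n \<in> test_functions \<Omega>" for n
  proof -
    have "smooth_on \<Omega> (\<lambda>x. ((- 1) * h n x) *\<^sub>R ?g x)"
      by (intro smooth_on_scaleR smooth_on_mult smooth_on_const hs gs \<Omega>)
    then show ?thesis unfolding v_def by (intro test_smooth_on_scaleR[OF \<Omega> \<kappa>\<Omega>]) simp
  qed
  have vn: "norm (v n x) \<le> 1" for n x
  proof -
    have "norm (v n x) = \<kappa> n x * (h n x * norm (?g x))" using \<kappa>(2)[of n x] hnn[of n x] by (simp add: v_def)
    also have "\<dots> \<le> 1 * 1" using \<kappa>(2,3)[of n x] hle[of n x] hnn[of n x] by (intro mult_mono) auto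
    finally show ?thesis by simp
  qed
  define F where "F n x = \<kappa> n x * (h n x * (norm (?g x))\<^sup>2)" for n x
  have F0: "F n x \<ge> 0" for n x using \<kappa>(2) hnn by (simp add: F_def)
  have FF: "F n x = - (\<Sum>i\<in>UNIV. partial_deriv i w x * v n x $ i)" for n x
  proof -
    have "(\<Sum>i\<in>UNIV. partial_deriv i w x * v n x $ i) = ?g x \<bullet> v n x"
      by (simp add: inner_vec_def gradient_def)
    also have "\<dots> = - F n x" by (simp add: v_def F_def power2_norm_eq_inner)
    finally show ?thesis by simp
  qed
  note ibp = integration_by_parts[OF \<Omega> w test_component[OF vt]]
  have Fi: "integrable lborel (F n)" for n unfolding FF using ibp(3) by auto
  have FA: "(\<integral>x. F n x \<partial>lborel) \<le> A" for n
  proof -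
    have "(\<integral>x. F n x \<partial>lborel) = (\<Sum>i\<in>UNIV. - (\<integral>x. partial_deriv i w x * v n x $ i \<partial>lborel))"
      unfolding FF using ibp(3) by (simp add: sum_negf)
    also have "\<dots> = (\<Sum>i\<in>UNIV. \<integral>x. w x * partial_deriv i (\<lambda>x. v n x $ i) x \<partial>lborel)" by (simp add: ibp(1))
    also have "\<dots> = (\<integral>x. w x * divergence (v n) x \<partial>lborel)"
      unfolding divergence_def sum_distrib_left by (rule Bochner_Integration.integral_sum[symmetric]) (rule ibp(2))
    also have "\<dots> \<le> A" by (rule A[OF vt vn])
    finally show ?thesis .
  qed
  have lim: "(\<lambda>n. F n x) \<longlonglongrightarrow> indicator \<Omega> x * norm (?g x)" for x
  proof (cases "x \<in> \<Omega>")
    case True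
    then obtain N where N: "\<And>n. n \<ge> N \<Longrightarrow> x \<in> K n" using K(4)[of "{x}"] by auto
    have "(\<lambda>n. h n x * (norm (?g x))\<^sup>2) \<longlonglongrightarrow> norm (?g x)"
    proof (cases "?g x = 0")
      case False
      have "d \<longlonglongrightarrow> 0" unfolding d_def using LIMSEQ_inverse_real_of_nat by (simp add: inverse_eq_divide)
      then have "(\<lambda>n. h n x * (norm (?g x))\<^sup>2) \<longlonglongrightarrow> ((norm (?g x))\<^sup>2 + 0) powr (- (1/2)) * (norm (?g x))\<^sup>2"
        unfolding h_def using False by (intro tendsto_intros) auto
      also have "((norm (?g x))\<^sup>2 + 0) powr (- (1/2)) * (norm (?g x))\<^sup>2 = norm (?g x)"
        using False by (simp add: powr_minus powr_half_sqrt power2_eq_square)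
      finally show ?thesis .
    qed simp
    moreover have "\<forall>\<^sub>F n in sequentially. h n x * (norm (?g x))\<^sup>2 = F n x"
      using eventually_ge_at_top[of N] by eventually_elim (use N \<kappa>(4) in \<open>auto simp: F_def\<close>)
    ultimately have "(\<lambda>n. F n x) \<longlonglongrightarrow> norm (?g x)" by (rule Lim_transform_eventually)
    then show ?thesis using True by simp
  next
    case False
    have "\<kappa> n x = 0" for n using \<kappa>\<Omega>[of n] False by (metis subsetD test_functionsE)
    then show ?thesis using False by (simp add: F_def)
  qed
  \<comment> \<open>Fatou's lemma is the right tool here, since integrability of the gradient is
    part of what is to be proved.\<close>
  have "ennreal (indicator \<Omega> x * norm (?g x)) = liminf (\<lambda>n. ennreal (F n x))" for x
    using tendsto_ennrealI[OF lim[of x]] by (intro lim_imp_Liminf[symmetric]) auto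
  then have "(\<integral>\<^sup>+x. ennreal (indicator \<Omega> x * norm (?g x)) \<partial>lborel) = (\<integral>\<^sup>+x. liminf (\<lambda>n. ennreal (F n x)) \<partial>lborel)" by simp
  also have "\<dots> \<le> liminf (\<lambda>n. \<integral>\<^sup>+x. ennreal (F n x) \<partial>lborel)"
    by (rule nn_integral_liminf) (use Fi in auto)
  also have "\<dots> \<le> ennreal A"
  proof (rule Liminf_le)
    show "\<forall>\<^sub>F n in sequentially. (\<integral>\<^sup>+x. ennreal (F n x) \<partial>lborel) \<le> ennreal A"
      using nn_integral_eq_integral[OF Fi] F0 FA by (auto intro!: always_eventually ennreal_leI)
  qed simp
  finally show ?thesis .
qed

section \<open>Lebesgue measure on an open set and Borel representatives\<close>

lemma lebesgue_on_AE_iff: "open \<Omega> \<Longrightarrow> (AE x in lebesgue_on \<Omega>. P x) \<longleftrightarrow> (AE x in lborel. x \<in> \<Omega> \<longrightarrow> P x)"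
  by (subst AE_restrict_space_iff) (auto simp: AE_completion_iff)

lemma lebesgue_on_borel:
  fixes f :: "'a::euclidean_space \<Rightarrow> real"
  assumes "open \<Omega>" "f \<in> borel_measurable borel"
  shows "f \<in> borel_measurable (lebesgue_on \<Omega>)"
  using assms by (intro measurable_restrict_space1 measurable_completion) auto

lemma lebesgue_on_lborel:
  fixes f :: "'a::euclidean_space \<Rightarrow> real"
  assumes "open \<Omega>" "f \<in> borel_measurable borel" "\<And>x. x \<notin> \<Omega> \<Longrightarrow> f x = 0"
  shows "(\<integral>x. f x \<partial>lebesgue_on \<Omega>) = (\<integral>x. f x \<partial>lborel)"
    and "integrable (lebesgue_on \<Omega>) f \<longleftrightarrow> integrable lborel f"
proof -
  have e: "(\<lambda>x. indicator \<Omega> x * f x) = f" using assms(3) by (auto simp: fun_eq_iff indicator_def)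
  have m: "f \<in> borel_measurable lborel" using assms by simp
  show "(\<integral>x. f x \<partial>lebesgue_on \<Omega>) = (\<integral>x. f x \<partial>lborel)"
    using assms(1) by (subst integral_restrict_space) (auto simp: e integral_completion[OF m])
  show "integrable (lebesgue_on \<Omega>) f \<longleftrightarrow> integrable lborel f"
    using assms(1) by (subst integrable_restrict_space) (auto simp: e integrable_completion[OF m])
qed

text \<open>Convolution and Fubini are carried out for Borel functions on the whole space. Every
  Lebesgue measurable function on \<Omega> has such a representative, extended by zero, and
  integrals on \<Omega> become integrals over the whole space.\<close>

lemma lebesgue_on_rep:
  fixes u :: "'a::euclidean_space \<Rightarrow> real"
  assumes "open \<Omega>" "u \<in> borel_measurable (lebesgue_on \<Omega>)"
  obtains u' where "u' \<in> borel_measurable borel" "\<And>x. x \<notin> \<Omega> \<Longrightarrow> u' x = 0" "AE x in lebesgue_on \<Omega>. u x = u' x"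
proof -
  have "(\<lambda>x. if x \<in> \<Omega> then u x else 0) \<in> borel_measurable lebesgue"
    by (rule borel_measurable_if_I) (use assms in auto)
  from completion_ex_borel_measurable_real[OF this]
  obtain g where g: "g \<in> borel_measurable borel" "AE x in lborel. (if x \<in> \<Omega> then u x else 0) = g x" by auto
  show ?thesis
  proof (rule that[of "\<lambda>x. indicator \<Omega> x * g x"])
    show "AE x in lebesgue_on \<Omega>. u x = indicator \<Omega> x * g x"
      unfolding lebesgue_on_AE_iff[OF assms(1)] using g(2) by eventually_elim auto
  qed (use g assms in auto)
qed

lemma Lp_space_iff:
  assumes "p > 0"
  shows "f \<in> Lp_space \<Omega> p \<longleftrightarrow> f \<in> borel_measurable (lebesgue_on \<Omega>) \<and> integrable (lebesgue_on \<Omega>) (\<lambda>x. \<bar>f x\<bar> powr p)"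
proof (cases "f \<in> borel_measurable (lebesgue_on \<Omega>)")
  case True
  then have [measurable]: "(\<lambda>x. \<bar>f x\<bar> powr p) \<in> borel_measurable (lebesgue_on \<Omega>)" by simp
  show ?thesis
    using True by (auto simp: Lp_space_def Lp_norm_def Let_def integrable_iff_bounded less_top)
qed (simp add: Lp_space_def)

lemma Lp_norm_eq:
  assumes "p > 0" "f \<in> Lp_space \<Omega> p"
  shows "Lp_norm \<Omega> p f = ennreal ((\<integral>x. \<bar>f x\<bar> powr p \<partial>lebesgue_on \<Omega>) powr (1 / p))"
proof -
  have i: "integrable (lebesgue_on \<Omega>) (\<lambda>x. \<bar>f x\<bar> powr p)" using assms Lp_space_iff by blast
  show ?thesis
    using nn_integral_eq_integral[OF i] by (simp add: Lp_norm_def Let_def enn2real_ennreal)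
qed

lemma test_lebesgue_on:
  fixes \<phi> :: "real^'n::finite \<Rightarrow> real"
  assumes "open \<Omega>" "\<phi> \<in> test_functions \<Omega>"
  shows "(\<integral>x. \<phi> x \<partial>lebesgue_on \<Omega>) = (\<integral>x. \<phi> x \<partial>lborel)" "integrable (lebesgue_on \<Omega>) \<phi>"
proof -
  have "\<phi> x = 0" if "x \<notin> \<Omega>" for x using assms(2) that by (metis subsetD test_functionsE)
  note * = lebesgue_on_lborel[OF assms(1) test_borel[OF assms(2)] this]
  show "(\<integral>x. \<phi> x \<partial>lebesgue_on \<Omega>) = (\<integral>x. \<phi> x \<partial>lborel)" "integrable (lebesgue_on \<Omega>) \<phi>"
    using * test_integrable[OF assms(2)] by auto
qed

lemma Lp_test_lebesgue_on:
  fixes \<phi> u :: "real^'n::finite \<Rightarrow> real"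
  assumes \<Omega>: "open \<Omega>" and p: "p \<ge> 1" and u: "u \<in> Lp_space \<Omega> p" and \<phi>: "\<phi> \<in> test_functions \<Omega>"
    and u': "u' \<in> borel_measurable borel" "\<And>x. x \<notin> \<Omega> \<Longrightarrow> u' x = 0" "AE x in lebesgue_on \<Omega>. u x = u' x"
  shows "(\<integral>x. u x * \<phi> x \<partial>lebesgue_on \<Omega>) = (\<integral>x. u' x * \<phi> x \<partial>lborel)"
    "integrable (lebesgue_on \<Omega>) (\<lambda>x. u x * \<phi> x)" "integrable lborel (\<lambda>x. \<bar>u' x\<bar> powr p)"
proof -
  have um: "u \<in> borel_measurable (lebesgue_on \<Omega>)" and ui: "integrable (lebesgue_on \<Omega>) (\<lambda>x. \<bar>u x\<bar> powr p)"
    using u Lp_space_iff[of p] p by auto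
  have u'm: "u' \<in> borel_measurable (lebesgue_on \<Omega>)" by (rule lebesgue_on_borel[OF \<Omega> u'(1)])
  have \<phi>m: "\<phi> \<in> borel_measurable (lebesgue_on \<Omega>)" by (rule lebesgue_on_borel[OF \<Omega> test_borel[OF \<phi>]])
  have "integrable (lebesgue_on \<Omega>) (\<lambda>x. \<bar>u' x\<bar> powr p)"
    by (rule integrable_cong_AE_imp[OF ui]) (use u'(3) u'm in auto)
  then show i: "integrable lborel (\<lambda>x. \<bar>u' x\<bar> powr p)"
    by (subst (asm) lebesgue_on_lborel(2)[OF \<Omega>]) (use u' p in auto)
  have "integrable lborel (\<lambda>x. u' x * \<phi> x)" by (rule test_times_Lp(1)[OF p u'(1) i \<phi>])
  then have i': "integrable (lebesgue_on \<Omega>) (\<lambda>x. u' x * \<phi> x)"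
    by (subst lebesgue_on_lborel(2)[OF \<Omega>]) (use u' test_borel[OF \<phi>] in auto)
  show "integrable (lebesgue_on \<Omega>) (\<lambda>x. u x * \<phi> x)"
    by (rule integrable_cong_AE_imp[OF i']) (use u'(3) um \<phi>m in \<open>auto elim!: eventually_mono\<close>)
  have "(\<integral>x. u x * \<phi> x \<partial>lebesgue_on \<Omega>) = (\<integral>x. u' x * \<phi> x \<partial>lebesgue_on \<Omega>)"
    by (rule integral_cong_AE) (use um u'm \<phi>m u'(3) in \<open>auto elim!: eventually_mono\<close>)
  then show "(\<integral>x. u x * \<phi> x \<partial>lebesgue_on \<Omega>) = (\<integral>x. u' x * \<phi> x \<partial>lborel)"
    using lebesgue_on_lborel(1)[OF \<Omega>, of "\<lambda>x. u' x * \<phi> x"] u' test_borel[OF \<phi>] by auto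
qed

lemma Lp_test_integrable:
  fixes \<phi> u :: "real^'n::finite \<Rightarrow> real"
  assumes "open \<Omega>" "p \<ge> 1" "u \<in> Lp_space \<Omega> p" "\<phi> \<in> test_functions \<Omega>"
  shows "integrable (lebesgue_on \<Omega>) (\<lambda>x. u x * \<phi> x)"
proof -
  have "u \<in> borel_measurable (lebesgue_on \<Omega>)" using assms(3) by (simp add: Lp_space_def)
  from lebesgue_on_rep[OF assms(1) this] Lp_test_lebesgue_on(2)[OF assms] show ?thesis by metis
qed

text \<open>The approximation theorem, transferred to functions on \<Omega> through a Borel
  representative. The bound on the variation of w is moreover turned into an L_1 bound on its
  gradient, the form in which the Poincare inequality takes it.\<close>

theorem meyers_serrin:
  fixes \<Omega> :: "(real^'n::finite) set" and u :: "real^'n \<Rightarrow> real"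
  assumes \<Omega>: "open \<Omega>" and p: "p \<ge> 1" and u: "u \<in> Lp_space \<Omega> p"
    and V: "\<And>v. v \<in> test_functions \<Omega> \<Longrightarrow> (\<And>x. norm (v x) \<le> 1) \<Longrightarrow> (\<integral>x. u x * divergence v x \<partial>lebesgue_on \<Omega>) \<le> V"
    and e: "e > 0"
  obtains w where "smooth_on \<Omega> w" "w \<in> Lp_space \<Omega> p"
    "integrable (lebesgue_on \<Omega>) (\<lambda>x. \<bar>w x - u x\<bar> powr p)" "(\<integral>x. \<bar>w x - u x\<bar> powr p \<partial>lebesgue_on \<Omega>) \<le> e"
    "(\<integral>\<^sup>+x. ennreal (norm (gradient w x)) \<partial>lebesgue_on \<Omega>) \<le> ennreal (V + e)"
    "\<And>v. v \<in> test_functions \<Omega> \<Longrightarrow> (\<And>x. norm (v x) \<le> 1) \<Longrightarrow> (\<integral>x. w x * divergence v x \<partial>lebesgue_on \<Omega>) \<le> V + e"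
proof -
  have um: "u \<in> borel_measurable (lebesgue_on \<Omega>)" and ui: "integrable (lebesgue_on \<Omega>) (\<lambda>x. \<bar>u x\<bar> powr p)"
    using u Lp_space_iff[of p] p by auto
  obtain u' where u': "u' \<in> borel_measurable borel" "\<And>x. x \<notin> \<Omega> \<Longrightarrow> u' x = 0" "AE x in lebesgue_on \<Omega>. u x = u' x"
    using lebesgue_on_rep[OF \<Omega> um] by blast
  note tr = Lp_test_lebesgue_on[OF \<Omega> p u _ u']
  have u'i: "integrable lborel (\<lambda>x. \<bar>u' x\<bar> powr p)" by (rule tr(3)[OF test_zero])
  have V': "(\<integral>x. u' x * divergence v x \<partial>lborel) \<le> V" if "v \<in> test_functions \<Omega>" "\<And>x. norm (v x) \<le> 1" for v
    using V[OF that] tr(1)[OF test_divergence[OF that(1)]] by simp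
  have "\<exists>w. smooth_on \<Omega> w \<and> (\<forall>x. x \<notin> \<Omega> \<longrightarrow> w x = 0) \<and> w \<in> borel_measurable borel \<and>
    integrable lborel (\<lambda>x. \<bar>w x - u' x\<bar> powr p) \<and> (\<integral>x. \<bar>w x - u' x\<bar> powr p \<partial>lborel) \<le> e \<and>
    (\<forall>v. v \<in> test_functions \<Omega> \<longrightarrow> (\<forall>x. norm (v x) \<le> 1) \<longrightarrow> (\<integral>x. w x * divergence v x \<partial>lborel) \<le> V + e)"
    by (rule smooth_approximation[OF \<Omega> p u'(1) _ u'i _ e, of V]) (use u'(2) V' in blast)+
  then obtain w where w: "smooth_on \<Omega> w" "\<And>x. x \<notin> \<Omega> \<Longrightarrow> w x = 0" "w \<in> borel_measurable borel"
    "integrable lborel (\<lambda>x. \<bar>w x - u' x\<bar> powr p)" "(\<integral>x. \<bar>w x - u' x\<bar> powr p \<partial>lborel) \<le> e"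
    "\<And>v. v \<in> test_functions \<Omega> \<Longrightarrow> (\<And>x. norm (v x) \<le> 1) \<Longrightarrow> (\<integral>x. w x * divergence v x \<partial>lborel) \<le> V + e"
    by blast
  have wm: "w \<in> borel_measurable (lebesgue_on \<Omega>)" by (rule lebesgue_on_borel[OF \<Omega> w(3)])
  have u'm: "u' \<in> borel_measurable (lebesgue_on \<Omega>)" by (rule lebesgue_on_borel[OF \<Omega> u'(1)])
  have i': "integrable (lebesgue_on \<Omega>) (\<lambda>x. \<bar>w x - u' x\<bar> powr p)"
    by (subst lebesgue_on_lborel(2)[OF \<Omega>]) (use u' w p in auto)
  have wi: "integrable (lebesgue_on \<Omega>) (\<lambda>x. \<bar>w x - u x\<bar> powr p)"
    by (rule integrable_cong_AE_imp[OF i']) (use u'(3) um wm in \<open>auto elim!: eventually_mono\<close>)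
  have "(\<integral>x. \<bar>w x - u x\<bar> powr p \<partial>lebesgue_on \<Omega>) = (\<integral>x. \<bar>w x - u' x\<bar> powr p \<partial>lebesgue_on \<Omega>)"
    by (rule integral_cong_AE) (use um u'm wm u'(3) in \<open>auto elim!: eventually_mono\<close>)
  also have "\<dots> = (\<integral>x. \<bar>w x - u' x\<bar> powr p \<partial>lborel)"
    by (rule lebesgue_on_lborel(1)[OF \<Omega>]) (use u' w p in auto)
  finally have wle: "(\<integral>x. \<bar>w x - u x\<bar> powr p \<partial>lebesgue_on \<Omega>) \<le> e" using w(5) by simp
  have wL: "w \<in> Lp_space \<Omega> p"
    using powr_integrable_add[of p "\<lambda>x. w x - u x" "lebesgue_on \<Omega>" u] wm um wi ui p by (subst Lp_space_iff) auto
  have "(\<integral>\<^sup>+x. ennreal (norm (gradient w x)) \<partial>lebesgue_on \<Omega>) = (\<integral>\<^sup>+x. ennreal (norm (gradient w x)) * indicator \<Omega> x \<partial>lebesgue)"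
    using \<Omega> by (subst nn_integral_restrict_space) auto
  also have "\<dots> = (\<integral>\<^sup>+x. ennreal (indicator \<Omega> x * norm (gradient w x)) \<partial>lborel)"
    unfolding nn_integral_completion by (intro nn_integral_cong) (auto simp: indicator_def)
  also have "\<dots> \<le> ennreal (V + e)" by (rule gradient_L1_le[OF \<Omega> w(1,6)])
  finally have wg: "(\<integral>\<^sup>+x. ennreal (norm (gradient w x)) \<partial>lebesgue_on \<Omega>) \<le> ennreal (V + e)" .
  have wV: "(\<integral>x. w x * divergence v x \<partial>lebesgue_on \<Omega>) \<le> V + e" if "v \<in> test_functions \<Omega>" "\<And>x. norm (v x) \<le> 1" for v
    using w(6)[OF that] Lp_test_lebesgue_on(1)[OF \<Omega> p wL test_divergence[OF that(1)] w(3,2)] by simp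
  show ?thesis by (rule that[OF w(1) wL wi wle wg wV])
qed

section \<open>Finite signed measures\<close>

lemma signed_sums:
  assumes "signed_borel_measure \<Omega> \<mu>" "\<And>k. A k \<in> sets (restrict_space borel \<Omega>)" "disjoint_family A"
  shows "(\<lambda>k. \<mu> (A k)) sums \<mu> (\<Union>k. A k)"
  using assms unfolding signed_borel_measure_def by blast

lemma signed_outside:
  assumes "signed_borel_measure \<Omega> \<mu>" "A \<notin> sets (restrict_space borel \<Omega>)"
  shows "\<mu> A = 0"
  using assms unfolding signed_borel_measure_def by blast

lemma signed_uminus:
  "signed_borel_measure \<Omega> \<mu> \<Longrightarrow> signed_borel_measure \<Omega> (\<lambda>A. - \<mu> A)"
  unfolding signed_borel_measure_def by (auto intro: sums_minus)

lemma signed_add: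
  "signed_borel_measure \<Omega> \<mu> \<Longrightarrow> signed_borel_measure \<Omega> \<nu> \<Longrightarrow> signed_borel_measure \<Omega> (\<lambda>A. \<mu> A + \<nu> A)"
  unfolding signed_borel_measure_def by (auto intro: sums_add)

lemma signed_cmult:
  "signed_borel_measure \<Omega> \<mu> \<Longrightarrow> signed_borel_measure \<Omega> (\<lambda>A. c * \<mu> A)"
  unfolding signed_borel_measure_def by (auto intro: sums_mult)

lemma signed_empty:
  assumes "signed_borel_measure \<Omega> \<mu>"
  shows "\<mu> {} = 0"
proof -
  have "(\<lambda>k::nat. \<mu> {}) sums \<mu> (\<Union>k::nat. {})"
    by (rule signed_sums[OF assms]) (auto simp: disjoint_family_on_def)
  then have "(\<lambda>k::nat. \<mu> {}) \<longlonglongrightarrow> 0" by (intro summable_LIMSEQ_zero) (rule sums_summable)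
  then show ?thesis by (simp add: LIMSEQ_const_iff)
qed

lemma signed_Un:
  assumes "signed_borel_measure \<Omega> \<mu>" "A \<in> sets (restrict_space borel \<Omega>)" "B \<in> sets (restrict_space borel \<Omega>)" "A \<inter> B = {}"
  shows "\<mu> (A \<union> B) = \<mu> A + \<mu> B"
proof -
  define F where "F k = (if k = 0 then A else if k = 1 then B else {})" for k :: nat
  have s: "(\<lambda>k. \<mu> (F k)) sums \<mu> (\<Union>k. F k)"
    by (rule signed_sums[OF assms(1)]) (use assms in \<open>auto simp: F_def disjoint_family_on_def\<close>)
  moreover have "(\<Union>k. F k) = A \<union> B"
  proof -
    have "F 0 = A" "F 1 = B" "F k \<subseteq> A \<union> B" for k by (auto simp: F_def)
    then show ?thesis by blast
  qed
  moreover have "(\<lambda>k. \<mu> (F k)) sums (\<Sum>k\<in>{0, 1}. \<mu> (F k))"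
    by (rule sums_finite) (auto simp: F_def signed_empty[OF assms(1)])
  ultimately show ?thesis using sums_unique2 by (fastforce simp: F_def)
qed

lemma signed_Diff:
  assumes "signed_borel_measure \<Omega> \<mu>" "A \<in> sets (restrict_space borel \<Omega>)" "B \<in> sets (restrict_space borel \<Omega>)" "B \<subseteq> A"
  shows "\<mu> (A - B) = \<mu> A - \<mu> B"
  using signed_Un[OF assms(1) assms(3) sets.Diff[OF assms(2,3)]] assms(4) by (auto simp: Un_absorb1)

text \<open>Otherwise one could split off disjoint pieces of measure at least \<open>1\<close> forever.\<close>

lemma signed_bounded:
  assumes s: "signed_borel_measure \<Omega> \<mu>"
  shows "\<exists>M. \<forall>B\<in>sets (restrict_space borel \<Omega>). \<bar>\<mu> B\<bar> \<le> M"
proof (rule ccontr)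
  let ?S = "sets (restrict_space borel \<Omega>)"
  assume neg: "\<not> ?thesis"
  define big where "big A \<longleftrightarrow> A \<in> ?S \<and> (\<forall>M. \<exists>B\<in>?S. B \<subseteq> A \<and> \<bar>\<mu> B\<bar> > M)" for A
  have "\<Omega> \<in> ?S" using sets.top[of "restrict_space borel \<Omega>"] by (simp add: space_restrict_space)
  moreover have "B \<subseteq> \<Omega>" if "B \<in> ?S" for B using sets.sets_into_space[OF that] by (simp add: space_restrict_space)
  ultimately have b0: "big \<Omega>" using neg by (fastforce simp: big_def not_le)
  have step: "\<exists>A'. big A' \<and> A' \<subseteq> A \<and> \<bar>\<mu> (A - A')\<bar> \<ge> 1" if "big A" for A
  proof -
    have A: "A \<in> ?S" using that by (simp add: big_def)
    \<comment> \<open>With |\<mu> B| > 1 + |\<mu> A| both B and A - B have measure at least 1 in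
      modulus, so whichever of them still has subsets of arbitrarily large measure, the other one
      may be split off.\<close>
    have "\<exists>B\<in>?S. B \<subseteq> A \<and> \<bar>\<mu> B\<bar> > 1 + \<bar>\<mu> A\<bar>" using that unfolding big_def by blast
    then obtain B where B: "B \<in> ?S" "B \<subseteq> A" "\<bar>\<mu> B\<bar> > 1 + \<bar>\<mu> A\<bar>" by blast
    have 1: "\<bar>\<mu> (A - B)\<bar> \<ge> 1" using signed_Diff[OF s A B(1,2)] B(3) by linarith
    have 2: "\<bar>\<mu> (A - (A - B))\<bar> \<ge> 1" using B by (simp add: double_diff)
    show ?thesis
    proof (cases "big B")
      case True
      then show ?thesis using 1 B by blast
    next
      case False
      then obtain M1 where M1: "\<And>C. C \<in> ?S \<Longrightarrow> C \<subseteq> B \<Longrightarrow> \<bar>\<mu> C\<bar> \<le> M1" using B by (auto simp: big_def not_less)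
      have "big (A - B)"
      proof (rule ccontr)
        assume "\<not> big (A - B)"
        then obtain M2 where M2: "\<And>C. C \<in> ?S \<Longrightarrow> C \<subseteq> A - B \<Longrightarrow> \<bar>\<mu> C\<bar> \<le> M2" using A B by (auto simp: big_def not_less)
        have "\<exists>C\<in>?S. C \<subseteq> A \<and> \<bar>\<mu> C\<bar> > M1 + M2" using that unfolding big_def by blast
        then obtain C where C: "C \<in> ?S" "C \<subseteq> A" "\<bar>\<mu> C\<bar> > M1 + M2" by blast
        have "\<mu> C = \<mu> (C \<inter> B) + \<mu> (C - B)"
          using signed_Un[OF s sets.Int[OF C(1) B(1)] sets.Diff[OF C(1) B(1)]] by (auto simp: Int_Diff_Un)
        moreover have "\<bar>\<mu> (C \<inter> B)\<bar> \<le> M1" "\<bar>\<mu> (C - B)\<bar> \<le> M2" using C B by (auto intro!: M1 M2)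
        ultimately show False using C(3) by linarith
      qed
      then show ?thesis using 2 by blast
    qed
  qed
  obtain f where f: "\<And>n. big (f n)" "\<And>n. f (Suc n) \<subseteq> f n" "\<And>n. \<bar>\<mu> (f n - f (Suc n))\<bar> \<ge> 1"
    using dependent_nat_choice[of "\<lambda>n. big" "\<lambda>n A A'. A' \<subseteq> A \<and> \<bar>\<mu> (A - A')\<bar> \<ge> 1"] b0 step by metis
  have mono: "f n \<subseteq> f m" if "m \<le> n" for m n using lift_Suc_antimono_le[of f m n] f(2) that by blast
  define D where "D n = f n - f (Suc n)" for n
  have "D m \<inter> D n = {}" if "m < n" for m n using mono[of "Suc m" n] that by (auto simp: D_def)
  then have "disjoint_family D" unfolding disjoint_family_on_def by (metis Int_commute linorder_neqE_nat)
  moreover have "D n \<in> ?S" for n using f(1) by (auto simp: D_def big_def)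
  ultimately have "(\<lambda>n. \<mu> (D n)) sums \<mu> (\<Union>n. D n)" by (intro signed_sums[OF s])
  then have "(\<lambda>n. \<mu> (D n)) \<longlonglongrightarrow> 0" by (intro summable_LIMSEQ_zero) (rule sums_summable)
  then have "\<forall>\<^sub>F n in sequentially. dist (\<mu> (D n)) 0 < 1" by (rule tendstoD) simp
  then obtain n where "dist (\<mu> (D n)) 0 < 1" by (auto simp: eventually_sequentially)
  then show False using f(3)[of n] by (simp add: D_def)
qed

text \<open>\<open>measure_of\<close> is only informative once the set function is known to be
  countably additive. The supremum is superadditive on disjoint sets, because competitors can be
  united; conversely a competitor inside a union is cut along the pieces. Finiteness is
  \<open>signed_bounded\<close>.\<close>

lemma pos_variation:
  assumes s: "signed_borel_measure \<Omega> \<mu>"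
  shows "sets (pos_variation \<Omega> \<mu>) = sets (restrict_space borel \<Omega>)"
    and "finite_measure (pos_variation \<Omega> \<mu>)"
    and "A \<in> sets (restrict_space borel \<Omega>) \<Longrightarrow> measure (pos_variation \<Omega> \<mu>) A =
      (SUP B\<in>{B \<in> sets (restrict_space borel \<Omega>). B \<subseteq> A}. \<mu> B)"
proof -
  let ?S = "sets (restrict_space borel \<Omega>)"
  define P where "P A = (SUP B\<in>{B \<in> ?S. B \<subseteq> A}. \<mu> B)" for A
  have PV: "pos_variation \<Omega> \<mu> = measure_of \<Omega> ?S (\<lambda>A. ennreal (P A))" by (simp add: pos_variation_def P_def)
  have \<Omega>S: "\<Omega> \<in> ?S" using sets.top[of "restrict_space borel \<Omega>"] by (simp add: space_restrict_space)
  have sub: "B \<subseteq> \<Omega>" if "B \<in> ?S" for B using sets.sets_into_space[OF that] by (simp add: space_restrict_space)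
  obtain M where M: "\<And>B. B \<in> ?S \<Longrightarrow> \<bar>\<mu> B\<bar> \<le> M" using signed_bounded[OF s] by blast
  have bdd: "bdd_above (\<mu> ` {B \<in> ?S. B \<subseteq> A})" for A
    by (rule bdd_aboveI2[of _ _ M]) (use M in \<open>auto simp: abs_le_iff\<close>)
  have ne: "{} \<in> {B \<in> ?S. B \<subseteq> A}" for A by auto
  have Pup: "\<mu> B \<le> P A" if "B \<in> ?S" "B \<subseteq> A" for A B
    unfolding P_def by (rule cSUP_upper[OF _ bdd]) (use that in auto)
  have Ple: "P A \<le> c" if "\<And>B. B \<in> ?S \<Longrightarrow> B \<subseteq> A \<Longrightarrow> \<mu> B \<le> c" for A c
    unfolding P_def by (rule cSUP_least) (use ne that in auto)
  have P0: "P A \<ge> 0" for A using Pup[of "{}" A] signed_empty[OF s] by simp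
  have Pmono: "P A \<le> P B" if "A \<subseteq> B" for A B by (rule Ple) (use that Pup in blast)
  have Psup: "P A + P B \<le> P (A \<union> B)" if d: "A \<inter> B = {}" for A B
  proof -
    have "P A \<le> P (A \<union> B) - P B"
    proof (rule Ple)
      fix C assume C: "C \<in> ?S" "C \<subseteq> A"
      have "P B \<le> P (A \<union> B) - \<mu> C"
      proof (rule Ple)
        fix D assume D: "D \<in> ?S" "D \<subseteq> B"
        have "C \<inter> D = {}" using C D d by blast
        then have "\<mu> C + \<mu> D = \<mu> (C \<union> D)" using signed_Un[OF s C(1) D(1)] by simp
        also have "\<dots> \<le> P (A \<union> B)" using C D by (intro Pup) auto
        finally show "\<mu> D \<le> P (A \<union> B) - \<mu> C" by simp
      qed
      then show "\<mu> C \<le> P (A \<union> B) - P B" by simp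
    qed
    then show ?thesis by simp
  qed
  have sa: "sigma_algebra \<Omega> ?S" using sets.sigma_algebra_axioms[of "restrict_space borel \<Omega>"] by (simp add: space_restrict_space)
  have "P {} \<le> 0" by (rule Ple) (simp add: signed_empty[OF s])
  then have P_empty: "P {} = 0" using P0[of "{}"] by linarith
  have ca: "countably_additive ?S (\<lambda>A. ennreal (P A))"
  proof (rule countably_additiveI)
    fix A :: "nat \<Rightarrow> (real^'a) set"
    assume A: "range A \<subseteq> ?S" "disjoint_family A" "(\<Union>i. A i) \<in> ?S"
    have fin: "(\<Sum>k<n. P (A k)) \<le> P (\<Union>k<n. A k)" for n
    proof (induction n)
      case (Suc n)
      have "A k \<inter> A n = {}" if "k < n" for k
        using disjoint_family_onD[OF A(2), of k n] that by simp
      then have d: "(\<Union>k<n. A k) \<inter> A n = {}" by blast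
      have "(\<Union>k<Suc n. A k) = (\<Union>k<n. A k) \<union> A n" by (simp only: lessThan_Suc UN_insert Un_commute)
      then show ?case using Psup[OF d] Suc by (simp del: UN_simps)
    qed (simp add: P_empty)
    have le: "(\<Sum>k. ennreal (P (A k))) \<le> ennreal (P (\<Union>i. A i))"
    proof (rule suminf_le_const)
      fix n
      have "(\<Sum>k<n. P (A k)) \<le> P (\<Union>i. A i)" by (rule order_trans[OF fin Pmono]) auto
      then show "(\<Sum>k<n. ennreal (P (A k))) \<le> ennreal (P (\<Union>i. A i))"
        by (subst sum_ennreal) (auto simp: P0 intro: ennreal_leI)
    qed auto
    then obtain t where t: "(\<Sum>k. ennreal (P (A k))) = ennreal t" "t \<ge> 0"
      by (cases "\<Sum>k. ennreal (P (A k))" rule: ennreal_cases) (auto simp: top_unique)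
    have "P (\<Union>i. A i) \<le> t"
    proof (rule Ple)
      fix B assume B: "B \<in> ?S" "B \<subseteq> (\<Union>i. A i)"
      have "(\<lambda>k. \<mu> (B \<inter> A k)) sums \<mu> (\<Union>k. B \<inter> A k)"
        by (rule signed_sums[OF s]) (use A B in \<open>auto simp: disjoint_family_on_def intro!: sets.Int\<close>)
      also have "(\<Union>k. B \<inter> A k) = B" using B by auto
      finally have "(\<lambda>n. \<Sum>k<n. \<mu> (B \<inter> A k)) \<longlonglongrightarrow> \<mu> B" by (simp add: sums_def)
      then show "\<mu> B \<le> t"
      proof (rule LIMSEQ_le_const2, intro exI allI impI)
        fix n
        have "(\<Sum>k<n. \<mu> (B \<inter> A k)) \<le> (\<Sum>k<n. P (A k))"
          using A B by (intro sum_mono Pup sets.Int) auto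
        also have "ennreal (\<Sum>k<n. P (A k)) = (\<Sum>k<n. ennreal (P (A k)))" by (subst sum_ennreal) (auto simp: P0)
        then have "ennreal (\<Sum>k<n. P (A k)) \<le> ennreal t"
          using sum_le_suminf[of "\<lambda>k. ennreal (P (A k))" "{..<n}"] t(1) by simp
        then have "(\<Sum>k<n. P (A k)) \<le> t" using t(2) by (simp add: ennreal_le_iff)
        finally show "(\<Sum>k<n. \<mu> (B \<inter> A k)) \<le> t" .
      qed
    qed
    then show "(\<Sum>i. ennreal (P (A i))) = ennreal (P (\<Union>i. A i))" using le t by (metis antisym ennreal_leI)
  qed
  have pos: "positive ?S (\<lambda>A. ennreal (P A))" by (simp add: positive_def P_empty)
  have em: "emeasure (pos_variation \<Omega> \<mu>) A = ennreal (P A)" if "A \<in> ?S" for A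
    unfolding PV by (rule emeasure_measure_of_sigma[OF sa pos ca that])
  show st: "sets (pos_variation \<Omega> \<mu>) = ?S"
    unfolding PV using sub sigma_algebra.sigma_sets_eq[OF sa] by (subst sets_measure_of) auto
  have sp: "space (pos_variation \<Omega> \<mu>) = \<Omega>" unfolding PV using sub by (subst space_measure_of) auto
  show "finite_measure (pos_variation \<Omega> \<mu>)"
    by (rule finite_measureI) (simp add: sp em[OF \<Omega>S])
  show "measure (pos_variation \<Omega> \<mu>) A = (SUP B\<in>{B \<in> ?S. B \<subseteq> A}. \<mu> B)" if "A \<in> ?S"
    using em[OF that] P0[of A] by (simp add: measure_def P_def[symmetric])
qed

lemma jordan_decomposition:
  assumes s: "signed_borel_measure \<Omega> \<mu>" and A: "A \<in> sets (restrict_space borel \<Omega>)"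
  shows "measure (pos_variation \<Omega> \<mu>) A - measure (pos_variation \<Omega> (\<lambda>A. - \<mu> A)) A = \<mu> A"
proof -
  let ?S = "sets (restrict_space borel \<Omega>)"
  let ?C = "{B \<in> ?S. B \<subseteq> A}"
  obtain M where M: "\<And>B. B \<in> ?S \<Longrightarrow> \<bar>\<mu> B\<bar> \<le> M" using signed_bounded[OF s] by blast
  have bdd: "bdd_above (\<mu> ` ?C)" "bdd_above ((\<lambda>B. - \<mu> B) ` ?C)"
    by (rule bdd_aboveI2[of _ _ M]; use M in \<open>auto simp: abs_le_iff\<close>)+
  have ne: "?C \<noteq> {}" by auto
  have "(SUP B\<in>?C. \<mu> B) \<le> (SUP B\<in>?C. - \<mu> B) + \<mu> A"
  proof (rule cSUP_least[OF ne])
    fix B assume B: "B \<in> ?C"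
    have "- \<mu> (A - B) \<le> (SUP B\<in>?C. - \<mu> B)" by (rule cSUP_upper[OF _ bdd(2)]) (use A B in auto)
    then show "\<mu> B \<le> (SUP B\<in>?C. - \<mu> B) + \<mu> A" using signed_Diff[OF s A] B by auto
  qed
  moreover have "(SUP B\<in>?C. - \<mu> B) \<le> (SUP B\<in>?C. \<mu> B) - \<mu> A"
  proof (rule cSUP_least[OF ne])
    fix B assume B: "B \<in> ?C"
    have "\<mu> (A - B) \<le> (SUP B\<in>?C. \<mu> B)" by (rule cSUP_upper[OF _ bdd(1)]) (use A B in auto)
    then show "- \<mu> B \<le> (SUP B\<in>?C. \<mu> B) - \<mu> A" using signed_Diff[OF s A] B by auto
  qed
  ultimately show ?thesis
    using pos_variation(3)[OF s A] pos_variation(3)[OF signed_uminus[OF s] A] by linarith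
qed

section \<open>Integration against signed measures\<close>

lemma finite_measure_bounded_integrable:
  fixes f :: "'a \<Rightarrow> real"
  assumes "finite_measure M" "f \<in> borel_measurable M" "\<And>x. \<bar>f x\<bar> \<le> B"
  shows "integrable M f"
proof -
  interpret finite_measure M by fact
  have "AE x in M. norm (f x) \<le> B" using assms(3) by (intro AE_I2) simp
  then show ?thesis using assms(2) by (rule integrable_const_bound)
qed

text \<open>The Jordan parts of \<mu> do not depend additively on \<mu>; only their differences do.
  A linear relation between finite measures passes to simple functions and, by dominated
  convergence, to bounded measurable ones. Additivity and homogeneity in \<mu>, and independence of
  the chosen decomposition, are then instances with finitely many measures.\<close>

lemma linear_relation_integrals:
  fixes c :: "'i \<Rightarrow> real" and f :: "'a \<Rightarrow> real"
  assumes I: "finite I" and M: "\<And>i. i \<in> I \<Longrightarrow> finite_measure (M i)" "\<And>i. i \<in> I \<Longrightarrow> sets (M i) = sets N"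
    and rel: "\<And>A. A \<in> sets N \<Longrightarrow> (\<Sum>i\<in>I. c i * measure (M i) A) = 0"
    and f: "f \<in> borel_measurable N" "\<And>x. \<bar>f x\<bar> \<le> B"
  shows "(\<Sum>i\<in>I. c i * (\<integral>x. f x \<partial>M i)) = 0"
proof -
  have sp: "space (M i) = space N" if "i \<in> I" for i using M(2)[OF that] by (rule sets_eq_imp_space_eq)
  obtain F where F: "\<And>k. simple_function N (F k)" "\<And>x. x \<in> space N \<Longrightarrow> (\<lambda>k. F k x) \<longlonglongrightarrow> f x"
    "\<And>k x. x \<in> space N \<Longrightarrow> dist (F k x) 0 \<le> 2 * dist (f x) 0"
    using borel_measurable_implies_sequence_metric[OF f(1), of 0] by metis
  have simple: "(\<Sum>i\<in>I. c i * (\<integral>x. F k x \<partial>M i)) = 0" for k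
  proof -
    let ?A = "\<lambda>y. F k -` {y} \<inter> space N"
    have A: "?A y \<in> sets N" for y using F(1)[of k] by (rule simple_functionD)
    have fin: "finite (F k ` space N)" using F(1)[of k] by (rule simple_functionD)
    have "(\<integral>x. F k x \<partial>M i) = (\<Sum>y\<in>F k ` space N. y * measure (M i) (?A y))" if i: "i \<in> I" for i
    proof -
      interpret finite_measure "M i" by (rule M(1)[OF i])
      have "(\<integral>x. F k x \<partial>M i) = (\<integral>x. (\<Sum>y\<in>F k ` space N. indicator (?A y) x * y) \<partial>M i)"
      proof (rule Bochner_Integration.integral_cong[OF refl])
        fix x assume "x \<in> space (M i)"
        then show "F k x = (\<Sum>y\<in>F k ` space N. indicator (?A y) x * y)"
          using simple_function_indicator_representation_banach[OF F(1)[of k], of x] sp[OF i]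
          by (simp only: real_scaleR_def)
      qed
      also have "\<dots> = (\<Sum>y\<in>F k ` space N. (\<integral>x. indicator (?A y) x * y \<partial>M i))"
        by (rule Bochner_Integration.integral_sum)
          (use A M(2)[OF i] in \<open>auto intro!: integrable_mult_left integrable_real_indicator simp: less_top[symmetric]\<close>)
      also have "\<dots> = (\<Sum>y\<in>F k ` space N. y * measure (M i) (?A y))"
      proof (rule sum.cong[OF refl])
        fix y
        have "?A y \<in> sets (M i)" using A M(2)[OF i] by simp
        moreover have "?A y \<inter> space (M i) = ?A y" using sp[OF i] by auto
        ultimately show "(\<integral>x. indicator (?A y) x * y \<partial>M i) = y * measure (M i) (?A y)" by simp
      qed
      finally show ?thesis .
    qed
    then have "(\<Sum>i\<in>I. c i * (\<integral>x. F k x \<partial>M i)) = (\<Sum>i\<in>I. \<Sum>y\<in>F k ` space N. y * (c i * measure (M i) (?A y)))"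
      by (simp add: sum_distrib_left mult_ac)
    also have "\<dots> = (\<Sum>y\<in>F k ` space N. y * (\<Sum>i\<in>I. c i * measure (M i) (?A y)))"
      by (subst sum.swap) (simp add: sum_distrib_left)
    also have "\<dots> = 0" using rel[OF A] by simp
    finally show ?thesis .
  qed
  have "(\<lambda>k. \<Sum>i\<in>I. c i * (\<integral>x. F k x \<partial>M i)) \<longlonglongrightarrow> (\<Sum>i\<in>I. c i * (\<integral>x. f x \<partial>M i))"
  proof (intro tendsto_sum tendsto_mult tendsto_const)
    fix i assume i: "i \<in> I"
    interpret finite_measure "M i" by (rule M(1)[OF i])
    have fm: "f \<in> borel_measurable (M i)" using f(1) measurable_cong_sets[OF M(2)[OF i] refl] by blast
    have Fm: "F k \<in> borel_measurable (M i)" for k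
      using borel_measurable_simple_function[OF F(1)[of k]] measurable_cong_sets[OF M(2)[OF i] refl] by blast
    show "(\<lambda>k. \<integral>x. F k x \<partial>M i) \<longlonglongrightarrow> (\<integral>x. f x \<partial>M i)"
    proof (rule integral_dominated_convergence[OF fm Fm])
      show "integrable (M i) (\<lambda>x. 2 * B)" by simp
      show "AE x in M i. (\<lambda>k. F k x) \<longlonglongrightarrow> f x" using F(2) sp[OF i] by (intro AE_I2) auto
      show "AE x in M i. norm (F k x) \<le> 2 * B" for k
      proof (rule AE_I2)
        fix x assume "x \<in> space (M i)"
        then have "dist (F k x) 0 \<le> 2 * dist (f x) 0" using F(3) sp[OF i] by auto
        then show "norm (F k x) \<le> 2 * B" using f(2)[of x] by simp
      qed
    qed
  qed
  then show ?thesis by (simp add: simple LIMSEQ_const_iff)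
qed

text \<open>Any representation of \<mu> as a difference of finite measures computes the integral,
  since its four measures and the Jordan parts satisfy one linear relation. It is applied to the
  positive and negative parts of a density.\<close>

lemma signed_integral_decomp:
  fixes f :: "real^'n::finite \<Rightarrow> real"
  assumes s: "signed_borel_measure \<Omega> \<mu>"
    and a: "finite_measure a" "sets a = sets (restrict_space borel \<Omega>)"
    and b: "finite_measure b" "sets b = sets (restrict_space borel \<Omega>)"
    and ab: "\<And>A. A \<in> sets (restrict_space borel \<Omega>) \<Longrightarrow> \<mu> A = measure a A - measure b A"
    and f: "f \<in> borel_measurable (restrict_space borel \<Omega>)" "\<And>x. \<bar>f x\<bar> \<le> B"
  shows "signed_integral \<Omega> \<mu> f = (\<integral>x. f x \<partial>a) - (\<integral>x. f x \<partial>b)"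
proof -
  let ?M = "\<lambda>i. [pos_variation \<Omega> \<mu>, pos_variation \<Omega> (\<lambda>A. - \<mu> A), a, b] ! i"
  let ?c = "\<lambda>i. [1, - 1, - 1, 1 :: real] ! i"
  note p = pos_variation[OF s] pos_variation[OF signed_uminus[OF s]]
  have I: "{..<4} = {0, 1, 2, 3 :: nat}" by auto
  have "(\<Sum>i\<in>{..<4}. ?c i * (\<integral>x. f x \<partial>?M i)) = 0"
  proof (rule linear_relation_integrals[OF _ _ _ _ f])
    fix A assume A: "A \<in> sets (restrict_space borel \<Omega>)"
    show "(\<Sum>i\<in>{..<4}. ?c i * measure (?M i) A) = 0"
      using jordan_decomposition[OF s A] ab[OF A] by (simp add: I)
  qed (use a b p in \<open>auto simp: I\<close>)
  then show ?thesis by (simp add: I signed_integral_def)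
qed

lemma signed_integral_add_measure:
  fixes f :: "real^'n::finite \<Rightarrow> real"
  assumes s: "signed_borel_measure \<Omega> \<mu>" "signed_borel_measure \<Omega> \<nu>"
    and f: "f \<in> borel_measurable (restrict_space borel \<Omega>)" "\<And>x. \<bar>f x\<bar> \<le> B"
  shows "signed_integral \<Omega> (\<lambda>A. \<mu> A + \<nu> A) f = signed_integral \<Omega> \<mu> f + signed_integral \<Omega> \<nu> f"
proof -
  note s3 = signed_add[OF s]
  let ?M = "\<lambda>i. [pos_variation \<Omega> \<mu>, pos_variation \<Omega> (\<lambda>A. - \<mu> A), pos_variation \<Omega> \<nu>, pos_variation \<Omega> (\<lambda>A. - \<nu> A),
    pos_variation \<Omega> (\<lambda>A. \<mu> A + \<nu> A), pos_variation \<Omega> (\<lambda>A. - (\<mu> A + \<nu> A))] ! i"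
  let ?c = "\<lambda>i. [1, - 1, 1, - 1, - 1, 1 :: real] ! i"
  note p = pos_variation[OF s(1)] pos_variation[OF signed_uminus[OF s(1)]] pos_variation[OF s(2)]
    pos_variation[OF signed_uminus[OF s(2)]] pos_variation[OF s3] pos_variation[OF signed_uminus[OF s3]]
  have I: "{..<6} = {0, 1, 2, 3, 4, 5 :: nat}" by auto
  have "(\<Sum>i\<in>{..<6}. ?c i * (\<integral>x. f x \<partial>?M i)) = 0"
  proof (rule linear_relation_integrals[OF _ _ _ _ f])
    fix A assume A: "A \<in> sets (restrict_space borel \<Omega>)"
    show "(\<Sum>i\<in>{..<6}. ?c i * measure (?M i) A) = 0"
      using jordan_decomposition[OF s(1) A] jordan_decomposition[OF s(2) A] jordan_decomposition[OF s3 A] by (simp add: I)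
  qed (use p in \<open>auto simp: I\<close>)
  then show ?thesis by (simp add: I signed_integral_def)
qed

lemma signed_integral_cmult_measure:
  fixes f :: "real^'n::finite \<Rightarrow> real"
  assumes s: "signed_borel_measure \<Omega> \<mu>"
    and f: "f \<in> borel_measurable (restrict_space borel \<Omega>)" "\<And>x. \<bar>f x\<bar> \<le> B"
  shows "signed_integral \<Omega> (\<lambda>A. r * \<mu> A) f = r * signed_integral \<Omega> \<mu> f"
proof -
  note s3 = signed_cmult[OF s, of r]
  let ?M = "\<lambda>i. [pos_variation \<Omega> \<mu>, pos_variation \<Omega> (\<lambda>A. - \<mu> A), pos_variation \<Omega> (\<lambda>A. r * \<mu> A), pos_variation \<Omega> (\<lambda>A. - (r * \<mu> A))] ! i"
  let ?c = "\<lambda>i. [r, - r, - 1, 1 :: real] ! i"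
  note p = pos_variation[OF s] pos_variation[OF signed_uminus[OF s]] pos_variation[OF s3] pos_variation[OF signed_uminus[OF s3]]
  have I: "{..<4} = {0, 1, 2, 3 :: nat}" by auto
  have "(\<Sum>i\<in>{..<4}. ?c i * (\<integral>x. f x \<partial>?M i)) = 0"
  proof (rule linear_relation_integrals[OF _ _ _ _ f])
    fix A assume A: "A \<in> sets (restrict_space borel \<Omega>)"
    have "r * (measure (pos_variation \<Omega> \<mu>) A - measure (pos_variation \<Omega> (\<lambda>A. - \<mu> A)) A) = r * \<mu> A"
      using jordan_decomposition[OF s A] by simp
    then show "(\<Sum>i\<in>{..<4}. ?c i * measure (?M i) A) = 0"
      using jordan_decomposition[OF s3 A] by (simp add: I algebra_simps)
  qed (use p in \<open>auto simp: I\<close>)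
  then show ?thesis by (simp add: I signed_integral_def algebra_simps)
qed

lemma signed_integral_integrable:
  fixes f :: "real^'n::finite \<Rightarrow> real"
  assumes s: "signed_borel_measure \<Omega> \<mu>"
    and f: "f \<in> borel_measurable (restrict_space borel \<Omega>)" "\<And>x. \<bar>f x\<bar> \<le> B"
  shows "integrable (pos_variation \<Omega> \<mu>) f" "integrable (pos_variation \<Omega> (\<lambda>A. - \<mu> A)) f"
proof -
  have "integrable M f" if "finite_measure M" "sets M = sets (restrict_space borel \<Omega>)" for M
    using measurable_cong_sets[OF that(2) refl] f(1) by (intro finite_measure_bounded_integrable[OF that(1) _ f(2)]) blast
  then show "integrable (pos_variation \<Omega> \<mu>) f" "integrable (pos_variation \<Omega> (\<lambda>A. - \<mu> A)) f"
    using pos_variation(1,2)[OF s] pos_variation(1,2)[OF signed_uminus[OF s]] by blast+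
qed

lemma signed_integral_linear:
  fixes f g :: "real^'n::finite \<Rightarrow> real"
  assumes s: "signed_borel_measure \<Omega> \<mu>"
    and f: "f \<in> borel_measurable (restrict_space borel \<Omega>)" "\<And>x. \<bar>f x\<bar> \<le> B"
    and g: "g \<in> borel_measurable (restrict_space borel \<Omega>)" "\<And>x. \<bar>g x\<bar> \<le> B'"
  shows "signed_integral \<Omega> \<mu> (\<lambda>x. a * f x + b * g x) = a * signed_integral \<Omega> \<mu> f + b * signed_integral \<Omega> \<mu> g"
  using signed_integral_integrable[OF s f] signed_integral_integrable[OF s g]
  by (simp add: signed_integral_def algebra_simps)

lemma signed_integral_bound:
  assumes s: "signed_borel_measure \<Omega> \<mu>"
  obtains C where "C \<ge> 0" "\<And>f B. f \<in> borel_measurable (restrict_space borel \<Omega>) \<Longrightarrow> (\<And>x. \<bar>f x\<bar> \<le> B) \<Longrightarrow>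
    \<bar>signed_integral \<Omega> \<mu> f\<bar> \<le> C * B"
proof -
  let ?P = "pos_variation \<Omega> \<mu>" and ?N = "pos_variation \<Omega> (\<lambda>A. - \<mu> A)"
  interpret P: finite_measure ?P by (rule pos_variation(2)[OF s])
  interpret N: finite_measure ?N by (rule pos_variation(2)[OF signed_uminus[OF s]])
  show ?thesis
  proof (rule that[of "measure ?P (space ?P) + measure ?N (space ?N)"])
    fix f :: "_ \<Rightarrow> real" and B assume f: "f \<in> borel_measurable (restrict_space borel \<Omega>)" "\<And>x. \<bar>f x\<bar> \<le> B"
    note i = signed_integral_integrable[OF s f]
    have "norm (\<integral>x. f x \<partial>?P) \<le> (\<integral>x. B \<partial>?P)" "norm (\<integral>x. f x \<partial>?N) \<le> (\<integral>x. B \<partial>?N)"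
      by (rule Bochner_Integration.integral_norm_bound_integral; use i f in simp)+
    then show "\<bar>signed_integral \<Omega> \<mu> f\<bar> \<le> (measure ?P (space ?P) + measure ?N (space ?N)) * B"
      by (simp add: signed_integral_def algebra_simps)
  qed simp
qed

section \<open>Uniqueness of signed measures, and measures with a density\<close>

lemma restrict_borel_generated:
  assumes "open \<Omega>"
  shows "sets (restrict_space borel \<Omega>) = sigma_sets \<Omega> {U. open U \<and> U \<subseteq> \<Omega>}"
proof -
  have "sets (restrict_space borel \<Omega>) = (\<inter>) \<Omega> ` sigma_sets UNIV {U. open U}"
    unfolding sets_restrict_space borel_def by (subst sets_measure_of) auto
  also have "\<dots> = sigma_sets \<Omega> ((\<inter>) \<Omega> ` {U. open U})"
    by (rule sigma_sets_Int) (auto intro: assms sigma_sets.Basic)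
  also have "(\<inter>) \<Omega> ` {U. open U} = {U. open U \<and> U \<subseteq> \<Omega>}"
  proof (intro equalityI subsetI)
    fix U assume "U \<in> {U. open U \<and> U \<subseteq> \<Omega>}"
    then show "U \<in> (\<inter>) \<Omega> ` {U. open U}" by (intro image_eqI[of _ _ U]) auto
  qed (use assms in blast)
  finally show ?thesis .
qed

lemma test_borel_restrict:
  "\<phi> \<in> test_functions U \<Longrightarrow> (\<phi> :: real^'n::finite \<Rightarrow> real) \<in> borel_measurable (restrict_space borel \<Omega>)"
  by (intro measurable_restrict_space1 test_borel)

text \<open>Cut-offs converge boundedly to the indicator of an open set, so the measures agree on
  open sets. These are stable under intersection and generate the Borel sets, and agreement is
  preserved under complements and disjoint unions.\<close>

lemma signed_measure_unique:
  fixes \<Omega> :: "(real^'n::finite) set"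
  assumes \<Omega>: "open \<Omega>" and s: "signed_borel_measure \<Omega> \<mu>" "signed_borel_measure \<Omega> \<nu>"
    and eq: "\<And>\<phi>. \<phi> \<in> test_functions \<Omega> \<Longrightarrow> signed_integral \<Omega> \<mu> \<phi> = signed_integral \<Omega> \<nu> \<phi>"
  shows "\<mu> = \<nu>"
proof
  fix A
  let ?S = "sets (restrict_space borel \<Omega>)"
  have op: "\<mu> U = \<nu> U" if U: "open U" "U \<subseteq> \<Omega>" for U
  proof -
    obtain K :: "nat \<Rightarrow> (real^'n) set" and \<kappa> :: "nat \<Rightarrow> real^'n \<Rightarrow> real" where
      K: "\<And>n. compact (K n)" "\<And>n. K n \<subseteq> U" "\<And>n. K n \<subseteq> interior (K (Suc n))"
      "\<And>L. compact L \<Longrightarrow> L \<subseteq> U \<Longrightarrow> \<exists>N. \<forall>n\<ge>N. L \<subseteq> K n"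
      and \<kappa>: "\<And>n. \<kappa> n \<in> test_functions (interior (K (Suc n)))" "\<And>n x. 0 \<le> \<kappa> n x" "\<And>n x. \<kappa> n x \<le> 1"
      "\<And>n x. x \<in> K n \<Longrightarrow> \<kappa> n x = 1"
      by (rule exhaustion_cutoffs[OF U(1)]) (erule that)
    have \<kappa>U: "\<kappa> n \<in> test_functions U" for n
      using test_mono[OF \<kappa>(1)] interior_subset K(2) by (meson order_trans)
    have lim: "(\<lambda>n. \<kappa> n x) \<longlonglongrightarrow> indicator U x" for x
    proof (cases "x \<in> U")
      case True
      then obtain N where "\<And>n. n \<ge> N \<Longrightarrow> x \<in> K n" using K(4)[of "{x}"] by auto
      then have "\<forall>\<^sub>F n in sequentially. \<kappa> n x = 1" using \<kappa>(4) by (auto simp: eventually_sequentially)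
      then show ?thesis using True by (simp add: tendsto_eventually)
    next
      case False
      have "\<kappa> n x = 0" for n using \<kappa>U[of n] False by (metis subsetD test_functionsE)
      then show ?thesis using False by simp
    qed
    have US: "U \<in> ?S" using U restrict_borel_generated[OF \<Omega>] by auto
    have L: "(\<lambda>n. signed_integral \<Omega> \<rho> (\<kappa> n)) \<longlonglongrightarrow> \<rho> U" if r: "signed_borel_measure \<Omega> \<rho>" for \<rho>
    proof -
      have l: "(\<lambda>n. \<integral>x. \<kappa> n x \<partial>M) \<longlonglongrightarrow> measure M U" if M: "finite_measure M" "sets M = ?S" for M
      proof -
        interpret finite_measure M by fact
        have m: "\<kappa> n \<in> borel_measurable M" for n
          using test_borel_restrict[OF \<kappa>(1)] measurable_cong_sets[OF M(2) refl] by blast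
        have mU: "indicator U \<in> borel_measurable M" using US M(2) by (intro borel_measurable_indicator) simp
        have "(\<lambda>n. \<integral>x. \<kappa> n x \<partial>M) \<longlonglongrightarrow> (\<integral>x. indicator U x \<partial>M)"
          by (rule integral_dominated_convergence[OF mU m, of "\<lambda>x. 1"]) (use lim \<kappa> in auto)
        moreover have "U \<inter> space M = U" using sets.sets_into_space[of U M] US M(2) by auto
        ultimately show ?thesis by simp
      qed
      show ?thesis
        unfolding signed_integral_def jordan_decomposition[OF r US, symmetric]
        by (intro tendsto_diff l) (rule pos_variation(1,2)[OF r] pos_variation(1,2)[OF signed_uminus[OF r]])+
    qed
    have "signed_integral \<Omega> \<mu> (\<kappa> n) = signed_integral \<Omega> \<nu> (\<kappa> n)" for n
      by (rule eq[OF test_mono[OF \<kappa>U U(2)]])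
    then show ?thesis using L[OF s(1)] L[OF s(2)] LIMSEQ_unique by auto
  qed
  show "\<mu> A = \<nu> A"
  proof (cases "A \<in> ?S")
    case True
    then have A: "A \<in> sigma_sets \<Omega> {U. open U \<and> U \<subseteq> \<Omega>}" using restrict_borel_generated[OF \<Omega>] by simp
    have \<Omega>S: "\<Omega> \<in> ?S" using restrict_borel_generated[OF \<Omega>] \<Omega> by auto
    show ?thesis
    proof (rule sigma_sets_induct_disjoint[OF _ _ A])
      show "Int_stable {U. open U \<and> U \<subseteq> \<Omega>}" by (auto simp: Int_stable_def)
    next
      fix B assume B: "B \<in> sigma_sets \<Omega> {U. open U \<and> U \<subseteq> \<Omega>}" "\<mu> B = \<nu> B"
      then have BS: "B \<in> ?S" using restrict_borel_generated[OF \<Omega>] by simp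
      then have "B \<subseteq> \<Omega>" using sets.sets_into_space[OF BS] by (simp add: space_restrict_space)
      then show "\<mu> (\<Omega> - B) = \<nu> (\<Omega> - B)"
        using signed_Diff[OF s(1) \<Omega>S BS] signed_Diff[OF s(2) \<Omega>S BS] B(2) op[OF \<Omega>] by simp
    next
      fix F :: "nat \<Rightarrow> _" assume F: "disjoint_family F" "range F \<subseteq> sigma_sets \<Omega> {U. open U \<and> U \<subseteq> \<Omega>}" "\<And>i. \<mu> (F i) = \<nu> (F i)"
      then have FS: "F k \<in> ?S" for k using restrict_borel_generated[OF \<Omega>] by auto
      show "\<mu> (\<Union>i. F i) = \<nu> (\<Union>i. F i)"
        using signed_sums[OF s(1) FS F(1)] signed_sums[OF s(2) FS F(1)] F(3) sums_unique2 by fastforce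
    qed (use op signed_empty[OF s(1)] signed_empty[OF s(2)] in auto)
  qed (simp add: signed_outside[OF s(1)] signed_outside[OF s(2)])
qed

text \<open>The source of all weak derivatives that have to be constructed, apart from sums and
  multiples of given ones: an integrable function acts as a signed measure, given by its positive
  and negative parts.\<close>

lemma signed_of_density:
  fixes g :: "real^'n::finite \<Rightarrow> real"
  assumes \<Omega>: "open \<Omega>" and g: "integrable lborel g" "\<And>x. x \<notin> \<Omega> \<Longrightarrow> g x = 0"
  obtains \<mu> where "signed_borel_measure \<Omega> \<mu>"
    "\<And>f B. f \<in> borel_measurable borel \<Longrightarrow> (\<And>x. \<bar>f x\<bar> \<le> B) \<Longrightarrow> signed_integral \<Omega> \<mu> f = (\<integral>x. g x * f x \<partial>lborel)"
proof -
  let ?L = "restrict_space lborel \<Omega>"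
  let ?S = "sets (restrict_space borel \<Omega>)"
  have SL: "sets ?L = ?S" by (simp add: sets_restrict_space)
  have [measurable]: "g \<in> borel_measurable borel" using g by auto
  define a where "a = density ?L (\<lambda>x. ennreal (max 0 (g x)))"
  define b where "b = density ?L (\<lambda>x. ennreal (max 0 (- g x)))"
  have gm: "(\<lambda>x. max 0 (g x)) \<in> borel_measurable ?L" "(\<lambda>x. max 0 (- g x)) \<in> borel_measurable ?L"
    by (auto intro!: measurable_restrict_space1)
  have intL: "(\<integral>x. h x \<partial>?L) = (\<integral>x. h x \<partial>lborel)" if "\<And>x. x \<notin> \<Omega> \<Longrightarrow> h x = (0::real)" for h
  proof -
    have "(\<lambda>x. indicator \<Omega> x * h x) = h" using that by (auto simp: fun_eq_iff indicator_def)
    then show ?thesis using \<Omega> by (subst integral_restrict_space) auto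
  qed
  have fin: "finite_measure (density ?L (\<lambda>x. ennreal (max 0 (h x))))" if h: "integrable lborel h" "\<And>x. x \<notin> \<Omega> \<Longrightarrow> h x = 0" for h
  proof (rule finite_measureI)
    have [measurable]: "h \<in> borel_measurable borel" using h by auto
    have hm: "(\<lambda>x. ennreal (max 0 (h x))) \<in> borel_measurable ?L" by (auto intro!: measurable_restrict_space1)
    have "emeasure (density ?L (\<lambda>x. ennreal (max 0 (h x)))) (space (density ?L (\<lambda>x. ennreal (max 0 (h x))))) =
      (\<integral>\<^sup>+x. ennreal (max 0 (h x)) * indicator \<Omega> x \<partial>lborel)"
      using \<Omega> hm sets.top[of ?L]
      by (subst emeasure_density)
        (auto simp: nn_integral_restrict_space space_restrict_space indicator_def intro!: nn_integral_cong)
    also have "\<dots> \<le> (\<integral>\<^sup>+x. ennreal (norm (h x)) \<partial>lborel)"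
      by (intro nn_integral_mono) (auto simp: indicator_def intro!: ennreal_leI)
    also have "\<dots> < \<infinity>" using h(1) by (simp add: integrable_iff_bounded)
    finally show "emeasure (density ?L (\<lambda>x. ennreal (max 0 (h x)))) (space (density ?L (\<lambda>x. ennreal (max 0 (h x))))) \<noteq> \<infinity>" by simp
  qed
  have fa: "finite_measure a" unfolding a_def by (rule fin) (use g in auto)
  have fb: "finite_measure b" unfolding b_def by (rule fin) (use g in auto)
  have sa: "sets a = ?S" "sets b = ?S" by (simp_all add: a_def b_def SL)
  define \<mu> where "\<mu> A = (if A \<in> ?S then measure a A - measure b A else 0)" for A
  have s: "signed_borel_measure \<Omega> \<mu>"
    unfolding signed_borel_measure_def
  proof (intro conjI allI impI)
    fix A :: "nat \<Rightarrow> (real^'n) set" assume A: "range A \<subseteq> ?S \<and> disjoint_family A"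
    have "(\<Union>k. A k) \<in> ?S" using A by (intro sets.countable_nat_UN) auto
    moreover have "(\<lambda>k. measure a (A k) - measure b (A k)) sums (measure a (\<Union>k. A k) - measure b (\<Union>k. A k))"
      using A sa by (intro sums_diff finite_measure.finite_measure_UNION fa fb) auto
    ultimately show "(\<lambda>k. \<mu> (A k)) sums \<mu> (\<Union>k. A k)" using A by (auto simp: \<mu>_def)
  qed (simp add: \<mu>_def)
  show ?thesis
  proof (rule that[OF s])
    fix f :: "real^'n \<Rightarrow> real" and B assume f: "f \<in> borel_measurable borel" "\<And>x. \<bar>f x\<bar> \<le> B"
    have [measurable]: "f \<in> borel_measurable borel" by fact
    have fr: "f \<in> borel_measurable (restrict_space borel \<Omega>)" by (rule measurable_restrict_space1[OF f(1)])
    have fL: "f \<in> borel_measurable ?L" by (rule measurable_restrict_space1) (use f in simp)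
    have "signed_integral \<Omega> \<mu> f = (\<integral>x. f x \<partial>a) - (\<integral>x. f x \<partial>b)"
      by (rule signed_integral_decomp[OF s fa sa(1) fb sa(2) _ fr f(2)]) (simp add: \<mu>_def)
    also have "(\<integral>x. f x \<partial>a) = (\<integral>x. max 0 (g x) * f x \<partial>lborel)"
      unfolding a_def using gm fL by (subst integral_density) (auto intro!: intL simp: g(2))
    also have "(\<integral>x. f x \<partial>b) = (\<integral>x. max 0 (- g x) * f x \<partial>lborel)"
      unfolding b_def using gm fL by (subst integral_density) (auto intro!: intL simp: g(2))
    also have "(\<integral>x. max 0 (g x) * f x \<partial>lborel) - (\<integral>x. max 0 (- g x) * f x \<partial>lborel) =
      (\<integral>x. max 0 (g x) * f x - max 0 (- g x) * f x \<partial>lborel)"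
    proof (rule Bochner_Integration.integral_diff[symmetric])
      have i: "integrable lborel (\<lambda>x. B * \<bar>g x\<bar>)" using g by auto
      have B: "B \<ge> 0" using f(2)[of 0] by simp
      have "\<bar>max 0 (g x) * f x\<bar> \<le> B * \<bar>g x\<bar>" "\<bar>max 0 (- g x) * f x\<bar> \<le> B * \<bar>g x\<bar>" for x
        unfolding abs_mult using f(2)[of x] B by (subst mult.commute, intro mult_mono; auto)+
      then have n: "norm (max 0 (g x) * f x) \<le> norm (B * \<bar>g x\<bar>)" "norm (max 0 (- g x) * f x) \<le> norm (B * \<bar>g x\<bar>)" for x
        using B by (simp_all add: abs_mult)
      show "integrable lborel (\<lambda>x. max 0 (g x) * f x)"
        by (rule Bochner_Integration.integrable_bound[OF i _ AE_I2[OF n(1)]]) measurable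
      show "integrable lborel (\<lambda>x. max 0 (- g x) * f x)"
        by (rule Bochner_Integration.integrable_bound[OF i _ AE_I2[OF n(2)]]) measurable
    qed
    also have "(\<lambda>x. max 0 (g x) * f x - max 0 (- g x) * f x) = (\<lambda>x. g x * f x)"
      by (auto simp: fun_eq_iff max_def)
    finally show "signed_integral \<Omega> \<mu> f = (\<integral>x. g x * f x \<partial>lborel)" .
  qed
qed

section \<open>Functions of bounded variation\<close>

lemma Lp_add:
  assumes "p \<ge> 1" "u \<in> Lp_space \<Omega> p" "w \<in> Lp_space \<Omega> p"
  shows "(\<lambda>x. u x + w x) \<in> Lp_space \<Omega> p"
proof -
  have p: "p > 0" "p \<ge> 0" using assms(1) by auto
  have "u \<in> borel_measurable (lebesgue_on \<Omega>)" "integrable (lebesgue_on \<Omega>) (\<lambda>x. \<bar>u x\<bar> powr p)"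
    "w \<in> borel_measurable (lebesgue_on \<Omega>)" "integrable (lebesgue_on \<Omega>) (\<lambda>x. \<bar>w x\<bar> powr p)"
    using assms(2,3) unfolding Lp_space_iff[OF p(1)] by blast+
  then show ?thesis unfolding Lp_space_iff[OF p(1)] using powr_integrable_add[OF p(2)] by (simp add: borel_measurable_add)
qed

lemma Lp_cmult:
  assumes "p \<ge> 1" "u \<in> Lp_space \<Omega> p"
  shows "(\<lambda>x. c * u x) \<in> Lp_space \<Omega> p"
  using assms by (auto simp: Lp_space_iff abs_mult powr_mult)

lemma Lp_diff:
  assumes "p \<ge> 1" "u \<in> Lp_space \<Omega> p" "w \<in> Lp_space \<Omega> p"
  shows "(\<lambda>x. u x - w x) \<in> Lp_space \<Omega> p"
  using Lp_add[OF assms(1,2) Lp_cmult[OF assms(1,3), of "- 1"]] by simp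

lemma Lp_zero: "p \<ge> 1 \<Longrightarrow> (\<lambda>x. 0) \<in> Lp_space \<Omega> p"
  by (auto simp: Lp_space_iff)

lemma is_weak_deriv_unique:
  assumes "open \<Omega>" "is_weak_deriv \<Omega> i u \<mu>" "is_weak_deriv \<Omega> i u \<nu>"
  shows "\<mu> = \<nu>"
  by (rule signed_measure_unique[OF assms(1)]) (use assms in \<open>auto simp: is_weak_deriv_def\<close>)

lemma weak_deriv_eqI: "open \<Omega> \<Longrightarrow> is_weak_deriv \<Omega> i u \<mu> \<Longrightarrow> weak_deriv \<Omega> i u = \<mu>"
  unfolding weak_deriv_def by (rule the_equality) (auto dest: is_weak_deriv_unique)

lemma weak_deriv:
  assumes "open \<Omega>" "u \<in> BV \<Omega> p"
  shows "is_weak_deriv \<Omega> i u (weak_deriv \<Omega> i u)"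
proof -
  obtain \<mu> where "is_weak_deriv \<Omega> i u \<mu>" using assms(2) unfolding BV_def by blast
  then show ?thesis using weak_deriv_eqI[OF assms(1)] by metis
qed

lemma weak_deriv_signed: "open \<Omega> \<Longrightarrow> u \<in> BV \<Omega> p \<Longrightarrow> signed_borel_measure \<Omega> (weak_deriv \<Omega> i u)"
  using weak_deriv unfolding is_weak_deriv_def by blast

lemma BV_Lp: "u \<in> BV \<Omega> p \<Longrightarrow> u \<in> Lp_space \<Omega> p"
  by (simp add: BV_def)

lemma is_weak_deriv_add:
  assumes \<Omega>: "open \<Omega>" and p: "p \<ge> 1" and L: "u \<in> Lp_space \<Omega> p" "w \<in> Lp_space \<Omega> p"
    and d: "is_weak_deriv \<Omega> i u \<mu>" "is_weak_deriv \<Omega> i w \<nu>"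
  shows "is_weak_deriv \<Omega> i (\<lambda>x. u x + w x) (\<lambda>A. \<mu> A + \<nu> A)"
  unfolding is_weak_deriv_def
proof (intro conjI ballI)
  have s: "signed_borel_measure \<Omega> \<mu>" "signed_borel_measure \<Omega> \<nu>" using d by (auto simp: is_weak_deriv_def)
  then show "signed_borel_measure \<Omega> (\<lambda>A. \<mu> A + \<nu> A)" by (rule signed_add)
  fix \<phi> :: "real^'a \<Rightarrow> real" assume \<phi>: "\<phi> \<in> test_functions \<Omega>"
  obtain B where B: "\<And>x. norm (\<phi> x) \<le> B" using test_bounded[OF \<phi>] by metis
  have "signed_integral \<Omega> (\<lambda>A. \<mu> A + \<nu> A) \<phi> = signed_integral \<Omega> \<mu> \<phi> + signed_integral \<Omega> \<nu> \<phi>"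
    by (rule signed_integral_add_measure[OF s test_borel_restrict[OF \<phi>], of B]) (use B in simp)
  moreover have "(\<integral>x. (u x + w x) * partial_deriv i \<phi> x \<partial>lebesgue_on \<Omega>) =
    (\<integral>x. u x * partial_deriv i \<phi> x \<partial>lebesgue_on \<Omega>) + (\<integral>x. w x * partial_deriv i \<phi> x \<partial>lebesgue_on \<Omega>)"
    using Lp_test_integrable[OF \<Omega> p L(1) test_partial_deriv[OF \<phi>]] Lp_test_integrable[OF \<Omega> p L(2) test_partial_deriv[OF \<phi>]]
    by (simp add: distrib_right)
  ultimately show "(\<integral>x. (u x + w x) * partial_deriv i \<phi> x \<partial>lebesgue_on \<Omega>) = - signed_integral \<Omega> (\<lambda>A. \<mu> A + \<nu> A) \<phi>"
    using d \<phi> unfolding is_weak_deriv_def by simp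
qed

lemma is_weak_deriv_cmult:
  assumes d: "is_weak_deriv \<Omega> i u \<mu>"
  shows "is_weak_deriv \<Omega> i (\<lambda>x. c * u x) (\<lambda>A. c * \<mu> A)"
  unfolding is_weak_deriv_def
proof (intro conjI ballI)
  have s: "signed_borel_measure \<Omega> \<mu>" using d by (auto simp: is_weak_deriv_def)
  then show "signed_borel_measure \<Omega> (\<lambda>A. c * \<mu> A)" by (rule signed_cmult)
  fix \<phi> :: "real^'a \<Rightarrow> real" assume \<phi>: "\<phi> \<in> test_functions \<Omega>"
  obtain B where B: "\<And>x. norm (\<phi> x) \<le> B" using test_bounded[OF \<phi>] by metis
  have "signed_integral \<Omega> (\<lambda>A. c * \<mu> A) \<phi> = c * signed_integral \<Omega> \<mu> \<phi>"
    by (rule signed_integral_cmult_measure[OF s test_borel_restrict[OF \<phi>], of B]) (use B in simp)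
  then show "(\<integral>x. (c * u x) * partial_deriv i \<phi> x \<partial>lebesgue_on \<Omega>) = - signed_integral \<Omega> (\<lambda>A. c * \<mu> A) \<phi>"
    using d \<phi> unfolding is_weak_deriv_def by (simp add: mult.assoc)
qed

lemma BV_add:
  assumes "open \<Omega>" "p \<ge> 1" "u \<in> BV \<Omega> p" "w \<in> BV \<Omega> p"
  shows "(\<lambda>x. u x + w x) \<in> BV \<Omega> p"
  using Lp_add[OF assms(2) BV_Lp[OF assms(3)] BV_Lp[OF assms(4)]]
    is_weak_deriv_add[OF assms(1,2) BV_Lp[OF assms(3)] BV_Lp[OF assms(4)] weak_deriv[OF assms(1,3)] weak_deriv[OF assms(1,4)]]
  unfolding BV_def by blast

lemma BV_cmult:
  assumes "open \<Omega>" "p \<ge> 1" "u \<in> BV \<Omega> p"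
  shows "(\<lambda>x. c * u x) \<in> BV \<Omega> p"
  using Lp_cmult[OF assms(2) BV_Lp[OF assms(3)]] is_weak_deriv_cmult[OF weak_deriv[OF assms(1,3)]]
  unfolding BV_def by blast

lemma BV_zero:
  assumes "open \<Omega>" "p \<ge> 1" shows "(\<lambda>x. 0) \<in> BV \<Omega> p"
proof -
  have s: "signed_borel_measure \<Omega> (\<lambda>A. 0)" by (simp add: signed_borel_measure_def)
  have "signed_integral \<Omega> (\<lambda>A. 0) \<phi> = 0" for \<phi> by (simp add: signed_integral_def)
  then have "is_weak_deriv \<Omega> i (\<lambda>x. 0) (\<lambda>A. 0)" for i using s by (simp add: is_weak_deriv_def)
  then show ?thesis using Lp_zero[OF assms(2)] unfolding BV_def by blast
qed

lemma cst_rel_cong: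
  assumes \<Omega>: "open \<Omega>" and p: "p \<ge> 1" and r: "(u, w) \<in> cst_rel \<Omega> p"
  shows "is_weak_deriv \<Omega> i u = is_weak_deriv \<Omega> i w"
    and "\<phi> \<in> test_functions \<Omega> \<Longrightarrow> (\<integral>x. \<phi> x \<partial>lborel) = 0 \<Longrightarrow>
      (\<integral>x. u x * \<phi> x \<partial>lebesgue_on \<Omega>) = (\<integral>x. w x * \<phi> x \<partial>lebesgue_on \<Omega>)"
proof -
  obtain c where uw: "u \<in> BV \<Omega> p" "w \<in> BV \<Omega> p" and c: "AE x in lebesgue_on \<Omega>. u x - w x = c"
    using r by (auto simp: cst_rel_def)
  show eq: "(\<integral>x. u x * \<phi> x \<partial>lebesgue_on \<Omega>) = (\<integral>x. w x * \<phi> x \<partial>lebesgue_on \<Omega>)"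
    if \<phi>: "\<phi> \<in> test_functions \<Omega>" "(\<integral>x. \<phi> x \<partial>lborel) = 0" for \<phi>
  proof -
    note t = test_lebesgue_on[OF \<Omega> \<phi>(1)]
    note i = Lp_test_integrable[OF \<Omega> p BV_Lp[OF uw(1)] \<phi>(1)] Lp_test_integrable[OF \<Omega> p BV_Lp[OF uw(2)] \<phi>(1)]
    have "(\<integral>x. u x * \<phi> x \<partial>lebesgue_on \<Omega>) = (\<integral>x. w x * \<phi> x + c * \<phi> x \<partial>lebesgue_on \<Omega>)"
    proof (rule integral_cong_AE)
      show "AE x in lebesgue_on \<Omega>. u x * \<phi> x = w x * \<phi> x + c * \<phi> x"
        using c by eventually_elim (auto simp: algebra_simps)
    qed (use i t in auto)
    also have "\<dots> = (\<integral>x. w x * \<phi> x \<partial>lebesgue_on \<Omega>) + c * (\<integral>x. \<phi> x \<partial>lebesgue_on \<Omega>)" using i t by simp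
    finally show ?thesis using t \<phi>(2) by simp
  qed
  have "(\<integral>x. u x * partial_deriv i \<phi> x \<partial>lebesgue_on \<Omega>) = (\<integral>x. w x * partial_deriv i \<phi> x \<partial>lebesgue_on \<Omega>)"
    if "\<phi> \<in> test_functions \<Omega>" for \<phi>
    by (rule eq[OF test_partial_deriv[OF that] integral_partial_deriv_test[OF that]])
  then show "is_weak_deriv \<Omega> i u = is_weak_deriv \<Omega> i w" unfolding is_weak_deriv_def by fastforce
qed

lemma equiv_cst_rel: "equiv (BV \<Omega> p) (cst_rel \<Omega> p)"
proof (rule equivI)
  show "refl_on (BV \<Omega> p) (cst_rel \<Omega> p)" by (auto simp: refl_on_def cst_rel_def)
  show "sym (cst_rel \<Omega> p)"
  proof (rule symI)
    fix u w assume "(u, w) \<in> cst_rel \<Omega> p"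
    then obtain c where uw: "u \<in> BV \<Omega> p" "w \<in> BV \<Omega> p" and c: "AE x in lebesgue_on \<Omega>. u x - w x = c" by (auto simp: cst_rel_def)
    from c have "AE x in lebesgue_on \<Omega>. w x - u x = - c" by eventually_elim auto
    then show "(w, u) \<in> cst_rel \<Omega> p" using uw unfolding cst_rel_def by blast
  qed
  show "trans (cst_rel \<Omega> p)"
  proof (rule transI)
    fix u w z assume "(u, w) \<in> cst_rel \<Omega> p" "(w, z) \<in> cst_rel \<Omega> p"
    then obtain c d where uw: "u \<in> BV \<Omega> p" "z \<in> BV \<Omega> p" and c: "AE x in lebesgue_on \<Omega>. u x - w x = c"
      "AE x in lebesgue_on \<Omega>. w x - z x = d" by (auto simp: cst_rel_def)
    from c have "AE x in lebesgue_on \<Omega>. u x - z x = c + d" by eventually_elim auto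
    then show "(u, z) \<in> cst_rel \<Omega> p" using uw unfolding cst_rel_def by blast
  qed
  show "cst_rel \<Omega> p \<subseteq> BV \<Omega> p \<times> BV \<Omega> p" by (auto simp: cst_rel_def)
qed

lemma BV_class_in: "u \<in> BV \<Omega> p \<Longrightarrow> BV_class \<Omega> p u \<in> BV_cst \<Omega> p"
  by (simp add: BV_class_def BV_cst_def quotientI)

lemma BV_cst_cases:
  assumes "X \<in> BV_cst \<Omega> p" obtains u where "u \<in> BV \<Omega> p" "X = BV_class \<Omega> p u"
  using assms unfolding BV_cst_def BV_class_def by (elim quotientE) auto

lemma BV_class_some:
  assumes "u \<in> BV \<Omega> p" shows "(u, SOME u'. u' \<in> BV_class \<Omega> p u) \<in> cst_rel \<Omega> p"
proof -
  have "u \<in> BV_class \<Omega> p u" unfolding BV_class_def using equiv_class_self[OF equiv_cst_rel assms] .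
  from someI[of "\<lambda>u'. u' \<in> BV_class \<Omega> p u", OF this] show ?thesis by (simp add: BV_class_def)
qed

section \<open>The derivative of a function paired with a field vanishing at infinity\<close>

definition deriv_pairing :: "(real^'n::finite) set \<Rightarrow> (real^'n \<Rightarrow> real) \<Rightarrow> (real^'n \<Rightarrow> real^'n) \<Rightarrow> real"
  where "deriv_pairing \<Omega> u v = (\<Sum>i\<in>UNIV. signed_integral \<Omega> (weak_deriv \<Omega> i u) (\<lambda>x. v x $ i))"

text \<open>\<open>div_op\<close> evaluates at the representative picked by \<open>SOME\<close>,
  which differs from \<open>u\<close> by a constant almost everywhere. Constants are invisible to
  weak derivatives, so the choice does not matter and one may compute with \<open>u\<close>
  itself.\<close>

lemma div_op_class:
  assumes "open \<Omega>" "p \<ge> 1" "u \<in> BV \<Omega> p"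
  shows "div_op \<Omega> p v (BV_class \<Omega> p u) = - deriv_pairing \<Omega> u v"
proof -
  have "weak_deriv \<Omega> i (SOME u'. u' \<in> BV_class \<Omega> p u) = weak_deriv \<Omega> i u" for i
    using cst_rel_cong(1)[OF assms(1,2) BV_class_some[OF assms(3)]] by (simp add: weak_deriv_def)
  then show ?thesis using BV_class_in[OF assms(3)] by (simp add: div_op_def deriv_pairing_def)
qed

lemma C0_bounded:
  assumes "v \<in> C0_fields \<Omega>"
  obtains B where "B > 0" "\<And>x. norm (v x) \<le> B"
proof -
  obtain K where K: "compact K" "K \<subseteq> \<Omega>" "\<And>x. x \<in> \<Omega> - K \<Longrightarrow> norm (v x) < 1"
    using assms unfolding C0_fields_def by (auto dest: spec[of _ 1])
  have "bounded (v ` K)"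
    using assms K by (intro compact_imp_bounded compact_continuous_image) (auto simp: C0_fields_def intro: continuous_on_subset)
  then obtain b where b: "\<And>x. x \<in> K \<Longrightarrow> norm (v x) \<le> b" unfolding bounded_iff by auto
  have "norm (v x) \<le> max b 1" for x
  proof (cases "x \<in> \<Omega>")
    case True
    then show ?thesis using b[of x] K(3)[of x] by (cases "x \<in> K") auto
  next
    case False
    then show ?thesis using assms by (auto simp: C0_fields_def)
  qed
  then show ?thesis by (intro that[of "max b 1"]) auto
qed

lemma C0_outside: "v \<in> C0_fields \<Omega> \<Longrightarrow> x \<notin> \<Omega> \<Longrightarrow> v x = 0"
  by (simp add: C0_fields_def)

lemma sup_norm_upper:
  assumes "v \<in> C0_fields \<Omega>" "\<Omega> \<noteq> {}"
  shows "norm (v x) \<le> sup_norm \<Omega> v" "sup_norm \<Omega> v \<ge> 0"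
proof -
  obtain B where B: "\<And>x. norm (v x) \<le> B" using C0_bounded[OF assms(1)] by metis
  have u: "norm (v x) \<le> sup_norm \<Omega> v" if "x \<in> \<Omega>" for x
    unfolding sup_norm_def by (rule cSUP_upper[OF that bdd_aboveI2]) (rule B)
  obtain y where "y \<in> \<Omega>" using assms(2) by blast
  then show n: "sup_norm \<Omega> v \<ge> 0" using u[of y] norm_ge_zero[of "v y"] by linarith
  show "norm (v x) \<le> sup_norm \<Omega> v" using u n C0_outside[OF assms(1), of x] by (cases "x \<in> \<Omega>") auto
qed

lemma sup_norm_least: "\<Omega> \<noteq> {} \<Longrightarrow> (\<And>x. x \<in> \<Omega> \<Longrightarrow> norm (v x) \<le> c) \<Longrightarrow> sup_norm \<Omega> v \<le> c"
  unfolding sup_norm_def by (rule cSUP_least)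

lemma test_C0:
  fixes v :: "real^'n::finite \<Rightarrow> real^'n"
  assumes "v \<in> test_functions \<Omega>" shows "v \<in> C0_fields \<Omega>"
proof -
  obtain K where K: "compact K" "K \<subseteq> \<Omega>" "\<And>x. x \<notin> K \<Longrightarrow> v x = 0" using test_functionsE[OF assms] by metis
  then have "\<forall>e>0. \<exists>K. compact K \<and> K \<subseteq> \<Omega> \<and> (\<forall>x\<in>\<Omega> - K. norm (v x) < e)" by (metis DiffD2 norm_zero)
  moreover have "v x = 0" if "x \<notin> \<Omega>" for x using K that by blast
  ultimately show ?thesis using test_continuous_on[OF assms] by (simp add: C0_fields_def)
qed

lemma C0_component_borel:
  assumes "v \<in> C0_fields \<Omega>"
  shows "(\<lambda>x. v x $ i) \<in> borel_measurable (restrict_space borel \<Omega>)"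
  using assms unfolding C0_fields_def
  by (intro borel_measurable_continuous_on_restrict continuous_on_component) auto

lemma C0_linear:
  assumes "v \<in> C0_fields \<Omega>" "w \<in> C0_fields \<Omega>"
  shows "(\<lambda>x. a *\<^sub>R v x + b *\<^sub>R w x) \<in> C0_fields \<Omega>"
proof -
  have "\<exists>K. compact K \<and> K \<subseteq> \<Omega> \<and> (\<forall>x\<in>\<Omega> - K. norm (a *\<^sub>R v x + b *\<^sub>R w x) < e)" if "e > 0" for e
  proof -
    define d where "d = e / (1 + \<bar>a\<bar> + \<bar>b\<bar>)"
    have d: "d > 0" using that by (simp add: d_def add_pos_nonneg)
    obtain K where K: "compact K" "K \<subseteq> \<Omega>" "\<forall>x\<in>\<Omega> - K. norm (v x) < d" using assms(1) d unfolding C0_fields_def by blast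
    obtain L where L: "compact L" "L \<subseteq> \<Omega>" "\<forall>x\<in>\<Omega> - L. norm (w x) < d" using assms(2) d unfolding C0_fields_def by blast
    have "norm (a *\<^sub>R v x + b *\<^sub>R w x) < e" if "x \<in> \<Omega> - (K \<union> L)" for x
    proof -
      have "norm (a *\<^sub>R v x + b *\<^sub>R w x) \<le> \<bar>a\<bar> * norm (v x) + \<bar>b\<bar> * norm (w x)" by (rule order_trans[OF norm_triangle_ineq]) simp
      also have "\<dots> \<le> \<bar>a\<bar> * d + \<bar>b\<bar> * d" using K L that by (intro add_mono mult_left_mono) (auto intro: less_imp_le)
      also have "\<dots> < (1 + \<bar>a\<bar> + \<bar>b\<bar>) * d" using d by (simp add: algebra_simps)
      also have "\<dots> = e" unfolding d_def by (simp add: add_pos_nonneg less_imp_neq[symmetric])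
      finally show ?thesis .
    qed
    then show ?thesis using K L by (intro exI[of _ "K \<union> L"]) auto
  qed
  then show ?thesis using assms unfolding C0_fields_def by (auto intro!: continuous_intros)
qed

lemma deriv_pairing_linear:
  assumes "open \<Omega>" "u \<in> BV \<Omega> p" "v \<in> C0_fields \<Omega>" "w \<in> C0_fields \<Omega>"
  shows "deriv_pairing \<Omega> u (\<lambda>x. a *\<^sub>R v x + b *\<^sub>R w x) = a * deriv_pairing \<Omega> u v + b * deriv_pairing \<Omega> u w"
proof -
  obtain B where B: "\<And>x. norm (v x) \<le> B" using C0_bounded[OF assms(3)] by metis
  obtain B' where B': "\<And>x. norm (w x) \<le> B'" using C0_bounded[OF assms(4)] by metis
  have "signed_integral \<Omega> (weak_deriv \<Omega> i u) (\<lambda>x. a * v x $ i + b * w x $ i) =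
    a * signed_integral \<Omega> (weak_deriv \<Omega> i u) (\<lambda>x. v x $ i) + b * signed_integral \<Omega> (weak_deriv \<Omega> i u) (\<lambda>x. w x $ i)" for i
    by (rule signed_integral_linear[OF weak_deriv_signed[OF assms(1,2)] C0_component_borel[OF assms(3)] _ C0_component_borel[OF assms(4)],
        where B = B and B' = B']) (rule order_trans[OF component_le_norm_cart B] order_trans[OF component_le_norm_cart B'])+
  then show ?thesis by (simp add: deriv_pairing_def sum.distrib sum_distrib_left)
qed

lemma deriv_pairing_test:
  assumes "open \<Omega>" "p \<ge> 1" "u \<in> BV \<Omega> p" "v \<in> test_functions \<Omega>"
  shows "deriv_pairing \<Omega> u v = - (\<integral>x. u x * divergence v x \<partial>lebesgue_on \<Omega>)"
proof -
  note t = test_component[OF assms(4)]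
  have "(\<integral>x. u x * partial_deriv i (\<lambda>x. v x $ i) x \<partial>lebesgue_on \<Omega>) = - signed_integral \<Omega> (weak_deriv \<Omega> i u) (\<lambda>x. v x $ i)" for i
    using weak_deriv[OF assms(1,3), of i] t unfolding is_weak_deriv_def by blast
  then have "deriv_pairing \<Omega> u v = - (\<Sum>i\<in>UNIV. \<integral>x. u x * partial_deriv i (\<lambda>x. v x $ i) x \<partial>lebesgue_on \<Omega>)"
    by (simp add: deriv_pairing_def sum_negf)
  also have "(\<Sum>i\<in>UNIV. \<integral>x. u x * partial_deriv i (\<lambda>x. v x $ i) x \<partial>lebesgue_on \<Omega>) = (\<integral>x. u x * divergence v x \<partial>lebesgue_on \<Omega>)"
    unfolding divergence_def sum_distrib_left
    by (rule Bochner_Integration.integral_sum[symmetric]) (rule Lp_test_integrable[OF assms(1,2) BV_Lp[OF assms(3)] test_partial_deriv[OF t]])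
  finally show ?thesis .
qed

text \<open>The constant is the crude total mass of the Jordan parts of all the coordinate
  derivatives. It serves to show that the total variation is a supremum over a bounded set and that
  the pairing is continuous in the field; the sharp bound by the total variation is derived from it
  by density.\<close>

lemma deriv_pairing_bound:
  assumes "open \<Omega>" "u \<in> BV \<Omega> p"
  obtains C where "C \<ge> 0" "\<And>v B. v \<in> C0_fields \<Omega> \<Longrightarrow> (\<And>x. norm (v x) \<le> B) \<Longrightarrow> \<bar>deriv_pairing \<Omega> u v\<bar> \<le> C * B"
proof -
  have "\<exists>C\<ge>0. \<forall>f B. f \<in> borel_measurable (restrict_space borel \<Omega>) \<longrightarrow> (\<forall>x. \<bar>f x\<bar> \<le> B) \<longrightarrow>
    \<bar>signed_integral \<Omega> (weak_deriv \<Omega> i u) f\<bar> \<le> C * B" for i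
    by (rule signed_integral_bound[OF weak_deriv_signed[OF assms, of i]]) blast
  then obtain C where C: "\<And>i. C i \<ge> 0" "\<And>i f B. f \<in> borel_measurable (restrict_space borel \<Omega>) \<Longrightarrow> (\<forall>x. \<bar>f x\<bar> \<le> B) \<Longrightarrow>
    \<bar>signed_integral \<Omega> (weak_deriv \<Omega> i u) f\<bar> \<le> C i * B" by metis
  show ?thesis
  proof (rule that[of "\<Sum>i\<in>UNIV. C i"])
    show "(\<Sum>i\<in>UNIV. C i) \<ge> 0" by (intro sum_nonneg C)
    fix v B assume v: "v \<in> C0_fields \<Omega>" "\<And>x. norm (v x) \<le> B"
    have "\<bar>deriv_pairing \<Omega> u v\<bar> \<le> (\<Sum>i\<in>UNIV. \<bar>signed_integral \<Omega> (weak_deriv \<Omega> i u) (\<lambda>x. v x $ i)\<bar>)"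
      unfolding deriv_pairing_def by (rule sum_abs)
    also have "\<dots> \<le> (\<Sum>i\<in>UNIV. C i * B)"
      by (intro sum_mono C C0_component_borel v allI order_trans[OF component_le_norm_cart v(2)])
    finally show "\<bar>deriv_pairing \<Omega> u v\<bar> \<le> (\<Sum>i\<in>UNIV. C i) * B" by (simp add: sum_distrib_right)
  qed
qed

text \<open>A bound on the variation that makes sense without knowing that the supremum in
  \<open>total_variation\<close> is over a bounded set, and for functions in L_p that are not known
  to have measures as derivatives.\<close>

definition tv_bounded :: "(real^'n::finite) set \<Rightarrow> (real^'n \<Rightarrow> real) \<Rightarrow> real \<Rightarrow> bool"
  where "tv_bounded \<Omega> u V \<longleftrightarrow> (\<forall>v\<in>test_functions \<Omega>. (\<forall>x. norm (v x) \<le> 1) \<longrightarrow> (\<integral>x. u x * divergence v x \<partial>lebesgue_on \<Omega>) \<le> V)"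

lemma test_sup_norm_le_iff:
  fixes v :: "real^'n::finite \<Rightarrow> real^'n"
  assumes "v \<in> test_functions \<Omega>" "\<Omega> \<noteq> {}"
  shows "sup_norm \<Omega> v \<le> c \<longleftrightarrow> (\<forall>x. norm (v x) \<le> c)"
proof
  show "\<forall>x. norm (v x) \<le> c" if "sup_norm \<Omega> v \<le> c"
    using order_trans[OF sup_norm_upper(1)[OF test_C0[OF assms(1)] assms(2)] that] by blast
  show "sup_norm \<Omega> v \<le> c" if "\<forall>x. norm (v x) \<le> c"
    by (rule sup_norm_least[OF assms(2)]) (use that in blast)
qed

lemma divergence_zero: "divergence (\<lambda>x::real^'n::finite. 0) = (\<lambda>x. 0)"
  by (simp add: divergence_def fun_eq_iff)

lemma tv_boundedD:
  assumes "tv_bounded \<Omega> u V" "\<Omega> \<noteq> {}"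
  shows "total_variation \<Omega> u \<le> V" "0 \<le> V"
    "\<And>v. v \<in> test_functions \<Omega> \<Longrightarrow> (\<And>x. norm (v x) \<le> 1) \<Longrightarrow> (\<integral>x. u x * divergence v x \<partial>lebesgue_on \<Omega>) \<le> total_variation \<Omega> u"
    "total_variation \<Omega> u \<ge> 0"
proof -
  have z: "(\<lambda>x. 0) \<in> {v \<in> test_functions \<Omega>. sup_norm \<Omega> v \<le> 1}"
    using test_zero test_sup_norm_le_iff[OF test_zero assms(2)] by auto
  show "total_variation \<Omega> u \<le> V"
    unfolding total_variation_def
    by (rule cSUP_least) (use assms z test_sup_norm_le_iff[OF _ assms(2)] in \<open>auto simp: tv_bounded_def\<close>)
  have b: "bdd_above ((\<lambda>v. \<integral>x. u x * divergence v x \<partial>lebesgue_on \<Omega>) ` {v \<in> test_functions \<Omega>. sup_norm \<Omega> v \<le> 1})"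
    by (rule bdd_aboveI2[of _ _ V]) (use assms test_sup_norm_le_iff[OF _ assms(2)] in \<open>auto simp: tv_bounded_def\<close>)
  show u: "(\<integral>x. u x * divergence v x \<partial>lebesgue_on \<Omega>) \<le> total_variation \<Omega> u"
    if "v \<in> test_functions \<Omega>" "\<And>x. norm (v x) \<le> 1" for v :: "real^_ \<Rightarrow> real^_"
    unfolding total_variation_def
    by (rule cSUP_upper[OF _ b]) (use that test_sup_norm_le_iff[OF _ assms(2)] in auto)
  show t: "total_variation \<Omega> u \<ge> 0" using u[OF test_zero] by (simp add: divergence_zero)
  then show "0 \<le> V" using \<open>total_variation \<Omega> u \<le> V\<close> by linarith
qed

text \<open>The derivatives of \<open>u\<close> are finite measures, so the crude bound on the
  pairing makes the supremum that defines the total variation one over a bounded set.\<close>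

lemma BV_tv_bounded:
  assumes "open \<Omega>" "\<Omega> \<noteq> {}" "p \<ge> 1" "u \<in> BV \<Omega> p"
  shows "tv_bounded \<Omega> u (total_variation \<Omega> u)"
proof -
  obtain C where C: "\<And>v B. v \<in> C0_fields \<Omega> \<Longrightarrow> (\<And>x. norm (v x) \<le> B) \<Longrightarrow> \<bar>deriv_pairing \<Omega> u v\<bar> \<le> C * B"
    using deriv_pairing_bound[OF assms(1,4)] by metis
  have "tv_bounded \<Omega> u (C * 1)"
    unfolding tv_bounded_def
  proof (intro ballI impI)
    fix v :: "real^'a \<Rightarrow> real^'a" assume v: "v \<in> test_functions \<Omega>" "\<forall>x. norm (v x) \<le> 1"
    show "(\<integral>x. u x * divergence v x \<partial>lebesgue_on \<Omega>) \<le> C * 1"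
      using C[OF test_C0[OF v(1)], of 1] v(2) deriv_pairing_test[OF assms(1,3,4) v(1)] by (simp add: abs_le_iff)
  qed
  from tv_boundedD(3)[OF this assms(2)] show ?thesis by (simp add: tv_bounded_def)
qed

lemma divergence_cmult:
  assumes "v \<in> test_functions \<Omega>"
  shows "divergence (\<lambda>x. c *\<^sub>R v x) x = c * divergence v x"
proof -
  have "partial_deriv i (\<lambda>x. c * v x $ i) x = c * partial_deriv i (\<lambda>x. v x $ i) x" for i
    using partial_deriv_compose_linear[OF bounded_linear_mult_right[of c] test_differentiable[OF test_component[OF assms]]] by simp
  then show ?thesis by (simp add: divergence_def sum_distrib_left)
qed

lemma tv_scaled:
  assumes "open \<Omega>" "\<Omega> \<noteq> {}" "p \<ge> 1" "u \<in> Lp_space \<Omega> p" "tv_bounded \<Omega> u V" "v \<in> test_functions \<Omega>" "\<And>x. norm (v x) \<le> r"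
  shows "\<bar>\<integral>x. u x * divergence v x \<partial>lebesgue_on \<Omega>\<bar> \<le> r * V"
proof -
  have r: "r \<ge> 0" using assms(7)[of undefined] norm_ge_zero order_trans by blast
  note tv = tv_boundedD[OF assms(5,2)]
  \<comment> \<open>The two signs give the two halves of the absolute value. The case r = 0 is
    separate because such a field cannot be normalised.\<close>
  have key: "s * (\<integral>x. u x * divergence v x \<partial>lebesgue_on \<Omega>) \<le> r * V" if s: "s = 1 \<or> s = -1" for s
  proof (cases "r = 0")
    case True
    then have "v = (\<lambda>x. 0)" using assms(7) by (simp add: fun_eq_iff)
    then show ?thesis using True by (simp add: divergence_zero)
  next
    case False
    then have "r > 0" using r by simp
    have "norm ((s / r) *\<^sub>R v x) \<le> 1" for x using s \<open>r > 0\<close> assms(7)[of x] by (auto simp: field_simps)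
    from tv(3)[OF test_cmult[OF assms(6)] this] have "(s / r) * (\<integral>x. u x * divergence v x \<partial>lebesgue_on \<Omega>) \<le> V"
      using tv(1) by (simp add: divergence_cmult[OF assms(6)] mult.left_commute)
    then show ?thesis using \<open>r > 0\<close> by (simp add: field_simps)
  qed
  from key[of 1] key[of "- 1"] show ?thesis by (simp add: abs_le_iff)
qed

text \<open>The classical partial derivatives are integrable, hence densities of signed measures,
  and integration by parts identifies these as the weak derivatives.\<close>

lemma smooth_BV:
  assumes \<Omega>: "open \<Omega>" and p: "p \<ge> 1" and w: "smooth_on \<Omega> w" "w \<in> Lp_space \<Omega> p"
    and fin: "(\<integral>\<^sup>+x. ennreal (norm (gradient w x)) \<partial>lebesgue_on \<Omega>) < \<infinity>"
  shows "w \<in> BV \<Omega> p"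
proof -
  have "\<exists>\<mu>. is_weak_deriv \<Omega> i w \<mu>" for i
  proof -
    define g where "g x = indicator \<Omega> x * partial_deriv i w x" for x
    have gm: "g \<in> borel_measurable borel"
      using borel_on_open[OF \<Omega> smooth_on_imp_continuous_on[OF smooth_on_partial_deriv[OF w(1)]]] by (simp add: g_def[abs_def])
    have "(\<integral>\<^sup>+x. ennreal (norm (g x)) \<partial>lborel) \<le> (\<integral>\<^sup>+x. ennreal (norm (gradient w x)) * indicator \<Omega> x \<partial>lborel)"
    proof (rule nn_integral_mono)
      fix x
      have "\<bar>partial_deriv i w x\<bar> \<le> norm (gradient w x)" using component_le_norm_cart[of "gradient w x" i] by (simp add: gradient_def)
      then show "ennreal (norm (g x)) \<le> ennreal (norm (gradient w x)) * indicator \<Omega> x"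
        by (auto simp: g_def indicator_def intro: ennreal_leI)
    qed
    also have "\<dots> = (\<integral>\<^sup>+x. ennreal (norm (gradient w x)) \<partial>lebesgue_on \<Omega>)"
      using \<Omega> by (subst nn_integral_restrict_space) (auto simp: nn_integral_completion)
    finally have gi: "integrable lborel g" using gm fin by (intro integrableI_bounded) auto
    obtain \<mu> where \<mu>: "signed_borel_measure \<Omega> \<mu>"
      "\<And>f B. f \<in> borel_measurable borel \<Longrightarrow> (\<And>x. \<bar>f x\<bar> \<le> B) \<Longrightarrow> signed_integral \<Omega> \<mu> f = (\<integral>x. g x * f x \<partial>lborel)"
      by (rule signed_of_density[OF \<Omega> gi]) (auto simp: g_def)
    have "(\<integral>x. w x * partial_deriv i \<phi> x \<partial>lebesgue_on \<Omega>) = - signed_integral \<Omega> \<mu> \<phi>" if \<phi>: "\<phi> \<in> test_functions \<Omega>" for \<phi>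
    proof -
      obtain B where B: "\<And>x. norm (\<phi> x) \<le> B" using test_bounded[OF \<phi>] by metis
      have \<phi>0: "\<phi> x = 0" if "x \<notin> \<Omega>" for x using \<phi> that by (metis subsetD test_functionsE)
      have "signed_integral \<Omega> \<mu> \<phi> = (\<integral>x. g x * \<phi> x \<partial>lborel)"
        by (rule \<mu>(2)[OF test_borel[OF \<phi>], of B]) (use B in simp)
      also have "(\<lambda>x. g x * \<phi> x) = (\<lambda>x. partial_deriv i w x * \<phi> x)"
        using \<phi>0 by (auto simp: g_def indicator_def fun_eq_iff)
      finally have "- signed_integral \<Omega> \<mu> \<phi> = (\<integral>x. w x * partial_deriv i \<phi> x \<partial>lborel)"
        using integration_by_parts(1)[OF \<Omega> w(1) \<phi>, of i] by simp
      also have "\<dots> = (\<integral>x. w x * partial_deriv i \<phi> x \<partial>lebesgue_on \<Omega>)"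
      proof (rule lebesgue_on_lborel(1)[OF \<Omega>, symmetric])
        show "(\<lambda>x. w x * partial_deriv i \<phi> x) \<in> borel_measurable borel"
          using borel_measurable_integrable[OF integration_by_parts(2)[OF \<Omega> w(1) \<phi>, of i]] by simp
        show "w x * partial_deriv i \<phi> x = 0" if "x \<notin> \<Omega>" for x
          using test_partial_deriv[OF \<phi>, of i] that by (metis mult_zero_right subsetD test_functionsE)
      qed
      finally show ?thesis by simp
    qed
    then show ?thesis using \<mu>(1) unfolding is_weak_deriv_def by blast
  qed
  then show ?thesis using w(2) unfolding BV_def by blast
qed

text \<open>Only a bound on the pairings of \<open>u\<close> is assumed, whereas the approximants
  are genuine elements of \<open>BV\<close>: they are smooth with integrable gradient. This is how a
  statement about \<open>BV\<close> is brought to bear on functions whose derivatives are not yet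
  represented by measures.\<close>

lemma BV_approximation:
  assumes \<Omega>: "open \<Omega>" "\<Omega> \<noteq> {}" and p: "p \<ge> 1" and u: "u \<in> Lp_space \<Omega> p" and V: "tv_bounded \<Omega> u V" and e: "e > 0"
  obtains w where "w \<in> BV \<Omega> p" "smooth_on \<Omega> w" "total_variation \<Omega> w \<le> V + e"
    "(\<integral>\<^sup>+x. ennreal (norm (gradient w x)) \<partial>lebesgue_on \<Omega>) \<le> ennreal (V + e)"
    "integrable (lebesgue_on \<Omega>) (\<lambda>x. \<bar>w x - u x\<bar> powr p)" "(\<integral>x. \<bar>w x - u x\<bar> powr p \<partial>lebesgue_on \<Omega>) \<le> e"
proof -
  have "\<exists>w. smooth_on \<Omega> w \<and> w \<in> Lp_space \<Omega> p \<and>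
    integrable (lebesgue_on \<Omega>) (\<lambda>x. \<bar>w x - u x\<bar> powr p) \<and> (\<integral>x. \<bar>w x - u x\<bar> powr p \<partial>lebesgue_on \<Omega>) \<le> e \<and>
    (\<integral>\<^sup>+x. ennreal (norm (gradient w x)) \<partial>lebesgue_on \<Omega>) \<le> ennreal (V + e) \<and> tv_bounded \<Omega> w (V + e)"
    by (rule meyers_serrin[OF \<Omega>(1) p u _ e, of V]) (use V in \<open>unfold tv_bounded_def, blast\<close>)+
  then obtain w where w: "smooth_on \<Omega> w" "w \<in> Lp_space \<Omega> p"
    "integrable (lebesgue_on \<Omega>) (\<lambda>x. \<bar>w x - u x\<bar> powr p)" "(\<integral>x. \<bar>w x - u x\<bar> powr p \<partial>lebesgue_on \<Omega>) \<le> e"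
    "(\<integral>\<^sup>+x. ennreal (norm (gradient w x)) \<partial>lebesgue_on \<Omega>) \<le> ennreal (V + e)" "tv_bounded \<Omega> w (V + e)" by blast
  have "w \<in> BV \<Omega> p" by (rule smooth_BV[OF \<Omega>(1) p w(1,2)]) (use w(5) in \<open>simp add: le_less_trans\<close>)
  then show ?thesis using that w tv_boundedD(1)[OF w(6) \<Omega>(2)] by blast
qed

lemma tv_triangle:
  assumes "open \<Omega>" "\<Omega> \<noteq> {}" "p \<ge> 1" "u \<in> BV \<Omega> p" "w \<in> BV \<Omega> p"
  shows "total_variation \<Omega> (\<lambda>x. u x + w x) \<le> total_variation \<Omega> u + total_variation \<Omega> w"
proof -
  have "tv_bounded \<Omega> (\<lambda>x. u x + w x) (total_variation \<Omega> u + total_variation \<Omega> w)"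
    unfolding tv_bounded_def
  proof (intro ballI impI)
    fix v :: "real^'a \<Rightarrow> real^'a" assume v: "v \<in> test_functions \<Omega>" "\<forall>x. norm (v x) \<le> 1"
    have "(\<integral>x. u x * divergence v x \<partial>lebesgue_on \<Omega>) \<le> total_variation \<Omega> u" "(\<integral>x. w x * divergence v x \<partial>lebesgue_on \<Omega>) \<le> total_variation \<Omega> w"
      using BV_tv_bounded[OF assms(1-4)] BV_tv_bounded[OF assms(1-3,5)] v unfolding tv_bounded_def by blast+
    then show "(\<integral>x. (u x + w x) * divergence v x \<partial>lebesgue_on \<Omega>) \<le> total_variation \<Omega> u + total_variation \<Omega> w"
      using Lp_test_integrable[OF assms(1,3) BV_Lp[OF assms(4)] test_divergence[OF v(1)]]
        Lp_test_integrable[OF assms(1,3) BV_Lp[OF assms(5)] test_divergence[OF v(1)]] by (simp add: distrib_right)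
  qed
  from tv_boundedD(1)[OF this assms(2)] show ?thesis .
qed

lemma tv_cmult_le:
  assumes "open \<Omega>" "\<Omega> \<noteq> {}" "p \<ge> 1" "u \<in> BV \<Omega> p"
  shows "total_variation \<Omega> (\<lambda>x. c * u x) \<le> \<bar>c\<bar> * total_variation \<Omega> u"
proof -
  have "tv_bounded \<Omega> (\<lambda>x. c * u x) (\<bar>c\<bar> * total_variation \<Omega> u)"
    unfolding tv_bounded_def
  proof (intro ballI impI)
    fix v :: "real^'a \<Rightarrow> real^'a" assume v: "v \<in> test_functions \<Omega>" "\<forall>x. norm (v x) \<le> 1"
    have "\<bar>\<integral>x. u x * divergence v x \<partial>lebesgue_on \<Omega>\<bar> \<le> 1 * total_variation \<Omega> u"
      by (rule tv_scaled[OF assms(1-3) BV_Lp[OF assms(4)] BV_tv_bounded[OF assms] v(1)]) (use v(2) in blast)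
    then have "\<bar>c\<bar> * \<bar>\<integral>x. u x * divergence v x \<partial>lebesgue_on \<Omega>\<bar> \<le> \<bar>c\<bar> * total_variation \<Omega> u"
      by (intro mult_left_mono) auto
    moreover have "(\<integral>x. (c * u x) * divergence v x \<partial>lebesgue_on \<Omega>) = c * (\<integral>x. u x * divergence v x \<partial>lebesgue_on \<Omega>)"
      by (simp add: mult.assoc)
    ultimately show "(\<integral>x. (c * u x) * divergence v x \<partial>lebesgue_on \<Omega>) \<le> \<bar>c\<bar> * total_variation \<Omega> u"
      by (simp add: abs_mult[symmetric])
  qed
  from tv_boundedD(1)[OF this assms(2)] show ?thesis .
qed

lemma tv_nonneg:
  assumes "open \<Omega>" "\<Omega> \<noteq> {}" "p \<ge> 1" "u \<in> BV \<Omega> p"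
  shows "total_variation \<Omega> u \<ge> 0"
  using tv_boundedD(4)[OF BV_tv_bounded[OF assms] assms(2)] .

section \<open>Hoelder's inequality and the Poincare inequality in dual form\<close>

lemma conjugate_exponents:
  fixes p :: real assumes "p > 1"
  shows "p / (p - 1) > 1" "1 / p + 1 / (p / (p - 1)) = 1" "(p / (p - 1) - 1) * p = p / (p - 1)"
proof -
  have "p / (p - 1) = 1 + 1 / (p - 1)" using assms by (simp add: field_simps)
  then show "p / (p - 1) > 1" "(p / (p - 1) - 1) * p = p / (p - 1)" using assms by simp_all
  show "1 / p + 1 / (p / (p - 1)) = 1" using assms by (simp add: add_divide_distrib[symmetric])
qed

definition Lp_real_norm :: "(real^'n::finite) set \<Rightarrow> real \<Rightarrow> (real^'n \<Rightarrow> real) \<Rightarrow> real"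
  where "Lp_real_norm \<Omega> p f = (\<integral>x. \<bar>f x\<bar> powr p \<partial>lebesgue_on \<Omega>) powr (1 / p)"

lemma holder:
  assumes p: "p > 1" and u: "u \<in> Lp_space \<Omega> p" and f: "f \<in> Lp_space \<Omega> (p / (p - 1))"
  shows "integrable (lebesgue_on \<Omega>) (\<lambda>x. u x * f x)"
    and "\<bar>\<integral>x. u x * f x \<partial>lebesgue_on \<Omega>\<bar> \<le> Lp_real_norm \<Omega> p u * Lp_real_norm \<Omega> (p / (p - 1)) f"
proof -
  let ?M = "lebesgue_on \<Omega>"
  define q where "q = p / (p - 1)"
  have q: "q > 1" "1 / p + 1 / q = 1" using conjugate_exponents[OF p] by (auto simp: q_def)
  have um: "u \<in> borel_measurable ?M" and ui: "integrable ?M (\<lambda>x. \<bar>u x\<bar> powr p)" using u p Lp_space_iff[of p] by auto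
  have fm: "f \<in> borel_measurable ?M" and fi: "integrable ?M (\<lambda>x. \<bar>f x\<bar> powr q)" using f q Lp_space_iff[of q] by (auto simp: q_def)
  have young: "\<bar>s * t\<bar> \<le> \<bar>s\<bar> powr p / p + \<bar>t\<bar> powr q / q" for s t :: real
    unfolding abs_mult by (rule Youngs_inequality) (use p q in auto)
  have idom: "integrable ?M (\<lambda>x. \<bar>u x\<bar> powr p / p + \<bar>f x\<bar> powr q / q)" using ui fi by auto
  show i: "integrable ?M (\<lambda>x. u x * f x)"
    by (rule Bochner_Integration.integrable_bound[OF idom]) (use um fm young in \<open>auto intro!: AE_I2 intro: order_trans[OF _ abs_ge_self]\<close>)
  define A where "A = (\<integral>x. \<bar>u x\<bar> powr p \<partial>?M)"
  define B where "B = (\<integral>x. \<bar>f x\<bar> powr q \<partial>?M)"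
  have AB: "A \<ge> 0" "B \<ge> 0" by (simp_all add: A_def B_def)
  define a where "a = A powr (1 / p)"
  define b where "b = B powr (1 / q)"
  have "\<bar>\<integral>x. u x * f x \<partial>?M\<bar> \<le> a * b"
  proof (cases "A = 0 \<or> B = 0")
    case True
    then have "AE x in ?M. u x * f x = 0"
    proof
      assume "A = 0"
      then have "AE x in ?M. \<bar>u x\<bar> powr p = 0" using integral_nonneg_eq_0_iff_AE[OF ui] by (simp add: A_def)
      then show ?thesis by eventually_elim simp
    next
      assume "B = 0"
      then have "AE x in ?M. \<bar>f x\<bar> powr q = 0" using integral_nonneg_eq_0_iff_AE[OF fi] by (simp add: B_def)
      then show ?thesis by eventually_elim simp
    qed
    then have "(\<integral>x. u x * f x \<partial>?M) = 0" by (rule integral_eq_zero_AE)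
    then show ?thesis by (simp add: a_def b_def)
  next
    case False
    then have AB': "A > 0" "B > 0" using AB by auto
    have ab: "a > 0" "b > 0" using AB' by (auto simp: a_def b_def)
    have apq: "a powr p = A" "b powr q = B" using AB' p q by (auto simp: a_def b_def powr_powr)
    have "\<bar>\<integral>x. u x * f x \<partial>?M\<bar> \<le> (\<integral>x. \<bar>u x * f x\<bar> \<partial>?M)" by (rule integral_abs_bound)
    also have "\<dots> \<le> (\<integral>x. (a * b) * (\<bar>u x\<bar> powr p / A / p + \<bar>f x\<bar> powr q / B / q) \<partial>?M)"
    proof (rule integral_mono)
      show "integrable ?M (\<lambda>x. \<bar>u x * f x\<bar>)" using i by auto
      show "integrable ?M (\<lambda>x. (a * b) * (\<bar>u x\<bar> powr p / A / p + \<bar>f x\<bar> powr q / B / q))" using ui fi by auto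
      fix x
      have "\<bar>(u x / a) * (f x / b)\<bar> \<le> \<bar>u x / a\<bar> powr p / p + \<bar>f x / b\<bar> powr q / q" by (rule young)
      also have "\<bar>u x / a\<bar> powr p = \<bar>u x\<bar> powr p / A" using ab by (simp add: powr_divide apq)
      also have "\<bar>f x / b\<bar> powr q = \<bar>f x\<bar> powr q / B" using ab by (simp add: powr_divide apq)
      finally show "\<bar>u x * f x\<bar> \<le> (a * b) * (\<bar>u x\<bar> powr p / A / p + \<bar>f x\<bar> powr q / B / q)"
        using ab by (simp add: abs_mult pos_divide_le_eq mult.commute)
    qed
    also have "\<dots> = (a * b) * (A / A / p + B / B / q)"
      using ui fi by (simp add: A_def B_def)
    also have "\<dots> = a * b" using AB' q by simp
    finally show ?thesis .
  qed
  then show "\<bar>\<integral>x. u x * f x \<partial>?M\<bar> \<le> Lp_real_norm \<Omega> p u * Lp_real_norm \<Omega> (p / (p - 1)) f"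
    by (simp add: Lp_real_norm_def a_def b_def A_def B_def q_def)
qed

lemma Lp_const_infinite:
  assumes "p > 0" "open \<Omega>" "emeasure lebesgue \<Omega> = \<infinity>" "(\<lambda>x. y) \<in> Lp_space \<Omega> p"
  shows "y = 0"
proof (rule ccontr)
  assume "y \<noteq> 0"
  have "integrable (lebesgue_on \<Omega>) (\<lambda>x. \<bar>y\<bar> powr p)" using assms Lp_space_iff[of p "\<lambda>x. y" \<Omega>] by simp
  then have "ennreal (\<bar>y\<bar> powr p) * emeasure (lebesgue_on \<Omega>) (space (lebesgue_on \<Omega>)) < \<infinity>"
    by (simp add: integrable_iff_bounded)
  then show False using \<open>y \<noteq> 0\<close> assms(2,3) by (simp add: emeasure_restrict_space ennreal_mult_top)
qed

text \<open>The constant y supplied by the Poincare inequality disappears when paired with f: if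
  \<Omega> has finite measure, f has mean zero; if not, y lies in L_p as the difference of w and w -
  y and must be 0. The rest is Hoelder's inequality.\<close>

lemma poincare_dual_smooth:
  assumes \<Omega>: "open \<Omega>" and p: "p > 1" and w: "w \<in> Lp_space \<Omega> p" and f: "f \<in> Lp_sharp \<Omega> (p / (p - 1))"
    and y: "Lp_norm \<Omega> p (\<lambda>x. w x - y) \<le> ennreal A" and A: "A \<ge> 0"
  shows "\<bar>\<integral>x. w x * f x \<partial>lebesgue_on \<Omega>\<bar> \<le> A * Lp_real_norm \<Omega> (p / (p - 1)) f"
proof -
  let ?M = "lebesgue_on \<Omega>"
  have wm: "w \<in> borel_measurable ?M" using w by (simp add: Lp_space_def)
  have L: "(\<lambda>x. w x - y) \<in> Lp_space \<Omega> p" using y wm by (auto simp: Lp_space_def le_less_trans)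
  have fL: "f \<in> Lp_space \<Omega> (p / (p - 1))" using f by (simp add: Lp_sharp_def)
  have yL: "(\<lambda>x. y) \<in> Lp_space \<Omega> p" using Lp_diff[OF _ w L] p by simp
  have "(\<integral>x. y * f x \<partial>?M) = 0"
  proof (cases "emeasure lebesgue \<Omega> < \<infinity>")
    case True
    then show ?thesis using f by (simp add: Lp_sharp_def)
  next
    case False
    then have "emeasure lebesgue \<Omega> = \<infinity>" by (simp add: less_top[symmetric])
    then have "y = 0" using Lp_const_infinite[OF _ \<Omega> _ yL] p by simp
    then show ?thesis by simp
  qed
  then have "(\<integral>x. w x * f x \<partial>?M) = (\<integral>x. (w x - y) * f x \<partial>?M)"
    using holder(1)[OF p w fL] holder(1)[OF p yL fL] by (simp add: left_diff_distrib)
  also have "\<bar>\<dots>\<bar> \<le> Lp_real_norm \<Omega> p (\<lambda>x. w x - y) * Lp_real_norm \<Omega> (p / (p - 1)) f" by (rule holder(2)[OF p L fL])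
  also have "\<dots> \<le> A * Lp_real_norm \<Omega> (p / (p - 1)) f"
  proof (rule mult_right_mono)
    show "Lp_real_norm \<Omega> p (\<lambda>x. w x - y) \<le> A"
      using y Lp_norm_eq[OF _ L] p A by (simp add: Lp_real_norm_def ennreal_le_iff)
  qed (simp add: Lp_real_norm_def)
  finally show ?thesis .
qed

text \<open>The dual form of the Poincare inequality is what extends from smooth functions to \<open>BV\<close> by density.\<close>

lemma poincare_dual:
  assumes \<Omega>: "open \<Omega>" "\<Omega> \<noteq> {}" and p: "p > 1" and P: "poincare \<Omega> p"
  obtains c where "c > 0" "\<And>u f. u \<in> BV \<Omega> p \<Longrightarrow> f \<in> Lp_sharp \<Omega> (p / (p - 1)) \<Longrightarrow>
    \<bar>\<integral>x. u x * f x \<partial>lebesgue_on \<Omega>\<bar> \<le> c * Lp_real_norm \<Omega> (p / (p - 1)) f * total_variation \<Omega> u"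
proof -
  obtain c where c: "c > 0" "\<And>u. smooth_on \<Omega> u \<Longrightarrow> u \<in> Lp_space \<Omega> p \<Longrightarrow>
       (\<exists>y. Lp_norm \<Omega> p (\<lambda>x. u x - y) \<le> ennreal c * (\<integral>\<^sup>+x. ennreal (norm (gradient u x)) \<partial>lebesgue_on \<Omega>))"
    using P unfolding poincare_def by blast
  show ?thesis
  proof (rule that[OF c(1)])
    fix u f assume u: "u \<in> BV \<Omega> p" and f: "f \<in> Lp_sharp \<Omega> (p / (p - 1))"
    let ?M = "lebesgue_on \<Omega>"
    define N where "N = Lp_real_norm \<Omega> (p / (p - 1)) f"
    define V where "V = total_variation \<Omega> u"
    have p1: "p \<ge> 1" using p by simp
    have N: "N \<ge> 0" by (simp add: N_def Lp_real_norm_def)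
    have V: "V \<ge> 0" unfolding V_def by (rule tv_nonneg[OF \<Omega> p1 u])
    have fL: "f \<in> Lp_space \<Omega> (p / (p - 1))" using f by (simp add: Lp_sharp_def)
    have tb: "tv_bounded \<Omega> u V" unfolding V_def by (rule BV_tv_bounded[OF \<Omega> p1 u])
    \<comment> \<open>A smooth approximant is handled by the smooth inequality, its distance to
      \<open>u\<close> by Hoelder's inequality; e is sent to 0 afterwards.\<close>
    have bound: "\<bar>\<integral>x. u x * f x \<partial>?M\<bar> \<le> c * N * (V + e) + e powr (1 / p) * N" if e: "e > 0" for e
    proof -
      obtain w where w: "w \<in> BV \<Omega> p" "smooth_on \<Omega> w" "total_variation \<Omega> w \<le> V + e"
        "(\<integral>\<^sup>+x. ennreal (norm (gradient w x)) \<partial>?M) \<le> ennreal (V + e)"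
        "integrable ?M (\<lambda>x. \<bar>w x - u x\<bar> powr p)" "(\<integral>x. \<bar>w x - u x\<bar> powr p \<partial>?M) \<le> e"
        by (rule BV_approximation[OF \<Omega> p1 BV_Lp[OF u] tb e]) (rule that)
      obtain y where y: "Lp_norm \<Omega> p (\<lambda>x. w x - y) \<le> ennreal c * (\<integral>\<^sup>+x. ennreal (norm (gradient w x)) \<partial>?M)"
        using c(2)[OF w(2) BV_Lp[OF w(1)]] by blast
      also have "\<dots> \<le> ennreal c * ennreal (V + e)" by (intro mult_left_mono w) auto
      also have "\<dots> = ennreal (c * (V + e))" using c V e by (simp add: ennreal_mult)
      finally have 1: "\<bar>\<integral>x. w x * f x \<partial>?M\<bar> \<le> c * (V + e) * N"
        unfolding N_def by (rule poincare_dual_smooth[OF \<Omega>(1) p BV_Lp[OF w(1)] f]) (use c V e in simp)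
      have L: "(\<lambda>x. w x - u x) \<in> Lp_space \<Omega> p" by (rule Lp_diff[OF p1 BV_Lp[OF w(1)] BV_Lp[OF u]])
      have "\<bar>\<integral>x. (w x - u x) * f x \<partial>?M\<bar> \<le> Lp_real_norm \<Omega> p (\<lambda>x. w x - u x) * N"
        unfolding N_def by (rule holder(2)[OF p L fL])
      also have "\<dots> \<le> e powr (1 / p) * N"
        unfolding Lp_real_norm_def using w(6) p N by (intro mult_right_mono powr_mono2) auto
      finally have 2: "\<bar>\<integral>x. (w x - u x) * f x \<partial>?M\<bar> \<le> e powr (1 / p) * N" .
      have "(\<integral>x. (w x - u x) * f x \<partial>?M) = (\<integral>x. w x * f x \<partial>?M) - (\<integral>x. u x * f x \<partial>?M)"
        using holder(1)[OF p BV_Lp[OF w(1)] fL] holder(1)[OF p BV_Lp[OF u] fL] by (simp add: left_diff_distrib)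
      then show ?thesis using 1 2 by (simp add: mult_ac abs_le_iff)
    qed
    have "((\<lambda>e. c * N * (V + e) + e powr (1 / p) * N) \<longlongrightarrow> c * N * (V + 0) + 0 * N) (at_right 0)"
    proof (intro tendsto_intros)
      show "((\<lambda>e. e powr (1 / p)) \<longlongrightarrow> 0) (at_right 0)"
        by (rule tendsto_zero_powrI[of "\<lambda>e. e" _ "\<lambda>_. 1/p" "1/p"]) (use p in \<open>auto intro: tendsto_ident_at eventually_mono[OF eventually_at_right_less less_imp_le]\<close>)
    qed
    moreover have "\<forall>\<^sub>F e in at_right 0. \<bar>\<integral>x. u x * f x \<partial>?M\<bar> \<le> c * N * (V + e) + e powr (1 / p) * N"
      using eventually_at_right_less[of "0::real"] by eventually_elim (rule bound)
    ultimately have "\<bar>\<integral>x. u x * f x \<partial>?M\<bar> \<le> c * N * (V + 0) + 0 * N"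
      by (intro tendsto_lowerbound) (auto simp: trivial_limit_at_right_real)
    then show "\<bar>\<integral>x. u x * f x \<partial>?M\<bar> \<le> c * Lp_real_norm \<Omega> (p / (p - 1)) f * total_variation \<Omega> u"
      by (simp add: N_def V_def)
  qed
qed

section \<open>Functional analysis in Lebesgue spaces\<close>

text \<open>Linearity is stated relative to a set of functions closed under the pointwise
  operations, since \<open>BV\<close> is such a set and not a type.\<close>

definition linear_on_space :: "('a \<Rightarrow> real) set \<Rightarrow> (('a \<Rightarrow> real) \<Rightarrow> real) \<Rightarrow> bool"
  where "linear_on_space D F \<longleftrightarrow> (\<forall>u\<in>D. \<forall>w\<in>D. F (\<lambda>x. u x + w x) = F u + F w) \<and> (\<forall>a. \<forall>u\<in>D. F (\<lambda>x. a * u x) = a * F u)"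

definition seminorm_on_space :: "('a \<Rightarrow> real) set \<Rightarrow> (('a \<Rightarrow> real) \<Rightarrow> real) \<Rightarrow> bool"
  where "seminorm_on_space D P \<longleftrightarrow> (\<forall>u\<in>D. \<forall>w\<in>D. P (\<lambda>x. u x + w x) \<le> P u + P w) \<and> (\<forall>a. \<forall>u\<in>D. P (\<lambda>x. a * u x) \<le> \<bar>a\<bar> * P u)"

lemma linear_on_spaceD:
  assumes "linear_on_space D F" "u \<in> D"
  shows "w \<in> D \<Longrightarrow> F (\<lambda>x. u x + w x) = F u + F w" "F (\<lambda>x. a * u x) = a * F u"
  using assms by (auto simp: linear_on_space_def)

lemma seminorm_on_spaceD:
  assumes "seminorm_on_space D P" "u \<in> D"
  shows "w \<in> D \<Longrightarrow> P (\<lambda>x. u x + w x) \<le> P u + P w" "P (\<lambda>x. a * u x) \<le> \<bar>a\<bar> * P u"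
  using assms by (auto simp: seminorm_on_space_def)

text \<open>On the slice where f is 1, a number t is needed between F - P and F + P. Any two such
  bounds are compatible: the difference of two points of the slice lies in the kernel of f, and
  there the hypothesis reads |F| <= P. Homogeneity carries the result from the slice to all u with f
  u nonzero.\<close>

lemma one_dimensional_hahn_banach:
  assumes D: "\<And>u w. u \<in> D \<Longrightarrow> w \<in> D \<Longrightarrow> (\<lambda>x. u x + w x) \<in> D" "\<And>a u. u \<in> D \<Longrightarrow> (\<lambda>x. a * u x) \<in> D"
    and F: "linear_on_space D F" and f: "linear_on_space D f" and P: "seminorm_on_space D P"
    and le: "\<And>u. u \<in> D \<Longrightarrow> \<bar>F u\<bar> \<le> \<theta> * \<bar>f u\<bar> + P u"
  obtains t where "\<And>u. u \<in> D \<Longrightarrow> \<bar>F u - t * f u\<bar> \<le> P u"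
proof (cases "\<forall>u\<in>D. f u = 0")
  case True
  then show ?thesis using le that[of 0] by fastforce
next
  case False
  then obtain u1 where u1: "u1 \<in> D" "f u1 \<noteq> 0" by blast
  define u0 where "u0 x = inverse (f u1) * u1 x" for x
  have u0: "u0 \<in> D" "f u0 = 1"
    using D(2)[OF u1(1)] u1(2) unfolding u0_def linear_on_spaceD(2)[OF f u1(1)] by auto
  have key: "F u - P u \<le> F w + P w" if "u \<in> D" "w \<in> D" "f u = 1" "f w = 1" for u w
  proof -
    define z where "z x = u x + (- 1) * w x" for x
    have mw: "(\<lambda>x. (- 1) * w x) \<in> D" by (rule D(2)[OF that(2)])
    have z: "z \<in> D" unfolding z_def by (rule D(1)[OF that(1) mw])
    have "f z = f u + f (\<lambda>x. (- 1) * w x)" "F z = F u + F (\<lambda>x. (- 1) * w x)" "P z \<le> P u + P (\<lambda>x. (- 1) * w x)"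
      unfolding z_def by (rule linear_on_spaceD(1)[OF f that(1) mw] linear_on_spaceD(1)[OF F that(1) mw] seminorm_on_spaceD(1)[OF P that(1) mw])+
    moreover have "f (\<lambda>x. (- 1) * w x) = (- 1) * f w" "F (\<lambda>x. (- 1) * w x) = (- 1) * F w" "P (\<lambda>x. (- 1) * w x) \<le> \<bar>- 1\<bar> * P w"
      by (rule linear_on_spaceD(2)[OF f that(2)] linear_on_spaceD(2)[OF F that(2)] seminorm_on_spaceD(2)[OF P that(2)])+
    ultimately have "f z = 0" "F z = F u - F w" "P z \<le> P u + P w" using that by auto
    then show ?thesis using le[OF z] by simp
  qed
  define S where "S = (\<lambda>u. F u - P u) ` {u \<in> D. f u = 1}"
  define t where "t = Sup S"
  have ne: "S \<noteq> {}" using u0 by (auto simp: S_def)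
  have up: "F u - P u \<le> t" if "u \<in> D" "f u = 1" for u
    unfolding t_def by (rule cSup_upper) (use that key u0 in \<open>auto simp: S_def intro!: bdd_aboveI2[of _ _ "F u0 + P u0"]\<close>)
  have lo: "t \<le> F u + P u" if "u \<in> D" "f u = 1" for u
    unfolding t_def by (rule cSup_least[OF ne]) (use that key in \<open>auto simp: S_def\<close>)
  show ?thesis
  proof (rule that[of t])
    fix u assume u: "u \<in> D"
    show "\<bar>F u - t * f u\<bar> \<le> P u"
    proof (cases "f u = 0")
      case True
      then show ?thesis using le[OF u] by simp
    next
      case False
      define c where "c = inverse (f u)"
      have c: "c * f u = 1" "c \<noteq> 0" using False by (auto simp: c_def)
      define w where "w x = c * u x" for x
      have w: "w \<in> D" unfolding w_def by (rule D(2)[OF u])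
      have fw: "f w = 1" "F w = c * F u" "P w \<le> \<bar>c\<bar> * P u"
        unfolding w_def linear_on_spaceD(2)[OF f u] linear_on_spaceD(2)[OF F u] c(1)
        by (rule refl seminorm_on_spaceD(2)[OF P u])+
      have "\<bar>F w - t\<bar> \<le> P w" using up[OF w fw(1)] lo[OF w fw(1)] by linarith
      then have "\<bar>c * F u - t * (c * f u)\<bar> \<le> \<bar>c\<bar> * P u" using fw c by simp
      then have "\<bar>c * (F u - t * f u)\<bar> \<le> \<bar>c\<bar> * P u" by (simp add: algebra_simps)
      then have "\<bar>c\<bar> * \<bar>F u - t * f u\<bar> \<le> \<bar>c\<bar> * P u" by (simp add: abs_mult)
      then show ?thesis using c(2) by (simp add: mult_le_cancel_left_pos)
    qed
  qed
qed

text \<open>The functionals are removed one at a time. For a given one, \<theta> times the sum of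
  the absolute values of the remaining ones is absorbed into the seminorm, and the one-dimensional
  case applies to F minus the multiples found so far.\<close>

lemma finite_dimensional_hahn_banach:
  assumes D: "\<And>u w. u \<in> D \<Longrightarrow> w \<in> D \<Longrightarrow> (\<lambda>x. u x + w x) \<in> D" "\<And>a u. u \<in> D \<Longrightarrow> (\<lambda>x. a * u x) \<in> D"
    and P: "seminorm_on_space D P" and E: "finite E" and \<theta>: "\<theta> \<ge> 0"
    and \<Lambda>: "\<And>f. f \<in> E \<Longrightarrow> linear_on_space D (\<Lambda> f)"
    and F: "linear_on_space D F" and le: "\<And>u. u \<in> D \<Longrightarrow> \<bar>F u\<bar> \<le> \<theta> * (\<Sum>f\<in>E. \<bar>\<Lambda> f u\<bar>) + P u"
  shows "\<exists>t. \<forall>u\<in>D. \<bar>F u - (\<Sum>f\<in>E. t f * \<Lambda> f u)\<bar> \<le> P u"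
  using E \<Lambda> F le
proof (induction E arbitrary: F rule: finite_induct)
  case empty
  then show ?case by simp
next
  case (insert f E)
  let ?P = "\<lambda>u. \<theta> * (\<Sum>f\<in>E. \<bar>\<Lambda> f u\<bar>) + P u"
  have L: "linear_on_space D (\<Lambda> f)" "\<And>g. g \<in> E \<Longrightarrow> linear_on_space D (\<Lambda> g)" using insert.prems(1) by auto
  have "seminorm_on_space D ?P"
    unfolding seminorm_on_space_def
  proof (intro conjI ballI allI)
    fix u w assume uw: "u \<in> D" "w \<in> D"
    have "(\<Sum>f\<in>E. \<bar>\<Lambda> f (\<lambda>x. u x + w x)\<bar>) \<le> (\<Sum>f\<in>E. \<bar>\<Lambda> f u\<bar> + \<bar>\<Lambda> f w\<bar>)"
    proof (rule sum_mono)
      fix g assume "g \<in> E"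
      then have "\<Lambda> g (\<lambda>x. u x + w x) = \<Lambda> g u + \<Lambda> g w" using linear_on_spaceD(1)[OF L(2) uw] by simp
      then show "\<bar>\<Lambda> g (\<lambda>x. u x + w x)\<bar> \<le> \<bar>\<Lambda> g u\<bar> + \<bar>\<Lambda> g w\<bar>" by simp
    qed
    then have "\<theta> * (\<Sum>f\<in>E. \<bar>\<Lambda> f (\<lambda>x. u x + w x)\<bar>) \<le> \<theta> * (\<Sum>f\<in>E. \<bar>\<Lambda> f u\<bar>) + \<theta> * (\<Sum>f\<in>E. \<bar>\<Lambda> f w\<bar>)"
      using \<theta> by (simp add: sum.distrib distrib_left[symmetric] mult_left_mono)
    moreover have "P (\<lambda>x. u x + w x) \<le> P u + P w" by (rule seminorm_on_spaceD(1)[OF P uw])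
    ultimately show "?P (\<lambda>x. u x + w x) \<le> ?P u + ?P w" by linarith
  next
    fix a u assume u: "u \<in> D"
    have "(\<Sum>f\<in>E. \<bar>\<Lambda> f (\<lambda>x. a * u x)\<bar>) = (\<Sum>f\<in>E. \<bar>a\<bar> * \<bar>\<Lambda> f u\<bar>)"
    proof (rule sum.cong[OF refl])
      fix g assume "g \<in> E"
      then have "\<Lambda> g (\<lambda>x. a * u x) = a * \<Lambda> g u" using linear_on_spaceD(2)[OF L(2) u] by simp
      then show "\<bar>\<Lambda> g (\<lambda>x. a * u x)\<bar> = \<bar>a\<bar> * \<bar>\<Lambda> g u\<bar>" by (simp add: abs_mult)
    qed
    moreover have "P (\<lambda>x. a * u x) \<le> \<bar>a\<bar> * P u" by (rule seminorm_on_spaceD(2)[OF P u])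
    ultimately show "?P (\<lambda>x. a * u x) \<le> \<bar>a\<bar> * ?P u"
      by (simp add: sum_distrib_left[symmetric] distrib_left mult.left_commute)
  qed
  moreover have "\<bar>F u\<bar> \<le> \<theta> * \<bar>\<Lambda> f u\<bar> + ?P u" if "u \<in> D" for u
    using insert.prems(3)[OF that] insert.hyps by (simp add: algebra_simps)
  ultimately obtain t0 where t0: "\<And>u. u \<in> D \<Longrightarrow> \<bar>F u - t0 * \<Lambda> f u\<bar> \<le> ?P u"
    using one_dimensional_hahn_banach[OF D insert.prems(2) L(1)] by blast
  have "linear_on_space D (\<lambda>u. F u - t0 * \<Lambda> f u)"
    using insert.prems(2) L(1) unfolding linear_on_space_def by (simp add: algebra_simps)
  from insert.IH[OF L(2) this t0] obtain t where
    t: "\<And>u. u \<in> D \<Longrightarrow> \<bar>F u - t0 * \<Lambda> f u - (\<Sum>g\<in>E. t g * \<Lambda> g u)\<bar> \<le> P u" by blast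
  have "(\<Sum>g\<in>E. (t(f := t0)) g * \<Lambda> g u) = (\<Sum>g\<in>E. t g * \<Lambda> g u)" for u
    using insert.hyps by (intro sum.cong) auto
  then have "\<bar>F u - (\<Sum>g\<in>insert f E. (t(f := t0)) g * \<Lambda> g u)\<bar> \<le> P u" if "u \<in> D" for u
    using t[OF that] insert.hyps by (simp add: algebra_simps)
  then show ?case by blast
qed

section \<open>Convexity inequalities for powers, and completeness of L_q\<close>

lemma powr_superadditive:
  fixes s t r :: real
  assumes "s \<ge> 0" "t \<ge> 0" "r \<ge> 1"
  shows "s powr r + t powr r \<le> (s + t) powr r"
proof -
  have e: "y powr r = y * y powr (r - 1)" if "y \<ge> 0" for y :: real
    using that by (cases "y = 0") (auto simp: powr_mult_base)
  have "s * s powr (r - 1) \<le> s * (s + t) powr (r - 1)" "t * t powr (r - 1) \<le> t * (s + t) powr (r - 1)"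
    using assms by (auto intro!: mult_left_mono powr_mono2)
  then show ?thesis using e[of s] e[of t] e[of "s + t"] assms by (simp add: distrib_right)
qed

lemma powr_midpoint:
  fixes a b r :: real
  assumes "r \<ge> 1"
  shows "\<bar>(a + b) / 2\<bar> powr r \<le> (\<bar>a\<bar> powr r + \<bar>b\<bar> powr r) / 2"
proof -
  define m where "m = (a + b) / 2"
  define c where "c = r * (sgn m * \<bar>m\<bar> powr (r - 1))"
  have "\<bar>m\<bar> powr r + c * (a - m) \<le> \<bar>a\<bar> powr r" "\<bar>m\<bar> powr r + c * (b - m) \<le> \<bar>b\<bar> powr r"
    unfolding c_def by (rule powr_tangent[OF assms])+
  moreover have "c * (a - m) + c * (b - m) = 0" by (simp add: m_def distrib_left[symmetric])
  ultimately have "2 * \<bar>m\<bar> powr r \<le> \<bar>a\<bar> powr r + \<bar>b\<bar> powr r" by linarith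
  then show ?thesis by (simp add: m_def)
qed

text \<open>With squares as variables, the parallelogram identity sits between superadditivity and
  convexity of t \<mapsto> t^(q / 2). Both require q / 2 to be at least 1, which is where q \<ge> 2
  enters.\<close>

lemma clarkson:
  fixes a b q :: real
  assumes "q \<ge> 2"
  shows "\<bar>(a + b) / 2\<bar> powr q + \<bar>(a - b) / 2\<bar> powr q \<le> (\<bar>a\<bar> powr q + \<bar>b\<bar> powr q) / 2"
proof -
  have sq: "\<bar>x\<bar> powr q = (x\<^sup>2) powr (q / 2)" for x :: real
  proof (cases "x = 0")
    case False
    then have "x\<^sup>2 = \<bar>x\<bar> powr 2" by simp
    then show ?thesis by (simp only: powr_powr) simp
  qed simp
  have "((a + b) / 2)\<^sup>2 powr (q / 2) + ((a - b) / 2)\<^sup>2 powr (q / 2) \<le> (((a + b) / 2)\<^sup>2 + ((a - b) / 2)\<^sup>2) powr (q / 2)"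
    by (rule powr_superadditive) (use assms in auto)
  also have "((a + b) / 2)\<^sup>2 + ((a - b) / 2)\<^sup>2 = (a\<^sup>2 + b\<^sup>2) / 2"
    by (simp add: power2_eq_square field_simps)
  also have "((a\<^sup>2 + b\<^sup>2) / 2) powr (q / 2) \<le> ((a\<^sup>2) powr (q / 2) + (b\<^sup>2) powr (q / 2)) / 2"
    using powr_midpoint[of "q / 2" "a\<^sup>2" "b\<^sup>2"] assms by simp
  finally show ?thesis by (simp only: sq)
qed

text \<open>Only differences of the sequence need to have integrable q-th powers. A rapidly Cauchy
  subsequence converges almost everywhere, and Fatou's lemma turns the Cauchy estimates into
  convergence in the mean to the pointwise limit.\<close>

lemma riesz_fischer:
  fixes h :: "nat \<Rightarrow> 'a \<Rightarrow> real"
  assumes q: "q \<ge> 1" and hm: "\<And>n. h n \<in> borel_measurable M"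
    and int: "\<And>n m. integrable M (\<lambda>x. \<bar>h n x - h m x\<bar> powr q)"
    and cauchy: "\<And>e. e > 0 \<Longrightarrow> \<exists>N. \<forall>n\<ge>N. \<forall>m\<ge>N. (\<integral>x. \<bar>h n x - h m x\<bar> powr q \<partial>M) \<le> e"
  obtains l r where "l \<in> borel_measurable M" "strict_mono r" "AE x in M. (\<lambda>k. h (r k) x) \<longlonglongrightarrow> l x"
    "\<And>n. integrable M (\<lambda>x. \<bar>h n x - l x\<bar> powr q)" "(\<lambda>n. \<integral>x. \<bar>h n x - l x\<bar> powr q \<partial>M) \<longlonglongrightarrow> 0"
proof -
  note [measurable] = hm
  \<comment> \<open>If the integral of \<open>d k\<close> is at most (2 \<rho>)^(-k), the series of
    \<rho>^k \<open>d k\<close> is integrable. Where its sum C is finite, q-th roots give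
    differences of at most C^(1/q) 2^(-k), which are summable.\<close>
  define \<rho> where "\<rho> = 2 powr q"
  have \<rho>: "\<rho> > 0" by (simp add: \<rho>_def)
  have "\<exists>N. \<forall>n\<ge>N. \<forall>m\<ge>N. (\<integral>x. \<bar>h n x - h m x\<bar> powr q \<partial>M) \<le> (1 / (2 * \<rho>)) ^ k" for k :: nat
    by (rule cauchy) (use \<rho> in simp)
  then obtain N where N: "\<And>k n m. n \<ge> N k \<Longrightarrow> m \<ge> N k \<Longrightarrow> (\<integral>x. \<bar>h n x - h m x\<bar> powr q \<partial>M) \<le> (1 / (2 * \<rho>)) ^ k" by metis
  define r where "r = rec_nat (N 0) (\<lambda>k rk. max (Suc rk) (N (Suc k)))"
  have r0: "r 0 = N 0" and rS: "r (Suc k) = max (Suc (r k)) (N (Suc k))" for k by (auto simp: r_def)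
  have sm: "strict_mono r" by (rule strict_monoI_Suc) (simp add: rS)
  have rN: "r k \<ge> N k" for k by (cases k) (auto simp: r0 rS)
  define d where "d k x = \<bar>h (r (Suc k)) x - h (r k) x\<bar> powr q" for k x
  have dle: "(\<integral>x. d k x \<partial>M) \<le> (1 / (2 * \<rho>)) ^ k" for k
    unfolding d_def by (rule N) (use rN[of k] rS[of k] in auto)
  have dm[measurable]: "d k \<in> borel_measurable M" for k unfolding d_def by measurable
  have "(\<integral>\<^sup>+x. (\<Sum>k. ennreal (\<rho> ^ k * d k x)) \<partial>M) = (\<Sum>k. \<integral>\<^sup>+x. ennreal (\<rho> ^ k * d k x) \<partial>M)"
    by (rule nn_integral_suminf) measurable
  also have "\<dots> \<le> (\<Sum>k. ennreal ((1/2) ^ k))"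
  proof (rule suminf_le)
    fix k
    have "(\<integral>\<^sup>+x. ennreal (\<rho> ^ k * d k x) \<partial>M) = ennreal (\<integral>x. \<rho> ^ k * d k x \<partial>M)"
      by (rule nn_integral_eq_integral) (use int \<rho> in \<open>auto simp: d_def\<close>)
    also have "\<dots> \<le> ennreal (\<rho> ^ k * (1 / (2 * \<rho>)) ^ k)"
      using dle[of k] \<rho> by (intro ennreal_leI) (simp add: mult_left_mono)
    also have "\<rho> ^ k * (1 / (2 * \<rho>)) ^ k = (1/2) ^ k" using \<rho> by (simp add: power_mult_distrib[symmetric])
    finally show "(\<integral>\<^sup>+x. ennreal (\<rho> ^ k * d k x) \<partial>M) \<le> ennreal ((1/2) ^ k)" .
  qed auto
  also have "\<dots> = ennreal 2"
    using geometric_sums[of "1/2::real"] by (intro suminf_ennreal_eq) auto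
  also have "\<dots> < \<infinity>" by simp
  finally have "AE x in M. (\<Sum>k. ennreal (\<rho> ^ k * d k x)) \<noteq> \<infinity>"
    by (intro nn_integral_PInf_AE) auto
  then have conv: "AE x in M. convergent (\<lambda>k. h (r k) x)"
  proof eventually_elim
    case (elim x)
    then obtain C where C: "(\<Sum>k. ennreal (\<rho> ^ k * d k x)) = ennreal C" "C \<ge> 0"
      by (cases "\<Sum>k. ennreal (\<rho> ^ k * d k x)" rule: ennreal_cases) auto
    have b: "\<bar>h (r (Suc k)) x - h (r k) x\<bar> \<le> C powr (1 / q) * (1/2) ^ k" for k
    proof -
      have "ennreal (\<rho> ^ k * d k x) \<le> ennreal C"
        using sum_le_suminf[of "\<lambda>k. ennreal (\<rho> ^ k * d k x)" "{k}"] C by simp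
      then have "\<rho> ^ k * d k x \<le> C" using C by (simp add: ennreal_le_iff)
      then have "(\<rho> ^ k * d k x) powr (1 / q) \<le> C powr (1 / q)" using q \<rho> by (intro powr_mono2) (auto simp: d_def)
      moreover have "(\<rho> ^ k * d k x) powr (1 / q) = 2 ^ k * \<bar>h (r (Suc k)) x - h (r k) x\<bar>"
      proof -
        have "\<rho> ^ k = (2 ^ k) powr q" by (simp add: \<rho>_def powr_realpow[symmetric] powr_powr mult.commute)
        then show ?thesis using q by (simp add: powr_mult d_def powr_powr)
      qed
      ultimately show ?thesis by (simp add: field_simps power_divide)
    qed
    have "summable (\<lambda>k. h (r (Suc k)) x - h (r k) x)"
      by (rule summable_comparison_test'[of "\<lambda>k. C powr (1 / q) * (1/2) ^ k" 0])
        (use b in \<open>auto intro!: summable_mult summable_geometric\<close>)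
    then have "convergent (\<lambda>n. \<Sum>k<n. h (r (Suc k)) x - h (r k) x)" by (simp add: summable_iff_convergent)
    then have "convergent (\<lambda>n. h (r n) x - h (r 0) x)" by (simp only: sum_lessThan_telescope[of "\<lambda>k. h (r k) x"])
    then show ?case by (simp add: convergent_diff_const_right_iff)
  qed
  define l where "l x = lim (\<lambda>k. h (r k) x)" for x
  have lm[measurable]: "l \<in> borel_measurable M" unfolding l_def by measurable
  have lim: "AE x in M. (\<lambda>k. h (r k) x) \<longlonglongrightarrow> l x"
    using conv by eventually_elim (simp add: l_def convergent_LIMSEQ_iff)
  \<comment> \<open>An estimate against all late members of the sequence passes to the limit
    function along the subsequence.\<close>
  have fatou: "(\<integral>\<^sup>+x. ennreal (\<bar>h n x - l x\<bar> powr q) \<partial>M) \<le> ennreal e"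
    if e: "\<And>m. m \<ge> K \<Longrightarrow> (\<integral>x. \<bar>h n x - h m x\<bar> powr q \<partial>M) \<le> e" for n e K
  proof -
    have "(\<integral>\<^sup>+x. ennreal (\<bar>h n x - l x\<bar> powr q) \<partial>M) = (\<integral>\<^sup>+x. liminf (\<lambda>k. ennreal (\<bar>h n x - h (r k) x\<bar> powr q)) \<partial>M)"
    proof (rule nn_integral_cong_AE)
      show "AE x in M. ennreal (\<bar>h n x - l x\<bar> powr q) = liminf (\<lambda>k. ennreal (\<bar>h n x - h (r k) x\<bar> powr q))"
        using lim
      proof eventually_elim
        case (elim x)
        have "(\<lambda>k. ennreal (\<bar>h n x - h (r k) x\<bar> powr q)) \<longlonglongrightarrow> ennreal (\<bar>h n x - l x\<bar> powr q)"
          using q by (intro tendsto_ennrealI tendsto_powr' tendsto_rabs tendsto_diff tendsto_const elim) auto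
        then show ?case by (intro lim_imp_Liminf[symmetric]) auto
      qed
    qed
    also have "\<dots> \<le> liminf (\<lambda>k. \<integral>\<^sup>+x. ennreal (\<bar>h n x - h (r k) x\<bar> powr q) \<partial>M)"
      by (rule nn_integral_liminf) measurable
    also have "\<dots> \<le> ennreal e"
    proof (rule Liminf_le)
      have "(\<integral>\<^sup>+x. ennreal (\<bar>h n x - h (r k) x\<bar> powr q) \<partial>M) \<le> ennreal e" if "k \<ge> K" for k
      proof -
        have "r k \<ge> K" using seq_suble[OF sm, of k] that by linarith
        then show ?thesis using nn_integral_eq_integral[OF int[of n "r k"]] e[of "r k"] by (simp add: ennreal_leI)
      qed
      then show "\<forall>\<^sub>F k in sequentially. (\<integral>\<^sup>+x. ennreal (\<bar>h n x - h (r k) x\<bar> powr q) \<partial>M) \<le> ennreal e"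
        by (auto simp: eventually_sequentially)
    qed simp
    finally show ?thesis .
  qed
  obtain N1 where N1: "\<And>n m. n \<ge> N1 \<Longrightarrow> m \<ge> N1 \<Longrightarrow> (\<integral>x. \<bar>h n x - h m x\<bar> powr q \<partial>M) \<le> 1" using cauchy[of 1] by auto
  have q0: "q \<ge> 0" using q by simp
  have iN: "integrable M (\<lambda>x. \<bar>h N1 x - l x\<bar> powr q)"
    by (rule integrableI_bounded) (use fatou[of N1 N1 1] N1 in \<open>auto simp: le_less_trans\<close>)
  have i: "integrable M (\<lambda>x. \<bar>h n x - l x\<bar> powr q)" for n
  proof -
    have "integrable M (\<lambda>x. \<bar>(h n x - h N1 x) + (h N1 x - l x)\<bar> powr q)"
      by (rule powr_integrable_add[OF q0 _ _ int iN]) measurable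
    then show ?thesis by simp
  qed
  have "(\<lambda>n. \<integral>x. \<bar>h n x - l x\<bar> powr q \<partial>M) \<longlonglongrightarrow> 0"
  proof (rule LIMSEQ_I)
    fix e :: real assume e: "e > 0"
    obtain K where K: "\<And>n m. n \<ge> K \<Longrightarrow> m \<ge> K \<Longrightarrow> (\<integral>x. \<bar>h n x - h m x\<bar> powr q \<partial>M) \<le> e / 2" using cauchy[of "e / 2"] e by auto
    have "norm ((\<integral>x. \<bar>h n x - l x\<bar> powr q \<partial>M) - 0) < e" if "n \<ge> K" for n
    proof -
      have "ennreal (\<integral>x. \<bar>h n x - l x\<bar> powr q \<partial>M) \<le> ennreal (e / 2)"
        using fatou[of K n "e / 2"] K that nn_integral_eq_integral[OF i[of n]] by simp
      then show ?thesis using e by (simp add: ennreal_le_iff)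
    qed
    then show "\<exists>K. \<forall>n\<ge>K. norm ((\<integral>x. \<bar>h n x - l x\<bar> powr q \<partial>M) - 0) < e" by blast
  qed
  then show ?thesis using that lm sm lim i by blast
qed

section \<open>Density of divergences in the dual\<close>

text \<open>The derivative of |t|^q / q, that is, the duality map of L_q evaluated
  pointwise.\<close>

definition power_sgn :: "real \<Rightarrow> real \<Rightarrow> real"
  where "power_sgn q t = sgn t * \<bar>t\<bar> powr (q - 1)"

lemma power_sgn_abs: "\<bar>power_sgn q t\<bar> = \<bar>t\<bar> powr (q - 1)"
  by (cases "t = 0") (auto simp: power_sgn_def abs_mult abs_sgn_eq)

lemma power_sgn_mult_self: "power_sgn q t * t = \<bar>t\<bar> powr q"
proof (cases "t = 0")
  case False
  have "power_sgn q t * t = \<bar>t\<bar> powr (q - 1) * \<bar>t\<bar>" by (simp add: power_sgn_def abs_sgn mult_ac)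
  then show ?thesis using False by (simp add: powr_mult_base mult.commute)
qed (simp add: power_sgn_def)

lemma power_sgn_tendsto:
  assumes "q > 1" "(f \<longlongrightarrow> t) F"
  shows "((\<lambda>x. power_sgn q (f x)) \<longlongrightarrow> power_sgn q t) F"
proof (cases "t = 0")
  case True
  have "((\<lambda>x. \<bar>f x\<bar>) \<longlongrightarrow> 0) F" using tendsto_rabs[OF assms(2)] True by simp
  from tendsto_zero_powrI[OF this tendsto_const[of "q - 1"]]
  have "((\<lambda>x. \<bar>power_sgn q (f x)\<bar>) \<longlongrightarrow> 0) F" using assms(1) by (simp add: power_sgn_abs)
  then show ?thesis using True by (simp add: power_sgn_def tendsto_rabs_zero_iff)
next
  case False
  then show ?thesis unfolding power_sgn_def
    by (intro tendsto_mult tendsto_sgn tendsto_powr tendsto_rabs tendsto_const assms(2)) auto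
qed

lemma power_sgn_borel [measurable]:
  assumes [measurable]: "f \<in> borel_measurable M"
  shows "(\<lambda>x. power_sgn q (f x)) \<in> borel_measurable M"
proof -
  have "(\<lambda>x. \<bar>f x\<bar> powr (q - 1)) \<in> borel_measurable M" by (rule measurable_abs_powr[OF assms])
  moreover have "(\<lambda>x. sgn (f x)) \<in> borel_measurable M" by measurable
  ultimately show ?thesis unfolding power_sgn_def by (intro borel_measurable_times)
qed

text \<open>Since (q - 1) p = q, the p-th power of the modulus of the duality map is |f|^q; so it
  maps L_q into L_p.\<close>

lemma power_sgn_Lp:
  assumes p: "p > 1" and f: "f \<in> Lp_space \<Omega> (p / (p - 1))"
  shows "(\<lambda>x. power_sgn (p / (p - 1)) (f x)) \<in> Lp_space \<Omega> p"
    and "Lp_real_norm \<Omega> p (\<lambda>x. power_sgn (p / (p - 1)) (f x)) = (\<integral>x. \<bar>f x\<bar> powr (p / (p - 1)) \<partial>lebesgue_on \<Omega>) powr (1 / p)"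
proof -
  have e: "\<bar>power_sgn (p / (p - 1)) t\<bar> powr p = \<bar>t\<bar> powr (p / (p - 1))" for t
    by (simp only: power_sgn_abs powr_powr conjugate_exponents(3)[OF p])
  have q: "p / (p - 1) > 0" using conjugate_exponents(1)[OF p] by linarith
  have fm: "f \<in> borel_measurable (lebesgue_on \<Omega>)" and fi: "integrable (lebesgue_on \<Omega>) (\<lambda>x. \<bar>f x\<bar> powr (p / (p - 1)))"
    using f Lp_space_iff[OF q, of f \<Omega>] by auto
  show "(\<lambda>x. power_sgn (p / (p - 1)) (f x)) \<in> Lp_space \<Omega> p"
    using Lp_space_iff[of p "\<lambda>x. power_sgn (p / (p - 1)) (f x)" \<Omega>] p fi power_sgn_borel[OF fm] by (simp only: e)
  show "Lp_real_norm \<Omega> p (\<lambda>x. power_sgn (p / (p - 1)) (f x)) = (\<integral>x. \<bar>f x\<bar> powr (p / (p - 1)) \<partial>lebesgue_on \<Omega>) powr (1 / p)"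
    by (simp only: Lp_real_norm_def e)
qed

text \<open>The pointwise tangent inequality, integrated. The first form is the subgradient
  inequality for the q-th power of the norm at b; the second follows by Hoelder and bounds how much
  the q-th power can drop over a short distance.\<close>

lemma Lq_tangent:
  assumes p: "p > 1" and a: "a \<in> Lp_space \<Omega> (p / (p - 1))" and b: "b \<in> Lp_space \<Omega> (p / (p - 1))"
  defines "q \<equiv> p / (p - 1)" and "N \<equiv> \<lambda>f. \<integral>x. \<bar>f x\<bar> powr (p / (p - 1)) \<partial>lebesgue_on \<Omega>"
  shows "N b + q * (\<integral>x. power_sgn q (b x) * (a x - b x) \<partial>lebesgue_on \<Omega>) \<le> N a"
    and "N b - q * (N b powr (1 / p) * N (\<lambda>x. a x - b x) powr (1 / q)) \<le> N a"
proof -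
  let ?M = "lebesgue_on \<Omega>"
  have q: "q > 1" using conjugate_exponents(1)[OF p] by (simp add: q_def)
  have i: "integrable ?M (\<lambda>x. \<bar>a x\<bar> powr q)" "integrable ?M (\<lambda>x. \<bar>b x\<bar> powr q)"
    using a b Lp_space_iff[of q] q by (auto simp: q_def)
  have d: "(\<lambda>x. a x - b x) \<in> Lp_space \<Omega> q" unfolding q_def by (rule Lp_diff[OF _ a b]) (use q in \<open>simp add: q_def\<close>)
  note s = power_sgn_Lp[OF p b, folded q_def]
  note h = holder[OF p s(1) d[unfolded q_def], folded q_def]
  have "(\<integral>x. \<bar>b x\<bar> powr q + q * (power_sgn q (b x) * (a x - b x)) \<partial>?M) \<le> (\<integral>x. \<bar>a x\<bar> powr q \<partial>?M)"
  proof (rule integral_mono)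
    show "integrable ?M (\<lambda>x. \<bar>b x\<bar> powr q + q * (power_sgn q (b x) * (a x - b x)))" using i h(1) by simp
    show "\<bar>b x\<bar> powr q + q * (power_sgn q (b x) * (a x - b x)) \<le> \<bar>a x\<bar> powr q" for x
      using powr_tangent[of q "b x" "a x"] q by (simp add: power_sgn_def mult.assoc)
  qed (rule i)
  then show 1: "N b + q * (\<integral>x. power_sgn q (b x) * (a x - b x) \<partial>?M) \<le> N a"
    using i h(1) by (simp add: N_def q_def)
  have "\<bar>\<integral>x. power_sgn q (b x) * (a x - b x) \<partial>?M\<bar> \<le> N b powr (1 / p) * N (\<lambda>x. a x - b x) powr (1 / q)"
    using h(2) unfolding s(2) by (simp add: Lp_real_norm_def N_def q_def)
  then have "- (N b powr (1 / p) * N (\<lambda>x. a x - b x) powr (1 / q)) \<le> (\<integral>x. power_sgn q (b x) * (a x - b x) \<partial>?M)" by (simp add: abs_le_iff)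
  then have "q * - (N b powr (1 / p) * N (\<lambda>x. a x - b x) powr (1 / q)) \<le> q * (\<integral>x. power_sgn q (b x) * (a x - b x) \<partial>?M)"
    using q by (intro mult_left_mono) auto
  then show "N b - q * (N b powr (1 / p) * N (\<lambda>x. a x - b x) powr (1 / q)) \<le> N a" using 1 by simp
qed

text \<open>The second tangent inequality with base point b gives the lower bound, with base point
  a_n the upper one. The latter has a factor depending on a_n, which the uniform bound
  \<open>B\<close> controls; thus Minkowski's inequality is avoided.\<close>

lemma Lq_norm_tendsto:
  assumes p: "p > 1" and a: "\<And>n. a n \<in> Lp_space \<Omega> (p / (p - 1))" and b: "b \<in> Lp_space \<Omega> (p / (p - 1))"
    and lim: "(\<lambda>n. \<integral>x. \<bar>a n x - b x\<bar> powr (p / (p - 1)) \<partial>lebesgue_on \<Omega>) \<longlonglongrightarrow> 0"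
  shows "(\<lambda>n. \<integral>x. \<bar>a n x\<bar> powr (p / (p - 1)) \<partial>lebesgue_on \<Omega>) \<longlonglongrightarrow> (\<integral>x. \<bar>b x\<bar> powr (p / (p - 1)) \<partial>lebesgue_on \<Omega>)"
proof -
  let ?M = "lebesgue_on \<Omega>"
  define q where "q = p / (p - 1)"
  define N where "N f = (\<integral>x. \<bar>f x\<bar> powr q \<partial>?M)" for f
  have q: "q > 1" using conjugate_exponents(1)[OF p] by (simp add: q_def)
  have aL: "a n \<in> Lp_space \<Omega> q" for n using a by (simp add: q_def)
  have bL: "b \<in> Lp_space \<Omega> q" using b by (simp add: q_def)
  have N0: "N f \<ge> 0" for f by (simp add: N_def)
  define e where "e n = N (\<lambda>x. a n x - b x)" for n
  have e0: "e \<longlonglongrightarrow> 0" using lim by (simp add: e_def[abs_def] N_def q_def)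
  have esym: "N (\<lambda>x. b x - a n x) = e n" for n by (simp add: e_def N_def abs_minus_commute)
  have er: "(\<lambda>n. e n powr (1 / q)) \<longlonglongrightarrow> 0"
    by (rule tendsto_zero_powrI[OF e0 tendsto_const]) (use q N0 in \<open>auto simp: e_def\<close>)
  have lo: "N b - q * (N b powr (1 / p) * e n powr (1 / q)) \<le> N (a n)" for n
    using Lq_tangent(2)[OF p a b] by (simp add: N_def e_def q_def)
  define B where "B = 2 powr q * (N b + 1)"
  have up: "N (a n) \<le> N b + q * (B powr (1 / p) * e n powr (1 / q))" if "e n < 1" for n
  proof -
    have "N (a n) = (\<integral>x. \<bar>(a n x - b x) + b x\<bar> powr q \<partial>?M)" by (simp add: N_def)
    also have "\<dots> \<le> 2 powr q * ((\<integral>x. \<bar>a n x - b x\<bar> powr q \<partial>?M) + (\<integral>x. \<bar>b x\<bar> powr q \<partial>?M))"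
      using Lp_diff[OF _ aL[of n] bL] bL q Lp_space_iff[of q] by (intro powr_integral_add_le) auto
    also have "\<dots> \<le> B" using that unfolding B_def by (intro mult_left_mono) (auto simp: e_def N_def)
    finally have "N (a n) powr (1 / p) \<le> B powr (1 / p)" using N0 p by (intro powr_mono2) auto
    then have "q * (N (a n) powr (1 / p) * e n powr (1 / q)) \<le> q * (B powr (1 / p) * e n powr (1 / q))"
      using q by (intro mult_left_mono mult_right_mono) auto
    moreover have "N (a n) - q * (N (a n) powr (1 / p) * e n powr (1 / q)) \<le> N b"
      using Lq_tangent(2)[OF p b a[of n]] esym[of n] by (simp add: N_def q_def)
    ultimately show ?thesis by linarith
  qed
  have "(\<lambda>n. N (a n)) \<longlonglongrightarrow> N b"
  proof (rule tendsto_sandwich)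
    show "(\<lambda>n. N b - q * (N b powr (1 / p) * e n powr (1 / q))) \<longlonglongrightarrow> N b"
      using tendsto_diff[OF tendsto_const tendsto_mult[OF tendsto_const tendsto_mult[OF tendsto_const er]], of "N b" q] by simp
    show "(\<lambda>n. N b + q * (B powr (1 / p) * e n powr (1 / q))) \<longlonglongrightarrow> N b"
      using tendsto_add[OF tendsto_const tendsto_mult[OF tendsto_const tendsto_mult[OF tendsto_const er]], of "N b" q] by simp
    show "\<forall>\<^sub>F n in sequentially. N b - q * (N b powr (1 / p) * e n powr (1 / q)) \<le> N (a n)" using lo by simp
    have "\<forall>\<^sub>F n in sequentially. e n < 1" using order_tendstoD(2)[OF e0] by simp
    then show "\<forall>\<^sub>F n in sequentially. N (a n) \<le> N b + q * (B powr (1 / p) * e n powr (1 / q))"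
      by eventually_elim (rule up)
  qed
  then show ?thesis by (simp add: N_def q_def)
qed

lemma test_Lp:
  fixes \<phi> :: "real^'n::finite \<Rightarrow> real"
  assumes "open \<Omega>" "p > 0" "\<phi> \<in> test_functions \<Omega>"
  shows "\<phi> \<in> Lp_space \<Omega> p"
proof -
  obtain K where K: "compact K" "K \<subseteq> \<Omega>" "\<And>x. x \<notin> K \<Longrightarrow> \<phi> x = 0" using test_functionsE[OF assms(3)] by metis
  have "integrable lborel (\<lambda>x. \<bar>\<phi> x\<bar> powr p)"
    by (rule compact_support_continuous_powr_integrable[OF assms(2) test_continuous_on[OF assms(3)] K(1,3)])
  moreover have "\<phi> x = 0" if "x \<notin> \<Omega>" for x using K that by blast
  ultimately have "integrable (lebesgue_on \<Omega>) (\<lambda>x. \<bar>\<phi> x\<bar> powr p)"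
    using test_borel[OF assms(3)] assms(2) by (subst lebesgue_on_lborel(2)[OF assms(1)]) auto
  then show ?thesis using Lp_space_iff[OF assms(2)] lebesgue_on_borel[OF assms(1) test_borel[OF assms(3)]] by blast
qed

lemma divergence_linear:
  fixes v w :: "real^'n::finite \<Rightarrow> real^'n"
  assumes "v \<in> test_functions \<Omega>" "w \<in> test_functions \<Omega>"
  shows "divergence (\<lambda>x. a *\<^sub>R v x + b *\<^sub>R w x) x = a * divergence v x + b * divergence w x"
proof -
  note t = test_cmult[OF assms(1), of a] test_cmult[OF assms(2), of b]
  have "divergence (\<lambda>x. a *\<^sub>R v x + b *\<^sub>R w x) x = divergence (\<lambda>x. a *\<^sub>R v x) x + divergence (\<lambda>x. b *\<^sub>R w x) x"
  proof -
    have "partial_deriv i (\<lambda>x. (a *\<^sub>R v x) $ i + (b *\<^sub>R w x) $ i) x = partial_deriv i (\<lambda>x. (a *\<^sub>R v x) $ i) x + partial_deriv i (\<lambda>x. (b *\<^sub>R w x) $ i) x" for i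
      by (rule partial_deriv_add) (rule test_differentiable[OF test_component] t)+
    then show ?thesis by (simp add: divergence_def sum.distrib)
  qed
  then show ?thesis by (simp add: divergence_cmult[OF assms(1)] divergence_cmult[OF assms(2)])
qed

text \<open>
  The nearest point \<open>l\<close> of \<open>g\<close> in the closure of the divergences of the unit ball exists by uniform
  convexity, and \<open>sgn l |l|^(q - 1)\<close> is a separating functional of bounded variation.
\<close>

lemma dual_density_unit:
  fixes \<Omega> :: "(real^'n::finite) set"
  assumes \<Omega>: "open \<Omega>" "\<Omega> \<noteq> {}" and p: "p > 1" and q2: "p / (p - 1) \<ge> 2"
    and g: "g \<in> Lp_space \<Omega> (p / (p - 1))"
    and gV: "\<And>u. u \<in> BV \<Omega> p \<Longrightarrow> \<bar>\<integral>x. u x * g x \<partial>lebesgue_on \<Omega>\<bar> \<le> total_variation \<Omega> u"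
    and \<delta>: "\<delta> > 0"
  obtains v where "v \<in> test_functions \<Omega>" "\<And>x. norm (v x) \<le> 1"
    "(\<integral>x. \<bar>g x - divergence v x\<bar> powr (p / (p - 1)) \<partial>lebesgue_on \<Omega>) < \<delta>"
proof -
  let ?M = "lebesgue_on \<Omega>"
  define q where "q = p / (p - 1)"
  define N where "N f = (\<integral>x. \<bar>f x\<bar> powr q \<partial>?M)" for f
  have q: "q > 1" "q \<ge> 2" "q > 0" "q \<ge> 1" "q \<ge> 0" using q2 by (auto simp: q_def)
  have p1: "p \<ge> 1" using p by simp
  note Lq = Lp_space_iff[OF q(3)]
  have N0: "N f \<ge> 0" for f by (simp add: N_def)
  have gL: "g \<in> Lp_space \<Omega> q" using g by (simp add: q_def)
  define B where "B = {v \<in> test_functions \<Omega>. \<forall>x. norm (v x :: real^'n) \<le> 1}"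
  have Bt: "v \<in> test_functions \<Omega>" "norm (v x) \<le> 1" if "v \<in> B" for v x using that by (auto simp: B_def)
  have BL: "divergence v \<in> Lp_space \<Omega> q" if "v \<in> B" for v by (rule test_Lp[OF \<Omega>(1) q(3) test_divergence[OF Bt(1)[OF that]]])
  have conv: "(\<lambda>x. a *\<^sub>R v x + b *\<^sub>R w x) \<in> B" if "v \<in> B" "w \<in> B" "a \<ge> 0" "b \<ge> 0" "a + b = 1" for a b v w
  proof -
    have "norm (a *\<^sub>R v x + b *\<^sub>R w x) \<le> 1" for x
    proof -
      have "norm (a *\<^sub>R v x + b *\<^sub>R w x) \<le> a * norm (v x) + b * norm (w x)" using that by (intro order_trans[OF norm_triangle_ineq]) simp
      also have "\<dots> \<le> a * 1 + b * 1" using that Bt by (intro add_mono mult_left_mono) auto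
      finally show ?thesis using that by simp
    qed
    then show ?thesis using test_add[OF test_cmult[OF Bt(1)[OF that(1)]] test_cmult[OF Bt(1)[OF that(2)]]] by (simp add: B_def)
  qed
  define J where "J v = N (\<lambda>x. g x - divergence v x)" for v
  define d where "d = (INF v\<in>B. J v)"
  have zB: "(\<lambda>x. 0) \<in> B" by (simp add: B_def test_zero)
  have bdd: "bdd_below (J ` B)" by (rule bdd_belowI2[of _ 0]) (simp add: J_def N0)
  have dle: "d \<le> J v" if "v \<in> B" for v unfolding d_def by (rule cINF_lower[OF bdd that])
  have "\<exists>v\<in>B. J v < d + 1 / real (Suc n)" for n
  proof -
    have "(INF v\<in>B. J v) < d + 1 / real (Suc n)" by (simp add: d_def)
    then show ?thesis using cINF_less_iff[OF _ bdd] zB by blast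
  qed
  then obtain v where v: "\<And>n. v n \<in> B" "\<And>n. J (v n) < d + 1 / real (Suc n)" by metis
  define h where "h n x = g x - divergence (v n) x" for n x
  have hL: "h n \<in> Lp_space \<Omega> q" for n unfolding h_def by (rule Lp_diff[OF q(4) gL BL[OF v(1)]])
  have hm: "h n \<in> borel_measurable ?M" and hi: "integrable ?M (\<lambda>x. \<bar>h n x\<bar> powr q)" for n using hL[of n] Lq by blast+
  have hJ: "N (h n) = J (v n)" for n by (simp add: J_def h_def[abs_def])
  have hint: "integrable ?M (\<lambda>x. \<bar>h n x - h m x\<bar> powr q)" for n m by (rule powr_integrable_diff[OF q(5) hm hm hi hi])
  have cauchy: "(\<integral>x. \<bar>h n x - h m x\<bar> powr q \<partial>?M) \<le> 2 powr q * ((1 / real (Suc n) + 1 / real (Suc m)) / 2)" for n m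
  proof -
    \<comment> \<open>The fields of norm at most 1 form a convex set, so the midpoint competes in
      the infimum. Clarkson's inequality then makes a minimising sequence Cauchy.\<close>
    have mid: "(\<lambda>x. (1/2) *\<^sub>R v n x + (1/2) *\<^sub>R v m x) \<in> B" by (rule conv[OF v(1) v(1)]) auto
    have e: "g x - divergence (\<lambda>x. (1/2) *\<^sub>R v n x + (1/2) *\<^sub>R v m x) x = (h n x + h m x) / 2" for x
      unfolding divergence_linear[OF Bt(1)[OF v(1)] Bt(1)[OF v(1)]] by (simp add: h_def field_simps)
    have d1: "d \<le> N (\<lambda>x. (h n x + h m x) / 2)" using dle[OF mid] by (simp only: J_def e)
    have ip: "integrable ?M (\<lambda>x. \<bar>(h n x + h m x) / 2\<bar> powr q)" "integrable ?M (\<lambda>x. \<bar>(h n x - h m x) / 2\<bar> powr q)"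
      using powr_integrable_add[OF q(5) hm[of n] hm[of m] hi hi] hint[of n m] by (simp_all add: powr_divide)
    have "(\<integral>x. \<bar>(h n x + h m x) / 2\<bar> powr q + \<bar>(h n x - h m x) / 2\<bar> powr q \<partial>?M) \<le> (\<integral>x. (\<bar>h n x\<bar> powr q + \<bar>h m x\<bar> powr q) / 2 \<partial>?M)"
      by (intro integral_mono clarkson q(2)) (use ip hi in auto)
    then have "N (\<lambda>x. (h n x + h m x) / 2) + N (\<lambda>x. (h n x - h m x) / 2) \<le> (N (h n) + N (h m)) / 2"
      using ip hi by (simp add: N_def)
    moreover have "Q \<le> (s + t) / 2" if "P + Q \<le> (a + b) / 2" "d \<le> P" "a < d + s" "b < d + t" for P Q a b s t :: real
      using that by (simp add: field_simps)
    ultimately have "N (\<lambda>x. (h n x - h m x) / 2) \<le> (1 / real (Suc n) + 1 / real (Suc m)) / 2"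
      using d1 v(2)[of n, folded hJ] v(2)[of m, folded hJ] by blast
    moreover have "N (\<lambda>x. (h n x - h m x) / 2) = (\<integral>x. \<bar>h n x - h m x\<bar> powr q \<partial>?M) / 2 powr q"
      by (simp add: N_def powr_divide)
    ultimately show ?thesis by (simp add: divide_le_eq mult.commute)
  qed
  have cauchy': "\<exists>K. \<forall>n\<ge>K. \<forall>m\<ge>K. (\<integral>x. \<bar>h n x - h m x\<bar> powr q \<partial>?M) \<le> e" if e: "e > 0" for e
  proof -
    obtain K where K: "1 / real (Suc K) < e / 2 powr q"
      using reals_Archimedean[of "e / 2 powr q"] e by (auto simp: inverse_eq_divide)
    have "(\<integral>x. \<bar>h n x - h m x\<bar> powr q \<partial>?M) \<le> e" if "n \<ge> K" "m \<ge> K" for n m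
    proof -
      have "1 / real (Suc n) \<le> 1 / real (Suc K)" "1 / real (Suc m) \<le> 1 / real (Suc K)"
        using that by (auto intro!: divide_left_mono)
      then have "(1 / real (Suc n) + 1 / real (Suc m)) / 2 \<le> (1 / real (Suc K) + 1 / real (Suc K)) / 2"
        by (intro divide_right_mono add_mono) auto
      also have "\<dots> = 1 / real (Suc K)" by (simp add: field_simps)
      also have "\<dots> \<le> e / 2 powr q" by (rule less_imp_le[OF K])
      finally have "(1 / real (Suc n) + 1 / real (Suc m)) / 2 \<le> e / 2 powr q" .
      then have "2 powr q * ((1 / real (Suc n) + 1 / real (Suc m)) / 2) \<le> 2 powr q * (e / 2 powr q)" by (intro mult_left_mono) auto
      then show ?thesis using cauchy[of n m] by simp
    qed
    then show ?thesis by blast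
  qed
  obtain l r where l: "l \<in> borel_measurable ?M" "\<And>n. integrable ?M (\<lambda>x. \<bar>h n x - l x\<bar> powr q)"
    "(\<lambda>n. \<integral>x. \<bar>h n x - l x\<bar> powr q \<partial>?M) \<longlonglongrightarrow> 0"
    using riesz_fischer[OF q(4) hm hint cauchy'] by blast
  have hlL: "(\<lambda>x. h n x - l x) \<in> Lp_space \<Omega> q" for n unfolding Lq using l hm by (simp add: borel_measurable_diff)
  have lL: "l \<in> Lp_space \<Omega> q" using Lp_diff[OF q(4) hL[of 0] hlL[of 0]] by simp
  have lm: "l \<in> borel_measurable ?M" and li: "integrable ?M (\<lambda>x. \<bar>l x\<bar> powr q)" using lL Lq by blast+
  have hlim: "(\<lambda>n. N (h n)) \<longlonglongrightarrow> N l"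
    using Lq_norm_tendsto[OF p hL[unfolded q_def] lL[unfolded q_def]] l(3) by (simp add: N_def q_def)
  have Nl: "N l \<le> d"
  proof (rule LIMSEQ_le[OF hlim])
    show "(\<lambda>n. d + 1 / real (Suc n)) \<longlonglongrightarrow> d"
      using tendsto_add[OF tendsto_const[of d] LIMSEQ_inverse_real_of_nat] by (simp add: inverse_eq_divide)
    show "\<exists>N'. \<forall>n\<ge>N'. N (h n) \<le> d + 1 / real (Suc n)" using v(2) hJ by (auto intro: less_imp_le)
  qed
  define U where "U x = power_sgn q (l x)" for x
  have UL: "U \<in> Lp_space \<Omega> p" unfolding U_def q_def by (rule power_sgn_Lp(1)[OF p lL[unfolded q_def]])
  have UlN: "(\<integral>x. U x * l x \<partial>?M) = N l" by (simp add: U_def N_def power_sgn_mult_self)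
  \<comment> \<open>The variational inequality of the nearest point: moving from l towards g -
    \<open>divergence z\<close> cannot decrease the norm, so U is nonpositive on the direction w =
    \<open>divergence z\<close> - (g - l).\<close>
  have var: "(\<integral>x. U x * divergence z x \<partial>?M) \<le> (\<integral>x. U x * (g x - l x) \<partial>?M)" if z: "z \<in> B" for z
  proof -
    define w where "w x = divergence z x - (g x - l x)" for x
    have glL: "(\<lambda>x. g x - l x) \<in> Lp_space \<Omega> q" by (rule Lp_diff[OF q(4) gL lL])
    have wL: "w \<in> Lp_space \<Omega> q" unfolding w_def by (rule Lp_diff[OF q(4) BL[OF z] glL])
    have wm: "w \<in> borel_measurable ?M" and wi: "integrable ?M (\<lambda>x. \<bar>w x\<bar> powr q)" using wL Lq by blast+
    have lswL: "(\<lambda>x. l x - s * w x) \<in> Lp_space \<Omega> q" for s by (rule Lp_diff[OF q(4) lL Lp_cmult[OF q(4) wL]])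
    \<comment> \<open>The infimum is not known to be attained by a field, so l - s w is reached as
      the limit of g minus the divergences of the admissible fields (1 - s) v_n + s z.\<close>
    have dmin: "d \<le> N (\<lambda>x. l x - s * w x)" if s: "0 \<le> s" "s \<le> 1" for s
    proof -
      define a where "a n x = h n x - s * (divergence z x - (g x - h n x))" for n x
      have aL: "a n \<in> Lp_space \<Omega> q" for n
        unfolding a_def by (rule Lp_diff[OF q(4) hL Lp_cmult[OF q(4) Lp_diff[OF q(4) BL[OF z] Lp_diff[OF q(4) gL hL]]]])
      have "d \<le> N (a n)" for n
      proof -
        have c: "(\<lambda>x. (1 - s) *\<^sub>R v n x + s *\<^sub>R z x) \<in> B" by (rule conv[OF v(1) z]) (use s in auto)
        have e: "g x - divergence (\<lambda>x. (1 - s) *\<^sub>R v n x + s *\<^sub>R z x) x = a n x" for x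
          unfolding divergence_linear[OF Bt(1)[OF v(1)] Bt(1)[OF z]] by (simp add: h_def a_def algebra_simps)
        show ?thesis using dle[OF c] by (simp only: J_def e)
      qed
      moreover have "(\<lambda>n. N (a n)) \<longlonglongrightarrow> N (\<lambda>x. l x - s * w x)"
      proof -
        have "(\<lambda>n. \<integral>x. \<bar>a n x - (l x - s * w x)\<bar> powr q \<partial>?M) = (\<lambda>n. (1 - s) powr q * (\<integral>x. \<bar>h n x - l x\<bar> powr q \<partial>?M))"
        proof
          fix n
          have "a n x - (l x - s * w x) = (1 - s) * (h n x - l x)" for x by (simp add: a_def w_def algebra_simps)
          then show "(\<integral>x. \<bar>a n x - (l x - s * w x)\<bar> powr q \<partial>?M) = (1 - s) powr q * (\<integral>x. \<bar>h n x - l x\<bar> powr q \<partial>?M)"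
            using s by (simp add: abs_mult powr_mult)
        qed
        moreover have "(\<lambda>n. (1 - s) powr q * (\<integral>x. \<bar>h n x - l x\<bar> powr q \<partial>?M)) \<longlonglongrightarrow> 0"
          using tendsto_mult[OF tendsto_const l(3)] by simp
        ultimately have "(\<lambda>n. \<integral>x. \<bar>a n x - (l x - s * w x)\<bar> powr q \<partial>?M) \<longlonglongrightarrow> 0" by simp
        from Lq_norm_tendsto[OF p aL[unfolded q_def] lswL[unfolded q_def] this[unfolded q_def]]
        show ?thesis by (simp add: N_def q_def)
      qed
      ultimately show ?thesis by (intro LIMSEQ_le_const) auto
    qed
    \<comment> \<open>The tangent inequality is taken at the perturbed point l - s w and evaluated
      at l. As neither has smaller norm than the other allows, the linear term is nonpositive,
      without differentiating the norm.\<close>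
    have neg: "(\<integral>x. power_sgn q (l x - s * w x) * w x \<partial>?M) \<le> 0" if s: "0 < s" "s \<le> 1" for s
    proof -
      have "N (\<lambda>x. l x - s * w x) + q * (\<integral>x. power_sgn q (l x - s * w x) * (l x - (l x - s * w x)) \<partial>?M) \<le> N l"
        unfolding N_def q_def by (rule Lq_tangent(1)[OF p lL[unfolded q_def] lswL[unfolded q_def]])
      moreover have "(\<integral>x. power_sgn q (l x - s * w x) * (l x - (l x - s * w x)) \<partial>?M) = s * (\<integral>x. power_sgn q (l x - s * w x) * w x \<partial>?M)"
        by (simp add: mult.left_commute)
      ultimately have "q * (s * (\<integral>x. power_sgn q (l x - s * w x) * w x \<partial>?M)) \<le> 0"
        using Nl dmin[of s] s by simp
      then show ?thesis using q s by (simp add: mult_le_0_iff)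
    qed
    \<comment> \<open>Now s = 1 / (n + 1) tends to 0. For s \<le> 1 the integrands are dominated by
      2^q (|l|^q + |w|^q).\<close>
    have "(\<lambda>n. \<integral>x. power_sgn q (l x - 1 / real (Suc n) * w x) * w x \<partial>?M) \<longlonglongrightarrow> (\<integral>x. U x * w x \<partial>?M)"
    proof (rule integral_dominated_convergence)
      show "integrable ?M (\<lambda>x. 2 powr q * (\<bar>l x\<bar> powr q + \<bar>w x\<bar> powr q))" using li wi by simp
      show "AE x in ?M. (\<lambda>n. power_sgn q (l x - 1 / real (Suc n) * w x) * w x) \<longlonglongrightarrow> U x * w x"
      proof (rule AE_I2)
        fix x
        have "(\<lambda>n. 1 / real (Suc n)) \<longlonglongrightarrow> 0" using LIMSEQ_inverse_real_of_nat by (simp add: inverse_eq_divide)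
        then have "(\<lambda>n. l x - 1 / real (Suc n) * w x) \<longlonglongrightarrow> l x - 0 * w x" by (intro tendsto_intros)
        then have "(\<lambda>n. power_sgn q (l x - 1 / real (Suc n) * w x)) \<longlonglongrightarrow> power_sgn q (l x - 0 * w x)" by (rule power_sgn_tendsto[OF q(1)])
        then show "(\<lambda>n. power_sgn q (l x - 1 / real (Suc n) * w x) * w x) \<longlonglongrightarrow> U x * w x"
          unfolding U_def by (intro tendsto_mult tendsto_const) simp
      qed
      show "AE x in ?M. norm (power_sgn q (l x - 1 / real (Suc n) * w x) * w x) \<le> 2 powr q * (\<bar>l x\<bar> powr q + \<bar>w x\<bar> powr q)" for n
      proof (rule AE_I2)
        fix x
        let ?m = "max \<bar>l x\<bar> \<bar>w x\<bar>"
        have "1 / real (Suc n) * \<bar>w x\<bar> \<le> 1 * \<bar>w x\<bar>" by (intro mult_right_mono) auto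
        then have "\<bar>l x - 1 / real (Suc n) * w x\<bar> \<le> \<bar>l x\<bar> + \<bar>w x\<bar>"
          using abs_triangle_ineq4[of "l x" "1 / real (Suc n) * w x"] by (simp add: abs_mult)
        also have "\<dots> \<le> 2 * ?m" by simp
        finally have 1: "\<bar>l x - 1 / real (Suc n) * w x\<bar> powr (q - 1) \<le> (2 * ?m) powr (q - 1)" using q by (intro powr_mono2) auto
        have "\<bar>power_sgn q (l x - 1 / real (Suc n) * w x) * w x\<bar> \<le> (2 * ?m) powr (q - 1) * (2 * ?m)"
          unfolding abs_mult power_sgn_abs by (intro mult_mono 1) auto
        also have "\<dots> = (2 * ?m) powr q"
        proof -
          have "2 * ?m \<ge> 0" by simp
          then show ?thesis by (cases "2 * ?m = 0") (auto simp: powr_mult_base mult.commute)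
        qed
        also have "\<dots> = 2 powr q * ?m powr q" by (rule powr_mult)
        also have "\<dots> \<le> 2 powr q * (\<bar>l x\<bar> powr q + \<bar>w x\<bar> powr q)" by (intro mult_left_mono) (auto simp: max_def)
        finally show "norm (power_sgn q (l x - 1 / real (Suc n) * w x) * w x) \<le> 2 powr q * (\<bar>l x\<bar> powr q + \<bar>w x\<bar> powr q)" by simp
      qed
    qed (use lm wm in \<open>auto simp: U_def intro!: borel_measurable_times power_sgn_borel borel_measurable_diff\<close>)
    then have "(\<integral>x. U x * w x \<partial>?M) \<le> 0"
    proof (rule LIMSEQ_le_const2, intro exI allI impI)
      show "(\<integral>x. power_sgn q (l x - 1 / real (Suc n) * w x) * w x \<partial>?M) \<le> 0" for n
        by (rule neg) auto
    qed
    moreover have "(\<integral>x. U x * w x \<partial>?M) = (\<integral>x. U x * divergence z x \<partial>?M) - (\<integral>x. U x * (g x - l x) \<partial>?M)"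
      unfolding w_def right_diff_distrib[of "U _" "divergence z _"]
      by (rule Bochner_Integration.integral_diff)
        (rule holder(1)[OF p UL BL[OF z, unfolded q_def]] holder(1)[OF p UL glL[unfolded q_def]])+
    ultimately show ?thesis by simp
  qed
  \<comment> \<open>By the variational inequality U pairs with every divergence of a unit test field
    to at most A, which is a bound on its variation.\<close>
  define A where "A = (\<integral>x. U x * (g x - l x) \<partial>?M)"
  have tb: "tv_bounded \<Omega> U A" unfolding tv_bounded_def A_def using var by (auto simp: B_def)
  \<comment> \<open>The hypothesis on g speaks about \<open>BV\<close>, to which U is not known to
    belong; it is applied to approximants of U with variation at most A + e, and e tends to
    0.\<close>
  have Ug: "(\<integral>x. U x * g x \<partial>?M) \<le> A"
  proof -
    define G where "G = Lp_real_norm \<Omega> q g"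
    have bound: "(\<integral>x. U x * g x \<partial>?M) \<le> (A + e) + e powr (1 / p) * G" if e: "e > 0" for e
    proof -
      obtain w where w: "w \<in> BV \<Omega> p" "smooth_on \<Omega> w" "total_variation \<Omega> w \<le> A + e"
        "(\<integral>\<^sup>+x. ennreal (norm (gradient w x)) \<partial>?M) \<le> ennreal (A + e)"
        "integrable ?M (\<lambda>x. \<bar>w x - U x\<bar> powr p)" "(\<integral>x. \<bar>w x - U x\<bar> powr p \<partial>?M) \<le> e"
        by (rule BV_approximation[OF \<Omega> p1 UL tb e]) (rule that)
      have L: "(\<lambda>x. U x - w x) \<in> Lp_space \<Omega> p" by (rule Lp_diff[OF p1 UL BV_Lp[OF w(1)]])
      have "\<bar>\<integral>x. (U x - w x) * g x \<partial>?M\<bar> \<le> Lp_real_norm \<Omega> p (\<lambda>x. U x - w x) * G"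
        unfolding G_def q_def by (rule holder(2)[OF p L g])
      also have "\<dots> \<le> e powr (1 / p) * G"
        unfolding Lp_real_norm_def G_def using w(6) p by (intro mult_right_mono powr_mono2) (auto simp: abs_minus_commute)
      finally have 2: "\<bar>\<integral>x. (U x - w x) * g x \<partial>?M\<bar> \<le> e powr (1 / p) * G" .
      have "(\<integral>x. (U x - w x) * g x \<partial>?M) = (\<integral>x. U x * g x \<partial>?M) - (\<integral>x. w x * g x \<partial>?M)"
        using holder(1)[OF p UL g] holder(1)[OF p BV_Lp[OF w(1)] g] by (simp add: left_diff_distrib)
      then show ?thesis using 2 gV[OF w(1)] w(3) by (simp add: abs_le_iff)
    qed
    have "((\<lambda>e. (A + e) + e powr (1 / p) * G) \<longlongrightarrow> (A + 0) + 0 * G) (at_right 0)"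
    proof (intro tendsto_intros)
      show "((\<lambda>e. e powr (1 / p)) \<longlongrightarrow> 0) (at_right 0)"
        by (rule tendsto_zero_powrI[of "\<lambda>e. e" _ "\<lambda>_. 1/p" "1/p"])
          (use p in \<open>auto intro: tendsto_ident_at eventually_mono[OF eventually_at_right_less less_imp_le]\<close>)
    qed
    moreover have "\<forall>\<^sub>F e in at_right 0. (\<integral>x. U x * g x \<partial>?M) \<le> (A + e) + e powr (1 / p) * G"
      using eventually_at_right_less[of "0::real"] by eventually_elim (rule bound)
    ultimately have "(\<integral>x. U x * g x \<partial>?M) \<le> (A + 0) + 0 * G"
      by (intro tendsto_lowerbound) (auto simp: trivial_limit_at_right_real)
    then show ?thesis by simp
  qed
  \<comment> \<open>As U pairs with l to \<open>N l\<close>, comparison with \<open>Ug\<close>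
    forces \<open>N l = 0\<close>: the nearest point is 0 and g is itself a limit of
    divergences.\<close>
  have "A = (\<integral>x. U x * g x \<partial>?M) - (\<integral>x. U x * l x \<partial>?M)"
    unfolding A_def using holder(1)[OF p UL g] holder(1)[OF p UL lL[unfolded q_def]] by (simp add: right_diff_distrib)
  then have "N l \<le> 0" using Ug UlN by simp
  then have "N l = 0" using N0[of l] by simp
  then have "\<forall>\<^sub>F n in sequentially. N (h n) < \<delta>" using order_tendstoD(2)[OF hlim] \<delta> by simp
  then obtain n where "N (h n) < \<delta>" by (auto simp: eventually_sequentially)
  then show ?thesis using that[OF Bt(1)[OF v(1)] Bt(2)[OF v(1)]] by (simp add: N_def h_def q_def)
qed

lemma dual_density:
  fixes \<Omega> :: "(real^'n::finite) set"
  assumes \<Omega>: "open \<Omega>" "\<Omega> \<noteq> {}" and p: "p > 1" and q2: "p / (p - 1) \<ge> 2"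
    and g: "g \<in> Lp_space \<Omega> (p / (p - 1))" and r: "r > 0"
    and gV: "\<And>u. u \<in> BV \<Omega> p \<Longrightarrow> \<bar>\<integral>x. u x * g x \<partial>lebesgue_on \<Omega>\<bar> \<le> r * total_variation \<Omega> u"
    and \<delta>: "\<delta> > 0"
  obtains v where "v \<in> test_functions \<Omega>" "\<And>x. norm (v x) \<le> r"
    "Lp_real_norm \<Omega> (p / (p - 1)) (\<lambda>x. g x - divergence v x) < \<delta>"
proof -
  let ?M = "lebesgue_on \<Omega>"
  define q where "q = p / (p - 1)"
  have q: "q > 0" "q \<ge> 1" using q2 by (auto simp: q_def)
  have g': "(\<lambda>x. inverse r * g x) \<in> Lp_space \<Omega> (p / (p - 1))"
    by (rule Lp_cmult[OF _ g]) (use q in \<open>simp add: q_def\<close>)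
  have b: "\<bar>\<integral>x. u x * (inverse r * g x) \<partial>?M\<bar> \<le> total_variation \<Omega> u" if "u \<in> BV \<Omega> p" for u
  proof -
    have "(\<integral>x. u x * (inverse r * g x) \<partial>?M) = inverse r * (\<integral>x. u x * g x \<partial>?M)" by (simp add: mult.left_commute)
    then have "\<bar>\<integral>x. u x * (inverse r * g x) \<partial>?M\<bar> = inverse r * \<bar>\<integral>x. u x * g x \<partial>?M\<bar>" using r by (simp add: abs_mult)
    also have "\<dots> \<le> inverse r * (r * total_variation \<Omega> u)" using gV[OF that] r by (intro mult_left_mono) auto
    also have "\<dots> = total_variation \<Omega> u" using r by simp
    finally show ?thesis .
  qed
  \<comment> \<open>After rescaling by r and taking the q-th root this tolerance becomes
    \<delta>.\<close>
  have \<delta>': "(\<delta> / r) powr q > 0" using \<delta> r by simp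
  obtain v where v: "v \<in> test_functions \<Omega>" "\<And>x. norm (v x) \<le> 1"
    "(\<integral>x. \<bar>inverse r * g x - divergence v x\<bar> powr (p / (p - 1)) \<partial>?M) < (\<delta> / r) powr q"
    by (rule dual_density_unit[OF \<Omega> p q2 g' b \<delta>']) (assumption | rule that)+
  show ?thesis
  proof (rule that[of "\<lambda>x. r *\<^sub>R v x"])
    show "(\<lambda>x. r *\<^sub>R v x) \<in> test_functions \<Omega>" by (rule test_cmult[OF v(1)])
    show "norm (r *\<^sub>R v x) \<le> r" for x using v(2)[of x] r by (simp add: mult_left_le)
    have "\<bar>g x - divergence (\<lambda>x. r *\<^sub>R v x) x\<bar> powr q = r powr q * \<bar>inverse r * g x - divergence v x\<bar> powr q" for x
    proof -
      have "g x - divergence (\<lambda>x. r *\<^sub>R v x) x = r * (inverse r * g x - divergence v x)"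
        using r by (simp add: divergence_cmult[OF v(1)] algebra_simps)
      then show ?thesis using r by (simp add: abs_mult powr_mult)
    qed
    then have "Lp_real_norm \<Omega> q (\<lambda>x. g x - divergence (\<lambda>x. r *\<^sub>R v x) x) =
      (r powr q * (\<integral>x. \<bar>inverse r * g x - divergence v x\<bar> powr q \<partial>?M)) powr (1 / q)"
      by (simp add: Lp_real_norm_def)
    also have "\<dots> < (r powr q * (\<delta> / r) powr q) powr (1 / q)"
      using v(3)[folded q_def] r q by (intro powr_less_mono2 mult_strict_left_mono) auto
    also have "\<dots> = \<delta>" using r \<delta> q by (simp add: powr_mult[symmetric] powr_powr)
    finally show "Lp_real_norm \<Omega> (p / (p - 1)) (\<lambda>x. g x - divergence (\<lambda>x. r *\<^sub>R v x) x) < \<delta>" by (simp add: q_def)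
  qed
qed

section \<open>Charges as limits of functions in L_q\<close>

lemma Lp_finite_integrable:
  assumes "q \<ge> 1" "f \<in> Lp_space \<Omega> q" "open \<Omega>" "emeasure lebesgue \<Omega> < \<infinity>"
  shows "integrable (lebesgue_on \<Omega>) f"
proof -
  have f: "f \<in> borel_measurable (lebesgue_on \<Omega>)" "integrable (lebesgue_on \<Omega>) (\<lambda>x. \<bar>f x\<bar> powr q)"
    using assms Lp_space_iff[of q f \<Omega>] by auto
  interpret finite_measure "lebesgue_on \<Omega>"
    by (rule finite_measureI) (use assms in \<open>simp add: emeasure_restrict_space\<close>)
  have i: "integrable (lebesgue_on \<Omega>) (\<lambda>x. 1 + \<bar>f x\<bar> powr q)" using f by simp
  show ?thesis
  proof (rule Bochner_Integration.integrable_bound[OF i f(1) AE_I2])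
    fix x
    have "\<bar>f x\<bar> \<le> 1 + \<bar>f x\<bar> powr q"
    proof (cases "\<bar>f x\<bar> \<le> 1")
      case False
      then have "\<bar>f x\<bar> powr 1 \<le> \<bar>f x\<bar> powr q" using assms(1) by (intro powr_mono) auto
      then show ?thesis using False by simp
    qed (auto intro: add_increasing2)
    then show "norm (f x) \<le> norm (1 + \<bar>f x\<bar> powr q)" by simp
  qed
qed

lemma Lp_sharp_linear:
  assumes "q \<ge> 1" "open \<Omega>" "f \<in> Lp_sharp \<Omega> q" "g \<in> Lp_sharp \<Omega> q"
  shows "(\<lambda>x. a * f x + b * g x) \<in> Lp_sharp \<Omega> q"
proof -
  have L: "f \<in> Lp_space \<Omega> q" "g \<in> Lp_space \<Omega> q" using assms by (auto simp: Lp_sharp_def)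
  have "(\<integral>x. a * f x + b * g x \<partial>lebesgue_on \<Omega>) = 0" if "emeasure lebesgue \<Omega> < \<infinity>"
  proof -
    have "(\<integral>x. f x \<partial>lebesgue_on \<Omega>) = 0" "(\<integral>x. g x \<partial>lebesgue_on \<Omega>) = 0" using assms that by (auto simp: Lp_sharp_def)
    then show ?thesis
      using Lp_finite_integrable[OF assms(1) L(1) assms(2) that] Lp_finite_integrable[OF assms(1) L(2) assms(2) that] by simp
  qed
  then show ?thesis using Lp_add[OF assms(1) Lp_cmult[OF assms(1) L(1)] Lp_cmult[OF assms(1) L(2)]] by (simp add: Lp_sharp_def)
qed

lemma Lp_sharp_zero: "q \<ge> 1 \<Longrightarrow> (\<lambda>x. 0) \<in> Lp_sharp \<Omega> q"
  by (simp add: Lp_sharp_def Lp_zero)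

lemma Lp_sharp_sum:
  assumes "q \<ge> 1" "open \<Omega>" "finite E" "E \<subseteq> Lp_sharp \<Omega> q"
  shows "(\<lambda>x. \<Sum>f\<in>E. t f * f x) \<in> Lp_sharp \<Omega> q"
  using assms(3,4)
proof (induction E rule: finite_induct)
  case (insert f E)
  have "(\<lambda>x. t f * f x + 1 * (\<Sum>f\<in>E. t f * f x)) \<in> Lp_sharp \<Omega> q"
    by (rule Lp_sharp_linear[OF assms(1,2)]) (use insert in auto)
  then show ?case using insert.hyps by simp
qed (simp add: Lp_sharp_zero[OF assms(1)])

lemma test_Lp_sharp:
  assumes "open \<Omega>" "q > 0" "\<phi> \<in> test_functions \<Omega>" "(\<integral>x. \<phi> x \<partial>lborel) = 0"
  shows "\<phi> \<in> Lp_sharp \<Omega> q"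
  using test_Lp[OF assms(1-3)] test_lebesgue_on(1)[OF assms(1,3)] assms(4) by (simp add: Lp_sharp_def)

lemma integral_divergence:
  assumes "v \<in> test_functions \<Omega>" shows "(\<integral>x. divergence v x \<partial>lborel) = 0"
  unfolding divergence_def
  using integral_partial_deriv_test[OF test_component[OF assms]] test_integrable[OF test_partial_deriv[OF test_component[OF assms]]]
  by (subst Bochner_Integration.integral_sum) simp_all

lemma Lp_real_norm_cmult:
  assumes "q > 0" shows "Lp_real_norm \<Omega> q (\<lambda>x. c * f x) = \<bar>c\<bar> * Lp_real_norm \<Omega> q f"
  using assms by (simp add: Lp_real_norm_def abs_mult powr_mult powr_powr)

lemma Lp_norm_real: "q > 0 \<Longrightarrow> f \<in> Lp_space \<Omega> q \<Longrightarrow> Lp_norm \<Omega> q f = ennreal (Lp_real_norm \<Omega> q f)"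
  by (simp add: Lp_norm_eq Lp_real_norm_def)

text \<open>The definition of a charge demands a non-empty set of functions of norm 1 even when the
  function to be normalised vanishes. The normalised difference of the indicators of two disjoint
  balls of equal radius has mean zero and supplies one.\<close>

lemma Lp_sharp_unit_exists:
  fixes \<Omega> :: "(real^'n::finite) set"
  assumes \<Omega>: "open \<Omega>" "\<Omega> \<noteq> {}" and q: "q \<ge> 1"
  obtains f where "f \<in> Lp_sharp \<Omega> q" "Lp_norm \<Omega> q f = 1"
proof -
  obtain a where "a \<in> \<Omega>" using \<Omega> by blast
  then obtain t where t: "t > 0" "ball a t \<subseteq> \<Omega>" using \<Omega>(1) open_contains_ball by blast
  \<comment> \<open>Two balls of radius s with centres 2 s apart are disjoint, and both lie within
    distance 3 s < t of a.\<close>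
  define s where "s = t / 4"
  have s: "s > 0" using t by (simp add: s_def)
  obtain i :: 'n where True by blast
  define b where "b = a + (2 * s) *\<^sub>R axis i 1"
  have ab: "dist a b = 2 * s" using s by (simp add: b_def dist_norm)
  define A where "A = ball a s"
  define B where "B = ball b s"
  have AO: "A \<subseteq> \<Omega>" using t s by (auto simp: A_def s_def)
  have BO: "B \<subseteq> \<Omega>"
  proof
    fix x assume "x \<in> B"
    then have "dist a x < 3 * s" using dist_triangle[of a x b] ab by (simp add: B_def)
    then show "x \<in> \<Omega>" using t(2) s by (auto simp: s_def)
  qed
  have dis: "A \<inter> B = {}"
  proof -
    have "False" if "x \<in> A" "x \<in> B" for x using that dist_triangle[of a b x] ab by (simp add: A_def B_def dist_commute)
    then show ?thesis by blast
  qed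
  define h where "h x = indicator A x - (indicator B x :: real)" for x
  have [measurable]: "A \<in> sets borel" "B \<in> sets borel" by (auto simp: A_def B_def)
  have hm: "h \<in> borel_measurable borel" unfolding h_def by measurable
  have h0: "h x = 0" if "x \<notin> \<Omega>" for x using that AO BO by (auto simp: h_def indicator_def)
  have iA: "integrable lborel (indicator A :: _ \<Rightarrow> real)" "integrable lborel (indicator B :: _ \<Rightarrow> real)"
    unfolding A_def B_def using emeasure_bounded_finite[OF bounded_ball] by (auto intro!: integrable_real_indicator)
  define m where "m = measure lborel A"
  have mB: "measure lborel B = m" using s by (simp add: m_def A_def B_def content_ball)
  have m: "m > 0" using s by (simp add: m_def A_def content_ball)
  have hq: "\<bar>h x\<bar> powr q = indicator A x + indicator B x" for x
    using dis by (auto simp: h_def indicator_def)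
  have hi: "integrable (lebesgue_on \<Omega>) (\<lambda>x. \<bar>h x\<bar> powr q)"
  proof (subst lebesgue_on_lborel(2)[OF \<Omega>(1)])
    show "integrable lborel (\<lambda>x. \<bar>h x\<bar> powr q)" unfolding hq using iA by (rule Bochner_Integration.integrable_add)
  qed (use hm h0 in auto)
  have N: "(\<integral>x. \<bar>h x\<bar> powr q \<partial>lebesgue_on \<Omega>) = 2 * m"
  proof (subst lebesgue_on_lborel(1)[OF \<Omega>(1)])
    show "(\<integral>x. \<bar>h x\<bar> powr q \<partial>lborel) = 2 * m" using iA mB by (simp add: hq m_def)
  qed (use hm h0 q in auto)
  have hI: "(\<integral>x. h x \<partial>lebesgue_on \<Omega>) = 0"
  proof (subst lebesgue_on_lborel(1)[OF \<Omega>(1) hm])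
    show "(\<integral>x. h x \<partial>lborel) = 0" using iA mB by (simp add: h_def m_def)
  qed (use h0 in auto)
  have q0: "q > 0" using q by simp
  have hL: "h \<in> Lp_sharp \<Omega> q"
    unfolding Lp_sharp_def mem_Collect_eq Lp_space_iff[OF q0] using hi hI lebesgue_on_borel[OF \<Omega>(1) hm] by blast
  define c where "c = Lp_real_norm \<Omega> q h"
  have c: "c > 0" using m by (simp add: c_def Lp_real_norm_def N)
  have fS: "(\<lambda>x. inverse c * h x + 0 * h x) \<in> Lp_sharp \<Omega> q" by (rule Lp_sharp_linear[OF q \<Omega>(1) hL hL])
  then have "(\<lambda>x. inverse c * h x) \<in> Lp_space \<Omega> q" by (simp add: Lp_sharp_def)
  from Lp_norm_real[OF q0 this] have "Lp_norm \<Omega> q (\<lambda>x. inverse c * h x) = 1"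
    using c unfolding Lp_real_norm_cmult[OF q0] c_def[symmetric] by simp
  then show ?thesis using that fS by simp
qed

text \<open>From left to right, the maximum over E is bounded by the sum and the Hahn-Banach
  argument, with \<epsilon> times the total variation as seminorm, yields a linear combination of E
  as g. From right to left, a single normalised multiple of g serves as E. The right-hand side
  behaves well under linear combinations, which is why it is used from here on.\<close>

lemma SCH_iff:
  fixes \<Omega> :: "(real^'n::finite) set"
  assumes \<Omega>: "open \<Omega>" "\<Omega> \<noteq> {}" and p: "p > 1"
  shows "F \<in> SCH \<Omega> p \<longleftrightarrow> F \<in> linear_forms \<Omega> p \<and>
    (\<forall>e>0. \<exists>g\<in>Lp_sharp \<Omega> (p / (p - 1)). \<forall>u\<in>BV \<Omega> p.
      \<bar>F (BV_class \<Omega> p u) - (\<integral>x. u x * g x \<partial>lebesgue_on \<Omega>)\<bar> \<le> e * total_variation \<Omega> u)"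
    (is "?L \<longleftrightarrow> ?R")
proof
  let ?M = "lebesgue_on \<Omega>"
  define q where "q = p / (p - 1)"
  have q: "q \<ge> 1" "q > 0" using conjugate_exponents(1)[OF p] by (auto simp: q_def)
  have p1: "p \<ge> 1" using p by simp
  {
    assume L: ?L
    have lf: "F \<in> linear_forms \<Omega> p" using L by (simp add: SCH_def)
    have "\<exists>g\<in>Lp_sharp \<Omega> (p / (p - 1)). \<forall>u\<in>BV \<Omega> p.
      \<bar>F (BV_class \<Omega> p u) - (\<integral>x. u x * g x \<partial>?M)\<bar> \<le> e * total_variation \<Omega> u" if e: "e > 0" for e
    proof -
      have "\<exists>E \<theta>. finite E \<and> E \<noteq> {} \<and>
         (\<forall>f\<in>E. f \<in> Lp_sharp \<Omega> (p / (p - 1)) \<and> Lp_norm \<Omega> (p / (p - 1)) f = 1) \<and> \<theta> > 0 \<and>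
         (\<forall>u\<in>BV \<Omega> p. \<bar>F (BV_class \<Omega> p u)\<bar>
            \<le> \<theta> * Max ((\<lambda>f. \<bar>\<integral>x. u x * f x \<partial>?M\<bar>) ` E) + e * total_variation \<Omega> u)"
        using L e unfolding SCH_def by simp
      then obtain E \<theta> where E: "finite E" "E \<noteq> {}" "\<And>f. f \<in> E \<Longrightarrow> f \<in> Lp_sharp \<Omega> q" "\<theta> > 0"
        and b: "\<And>u. u \<in> BV \<Omega> p \<Longrightarrow> \<bar>F (BV_class \<Omega> p u)\<bar> \<le> \<theta> * Max ((\<lambda>f. \<bar>\<integral>x. u x * f x \<partial>?M\<bar>) ` E) + e * total_variation \<Omega> u"
        unfolding q_def by blast
      have EL: "f \<in> Lp_space \<Omega> (p / (p - 1))" if "f \<in> E" for f using E(3)[OF that] by (simp add: Lp_sharp_def q_def)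
      note hi = holder(1)[OF p BV_Lp EL]
      have "\<exists>t. \<forall>u\<in>BV \<Omega> p. \<bar>F (BV_class \<Omega> p u) - (\<Sum>f\<in>E. t f * (\<integral>x. u x * f x \<partial>?M))\<bar> \<le> e * total_variation \<Omega> u"
      proof (rule finite_dimensional_hahn_banach[OF BV_add[OF \<Omega>(1) p1] BV_cmult[OF \<Omega>(1) p1] _ E(1), where \<theta> = \<theta>])
        show "seminorm_on_space (BV \<Omega> p) (\<lambda>u. e * total_variation \<Omega> u)"
          unfolding seminorm_on_space_def
        proof (intro conjI ballI allI)
          fix u w assume uw: "u \<in> BV \<Omega> p" "w \<in> BV \<Omega> p"
          have "e * total_variation \<Omega> (\<lambda>x. u x + w x) \<le> e * (total_variation \<Omega> u + total_variation \<Omega> w)"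
            using tv_triangle[OF \<Omega> p1 uw] e by (intro mult_left_mono) auto
          then show "e * total_variation \<Omega> (\<lambda>x. u x + w x) \<le> e * total_variation \<Omega> u + e * total_variation \<Omega> w" by (simp add: distrib_left)
        next
          fix a u assume u: "u \<in> BV \<Omega> p"
          have "e * total_variation \<Omega> (\<lambda>x. a * u x) \<le> e * (\<bar>a\<bar> * total_variation \<Omega> u)"
            using tv_cmult_le[OF \<Omega> p1 u] e by (intro mult_left_mono) auto
          then show "e * total_variation \<Omega> (\<lambda>x. a * u x) \<le> \<bar>a\<bar> * (e * total_variation \<Omega> u)" by (simp add: mult.left_commute)
        qed
        show "\<theta> \<ge> 0" using E by simp
        show "linear_on_space (BV \<Omega> p) (\<lambda>u. \<integral>x. u x * f x \<partial>?M)" if "f \<in> E" for f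
          unfolding linear_on_space_def using hi[OF _ that] by (simp add: distrib_right mult.assoc)
        show "linear_on_space (BV \<Omega> p) (\<lambda>u. F (BV_class \<Omega> p u))"
          using lf unfolding linear_on_space_def linear_forms_def by blast
        show "\<bar>F (BV_class \<Omega> p u)\<bar> \<le> \<theta> * (\<Sum>f\<in>E. \<bar>\<integral>x. u x * f x \<partial>?M\<bar>) + e * total_variation \<Omega> u" if u: "u \<in> BV \<Omega> p" for u
        proof -
          have "Max ((\<lambda>f. \<bar>\<integral>x. u x * f x \<partial>?M\<bar>) ` E) \<le> (\<Sum>f\<in>E. \<bar>\<integral>x. u x * f x \<partial>?M\<bar>)"
            using E by (intro Max.boundedI) (auto intro!: member_le_sum)
          then have "\<theta> * Max ((\<lambda>f. \<bar>\<integral>x. u x * f x \<partial>?M\<bar>) ` E) \<le> \<theta> * (\<Sum>f\<in>E. \<bar>\<integral>x. u x * f x \<partial>?M\<bar>)"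
            using E(4) by (intro mult_left_mono) auto
          then show ?thesis using b[OF u] by linarith
        qed
      qed
      then obtain t where t: "\<And>u. u \<in> BV \<Omega> p \<Longrightarrow> \<bar>F (BV_class \<Omega> p u) - (\<Sum>f\<in>E. t f * (\<integral>x. u x * f x \<partial>?M))\<bar> \<le> e * total_variation \<Omega> u" by blast
      define g where "g x = (\<Sum>f\<in>E. t f * f x)" for x
      have gS: "g \<in> Lp_sharp \<Omega> q" unfolding g_def by (rule Lp_sharp_sum[OF q(1) \<Omega>(1) E(1)]) (use E(3) in blast)
      have "(\<integral>x. u x * g x \<partial>?M) = (\<Sum>f\<in>E. t f * (\<integral>x. u x * f x \<partial>?M))" if u: "u \<in> BV \<Omega> p" for u
      proof -
        have "(\<integral>x. u x * g x \<partial>?M) = (\<integral>x. (\<Sum>f\<in>E. t f * (u x * f x)) \<partial>?M)"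
          by (simp add: g_def sum_distrib_left mult.left_commute)
        also have "\<dots> = (\<Sum>f\<in>E. \<integral>x. t f * (u x * f x) \<partial>?M)"
          by (rule Bochner_Integration.integral_sum) (use hi[OF u] in auto)
        finally show ?thesis by simp
      qed
      then show ?thesis using gS t unfolding q_def by (intro bexI[of _ g]) auto
    qed
    then show ?R using lf by blast
  }
  {
    assume R: ?R
    \<comment> \<open>Stands in for g when g has norm 0 and cannot be normalised.\<close>
    obtain f0 where f0: "f0 \<in> Lp_sharp \<Omega> q" "Lp_norm \<Omega> q f0 = 1" using Lp_sharp_unit_exists[OF \<Omega> q(1)] by blast
    have "\<exists>E \<theta>. finite E \<and> E \<noteq> {} \<and>
         (\<forall>f\<in>E. f \<in> Lp_sharp \<Omega> (p / (p - 1)) \<and> Lp_norm \<Omega> (p / (p - 1)) f = 1) \<and> \<theta> > 0 \<and>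
         (\<forall>u\<in>BV \<Omega> p. \<bar>F (BV_class \<Omega> p u)\<bar>
            \<le> \<theta> * Max ((\<lambda>f. \<bar>\<integral>x. u x * f x \<partial>?M\<bar>) ` E) + e * total_variation \<Omega> u)" if e: "e > 0" for e
    proof -
      obtain g where g: "g \<in> Lp_sharp \<Omega> q" "\<And>u. u \<in> BV \<Omega> p \<Longrightarrow>
        \<bar>F (BV_class \<Omega> p u) - (\<integral>x. u x * g x \<partial>?M)\<bar> \<le> e * total_variation \<Omega> u"
        using R e unfolding q_def by blast
      have gL: "g \<in> Lp_space \<Omega> q" using g by (simp add: Lp_sharp_def)
      define c where "c = Lp_real_norm \<Omega> q g"
      have c0: "c \<ge> 0" by (simp add: c_def Lp_real_norm_def)
      have "\<exists>f \<theta>. f \<in> Lp_sharp \<Omega> q \<and> Lp_norm \<Omega> q f = 1 \<and> \<theta> > 0 \<and>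
        (\<forall>u\<in>BV \<Omega> p. \<bar>\<integral>x. u x * g x \<partial>?M\<bar> \<le> \<theta> * \<bar>\<integral>x. u x * f x \<partial>?M\<bar>)"
      proof (cases "c = 0")
        case True
        have "\<bar>\<integral>x. u x * g x \<partial>?M\<bar> \<le> 0" if "u \<in> BV \<Omega> p" for u
          using holder(2)[OF p BV_Lp[OF that] gL[unfolded q_def]] True by (simp add: c_def q_def)
        then show ?thesis using f0 by (intro exI[of _ f0] exI[of _ 1]) auto
      next
        case False
        then have c: "c > 0" using c0 by simp
        have fS: "(\<lambda>x. inverse c * g x) \<in> Lp_sharp \<Omega> q" using Lp_sharp_linear[OF q(1) \<Omega>(1) g(1) g(1), of "inverse c" 0] by simp
        then have "(\<lambda>x. inverse c * g x) \<in> Lp_space \<Omega> q" by (simp add: Lp_sharp_def)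
        from Lp_norm_real[OF q(2) this] have n: "Lp_norm \<Omega> q (\<lambda>x. inverse c * g x) = 1"
          using c unfolding Lp_real_norm_cmult[OF q(2)] c_def[symmetric] by simp
        have "\<bar>\<integral>x. u x * g x \<partial>?M\<bar> \<le> c * \<bar>\<integral>x. u x * (inverse c * g x) \<partial>?M\<bar>" for u
        proof -
          have "(\<integral>x. u x * (inverse c * g x) \<partial>?M) = inverse c * (\<integral>x. u x * g x \<partial>?M)" by (simp add: mult.left_commute)
          then have "c * \<bar>\<integral>x. u x * (inverse c * g x) \<partial>?M\<bar> = (c * inverse c) * \<bar>\<integral>x. u x * g x \<partial>?M\<bar>"
            using c by (simp only: abs_mult) simp
          then show ?thesis using c by simp
        qed
        then show ?thesis using fS n c by blast
      qed
      then obtain f \<theta> where f: "f \<in> Lp_sharp \<Omega> q" "Lp_norm \<Omega> q f = 1" "\<theta> > 0"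
        "\<And>u. u \<in> BV \<Omega> p \<Longrightarrow> \<bar>\<integral>x. u x * g x \<partial>?M\<bar> \<le> \<theta> * \<bar>\<integral>x. u x * f x \<partial>?M\<bar>" by blast
      have "\<bar>F (BV_class \<Omega> p u)\<bar> \<le> \<theta> * Max ((\<lambda>f. \<bar>\<integral>x. u x * f x \<partial>?M\<bar>) ` {f}) + e * total_variation \<Omega> u" if u: "u \<in> BV \<Omega> p" for u
      proof -
        have "\<bar>F (BV_class \<Omega> p u)\<bar> \<le> \<theta> * \<bar>\<integral>x. u x * f x \<partial>?M\<bar> + e * total_variation \<Omega> u"
          using f(4)[OF u] g(2)[OF u] by linarith
        then show ?thesis by simp
      qed
      then show ?thesis using f unfolding q_def by (intro exI[of _ "{f}"] exI[of _ \<theta>]) auto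
    qed
    then show ?L using R unfolding SCH_def by blast
  }
qed

lemma SCH_linear_forms: "F \<in> SCH \<Omega> p \<Longrightarrow> F \<in> linear_forms \<Omega> p"
  by (simp add: SCH_def)

lemma linear_forms_linear:
  assumes "F \<in> linear_forms \<Omega> p" "G \<in> linear_forms \<Omega> p"
  shows "(\<lambda>X. a * F X + b * G X) \<in> linear_forms \<Omega> p"
  using assms unfolding linear_forms_def by (auto simp: algebra_simps)

lemma SCH_linear:
  fixes \<Omega> :: "(real^'n::finite) set"
  assumes \<Omega>: "open \<Omega>" "\<Omega> \<noteq> {}" and p: "p > 1" and F: "F \<in> SCH \<Omega> p" and G: "G \<in> SCH \<Omega> p"
  shows "(\<lambda>X. a * F X + b * G X) \<in> SCH \<Omega> p"
  unfolding SCH_iff[OF \<Omega> p]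
proof (intro conjI allI impI)
  show "(\<lambda>X. a * F X + b * G X) \<in> linear_forms \<Omega> p" by (intro linear_forms_linear SCH_linear_forms F G)
  fix e :: real assume e: "e > 0"
  let ?M = "lebesgue_on \<Omega>"
  have q: "p / (p - 1) \<ge> 1" using conjugate_exponents(1)[OF p] by simp
  define d where "d = e / (1 + \<bar>a\<bar> + \<bar>b\<bar>)"
  have d: "d > 0" "(\<bar>a\<bar> + \<bar>b\<bar>) * d \<le> e" using e by (auto simp: d_def add_pos_nonneg field_simps)
  obtain f where f: "f \<in> Lp_sharp \<Omega> (p / (p - 1))" "\<And>u. u \<in> BV \<Omega> p \<Longrightarrow> \<bar>F (BV_class \<Omega> p u) - (\<integral>x. u x * f x \<partial>?M)\<bar> \<le> d * total_variation \<Omega> u"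
    using F d(1) unfolding SCH_iff[OF \<Omega> p] by blast
  obtain g where g: "g \<in> Lp_sharp \<Omega> (p / (p - 1))" "\<And>u. u \<in> BV \<Omega> p \<Longrightarrow> \<bar>G (BV_class \<Omega> p u) - (\<integral>x. u x * g x \<partial>?M)\<bar> \<le> d * total_variation \<Omega> u"
    using G d(1) unfolding SCH_iff[OF \<Omega> p] by blast
  have L: "f \<in> Lp_space \<Omega> (p / (p - 1))" "g \<in> Lp_space \<Omega> (p / (p - 1))" using f g by (auto simp: Lp_sharp_def)
  show "\<exists>g\<in>Lp_sharp \<Omega> (p / (p - 1)). \<forall>u\<in>BV \<Omega> p.
      \<bar>(a * F (BV_class \<Omega> p u) + b * G (BV_class \<Omega> p u)) - (\<integral>x. u x * g x \<partial>?M)\<bar> \<le> e * total_variation \<Omega> u"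
  proof (rule bexI[OF _ Lp_sharp_linear[OF q \<Omega>(1) f(1) g(1), of a b]], rule ballI)
    fix u assume u: "u \<in> BV \<Omega> p"
    have tv: "total_variation \<Omega> u \<ge> 0" by (rule tv_nonneg[OF \<Omega> _ u]) (use p in simp)
    have "(\<integral>x. u x * (a * f x + b * g x) \<partial>?M) = a * (\<integral>x. u x * f x \<partial>?M) + b * (\<integral>x. u x * g x \<partial>?M)"
      using holder(1)[OF p BV_Lp[OF u] L(1)] holder(1)[OF p BV_Lp[OF u] L(2)]
      by (simp add: distrib_left mult.left_commute)
    then have "(a * F (BV_class \<Omega> p u) + b * G (BV_class \<Omega> p u)) - (\<integral>x. u x * (a * f x + b * g x) \<partial>?M) =
      a * (F (BV_class \<Omega> p u) - (\<integral>x. u x * f x \<partial>?M)) + b * (G (BV_class \<Omega> p u) - (\<integral>x. u x * g x \<partial>?M))"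
      by (simp add: algebra_simps)
    also have "\<bar>\<dots>\<bar> \<le> \<bar>a\<bar> * \<bar>F (BV_class \<Omega> p u) - (\<integral>x. u x * f x \<partial>?M)\<bar> + \<bar>b\<bar> * \<bar>G (BV_class \<Omega> p u) - (\<integral>x. u x * g x \<partial>?M)\<bar>"
      by (rule order_trans[OF abs_triangle_ineq]) (simp add: abs_mult)
    also have "\<dots> \<le> \<bar>a\<bar> * (d * total_variation \<Omega> u) + \<bar>b\<bar> * (d * total_variation \<Omega> u)"
      using f(2)[OF u] g(2)[OF u] by (intro add_mono mult_left_mono) auto
    also have "\<dots> = ((\<bar>a\<bar> + \<bar>b\<bar>) * d) * total_variation \<Omega> u" by (simp add: algebra_simps)
    also have "\<dots> \<le> e * total_variation \<Omega> u" by (rule mult_right_mono[OF d(2) tv])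
    finally show "\<bar>(a * F (BV_class \<Omega> p u) + b * G (BV_class \<Omega> p u)) - (\<integral>x. u x * (a * f x + b * g x) \<partial>?M)\<bar> \<le> e * total_variation \<Omega> u" .
  qed
qed

lemma linear_forms_cmult: "F \<in> linear_forms \<Omega> p \<Longrightarrow> u \<in> BV \<Omega> p \<Longrightarrow> F (BV_class \<Omega> p (\<lambda>x. a * u x)) = a * F (BV_class \<Omega> p u)"
  by (simp add: linear_forms_def)

lemma SCH_norm_least:
  assumes \<Omega>: "open \<Omega>" "\<Omega> \<noteq> {}" and p: "p > 1" and C: "C \<ge> 0"
    "\<And>u. u \<in> BV \<Omega> p \<Longrightarrow> \<bar>F (BV_class \<Omega> p u)\<bar> \<le> C * total_variation \<Omega> u"
  shows "SCH_norm \<Omega> p F \<le> C"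
  unfolding SCH_norm_def
proof (rule cSUP_least)
  have p1: "p \<ge> 1" using p by simp
  have "tv_bounded \<Omega> (\<lambda>x. 0) 0" by (simp add: tv_bounded_def)
  from tv_boundedD(1)[OF this \<Omega>(2)] show "{u \<in> BV \<Omega> p. total_variation \<Omega> u \<le> 1} \<noteq> {}"
    using BV_zero[OF \<Omega>(1) p1] by force
  fix u assume u: "u \<in> {u \<in> BV \<Omega> p. total_variation \<Omega> u \<le> 1}"
  then have "C * total_variation \<Omega> u \<le> C * 1" using C(1) by (intro mult_left_mono) auto
  then show "\<bar>F (BV_class \<Omega> p u)\<bar> \<le> C" using C(2)[of u] u by simp
qed

text \<open>The supremum is one over a bounded set: F is within total variation distance 1 of the
  pairing with some g, and the dual Poincare inequality bounds that pairing by a multiple of the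
  total variation.\<close>

lemma SCH_norm_upper:
  assumes \<Omega>: "open \<Omega>" "\<Omega> \<noteq> {}" and p: "p > 1" and P: "poincare \<Omega> p" and F: "F \<in> SCH \<Omega> p"
  shows "u \<in> BV \<Omega> p \<Longrightarrow> \<bar>F (BV_class \<Omega> p u)\<bar> \<le> SCH_norm \<Omega> p F * total_variation \<Omega> u"
    and "SCH_norm \<Omega> p F \<ge> 0"
proof -
  let ?M = "lebesgue_on \<Omega>"
  have p1: "p \<ge> 1" using p by simp
  have lf: "F \<in> linear_forms \<Omega> p" by (rule SCH_linear_forms[OF F])
  obtain c where c: "c > 0" "\<And>u f. u \<in> BV \<Omega> p \<Longrightarrow> f \<in> Lp_sharp \<Omega> (p / (p - 1)) \<Longrightarrow>
    \<bar>\<integral>x. u x * f x \<partial>?M\<bar> \<le> c * Lp_real_norm \<Omega> (p / (p - 1)) f * total_variation \<Omega> u"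
    using poincare_dual[OF \<Omega> p P] by blast
  obtain g where g: "g \<in> Lp_sharp \<Omega> (p / (p - 1))" "\<And>u. u \<in> BV \<Omega> p \<Longrightarrow> \<bar>F (BV_class \<Omega> p u) - (\<integral>x. u x * g x \<partial>?M)\<bar> \<le> 1 * total_variation \<Omega> u"
    using F unfolding SCH_iff[OF \<Omega> p] by (meson zero_less_one)
  define C where "C = c * Lp_real_norm \<Omega> (p / (p - 1)) g + 1"
  have C0: "C \<ge> 0" using c by (simp add: C_def Lp_real_norm_def)
  have b: "\<bar>F (BV_class \<Omega> p u)\<bar> \<le> C * total_variation \<Omega> u" if "u \<in> BV \<Omega> p" for u
    using c(2)[OF that g(1)] g(2)[OF that] by (simp add: C_def distrib_right)
  have bdd: "bdd_above ((\<lambda>u. \<bar>F (BV_class \<Omega> p u)\<bar>) ` {u \<in> BV \<Omega> p. total_variation \<Omega> u \<le> 1})"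
  proof (rule bdd_aboveI2)
    fix u assume u: "u \<in> {u \<in> BV \<Omega> p. total_variation \<Omega> u \<le> 1}"
    then have "C * total_variation \<Omega> u \<le> C * 1" using C0 by (intro mult_left_mono) auto
    then show "\<bar>F (BV_class \<Omega> p u)\<bar> \<le> C" using b[of u] u by simp
  qed
  have up: "\<bar>F (BV_class \<Omega> p u)\<bar> \<le> SCH_norm \<Omega> p F" if "u \<in> BV \<Omega> p" "total_variation \<Omega> u \<le> 1" for u
    unfolding SCH_norm_def by (rule cSUP_upper[OF _ bdd]) (use that in auto)
  have "tv_bounded \<Omega> (\<lambda>x. 0) 0" by (simp add: tv_bounded_def)
  from tv_boundedD(1)[OF this \<Omega>(2)] show n: "SCH_norm \<Omega> p F \<ge> 0"
    using up[OF BV_zero[OF \<Omega>(1) p1]] abs_ge_zero order_trans by force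
  show "\<bar>F (BV_class \<Omega> p u)\<bar> \<le> SCH_norm \<Omega> p F * total_variation \<Omega> u" if u: "u \<in> BV \<Omega> p"
  \<comment> \<open>A function of zero variation cannot be rescaled to the unit ball; the crude
    bound \<open>b\<close> shows that F vanishes on it.\<close>
  proof (cases "total_variation \<Omega> u = 0")
    case True
    then show ?thesis using b[OF u] by simp
  next
    case False
    then have V: "total_variation \<Omega> u > 0" using tv_nonneg[OF \<Omega> p1 u] by simp
    let ?c = "inverse (total_variation \<Omega> u)"
    have "total_variation \<Omega> (\<lambda>x. ?c * u x) \<le> 1" using tv_cmult_le[OF \<Omega> p1 u, of ?c] V by simp
    from up[OF BV_cmult[OF \<Omega>(1) p1 u] this] have "?c * \<bar>F (BV_class \<Omega> p u)\<bar> \<le> SCH_norm \<Omega> p F"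
      using V by (simp add: linear_forms_cmult[OF lf u] abs_mult)
    then show ?thesis using V by (simp add: field_simps)
  qed
qed

section \<open>The divergence operator\<close>

text \<open>Polynomials with rational coefficients as syntax trees: countability comes with the
  datatype, and evaluation is visibly compatible with sums and products.\<close>

datatype 'n poly_expr = PConst rat | PVar 'n | PAdd "'n poly_expr" "'n poly_expr" | PMult "'n poly_expr" "'n poly_expr"

instance poly_expr :: (countable) countable
  by countable_datatype

primrec poly_eval :: "'n poly_expr \<Rightarrow> real^'n::finite \<Rightarrow> real" where
  "poly_eval (PConst c) x = of_rat c"
| "poly_eval (PVar i) x = x $ i"
| "poly_eval (PAdd a b) x = poly_eval a x + poly_eval b x"
| "poly_eval (PMult a b) x = poly_eval a x * poly_eval b x"

lemma smooth_poly_eval: "smooth_on UNIV (poly_eval e)"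
proof (induction e)
  case (PConst c)
  then show ?case using smooth_on_const[of UNIV "of_rat c :: real"] by simp
next
  case (PVar i)
  then show ?case using smooth_on_bounded_linear[OF bounded_linear_vec_nth[of i], of UNIV] by simp
next
  case (PAdd a b)
  then show ?case using smooth_on_add[OF open_UNIV PAdd] by simp
next
  case (PMult a b)
  then show ?case using smooth_on_mult[OF open_UNIV PMult] by simp
qed

lemma poly_eval_approx_mult:
  fixes K :: "(real^'n::finite) set"
  assumes K: "compact K" and f: "continuous_on K f" "\<forall>\<epsilon>>0. \<exists>e. \<forall>x\<in>K. \<bar>f x - poly_eval e x\<bar> < \<epsilon>"
    and g: "continuous_on K g" "\<forall>\<epsilon>>0. \<exists>e. \<forall>x\<in>K. \<bar>g x - poly_eval e x\<bar> < \<epsilon>" and \<epsilon>: "\<epsilon> > 0"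
  shows "\<exists>e. \<forall>x\<in>K. \<bar>f x * g x - poly_eval e x\<bar> < \<epsilon>"
proof -
  have "bounded (f ` K)" "bounded (g ` K)" using K f g by (auto intro: compact_imp_bounded compact_continuous_image)
  then obtain A B where A: "\<And>x. x \<in> K \<Longrightarrow> \<bar>f x\<bar> \<le> A" and B: "\<And>x. x \<in> K \<Longrightarrow> \<bar>g x\<bar> \<le> B"
    unfolding bounded_iff by (metis imageI real_norm_def)
  define A' where "A' = max A 0 + 1"
  define B' where "B' = max B 0 + 1"
  have A': "A' \<ge> 1" "\<And>x. x \<in> K \<Longrightarrow> \<bar>f x\<bar> \<le> A'" using A by (fastforce simp: A'_def)+
  have B': "B' \<ge> 1" "\<And>x. x \<in> K \<Longrightarrow> \<bar>g x\<bar> \<le> B'" using B by (fastforce simp: B'_def)+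
  \<comment> \<open>The error of the product is at most d B' + (A' + 1) d, where A' + 1 bounds the
    approximating polynomial because d is at most 1.\<close>
  define d where "d = min 1 (\<epsilon> / (2 * (A' + B' + 1)))"
  have S: "A' + B' + 1 > 0" using A'(1) B'(1) by linarith
  have d: "d > 0" "d \<le> 1" using \<epsilon> S by (auto simp: d_def)
  have "d * (A' + B' + 1) \<le> \<epsilon> / (2 * (A' + B' + 1)) * (A' + B' + 1)"
    using S by (intro mult_right_mono) (auto simp: d_def)
  also have "\<dots> = \<epsilon> / 2"
  proof -
    have "\<epsilon> / (2 * Q) * Q = \<epsilon> / 2" if "Q > 0" for Q :: real using that by simp
    from this[OF S] show ?thesis .
  qed
  finally have dS: "d * (A' + B' + 1) \<le> \<epsilon> / 2" .
  obtain a where a: "\<And>x. x \<in> K \<Longrightarrow> \<bar>f x - poly_eval a x\<bar> < d" using f(2) d(1) by blast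
  obtain b where b: "\<And>x. x \<in> K \<Longrightarrow> \<bar>g x - poly_eval b x\<bar> < d" using g(2) d(1) by blast
  have "\<bar>f x * g x - poly_eval (PMult a b) x\<bar> < \<epsilon>" if x: "x \<in> K" for x
  proof -
    have fa: "\<bar>f x - poly_eval a x\<bar> \<le> d" "\<bar>g x - poly_eval b x\<bar> \<le> d" using a[OF x] b[OF x] by auto
    have pa: "\<bar>poly_eval a x\<bar> \<le> A' + 1" using A'(2)[OF x] fa(1) d(2) by linarith
    have "f x * g x - poly_eval (PMult a b) x = (f x - poly_eval a x) * g x + poly_eval a x * (g x - poly_eval b x)"
      by (simp add: algebra_simps)
    also have "\<bar>\<dots>\<bar> \<le> \<bar>f x - poly_eval a x\<bar> * \<bar>g x\<bar> + \<bar>poly_eval a x\<bar> * \<bar>g x - poly_eval b x\<bar>"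
      by (rule order_trans[OF abs_triangle_ineq]) (simp add: abs_mult)
    also have "\<dots> \<le> d * B' + (A' + 1) * d"
      using fa pa B'(2)[OF x] d(1) A'(1) by (intro add_mono mult_mono) auto
    also have "\<dots> = d * (A' + B' + 1)" by (simp add: algebra_simps)
    also have "\<dots> \<le> \<epsilon> / 2" by (rule dS)
    also have "\<dots> < \<epsilon>" using \<epsilon> by simp
    finally show ?thesis .
  qed
  then show ?thesis by blast
qed

text \<open>Stone-Weierstrass asks for a ring containing all real constants, so it is applied to the
  functions uniformly approximable by rational polynomials; their limits are approximable
  again.\<close>

lemma poly_eval_dense:
  fixes K :: "(real^'n::finite) set"
  assumes K: "compact K" and f: "continuous_on K f" and \<epsilon>: "\<epsilon> > 0"
  obtains e where "\<And>x. x \<in> K \<Longrightarrow> \<bar>f x - poly_eval e x\<bar> < \<epsilon>"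
proof -
  define R where "R = {f. continuous_on K f \<and> (\<forall>\<epsilon>>0. \<exists>e. \<forall>x\<in>K. \<bar>f x - poly_eval e x\<bar> < \<epsilon>)}"
  interpret function_ring_on R K
  proof
    show "compact K" by (rule K)
    show "continuous_on K f" if "f \<in> R" for f using that by (simp add: R_def)
    show "(\<lambda>x. f x + g x) \<in> R" if fg: "f \<in> R" "g \<in> R" for f g
    proof -
      have "\<exists>e. \<forall>x\<in>K. \<bar>f x + g x - poly_eval e x\<bar> < \<epsilon>" if "\<epsilon> > 0" for \<epsilon>
      proof -
        have h: "\<epsilon> / 2 > 0" using that by simp
        have R: "\<forall>\<epsilon>>0. \<exists>e. \<forall>x\<in>K. \<bar>f x - poly_eval e x\<bar> < \<epsilon>" "\<forall>\<epsilon>>0. \<exists>e. \<forall>x\<in>K. \<bar>g x - poly_eval e x\<bar> < \<epsilon>"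
          using fg by (simp_all add: R_def)
        obtain a where a: "\<And>x. x \<in> K \<Longrightarrow> \<bar>f x - poly_eval a x\<bar> < \<epsilon> / 2" using R(1) h by metis
        obtain b where b: "\<And>x. x \<in> K \<Longrightarrow> \<bar>g x - poly_eval b x\<bar> < \<epsilon> / 2" using R(2) h by metis
        have "\<bar>f x + g x - poly_eval (PAdd a b) x\<bar> < \<epsilon>" if "x \<in> K" for x
        proof -
          have "\<bar>f x + g x - poly_eval (PAdd a b) x\<bar> \<le> \<bar>f x - poly_eval a x\<bar> + \<bar>g x - poly_eval b x\<bar>" by simp
          also have "\<dots> < \<epsilon> / 2 + \<epsilon> / 2" by (rule add_strict_mono[OF a[OF that] b[OF that]])
          finally show ?thesis by simp
        qed
        then show ?thesis by blast
      qed
      then show ?thesis using fg by (simp add: R_def continuous_on_add)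
    qed
    show "(\<lambda>x. f x * g x) \<in> R" if fg: "f \<in> R" "g \<in> R" for f g
      using fg poly_eval_approx_mult[OF K, of f g] by (simp add: R_def continuous_on_mult)
    show "(\<lambda>_. c) \<in> R" for c
    proof -
      have "\<exists>e. \<forall>x\<in>K. \<bar>c - poly_eval e x\<bar> < \<epsilon>" if e0: "\<epsilon> > 0" for \<epsilon>
      proof -
        have "c - \<epsilon> < c + \<epsilon>" using e0 by simp
        from of_rat_dense[OF this] obtain r where "c - \<epsilon> < of_rat r" "of_rat r < c + \<epsilon>" by blast
        then have "\<bar>c - of_rat r\<bar> < \<epsilon>" by (simp add: abs_less_iff)
        then show ?thesis by (intro exI[of _ "PConst r"]) simp
      qed
      then show ?thesis by (simp add: R_def)
    qed
    show "\<exists>f\<in>R. f x \<noteq> f y" if xy: "x \<noteq> y" for x y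
    proof -
      obtain i where i: "x $ i \<noteq> y $ i" using xy by (auto simp: vec_eq_iff)
      have "\<exists>e. \<forall>z\<in>K. \<bar>z $ i - poly_eval e z\<bar> < \<epsilon>" if "\<epsilon> > 0" for \<epsilon>
        using that by (intro exI[of _ "PVar i"]) simp
      then have "(\<lambda>z. z $ i) \<in> R" by (simp add: R_def continuous_on_component)
      from bexI[of "\<lambda>f. f x \<noteq> f y", OF i this] show ?thesis .
    qed
  qed
  obtain g where g: "g \<in> R" "\<And>x. x \<in> K \<Longrightarrow> \<bar>f x - g x\<bar> < \<epsilon> / 2"
    using Stone_Weierstrass_basic[OF f, of "\<epsilon> / 2"] \<epsilon> by auto
  have "\<epsilon> / 2 > 0" using \<epsilon> by simp
  moreover have "\<forall>\<epsilon>>0. \<exists>e. \<forall>x\<in>K. \<bar>g x - poly_eval e x\<bar> < \<epsilon>" using g(1) by (simp add: R_def)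
  ultimately obtain e where e: "\<And>x. x \<in> K \<Longrightarrow> \<bar>g x - poly_eval e x\<bar> < \<epsilon> / 2" by metis
  show ?thesis
  proof (rule that[of e])
    fix x assume x: "x \<in> K"
    have "\<bar>f x - poly_eval e x\<bar> \<le> \<bar>f x - g x\<bar> + \<bar>g x - poly_eval e x\<bar>" by simp
    also have "\<dots> < \<epsilon> / 2 + \<epsilon> / 2" by (rule add_strict_mono[OF g(2)[OF x] e[OF x]])
    finally show "\<bar>f x - poly_eval e x\<bar> < \<epsilon>" by simp
  qed
qed

text \<open>The dense set consists of cut-offs times fields with rational polynomial components. As
  these are test fields, density of \<open>test_functions\<close> in \<open>C0_fields\<close> comes
  with separability; the divergence operator relies on the former, the selection argument on the
  latter.\<close>

lemma C0_separable:
  fixes \<Omega> :: "(real^'n::finite) set"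
  assumes \<Omega>: "open \<Omega>"
  obtains D where "countable D" "D \<subseteq> test_functions \<Omega>"
    "\<And>v \<epsilon>. v \<in> C0_fields \<Omega> \<Longrightarrow> \<epsilon> > 0 \<Longrightarrow> \<exists>w\<in>D. \<forall>x. norm (v x - w x) \<le> \<epsilon>"
proof -
  obtain K :: "nat \<Rightarrow> (real^'n) set" and \<kappa> :: "nat \<Rightarrow> real^'n \<Rightarrow> real" where
    K: "\<And>n. compact (K n)" "\<And>n. K n \<subseteq> \<Omega>" "\<And>n. K n \<subseteq> interior (K (Suc n))"
    "\<And>L. compact L \<Longrightarrow> L \<subseteq> \<Omega> \<Longrightarrow> \<exists>N. \<forall>n\<ge>N. L \<subseteq> K n"
    and \<kappa>: "\<And>n. \<kappa> n \<in> test_functions (interior (K (Suc n)))" "\<And>n x. 0 \<le> \<kappa> n x" "\<And>n x. \<kappa> n x \<le> 1"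
    "\<And>n x. x \<in> K n \<Longrightarrow> \<kappa> n x = 1"
    by (rule exhaustion_cutoffs[OF \<Omega>]) (erule that)
  have \<kappa>\<Omega>: "\<kappa> n \<in> test_functions \<Omega>" for n
    using test_mono[OF \<kappa>(1)] interior_subset K(2) by (meson order_trans)
  define P where "P n es x = \<kappa> n x *\<^sub>R (\<chi> i. poly_eval (es i) x)" for n and es :: "'n \<Rightarrow> 'n poly_expr" and x
  define D where "D = range (\<lambda>(n, es). P n es)"
  have Pt: "P n es \<in> test_functions \<Omega>" for n es
    unfolding P_def
  proof (rule test_smooth_scaleR[OF \<kappa>\<Omega>])
    show "smooth_on UNIV (\<lambda>x. \<chi> i. poly_eval (es i) x)"
      by (rule smooth_on_vec[OF open_UNIV]) (simp add: smooth_poly_eval)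
  qed
  show ?thesis
  proof (rule that[of D])
    show "countable D" by (simp add: D_def)
    show "D \<subseteq> test_functions \<Omega>" using Pt by (auto simp: D_def)
    fix v :: "real^'n \<Rightarrow> real^'n" and \<epsilon> :: real assume v: "v \<in> C0_fields \<Omega>" and \<epsilon>: "\<epsilon> > 0"
    obtain L where L: "compact L" "L \<subseteq> \<Omega>" "\<And>x. x \<in> \<Omega> - L \<Longrightarrow> norm (v x) < \<epsilon> / 2"
      using v \<epsilon> unfolding C0_fields_def by (auto dest!: spec[of _ "\<epsilon> / 2"])
    obtain N where N: "L \<subseteq> K N" using K(4)[OF L(1,2)] by auto
    \<comment> \<open>The Euclidean norm is bounded by the sum over the coordinates, so each may
      contribute \<epsilon> / 2 divided by their number.\<close>
    define \<delta> where "\<delta> = \<epsilon> / (2 * real CARD('n))"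
    have \<delta>: "\<delta> > 0" using \<epsilon> by (simp add: \<delta>_def)
    \<comment> \<open>The approximation must be good wherever the cut-off can be nonzero, that is on
      \<open>K (Suc N)\<close>, and not only on L. Between \<open>K N\<close> and
      \<open>K (Suc N)\<close> the field v is small already.\<close>
    have "continuous_on (K (Suc N)) (\<lambda>x. v x $ i)" for i
      using v K(2) by (auto simp: C0_fields_def intro!: continuous_on_component intro: continuous_on_subset)
    then have "\<exists>e. \<forall>x\<in>K (Suc N). \<bar>v x $ i - poly_eval e x\<bar> < \<delta>" for i
      using poly_eval_dense[OF K(1) _ \<delta>] by metis
    then obtain es where es: "\<And>i x. x \<in> K (Suc N) \<Longrightarrow> \<bar>v x $ i - poly_eval (es i) x\<bar> < \<delta>" by metis
    have "norm (v x - P N es x) \<le> \<epsilon>" for x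
    proof -
      let ?p = "\<chi> i. poly_eval (es i) x"
      have "v x - P N es x = \<kappa> N x *\<^sub>R (v x - ?p) + (1 - \<kappa> N x) *\<^sub>R v x" by (simp add: P_def algebra_simps)
      then have "norm (v x - P N es x) \<le> \<kappa> N x * norm (v x - ?p) + (1 - \<kappa> N x) * norm (v x)"
        using norm_triangle_ineq[of "\<kappa> N x *\<^sub>R (v x - ?p)" "(1 - \<kappa> N x) *\<^sub>R v x"] \<kappa>(2,3)[of N x] by simp
      moreover have "\<kappa> N x * norm (v x - ?p) \<le> \<epsilon> / 2"
      proof (cases "x \<in> K (Suc N)")
        case True
        have "norm (v x - ?p) \<le> (\<Sum>i\<in>UNIV. \<bar>(v x - ?p) $ i\<bar>)" by (rule norm_le_l1_cart)
        also have "\<dots> \<le> (\<Sum>i\<in>(UNIV::'n set). \<delta>)" using es[OF True] by (intro sum_mono) (simp add: less_imp_le)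
        also have "\<dots> = \<epsilon> / 2" by (simp add: \<delta>_def)
        finally have "\<kappa> N x * norm (v x - ?p) \<le> 1 * (\<epsilon> / 2)" using \<kappa>(2,3)[of N x] by (intro mult_mono) auto
        then show ?thesis by simp
      next
        case False
        then have "\<kappa> N x = 0" using \<kappa>(1)[of N] interior_subset[of "K (Suc N)"] by (metis subsetD test_functionsE)
        then show ?thesis using \<epsilon> by simp
      qed
      moreover have "(1 - \<kappa> N x) * norm (v x) \<le> \<epsilon> / 2"
      proof (cases "x \<in> K N")
        case True
        then show ?thesis using \<kappa>(4)[OF True] \<epsilon> by simp
      next
        case False
        then have "x \<notin> L" using N by blast
        then have "norm (v x) \<le> \<epsilon> / 2" using L(3)[of x] C0_outside[OF v, of x] \<epsilon> by (cases "x \<in> \<Omega>") auto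
        then have "(1 - \<kappa> N x) * norm (v x) \<le> 1 * (\<epsilon> / 2)" using \<kappa>(2,3)[of N x] by (intro mult_mono) auto
        then show ?thesis by simp
      qed
      ultimately show ?thesis using field_sum_of_halves[of \<epsilon>] by linarith
    qed
    moreover have "P N es \<in> D" by (auto simp: D_def)
    ultimately show "\<exists>w\<in>D. \<forall>x. norm (v x - w x) \<le> \<epsilon>" by blast
  qed
qed

section \<open>The divergence of a field is a charge\<close>

lemma C0_diff:
  assumes "v \<in> C0_fields \<Omega>" "w \<in> C0_fields \<Omega>" shows "(\<lambda>x. v x - w x) \<in> C0_fields \<Omega>"
  using C0_linear[OF assms, of 1 "- 1"] by simp

text \<open>For test fields this is the definition of the total variation. A general field is within
  d of a test field, and the crude constant C is multiplied by d only, so it disappears as d tends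
  to 0.\<close>

lemma deriv_pairing_le:
  assumes \<Omega>: "open \<Omega>" "\<Omega> \<noteq> {}" and p: "p \<ge> 1" and u: "u \<in> BV \<Omega> p" and v: "v \<in> C0_fields \<Omega>" "\<And>x. norm (v x) \<le> r"
  shows "\<bar>deriv_pairing \<Omega> u v\<bar> \<le> r * total_variation \<Omega> u"
proof -
  let ?V = "total_variation \<Omega> u"
  obtain D where D: "D \<subseteq> test_functions \<Omega>" "\<And>v \<epsilon>. v \<in> C0_fields \<Omega> \<Longrightarrow> \<epsilon> > 0 \<Longrightarrow> \<exists>w\<in>D. \<forall>x. norm (v x - w x) \<le> \<epsilon>"
    using C0_separable[OF \<Omega>(1)] by metis
  obtain C where C: "C \<ge> 0" "\<And>v B. v \<in> C0_fields \<Omega> \<Longrightarrow> (\<And>x. norm (v x) \<le> B) \<Longrightarrow> \<bar>deriv_pairing \<Omega> u v\<bar> \<le> C * B"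
    using deriv_pairing_bound[OF \<Omega>(1) u] by metis
  have V: "?V \<ge> 0" by (rule tv_nonneg[OF \<Omega> p u])
  have "\<bar>deriv_pairing \<Omega> u v\<bar> \<le> r * ?V + e" if e: "e > 0" for e
  proof -
    define d where "d = e / (C + ?V + 1)"
    have d: "d > 0" "d * (C + ?V) \<le> e" using e C(1) V by (auto simp: d_def field_simps add_nonneg_pos)
    obtain w where w: "w \<in> D" "\<And>x. norm (v x - w x) \<le> d" using D(2)[OF v(1) d(1)] by blast
    have wt: "w \<in> test_functions \<Omega>" using w D by blast
    have "norm (w x) \<le> r + d" for x
      using norm_triangle_ineq4[of "v x" "v x - w x"] v(2)[of x] w(2)[of x] by simp
    from tv_scaled[OF \<Omega> p BV_Lp[OF u] BV_tv_bounded[OF \<Omega> p u] wt this]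
    have 1: "\<bar>deriv_pairing \<Omega> u w\<bar> \<le> (r + d) * ?V" using deriv_pairing_test[OF \<Omega>(1) p u wt] by simp
    have 2: "\<bar>deriv_pairing \<Omega> u (\<lambda>x. v x - w x)\<bar> \<le> C * d" by (rule C(2)[OF C0_diff[OF v(1) test_C0[OF wt]] w(2)])
    have "deriv_pairing \<Omega> u (\<lambda>x. v x - w x) = deriv_pairing \<Omega> u v - deriv_pairing \<Omega> u w"
      using deriv_pairing_linear[OF \<Omega>(1) u v(1) test_C0[OF wt], of 1 "- 1"] by simp
    then have "\<bar>deriv_pairing \<Omega> u v\<bar> \<le> (r + d) * ?V + C * d" using 1 2 by linarith
    also have "\<dots> = r * ?V + d * (C + ?V)" by (simp add: algebra_simps)
    also have "\<dots> \<le> r * ?V + e" using d(2) by simp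
    finally show ?thesis .
  qed
  then show ?thesis by (rule field_le_epsilon)
qed

lemma deriv_pairing_add:
  assumes "open \<Omega>" "p \<ge> 1" "u \<in> BV \<Omega> p" "w \<in> BV \<Omega> p" "v \<in> C0_fields \<Omega>"
  shows "deriv_pairing \<Omega> (\<lambda>x. u x + w x) v = deriv_pairing \<Omega> u v + deriv_pairing \<Omega> w v"
proof -
  obtain B where B: "\<And>x. norm (v x) \<le> B" using C0_bounded[OF assms(5)] by metis
  have "signed_integral \<Omega> (weak_deriv \<Omega> i (\<lambda>x. u x + w x)) (\<lambda>x. v x $ i) =
    signed_integral \<Omega> (weak_deriv \<Omega> i u) (\<lambda>x. v x $ i) + signed_integral \<Omega> (weak_deriv \<Omega> i w) (\<lambda>x. v x $ i)" for i
    unfolding weak_deriv_eqI[OF assms(1) is_weak_deriv_add[OF assms(1,2) BV_Lp[OF assms(3)] BV_Lp[OF assms(4)]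
        weak_deriv[OF assms(1,3)] weak_deriv[OF assms(1,4)]]]
    by (rule signed_integral_add_measure[OF weak_deriv_signed[OF assms(1,3)] weak_deriv_signed[OF assms(1,4)] C0_component_borel[OF assms(5)]])
      (rule order_trans[OF component_le_norm_cart B])
  then show ?thesis by (simp add: deriv_pairing_def sum.distrib)
qed

lemma deriv_pairing_cmult:
  assumes "open \<Omega>" "u \<in> BV \<Omega> p" "v \<in> C0_fields \<Omega>"
  shows "deriv_pairing \<Omega> (\<lambda>x. c * u x) v = c * deriv_pairing \<Omega> u v"
proof -
  obtain B where B: "\<And>x. norm (v x) \<le> B" using C0_bounded[OF assms(3)] by metis
  have "signed_integral \<Omega> (weak_deriv \<Omega> i (\<lambda>x. c * u x)) (\<lambda>x. v x $ i) = c * signed_integral \<Omega> (weak_deriv \<Omega> i u) (\<lambda>x. v x $ i)" for i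
    unfolding weak_deriv_eqI[OF assms(1) is_weak_deriv_cmult[OF weak_deriv[OF assms(1,2)]]]
    by (rule signed_integral_cmult_measure[OF weak_deriv_signed[OF assms(1,2)] C0_component_borel[OF assms(3)]])
      (rule order_trans[OF component_le_norm_cart B])
  then show ?thesis by (simp add: deriv_pairing_def sum_distrib_left)
qed

text \<open>If w is a test field within e of v, the function \<open>divergence w\<close> has mean
  zero and lies in L_q, and by the sharp bound on the pairing it represents the divergence of v up
  to e times the total variation. This is the criterion of \<open>SCH_iff\<close>.\<close>

lemma div_op_SCH:
  assumes \<Omega>: "open \<Omega>" "\<Omega> \<noteq> {}" and p: "p > 1" and v: "v \<in> C0_fields \<Omega>"
  shows "div_op \<Omega> p v \<in> SCH \<Omega> p"
  unfolding SCH_iff[OF \<Omega> p]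
proof (intro conjI allI impI)
  have p1: "p \<ge> 1" using p by simp
  note dc = div_op_class[OF \<Omega>(1) p1]
  show "div_op \<Omega> p v \<in> linear_forms \<Omega> p"
    unfolding linear_forms_def mem_Collect_eq
  proof (intro conjI ballI allI impI)
    fix u w assume uw: "u \<in> BV \<Omega> p" "w \<in> BV \<Omega> p"
    show "div_op \<Omega> p v (BV_class \<Omega> p (\<lambda>x. u x + w x)) = div_op \<Omega> p v (BV_class \<Omega> p u) + div_op \<Omega> p v (BV_class \<Omega> p w)"
      unfolding dc[OF uw(1)] dc[OF uw(2)] dc[OF BV_add[OF \<Omega>(1) p1 uw]] deriv_pairing_add[OF \<Omega>(1) p1 uw v] by simp
  next
    fix a u assume u: "u \<in> BV \<Omega> p"
    show "div_op \<Omega> p v (BV_class \<Omega> p (\<lambda>x. a * u x)) = a * div_op \<Omega> p v (BV_class \<Omega> p u)"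
      unfolding dc[OF u] dc[OF BV_cmult[OF \<Omega>(1) p1 u]] deriv_pairing_cmult[OF \<Omega>(1) u v] by simp
  next
    fix X assume "X \<notin> BV_cst \<Omega> p"
    then show "div_op \<Omega> p v X = 0" by (simp add: div_op_def)
  qed
  fix e :: real assume e: "e > 0"
  obtain D where D: "D \<subseteq> test_functions \<Omega>" "\<And>v \<epsilon>. v \<in> C0_fields \<Omega> \<Longrightarrow> \<epsilon> > 0 \<Longrightarrow> \<exists>w\<in>D. \<forall>x. norm (v x - w x) \<le> \<epsilon>"
    using C0_separable[OF \<Omega>(1)] by metis
  obtain w where w: "w \<in> D" "\<And>x. norm (v x - w x) \<le> e" using D(2)[OF v e] by blast
  have wt: "w \<in> test_functions \<Omega>" using w D by blast
  have q0: "p / (p - 1) > 0" using p by simp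
  show "\<exists>g\<in>Lp_sharp \<Omega> (p / (p - 1)). \<forall>u\<in>BV \<Omega> p.
      \<bar>div_op \<Omega> p v (BV_class \<Omega> p u) - (\<integral>x. u x * g x \<partial>lebesgue_on \<Omega>)\<bar> \<le> e * total_variation \<Omega> u"
  proof (rule bexI[OF _ test_Lp_sharp[OF \<Omega>(1) q0 test_divergence[OF wt] integral_divergence[OF wt]]], rule ballI)
    fix u assume u: "u \<in> BV \<Omega> p"
    have "deriv_pairing \<Omega> u (\<lambda>x. v x - w x) = deriv_pairing \<Omega> u v - deriv_pairing \<Omega> u w"
      using deriv_pairing_linear[OF \<Omega>(1) u v test_C0[OF wt], of 1 "- 1"] by simp
    moreover have "\<bar>deriv_pairing \<Omega> u (\<lambda>x. v x - w x)\<bar> \<le> e * total_variation \<Omega> u"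
      by (rule deriv_pairing_le[OF \<Omega> p1 u C0_diff[OF v test_C0[OF wt]] w(2)])
    ultimately show "\<bar>div_op \<Omega> p v (BV_class \<Omega> p u) - (\<integral>x. u x * divergence w x \<partial>lebesgue_on \<Omega>)\<bar> \<le> e * total_variation \<Omega> u"
      unfolding dc[OF u] using deriv_pairing_test[OF \<Omega>(1) p1 u wt] by (simp add: abs_minus_commute)
  qed
qed

lemma div_op_linear:
  assumes \<Omega>: "open \<Omega>" and p: "p \<ge> 1" and v: "v \<in> C0_fields \<Omega>" and w: "w \<in> C0_fields \<Omega>"
  shows "div_op \<Omega> p (\<lambda>x. a *\<^sub>R v x + b *\<^sub>R w x) = (\<lambda>X. a * div_op \<Omega> p v X + b * div_op \<Omega> p w X)"
proof
  fix X
  show "div_op \<Omega> p (\<lambda>x. a *\<^sub>R v x + b *\<^sub>R w x) X = a * div_op \<Omega> p v X + b * div_op \<Omega> p w X"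
  proof (cases "X \<in> BV_cst \<Omega> p")
    case True
    then obtain u where u: "u \<in> BV \<Omega> p" "X = BV_class \<Omega> p u" by (rule BV_cst_cases)
    show ?thesis unfolding u(2) div_op_class[OF \<Omega> p u(1)] deriv_pairing_linear[OF \<Omega> u(1) v w] by simp
  qed (simp add: div_op_def)
qed

lemma div_op_norm_le:
  assumes \<Omega>: "open \<Omega>" "\<Omega> \<noteq> {}" and p: "p > 1" and v: "v \<in> C0_fields \<Omega>"
  shows "SCH_norm \<Omega> p (div_op \<Omega> p v) \<le> sup_norm \<Omega> v"
proof (rule SCH_norm_least[OF \<Omega> p sup_norm_upper(2)[OF v \<Omega>(2)]])
  have p1: "p \<ge> 1" using p by simp
  fix u assume u: "u \<in> BV \<Omega> p"
  show "\<bar>div_op \<Omega> p v (BV_class \<Omega> p u)\<bar> \<le> sup_norm \<Omega> v * total_variation \<Omega> u"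
    using deriv_pairing_le[OF \<Omega> p1 u v sup_norm_upper(1)[OF v \<Omega>(2)]] by (simp add: div_op_class[OF \<Omega>(1) p1 u])
qed

text \<open>Half of the error is spent on replacing F by a function g, the other half on replacing g
  by a divergence. The norm of the field is controlled because g inherits from F, up to \<delta>,
  the bound that density of divergences asks for.\<close>

lemma approximate_lifting:
  fixes \<Omega> :: "(real^'n::finite) set"
  assumes \<Omega>: "open \<Omega>" "\<Omega> \<noteq> {}" and p: "p > 1" and q2: "p / (p - 1) \<ge> 2" and P: "poincare \<Omega> p"
    and F: "F \<in> SCH \<Omega> p" and \<delta>: "\<delta> > 0"
  obtains v where "v \<in> C0_fields \<Omega>" "sup_norm \<Omega> v \<le> SCH_norm \<Omega> p F + \<delta>"
    "SCH_norm \<Omega> p (\<lambda>X. F X - div_op \<Omega> p v X) \<le> \<delta>"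
proof -
  let ?M = "lebesgue_on \<Omega>"
  have p1: "p \<ge> 1" using p by simp
  obtain c where c: "c > 0" "\<And>u f. u \<in> BV \<Omega> p \<Longrightarrow> f \<in> Lp_sharp \<Omega> (p / (p - 1)) \<Longrightarrow>
    \<bar>\<integral>x. u x * f x \<partial>?M\<bar> \<le> c * Lp_real_norm \<Omega> (p / (p - 1)) f * total_variation \<Omega> u"
    using poincare_dual[OF \<Omega> p P] by blast
  have \<delta>2: "\<delta> / 2 > 0" using \<delta> by simp
  obtain g where g: "g \<in> Lp_sharp \<Omega> (p / (p - 1))" "\<And>u. u \<in> BV \<Omega> p \<Longrightarrow>
    \<bar>F (BV_class \<Omega> p u) - (\<integral>x. u x * g x \<partial>?M)\<bar> \<le> \<delta> / 2 * total_variation \<Omega> u"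
    using F \<delta>2 unfolding SCH_iff[OF \<Omega> p] by blast
  have gL: "g \<in> Lp_space \<Omega> (p / (p - 1))" using g by (simp add: Lp_sharp_def)
  \<comment> \<open>The summand \<delta> absorbs the passage from F to g and makes r positive even
    for F = 0, as \<open>dual_density\<close> requires.\<close>
  define r where "r = SCH_norm \<Omega> p F + \<delta>"
  have r: "r > 0" using SCH_norm_upper(2)[OF \<Omega> p P F] \<delta> by (simp add: r_def)
  have gV: "\<bar>\<integral>x. u x * g x \<partial>?M\<bar> \<le> r * total_variation \<Omega> u" if u: "u \<in> BV \<Omega> p" for u
  proof -
    have "\<delta> / 2 * total_variation \<Omega> u \<le> \<delta> * total_variation \<Omega> u"
      using \<delta> tv_nonneg[OF \<Omega> p1 u] by (intro mult_right_mono) auto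
    then show ?thesis using g(2)[OF u] SCH_norm_upper(1)[OF \<Omega> p P F u] unfolding r_def distrib_right by linarith
  qed
  \<comment> \<open>Chosen so that the dual Poincare inequality with constant c turns the L_q error
    into \<delta> / 2.\<close>
  have "\<delta> / (2 * c) > 0" using \<delta> c by simp
  from dual_density[OF \<Omega> p q2 gL r gV this]
  obtain v where v: "v \<in> test_functions \<Omega>" "\<And>x. norm (v x) \<le> r"
    "Lp_real_norm \<Omega> (p / (p - 1)) (\<lambda>x. g x - divergence v x) < \<delta> / (2 * c)" by blast
  have q0: "p / (p - 1) > 0" "p / (p - 1) \<ge> 1" using q2 by auto
  have dS: "divergence v \<in> Lp_sharp \<Omega> (p / (p - 1))"
    by (rule test_Lp_sharp[OF \<Omega>(1) q0(1) test_divergence[OF v(1)] integral_divergence[OF v(1)]])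
  then have dL: "divergence v \<in> Lp_space \<Omega> (p / (p - 1))" by (simp add: Lp_sharp_def)
  have gd: "(\<lambda>x. g x - divergence v x) \<in> Lp_sharp \<Omega> (p / (p - 1))"
    using Lp_sharp_linear[OF q0(2) \<Omega>(1) g(1) dS, of 1 "- 1"] by simp
  show ?thesis
  proof (rule that[of v])
    show "v \<in> C0_fields \<Omega>" by (rule test_C0[OF v(1)])
    show "sup_norm \<Omega> v \<le> SCH_norm \<Omega> p F + \<delta>" using sup_norm_least[OF \<Omega>(2) v(2)] by (simp add: r_def)
    show "SCH_norm \<Omega> p (\<lambda>X. F X - div_op \<Omega> p v X) \<le> \<delta>"
    proof (rule SCH_norm_least[OF \<Omega> p])
      show "\<delta> \<ge> 0" using \<delta> by simp
      fix u assume u: "u \<in> BV \<Omega> p"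
      have V: "total_variation \<Omega> u \<ge> 0" by (rule tv_nonneg[OF \<Omega> p1 u])
      have "div_op \<Omega> p v (BV_class \<Omega> p u) = (\<integral>x. u x * divergence v x \<partial>?M)"
        by (simp add: div_op_class[OF \<Omega>(1) p1 u] deriv_pairing_test[OF \<Omega>(1) p1 u v(1)])
      moreover have "(\<integral>x. u x * (g x - divergence v x) \<partial>?M) = (\<integral>x. u x * g x \<partial>?M) - (\<integral>x. u x * divergence v x \<partial>?M)"
        using holder(1)[OF p BV_Lp[OF u] gL] holder(1)[OF p BV_Lp[OF u] dL] by (simp add: right_diff_distrib)
      moreover have "\<bar>\<integral>x. u x * (g x - divergence v x) \<partial>?M\<bar> \<le> \<delta> / 2 * total_variation \<Omega> u"
      proof -
        have "c * Lp_real_norm \<Omega> (p / (p - 1)) (\<lambda>x. g x - divergence v x) \<le> c * (\<delta> / (2 * c))"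
          using v(3) c(1) by (intro mult_left_mono) auto
        also have "\<dots> = \<delta> / 2" using c(1) by simp
        finally show ?thesis using c(2)[OF u gd] V by (meson mult_right_mono order_trans)
      qed
      ultimately have "\<bar>F (BV_class \<Omega> p u) - div_op \<Omega> p v (BV_class \<Omega> p u)\<bar> \<le> \<delta> / 2 * total_variation \<Omega> u + \<delta> / 2 * total_variation \<Omega> u"
        using g(2)[OF u] by linarith
      then show "\<bar>F (BV_class \<Omega> p u) - div_op \<Omega> p v (BV_class \<Omega> p u)\<bar> \<le> \<delta> * total_variation \<Omega> u"
        by (simp add: distrib_right[symmetric])
    qed
  qed
qed

section \<open>Continuous right inverses\<close>

lemma weierstrass_continuous:
  fixes f :: "nat \<Rightarrow> 'a::topological_space \<Rightarrow> 'b::banach"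
  assumes "\<And>n. continuous_on A (f n)" "\<And>n x. x \<in> A \<Longrightarrow> norm (f n x) \<le> M n" "summable M"
  shows "continuous_on A (\<lambda>x. \<Sum>n. f n x)"
proof (rule uniform_limit_theorem)
  show "uniform_limit A (\<lambda>n x. \<Sum>i<n. f i x) (\<lambda>x. \<Sum>n. f n x) sequentially"
    by (rule Weierstrass_m_test[OF assms(2,3)])
  show "\<forall>\<^sub>F n in sequentially. continuous_on A (\<lambda>x. \<Sum>i<n. f i x)"
    by (intro always_eventually allI continuous_on_sum assms(1))
qed simp

lemma closed_subspace_sums:
  fixes X :: "'a::real_normed_vector set"
  assumes "subspace X" "closed X" "\<And>n. f n \<in> X" "f sums s"
  shows "s \<in> X"
  by (rule closed_sequentially[OF assms(2) _ assms(4)[unfolded sums_def]]) (intro subspace_sum assms(1,3))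

text \<open>The abstract situation of the selection theorem. \<open>lift\<close> is solvability up
  to an arbitrary absolute error, at a cost exceeding the norm arbitrarily little; \<open>D\<close>
  is a countable dense subset of \<open>X\<close>. \<open>Y\<close> is a subspace of a larger normed
  type since it will be the image of the charges.\<close>

locale approximate_lifting_setup =
  fixes X :: "'a::banach set" and Y :: "'b::real_normed_vector set" and T :: "'a \<Rightarrow> 'b" and D :: "'a set"
  assumes X: "subspace X" "closed X" and Y: "subspace Y"
    and T_linear: "\<And>x y a b. x \<in> X \<Longrightarrow> y \<in> X \<Longrightarrow> T (a *\<^sub>R x + b *\<^sub>R y) = a *\<^sub>R T x + b *\<^sub>R T y"
    and T_in: "\<And>x. x \<in> X \<Longrightarrow> T x \<in> Y"
    and T_norm: "\<And>x. x \<in> X \<Longrightarrow> norm (T x) \<le> norm x"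
    and D: "countable D" "D \<subseteq> X" "\<And>x e. x \<in> X \<Longrightarrow> e > 0 \<Longrightarrow> \<exists>d\<in>D. norm (x - d) \<le> e"
    and lift: "\<And>y e. y \<in> Y \<Longrightarrow> e > 0 \<Longrightarrow> \<exists>x\<in>X. norm x \<le> norm y + e \<and> norm (y - T x) \<le> e"
begin

lemma T_scale: "x \<in> X \<Longrightarrow> T (a *\<^sub>R x) = a *\<^sub>R T x"
  using T_linear[of x x a 0] by simp

lemma T_diff: "x \<in> X \<Longrightarrow> y \<in> X \<Longrightarrow> T (x - y) = T x - T y"
  using T_linear[of x y 1 "- 1"] by simp

lemma T_add: "x \<in> X \<Longrightarrow> y \<in> X \<Longrightarrow> T (x + y) = T x + T y"
  using T_linear[of x y 1 1] by simp

lemma T_zero: "T 0 = 0"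
  using T_scale[of 0 0] subspace_0[OF X(1)] by simp

lemma T_sum: "(\<And>i. i \<in> I \<Longrightarrow> f i \<in> X) \<Longrightarrow> T (\<Sum>i\<in>I. f i) = (\<Sum>i\<in>I. T (f i))"
proof (induction I rule: infinite_finite_induct)
  case (insert i I)
  then show ?case using T_add[of "f i" "\<Sum>i\<in>I. f i"] subspace_sum[OF X(1), of I f] by simp
qed (auto simp: T_zero)

lemma T_continuous: "continuous_on X T"
  unfolding continuous_on_iff
proof (intro ballI allI impI)
  fix x and e :: real assume x: "x \<in> X" "e > 0"
  have "dist (T y) (T x) \<le> dist y x" if "y \<in> X" for y
    using T_norm[of "y - x"] subspace_diff[OF X(1) that x(1)] T_diff[OF that x(1)] by (simp add: dist_norm)
  then show "\<exists>d>0. \<forall>y\<in>X. dist y x < d \<longrightarrow> dist (T y) (T x) < e" using x(2) le_less_trans by blast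
qed

lemma T_sums:
  assumes "\<And>n. f n \<in> X" "f sums s"
  shows "(\<lambda>n. T (f n)) sums T s"
proof -
  have s: "s \<in> X" by (rule closed_subspace_sums[OF X assms])
  have "(\<lambda>N. T (\<Sum>n<N. f n)) \<longlonglongrightarrow> T s"
    by (rule continuous_on_tendsto_compose[OF T_continuous assms(2)[unfolded sums_def] s])
      (intro always_eventually allI subspace_sum X assms(1))
  then show ?thesis unfolding sums_def using T_sum[of _ f] assms(1) by simp
qed

text \<open>
  By separability, a countable weighted average of the points of \<open>D\<close> with image near \<open>y\<close> replaces
  the partition of unity of Bartle and Graves.
\<close>

lemma unit_selection:
  assumes \<delta>: "\<delta> > 0"
  obtains S where "continuous_on {y \<in> Y. norm y = 1} S"
    "\<And>y. y \<in> Y \<Longrightarrow> norm y = 1 \<Longrightarrow> S y \<in> X \<and> norm (S y) \<le> 1 + \<delta> \<and> norm (y - T (S y)) \<le> \<delta>"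
proof -
  let ?U = "{y \<in> Y. norm y = 1}"
  have Dne: "D \<noteq> {}" using D(3)[OF subspace_0[OF X(1)], of 1] by auto
  define v where "v = from_nat_into D"
  have vX: "v n \<in> X" for n using from_nat_into[OF Dne, of n] D(2) by (auto simp: v_def)
  \<comment> \<open>The two factors vanish unless v_n nearly solves the equation for y and has
    admissible norm, so only good points enter the average; they are continuous in y. The power of
    1/2 makes all series converge uniformly.\<close>
  define \<alpha> where "\<alpha> n y = (1/2) ^ n * (max 0 (\<delta> - norm (y - T (v n))) * max 0 (1 + \<delta> - norm (v n)))" for n y
  have \<alpha>0: "\<alpha> n y \<ge> 0" for n y by (simp add: \<alpha>_def)
  have \<alpha>v: "norm (v n) \<le> 1 + \<delta>" "norm (y - T (v n)) \<le> \<delta>" if "\<alpha> n y \<noteq> 0" for n y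
    using that by (auto simp: \<alpha>_def max_def split: if_splits)
  define C where "C = \<delta> * (1 + \<delta>)"
  have C: "C \<ge> 0" using \<delta> by (simp add: C_def)
  have \<alpha>C: "\<alpha> n y \<le> C * (1/2) ^ n" for n y
  proof -
    have "max 0 (\<delta> - norm (y - T (v n))) * max 0 (1 + \<delta> - norm (v n)) \<le> \<delta> * (1 + \<delta>)"
      using \<delta> by (intro mult_mono) auto
    then show ?thesis by (simp add: \<alpha>_def C_def mult.commute mult_left_mono)
  qed
  have sM: "summable (\<lambda>n. C * (1/2) ^ n)" "summable (\<lambda>n. C * (1 + \<delta>) * (1/2) ^ n)"
    by (intro summable_mult summable_geometric; simp)+
  have \<alpha>n: "norm (\<alpha> n y) \<le> C * (1/2) ^ n" for n y using \<alpha>C[of n y] \<alpha>0[of n y] by simp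
  have \<alpha>vn: "norm (\<alpha> n y *\<^sub>R v n) \<le> C * (1 + \<delta>) * (1/2) ^ n" for n y
  proof (cases "\<alpha> n y = 0")
    case True
    then show ?thesis using C \<delta> by simp
  next
    case False
    have "norm (\<alpha> n y *\<^sub>R v n) = \<alpha> n y * norm (v n)" using \<alpha>0 by simp
    also have "\<dots> \<le> (C * (1/2) ^ n) * (1 + \<delta>)" using \<alpha>C \<alpha>0 \<alpha>v(1)[OF False] C by (intro mult_mono) auto
    finally show ?thesis by (simp add: mult_ac)
  qed
  have \<alpha>cont: "continuous_on A (\<alpha> n)" for n A unfolding \<alpha>_def by (intro continuous_intros)
  define \<sigma> where "\<sigma> y = (\<Sum>n. \<alpha> n y)" for y
  define m where "m y = (\<Sum>n. \<alpha> n y *\<^sub>R v n)" for y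
  have \<sigma>c: "continuous_on ?U \<sigma>" unfolding \<sigma>_def by (rule weierstrass_continuous[OF \<alpha>cont \<alpha>n sM(1)])
  have mc: "continuous_on ?U m"
    unfolding m_def by (rule weierstrass_continuous[OF _ \<alpha>vn sM(2)]) (intro continuous_intros \<alpha>cont)
  have \<sigma>s: "(\<lambda>n. \<alpha> n y) sums \<sigma> y" for y
    unfolding \<sigma>_def by (rule summable_sums[OF summable_comparison_test'[OF sM(1) \<alpha>n]])
  have ms: "(\<lambda>n. \<alpha> n y *\<^sub>R v n) sums m y" for y
    unfolding m_def by (rule summable_sums[OF summable_comparison_test'[OF sM(2) \<alpha>vn]])
  have \<sigma>pos: "\<sigma> y > 0" if y: "y \<in> Y" "norm y = 1" for y
  proof -
    \<comment> \<open>One third is lost in lifting and one in passing to a point of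
      \<open>D\<close>; the last one makes both inequalities strict, so that the weight of that
      point is positive.\<close>
    have d3: "\<delta> / 3 > 0" using \<delta> by simp
    obtain x where x: "x \<in> X" "norm x \<le> norm y + \<delta> / 3" "norm (y - T x) \<le> \<delta> / 3" using lift[OF y(1) d3] by blast
    obtain d where d: "d \<in> D" "norm (x - d) \<le> \<delta> / 3" using D(3)[OF x(1) d3] by blast
    obtain n where n: "d = v n" using from_nat_into_surj[OF D(1) d(1)] by (auto simp: v_def)
    have "norm (v n) \<le> norm x + norm (x - v n)" using norm_triangle_ineq4[of x "x - v n"] by simp
    then have 1: "norm (v n) < 1 + \<delta>" using x(2) d(2) y(2) n \<delta> by simp
    have "norm (y - T (v n)) \<le> norm (y - T x) + norm (T x - T (v n))" using norm_triangle_ineq[of "y - T x" "T x - T (v n)"] by simp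
    moreover have "norm (T x - T (v n)) \<le> norm (x - v n)"
      using T_norm[OF subspace_diff[OF X(1) x(1) vX[of n]]] T_diff[OF x(1) vX[of n]] by simp
    ultimately have 2: "norm (y - T (v n)) < \<delta>" using x(3) d(2) n \<delta> by simp
    have "\<alpha> n y > 0" using 1 2 by (simp add: \<alpha>_def)
    then show ?thesis
      unfolding \<sigma>_def by (intro suminf_pos2[OF sums_summable[OF \<sigma>s] \<alpha>0])
  qed
  define S where "S y = inverse (\<sigma> y) *\<^sub>R m y" for y
  show ?thesis
  proof (rule that[of S])
    show "continuous_on ?U S"
      unfolding S_def by (intro continuous_intros \<sigma>c mc) (use \<sigma>pos in fastforce)
    fix y assume y: "y \<in> Y" "norm y = 1"
    have \<sigma>p: "\<sigma> y > 0" by (rule \<sigma>pos[OF y])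
    have \<alpha>X: "\<alpha> n y *\<^sub>R v n \<in> X" for n by (rule subspace_scale[OF X(1) vX])
    have mX: "m y \<in> X" by (rule closed_subspace_sums[OF X \<alpha>X ms])
    \<comment> \<open>Both the norm bound and the error bound are convex conditions satisfied by
      every point of positive weight; they pass to finite weighted sums and then to the
      limit.\<close>
    have "norm (m y) \<le> (1 + \<delta>) * \<sigma> y"
    proof (rule LIMSEQ_le[OF tendsto_norm[OF ms[unfolded sums_def]] tendsto_mult[OF tendsto_const \<sigma>s[unfolded sums_def]]], intro exI allI impI)
      fix N
      have "norm (\<Sum>n<N. \<alpha> n y *\<^sub>R v n) \<le> (\<Sum>n<N. norm (\<alpha> n y *\<^sub>R v n))" by (rule norm_sum)
      also have "\<dots> \<le> (\<Sum>n<N. (1 + \<delta>) * \<alpha> n y)"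
      proof (rule sum_mono)
        fix n
        show "norm (\<alpha> n y *\<^sub>R v n) \<le> (1 + \<delta>) * \<alpha> n y"
          using \<alpha>v(1)[of n y] \<alpha>0[of n y] mult_right_mono[of "norm (v n)" "1 + \<delta>" "\<alpha> n y"]
          by (cases "\<alpha> n y = 0") (auto simp: mult.commute)
      qed
      finally show "norm (\<Sum>n<N. \<alpha> n y *\<^sub>R v n) \<le> (1 + \<delta>) * (\<Sum>n<N. \<alpha> n y)" by (simp add: sum_distrib_left)
    qed
    then have 1: "norm (S y) \<le> 1 + \<delta>" using \<sigma>p by (simp add: S_def field_simps)
    have Tm: "(\<lambda>n. T (\<alpha> n y *\<^sub>R v n)) sums T (m y)" by (rule T_sums[OF \<alpha>X ms])
    have dm: "(\<lambda>n. \<alpha> n y *\<^sub>R y - T (\<alpha> n y *\<^sub>R v n)) sums (\<sigma> y *\<^sub>R y - T (m y))"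
      by (intro sums_diff Tm bounded_linear.sums[OF bounded_linear_scaleR_left \<sigma>s])
    have n: "norm (\<sigma> y *\<^sub>R y - T (m y)) \<le> \<delta> * \<sigma> y"
    proof (rule LIMSEQ_le[OF tendsto_norm[OF dm[unfolded sums_def]] tendsto_mult[OF tendsto_const \<sigma>s[unfolded sums_def]]], intro exI allI impI)
      fix N
      have "norm (\<Sum>n<N. \<alpha> n y *\<^sub>R y - T (\<alpha> n y *\<^sub>R v n)) \<le> (\<Sum>n<N. norm (\<alpha> n y *\<^sub>R y - T (\<alpha> n y *\<^sub>R v n)))" by (rule norm_sum)
      also have "\<dots> \<le> (\<Sum>n<N. \<delta> * \<alpha> n y)"
      proof (rule sum_mono)
        fix n
        have "\<alpha> n y *\<^sub>R y - T (\<alpha> n y *\<^sub>R v n) = \<alpha> n y *\<^sub>R (y - T (v n))" by (simp add: T_scale[OF vX] scaleR_diff_right)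
        then show "norm (\<alpha> n y *\<^sub>R y - T (\<alpha> n y *\<^sub>R v n)) \<le> \<delta> * \<alpha> n y"
          using \<alpha>v(2)[of n y] \<alpha>0[of n y] mult_right_mono[of "norm (y - T (v n))" \<delta> "\<alpha> n y"]
          by (cases "\<alpha> n y = 0") (auto simp: mult.commute)
      qed
      finally show "norm (\<Sum>n<N. \<alpha> n y *\<^sub>R y - T (\<alpha> n y *\<^sub>R v n)) \<le> \<delta> * (\<Sum>n<N. \<alpha> n y)" by (simp add: sum_distrib_left)
    qed
    have eq: "y - T (S y) = inverse (\<sigma> y) *\<^sub>R (\<sigma> y *\<^sub>R y - T (m y))"
      using \<sigma>p by (simp add: S_def T_scale[OF mX] scaleR_diff_right)
    have "norm (y - T (S y)) = inverse (\<sigma> y) * norm (\<sigma> y *\<^sub>R y - T (m y))"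
      unfolding eq using \<sigma>p by simp
    also have "\<dots> \<le> inverse (\<sigma> y) * (\<delta> * \<sigma> y)" using n \<sigma>p by (intro mult_left_mono) auto
    also have "\<dots> = \<delta>" using \<sigma>p by simp
    finally have 2: "norm (y - T (S y)) \<le> \<delta>" .
    show "S y \<in> X \<and> norm (S y) \<le> 1 + \<delta> \<and> norm (y - T (S y)) \<le> \<delta>"
      using 1 2 subspace_scale[OF X(1) mX] by (simp add: S_def)
  qed
qed

text \<open>The selection on the unit sphere is extended along rays. Away from 0 continuity is
  inherited through \<open>sgn\<close>; at 0 it follows from the bound (1 + \<delta>) |y|.\<close>

lemma homogeneous_selection:
  assumes \<delta>: "\<delta> > 0"
  obtains S where "continuous_on Y S" "\<And>y t. t \<ge> 0 \<Longrightarrow> S (t *\<^sub>R y) = t *\<^sub>R S y"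
    "\<And>y. y \<in> Y \<Longrightarrow> S y \<in> X" "\<And>y. y \<in> Y \<Longrightarrow> norm (S y) \<le> (1 + \<delta>) * norm y"
    "\<And>y. y \<in> Y \<Longrightarrow> norm (y - T (S y)) \<le> \<delta> * norm y"
proof -
  obtain S1 where S1: "continuous_on {y \<in> Y. norm y = 1} S1"
    "\<And>y. y \<in> Y \<Longrightarrow> norm y = 1 \<Longrightarrow> S1 y \<in> X \<and> norm (S1 y) \<le> 1 + \<delta> \<and> norm (y - T (S1 y)) \<le> \<delta>"
    using unit_selection[OF \<delta>] by blast
  \<comment> \<open>The factor \<open>norm y\<close> gives the value 0 at y = 0, whatever
    \<open>S1\<close> is there.\<close>
  define S where "S y = norm y *\<^sub>R S1 (sgn y)" for y
  have sgnY: "sgn y \<in> Y" "norm (sgn y) = 1" if "y \<in> Y" "y \<noteq> 0" for y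
    using that subspace_scale[OF Y that(1)] by (auto simp: sgn_div_norm norm_sgn)
  have S0: "S 0 = 0" by (simp add: S_def)
  have b: "norm (S y) \<le> (1 + \<delta>) * norm y" if "y \<in> Y" for y
  proof (cases "y = 0")
    case False
    have "norm y * norm (S1 (sgn y)) \<le> norm y * (1 + \<delta>)" using S1(2)[OF sgnY[OF that False]] by (intro mult_left_mono) auto
    then show ?thesis by (simp add: S_def mult.commute)
  qed (simp add: S0)
  show ?thesis
  proof (rule that[of S])
    show "S (t *\<^sub>R y) = t *\<^sub>R S y" if "t \<ge> 0" for t y
      using that by (cases "t = 0") (auto simp: S_def sgn_scaleR)
    show SX: "S y \<in> X" if "y \<in> Y" for y
      using that S1(2)[OF sgnY[OF that]] subspace_0[OF X(1)] subspace_scale[OF X(1)] S0 by (cases "y = 0") (auto simp: S_def)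
    show "norm (S y) \<le> (1 + \<delta>) * norm y" if "y \<in> Y" for y by (rule b[OF that])
    show "norm (y - T (S y)) \<le> \<delta> * norm y" if y: "y \<in> Y" for y
    proof (cases "y = 0")
      case False
      note s = S1(2)[OF sgnY[OF y False]]
      have "y - T (S y) = norm y *\<^sub>R (sgn y - T (S1 (sgn y)))"
        using s False by (simp add: S_def T_scale scaleR_diff_right sgn_div_norm)
      then have "norm (y - T (S y)) = norm y * norm (sgn y - T (S1 (sgn y)))" by simp
      also have "\<dots> \<le> norm y * \<delta>" using s by (intro mult_left_mono) auto
      finally show ?thesis by (simp add: mult.commute)
    qed (simp add: S0 T_zero)
    show "continuous_on Y S"
      unfolding continuous_on_def
    proof
      fix y assume y: "y \<in> Y"
      show "(S \<longlongrightarrow> S y) (at y within Y)"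
      proof (cases "y = 0")
        case True
        have "((\<lambda>z. (1 + \<delta>) * norm z) \<longlongrightarrow> (1 + \<delta>) * norm (0::'b)) (at 0 within Y)" by (intro tendsto_intros)
        then have "((\<lambda>z. (1 + \<delta>) * norm z) \<longlongrightarrow> 0) (at 0 within Y)" by simp
        moreover have "\<forall>\<^sub>F z in at 0 within Y. norm (S z) \<le> (1 + \<delta>) * norm z"
          using b by (auto simp: eventually_at_filter)
        ultimately have "(S \<longlongrightarrow> 0) (at 0 within Y)" by (rule Lim_null_comparison[rotated])
        then show ?thesis using True S0 by simp
      next
        case False
        have "continuous_on (Y - {0}) S"
          unfolding S_def
          by (intro continuous_intros continuous_on_compose2[OF S1(1)]) (use sgnY in \<open>auto simp: continuous_on_sgn\<close>)
        then have "(S \<longlongrightarrow> S y) (at y within (Y - {0}))" using y False by (auto simp: continuous_on_def)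
        moreover have "at y within (Y - {0}) = at y within Y"
          by (rule at_within_nhd[of _ "- {0}"]) (use False in auto)
        ultimately show ?thesis by simp
      qed
    qed
  qed
qed

text \<open>The approximate selection S is applied to y, then to the residual R y, and so on. The
  residuals decay like \<delta>^n, so the corrections form a convergent series whose image
  telescopes to y. Each term is continuous and positively homogeneous because S and R are.\<close>

theorem bartle_graves:
  assumes \<epsilon>: "\<epsilon> > 0"
  obtains I where "\<And>y. y \<in> Y \<Longrightarrow> I y \<in> X" "\<And>y. y \<in> Y \<Longrightarrow> T (I y) = y"
    "\<And>y t. y \<in> Y \<Longrightarrow> t \<ge> 0 \<Longrightarrow> I (t *\<^sub>R y) = t *\<^sub>R I y" "continuous_on Y I"
    "\<And>y. y \<in> Y \<Longrightarrow> norm (I y) \<le> (1 + \<epsilon>) * norm y"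
proof -
  \<comment> \<open>The solution of (1 + \<delta>) / (1 - \<delta>) = 1 + \<epsilon>, the left side
    being the total cost of the geometric series of corrections.\<close>
  define \<delta> where "\<delta> = \<epsilon> / (2 + \<epsilon>)"
  have \<delta>: "\<delta> > 0" "\<delta> < 1" using \<epsilon> by (auto simp: \<delta>_def field_simps)
  have \<delta>\<epsilon>: "(1 + \<delta>) * (1 / (1 - \<delta>)) = 1 + \<epsilon>"
  proof -
    have "1 - \<delta> = 2 / (2 + \<epsilon>)" "1 + \<delta> = (2 + 2 * \<epsilon>) / (2 + \<epsilon>)" using \<epsilon> by (auto simp: \<delta>_def field_simps)
    then show ?thesis using \<epsilon> by simp
  qed
  obtain S where Sc: "continuous_on Y S" and Sh: "\<And>y t. t \<ge> 0 \<Longrightarrow> S (t *\<^sub>R y) = t *\<^sub>R S y"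
    and SX: "\<And>y. y \<in> Y \<Longrightarrow> S y \<in> X" and Sn: "\<And>y. y \<in> Y \<Longrightarrow> norm (S y) \<le> (1 + \<delta>) * norm y"
    and Sr: "\<And>y. y \<in> Y \<Longrightarrow> norm (y - T (S y)) \<le> \<delta> * norm y"
    using homogeneous_selection[OF \<delta>(1)] by blast
  define R where "R y = y - T (S y)" for y
  have RY: "R y \<in> Y" if "y \<in> Y" for y unfolding R_def by (intro subspace_diff Y that T_in SX)
  have Rc: "continuous_on Y R"
    unfolding R_def by (intro continuous_intros continuous_on_compose2[OF T_continuous Sc]) (use SX in auto)
  have RnY: "(R ^^ n) y \<in> Y" if "y \<in> Y" for n y by (induction n) (auto simp: that RY)
  have Rnc: "continuous_on Y (R ^^ n)" for n
  proof (induction n)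
    case (Suc n)
    have "continuous_on Y (\<lambda>y. R ((R ^^ n) y))"
      by (rule continuous_on_compose2[OF Rc Suc]) (use RnY in auto)
    then show ?case by (simp add: o_def)
  qed (simp add: id_def)
  have Rnn: "norm ((R ^^ n) y) \<le> \<delta> ^ n * norm y" if "y \<in> Y" for n y
  proof (induction n)
    case (Suc n)
    have "norm ((R ^^ Suc n) y) \<le> \<delta> * norm ((R ^^ n) y)" using Sr[OF RnY[OF that]] by (simp add: R_def)
    also have "\<dots> \<le> \<delta> * (\<delta> ^ n * norm y)" using Suc \<delta> by (intro mult_left_mono) auto
    finally show ?case by simp
  qed simp
  have Rnh: "(R ^^ n) (t *\<^sub>R y) = t *\<^sub>R (R ^^ n) y" if "y \<in> Y" "t \<ge> 0" for n t y
  proof (induction n)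
    case (Suc n)
    have "R (t *\<^sub>R (R ^^ n) y) = t *\<^sub>R R ((R ^^ n) y)"
      unfolding R_def Sh[OF that(2)] T_scale[OF SX[OF RnY[OF that(1)]]] by (simp add: scaleR_diff_right R_def)
    then show ?case using Suc by simp
  qed simp
  define f where "f n y = S ((R ^^ n) y)" for n y
  have fX: "f n y \<in> X" if "y \<in> Y" for n y unfolding f_def by (rule SX[OF RnY[OF that]])
  have fn: "norm (f n y) \<le> (1 + \<delta>) * norm y * \<delta> ^ n" if "y \<in> Y" for n y
  proof -
    have "norm (f n y) \<le> (1 + \<delta>) * norm ((R ^^ n) y)" unfolding f_def by (rule Sn[OF RnY[OF that]])
    also have "\<dots> \<le> (1 + \<delta>) * (\<delta> ^ n * norm y)" using Rnn[OF that] \<delta> by (intro mult_left_mono) auto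
    finally show ?thesis by (simp add: mult_ac)
  qed
  have geo: "(\<lambda>n. c * \<delta> ^ n) sums (c * (1 / (1 - \<delta>)))" for c
    by (intro sums_mult geometric_sums) (use \<delta> in simp)
  define I where "I y = (\<Sum>n. f n y)" for y
  have fs: "(\<lambda>n. f n y) sums I y" if "y \<in> Y" for y
    unfolding I_def by (rule summable_sums[OF summable_comparison_test'[OF sums_summable[OF geo] fn[OF that]]])
  show ?thesis
  proof (rule that[of I])
    show "I y \<in> X" if y: "y \<in> Y" for y by (rule closed_subspace_sums[OF X fX[OF y] fs[OF y]])
    show "T (I y) = y" if y: "y \<in> Y" for y
    proof -
      have "(\<lambda>n. T (f n y)) sums T (I y)" by (rule T_sums[OF fX[OF y] fs[OF y]])
      \<comment> \<open>Telescoping, since T (S z) = z - R z for every residual z.\<close>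
      moreover have "(\<Sum>n<N. T (f n y)) = y - (R ^^ N) y" for N
        by (induction N) (simp_all add: f_def R_def[of "(R ^^ _) y"])
      ultimately have "(\<lambda>N. y - (R ^^ N) y) \<longlonglongrightarrow> T (I y)" by (simp add: sums_def)
      moreover have "(\<lambda>N. y - (R ^^ N) y) \<longlonglongrightarrow> y - 0"
      proof (intro tendsto_diff tendsto_const)
        have "(\<lambda>n. \<delta> ^ n * norm y) \<longlonglongrightarrow> 0 * norm y" by (intro tendsto_mult tendsto_const LIMSEQ_realpow_zero) (use \<delta> in auto)
        then show "(\<lambda>N. (R ^^ N) y) \<longlonglongrightarrow> 0"
          by (intro Lim_null_comparison[of "\<lambda>N. (R ^^ N) y" "\<lambda>n. \<delta> ^ n * norm y"]) (use Rnn[OF y] in auto)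
      qed
      ultimately show ?thesis using LIMSEQ_unique by fastforce
    qed
    show "I (t *\<^sub>R y) = t *\<^sub>R I y" if "y \<in> Y" "t \<ge> 0" for y t
      unfolding I_def f_def Rnh[OF that] Sh[OF that(2)]
      by (rule suminf_scaleR_right[symmetric]) (use sums_summable[OF fs[OF that(1)]] in \<open>simp add: f_def\<close>)
    show "norm (I y) \<le> (1 + \<epsilon>) * norm y" if y: "y \<in> Y" for y
    proof -
      have "norm (I y) \<le> (\<Sum>n. (1 + \<delta>) * norm y * \<delta> ^ n)"
        unfolding I_def by (rule norm_suminf_le[OF fn[OF y] sums_summable[OF geo]])
      also have "\<dots> = (1 + \<delta>) * norm y * (1 / (1 - \<delta>))" by (rule sums_unique[OF geo, symmetric])
      also have "\<dots> = ((1 + \<delta>) * (1 / (1 - \<delta>))) * norm y" by simp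
      finally show ?thesis by (simp only: \<delta>\<epsilon>)
    qed
    show "continuous_on Y I"
    \<comment> \<open>The series converges uniformly only on bounded parts of \<open>Y\<close>. A
      convergent sequence together with its limit stays in such a part, which is all that sequential
      continuity needs.\<close>
    proof (rule continuous_on_sequentiallyI)
      fix u a assume u: "\<forall>n. u n \<in> Y" "a \<in> Y" "u \<longlonglongrightarrow> a"
      obtain M where M: "\<And>n. norm (u n) \<le> M" using convergent_imp_bounded[OF u(3)] unfolding bounded_iff by auto
      define A where "A = {y \<in> Y. norm y \<le> max M (norm a)}"
      have "continuous_on A I"
        unfolding I_def
      proof (rule weierstrass_continuous)
        show "continuous_on A (f n)" for n
          unfolding f_def by (rule continuous_on_subset[OF continuous_on_compose2[OF Sc Rnc]]) (use RnY in \<open>auto simp: A_def\<close>)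
        show "norm (f n y) \<le> (1 + \<delta>) * max M (norm a) * \<delta> ^ n" if "y \<in> A" for n y
        proof -
          have "(1 + \<delta>) * norm y * \<delta> ^ n \<le> (1 + \<delta>) * max M (norm a) * \<delta> ^ n"
            using that \<delta> by (intro mult_right_mono mult_left_mono) (auto simp: A_def)
          then show ?thesis using fn[of y n] that by (auto simp: A_def)
        qed
        show "summable (\<lambda>n. (1 + \<delta>) * max M (norm a) * \<delta> ^ n)" by (rule sums_summable[OF geo])
      qed
      then show "(\<lambda>n. I (u n)) \<longlonglongrightarrow> I a"
        by (rule continuous_on_tendsto_compose[OF _ u(3)]) (use u M in \<open>auto simp: A_def le_max_iff_disj\<close>)
    qed
  qed
qed

end

section \<open>Embedding into bounded continuous functions\<close>

instance bcontfun :: (metric_space, banach) banach ..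

text \<open>At a point outside \<Omega> the complement of a compact subset of \<Omega> is a
  neighbourhood on which v is small. So the extension by zero is continuous, and fields can be
  regarded as bounded continuous functions on the whole space, which form a Banach space.\<close>

lemma C0_continuous:
  fixes v :: "real^'n::finite \<Rightarrow> real^'n"
  assumes \<Omega>: "open \<Omega>" and v: "v \<in> C0_fields \<Omega>"
  shows "continuous_on UNIV v"
proof -
  have "isCont v x" for x
  proof (cases "x \<in> \<Omega>")
    case True
    have "continuous_on \<Omega> v" using v unfolding C0_fields_def mem_Collect_eq by (rule conjunct1)
    then have "\<forall>x\<in>\<Omega>. isCont v x" by (rule continuous_on_eq_continuous_at[OF \<Omega>, THEN iffD1])
    then show ?thesis using True by (rule bspec)
  next
    case False
    show ?thesis
      unfolding continuous_at_eps_delta dist_norm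
    proof (intro allI impI)
      fix e :: real assume "e > 0"
      then obtain K where K: "compact K" "K \<subseteq> \<Omega>" "\<And>y. y \<in> \<Omega> - K \<Longrightarrow> norm (v y) < e"
        using v unfolding C0_fields_def mem_Collect_eq by metis
      have "open (- K)" "x \<in> - K" using compact_imp_closed[OF K(1)] K(2) False by auto
      then obtain d where d: "d > 0" "ball x d \<subseteq> - K" unfolding open_contains_ball by blast
      have "norm (v y - v x) < e" if "norm (y - x) < d" for y
      proof -
        have "y \<notin> K" using that d(2) by (auto simp: dist_norm norm_minus_commute)
        then show ?thesis using K(3)[of y] C0_outside[OF v False] C0_outside[OF v, of y] \<open>e > 0\<close>
          by (cases "y \<in> \<Omega>") auto
      qed
      then show "\<exists>d>0. \<forall>y. norm (y - x) < d \<longrightarrow> norm (v y - v x) < e" using d(1) by blast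
    qed
  qed
  then show ?thesis by (intro continuous_at_imp_continuous_on ballI)
qed

lemma C0_bcontfun:
  fixes v :: "real^'n::finite \<Rightarrow> real^'n"
  assumes "open \<Omega>" "v \<in> C0_fields \<Omega>"
  shows "apply_bcontfun (Bcontfun v) = v"
proof (rule Bcontfun_inverse)
  obtain B where "\<And>x. norm (v x) \<le> B" using C0_bounded[OF assms(2)] by metis
  then show "v \<in> bcontfun"
    using C0_continuous[OF assms] by (auto simp: bcontfun_def bounded_iff)
qed

lemma C0_norm:
  fixes f :: "(real^'n::finite) \<Rightarrow>\<^sub>C (real^'n)"
  assumes "\<Omega> \<noteq> {}" "apply_bcontfun f \<in> C0_fields \<Omega>"
  shows "norm f = sup_norm \<Omega> (apply_bcontfun f)"
proof (rule antisym)
  show "norm f \<le> sup_norm \<Omega> (apply_bcontfun f)" by (rule norm_bound) (rule sup_norm_upper(1)[OF assms(2,1)])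
  show "sup_norm \<Omega> (apply_bcontfun f) \<le> norm f" by (rule sup_norm_least[OF assms(1)]) (rule norm_bounded)
qed

lemma C0_subspace:
  fixes \<Omega> :: "(real^'n::finite) set"
  assumes "open \<Omega>"
  shows "subspace {f :: (real^'n) \<Rightarrow>\<^sub>C (real^'n). apply_bcontfun f \<in> C0_fields \<Omega>}"
proof -
  have z: "(\<lambda>x. 0) \<in> C0_fields \<Omega>" unfolding C0_fields_def by auto
  have a: "(\<lambda>x. v x + w x) \<in> C0_fields \<Omega>" if "v \<in> C0_fields \<Omega>" "w \<in> C0_fields \<Omega>" for v w
    using C0_linear[OF that, of 1 1] by simp
  have s: "(\<lambda>x. c *\<^sub>R v x) \<in> C0_fields \<Omega>" if "v \<in> C0_fields \<Omega>" for v c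
    using C0_linear[OF that that, of c 0] by simp
  have [simp]: "apply_bcontfun 0 = (\<lambda>x. 0)" "apply_bcontfun (f + g) = (\<lambda>x. f x + g x)"
    "apply_bcontfun (c *\<^sub>R f) = (\<lambda>x. c *\<^sub>R f x)" for f g :: "(real^'n) \<Rightarrow>\<^sub>C (real^'n)" and c
    by (auto simp: fun_eq_iff)
  show ?thesis unfolding subspace_def by (simp add: z a s)
qed

lemma C0_closed:
  fixes \<Omega> :: "(real^'n::finite) set"
  shows "closed {f :: (real^'n) \<Rightarrow>\<^sub>C (real^'n). apply_bcontfun f \<in> C0_fields \<Omega>}"
  unfolding closed_sequential_limits
proof (intro allI impI, elim conjE)
  fix f :: "nat \<Rightarrow> (real^'n) \<Rightarrow>\<^sub>C (real^'n)" and g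
  assume f: "\<forall>n. f n \<in> {f. apply_bcontfun f \<in> C0_fields \<Omega>}" "f \<longlonglongrightarrow> g"
  have near: "\<exists>n. \<forall>x. norm (g x - f n x) < e" if "e > 0" for e
  proof -
    obtain n where "dist (f n) g < e" using f(2) \<open>e > 0\<close> unfolding lim_sequentially by blast
    then have "norm (g x - f n x) < e" for x
      using dist_bounded[of "f n" x g] by (simp add: dist_norm norm_minus_commute)
    then show ?thesis by blast
  qed
  have "\<exists>K. compact K \<and> K \<subseteq> \<Omega> \<and> (\<forall>x\<in>\<Omega> - K. norm (g x) < e)" if "e > 0" for e
  proof -
    have e2: "e / 2 > 0" using \<open>e > 0\<close> by simp
    obtain n where n: "\<forall>x. norm (g x - f n x) < e / 2" using near[OF e2] ..
    have fn: "apply_bcontfun (f n) \<in> C0_fields \<Omega>" using f(1) by simp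
    then obtain K where K: "compact K" "K \<subseteq> \<Omega>" "\<forall>x\<in>\<Omega> - K. norm (f n x) < e / 2"
      unfolding C0_fields_def mem_Collect_eq using e2 by metis
    have "norm (g x) < e" if "x \<in> \<Omega> - K" for x
      using norm_triangle_ineq[of "g x - f n x" "f n x"] n[rule_format, of x] K(3)[rule_format, OF that] by simp
    then show ?thesis using K(1,2) by blast
  qed
  moreover have "g x = 0" if x: "x \<notin> \<Omega>" for x
  proof (rule ccontr)
    assume "g x \<noteq> 0"
    then have "norm (g x) > 0" by simp
    from near[OF this] obtain n where n: "\<forall>y. norm (g y - f n y) < norm (g x)" ..
    have "apply_bcontfun (f n) \<in> C0_fields \<Omega>" using f(1) by simp
    from C0_outside[OF this x] show False using n[rule_format, of x] by simp
  qed
  ultimately show "g \<in> {f. apply_bcontfun f \<in> C0_fields \<Omega>}"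
    by (simp add: C0_fields_def continuous_on_apply_bcontfun)
qed

text \<open>
  Charges are realised in a normed space of bounded functions on the unit ball of \<open>BV\<close>; the
  discrete topology makes every such function continuous.
\<close>

definition charge_embed ::
    "(real^'n::finite) set \<Rightarrow> real \<Rightarrow> ((real^'n \<Rightarrow> real) set \<Rightarrow> real) \<Rightarrow> (real^'n \<Rightarrow> real) discrete \<Rightarrow>\<^sub>C real"
  where "charge_embed \<Omega> p F = Bcontfun (\<lambda>d.
    if of_discrete d \<in> BV \<Omega> p \<and> total_variation \<Omega> (of_discrete d) \<le> 1
    then F (BV_class \<Omega> p (of_discrete d)) else 0)"

context
  fixes \<Omega> :: "(real^'n::finite) set" and p :: real
  assumes \<Omega>: "open \<Omega>" "\<Omega> \<noteq> {}" and p: "p > 1" and P: "poincare \<Omega> p"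
begin

lemma charge_embed_apply:
  assumes "F \<in> SCH \<Omega> p"
  shows "apply_bcontfun (charge_embed \<Omega> p F) d =
    (if of_discrete d \<in> BV \<Omega> p \<and> total_variation \<Omega> (of_discrete d) \<le> 1
    then F (BV_class \<Omega> p (of_discrete d)) else 0)" (is "_ = ?f d")
proof -
  note n = SCH_norm_upper[OF \<Omega> p P assms]
  have b: "norm (?f d) \<le> SCH_norm \<Omega> p F" for d
  proof (cases "of_discrete d \<in> BV \<Omega> p \<and> total_variation \<Omega> (of_discrete d) \<le> 1")
    case True
    then have "SCH_norm \<Omega> p F * total_variation \<Omega> (of_discrete d) \<le> SCH_norm \<Omega> p F * 1"
      by (intro mult_left_mono n(2)) simp
    then show ?thesis using n(1)[of "of_discrete d"] True by simp
  next
    case False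
    then show ?thesis using n(2) by (simp only: if_False norm_zero)
  qed
  have "?f \<in> bcontfun"
    unfolding bcontfun_def mem_Collect_eq
  proof
    show "continuous_on UNIV ?f" unfolding continuous_on_open_vimage[OF open_UNIV] using open_discrete by blast
    show "bounded (range ?f)" unfolding bounded_iff using b by blast
  qed
  then show ?thesis unfolding charge_embed_def by (simp add: Bcontfun_inverse)
qed

lemma charge_embed_linear:
  assumes F: "F \<in> SCH \<Omega> p" and G: "G \<in> SCH \<Omega> p"
  shows "charge_embed \<Omega> p (\<lambda>X. a * F X + b * G X) = a *\<^sub>R charge_embed \<Omega> p F + b *\<^sub>R charge_embed \<Omega> p G"
  by (rule bcontfun_eqI) (simp add: charge_embed_apply F G SCH_linear[OF \<Omega> p F G])

lemma charge_embed_diff: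
  assumes F: "F \<in> SCH \<Omega> p" and G: "G \<in> SCH \<Omega> p"
  shows "charge_embed \<Omega> p (\<lambda>X. F X - G X) = charge_embed \<Omega> p F - charge_embed \<Omega> p G"
  using charge_embed_linear[OF F G, of 1 "- 1"] by simp

lemma charge_embed_norm:
  assumes F: "F \<in> SCH \<Omega> p"
  shows "norm (charge_embed \<Omega> p F) = SCH_norm \<Omega> p F"
proof (rule antisym)
  note n = SCH_norm_upper[OF \<Omega> p P F]
  show "norm (charge_embed \<Omega> p F) \<le> SCH_norm \<Omega> p F"
  proof (rule norm_bound)
    fix d
    show "norm (apply_bcontfun (charge_embed \<Omega> p F) d) \<le> SCH_norm \<Omega> p F"
    proof (cases "of_discrete d \<in> BV \<Omega> p \<and> total_variation \<Omega> (of_discrete d) \<le> 1")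
      case True
      then have "SCH_norm \<Omega> p F * total_variation \<Omega> (of_discrete d) \<le> SCH_norm \<Omega> p F * 1"
        by (intro mult_left_mono n(2)) simp
      then show ?thesis using n(1)[of "of_discrete d"] True by (simp add: charge_embed_apply F)
    next
      case False
      then show ?thesis unfolding charge_embed_apply[OF F] using n(2) by (simp only: if_False norm_zero)
    qed
  qed
  show "SCH_norm \<Omega> p F \<le> norm (charge_embed \<Omega> p F)"
    unfolding SCH_norm_def
  proof (rule cSUP_least)
    have "tv_bounded \<Omega> (\<lambda>x. 0) 0" by (simp add: tv_bounded_def)
    from tv_boundedD(1)[OF this \<Omega>(2)] have "total_variation \<Omega> (\<lambda>x. 0) \<le> 1" by simp
    then show "{u \<in> BV \<Omega> p. total_variation \<Omega> u \<le> 1} \<noteq> {}" using BV_zero[OF \<Omega>(1), of p] p by auto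
    fix u assume "u \<in> {u \<in> BV \<Omega> p. total_variation \<Omega> u \<le> 1}"
    then show "\<bar>F (BV_class \<Omega> p u)\<bar> \<le> norm (charge_embed \<Omega> p F)"
      using norm_bounded[of "charge_embed \<Omega> p F" "discrete u"] by (simp add: charge_embed_apply[OF F] discrete_inverse)
  qed
qed

text \<open>The charge norm controls the value on every class by a multiple of the total variation,
  so a difference of norm 0 vanishes on the quotient; off the quotient all forms are 0 by
  convention.\<close>

lemma charge_embed_inj:
  assumes F: "F \<in> SCH \<Omega> p" and G: "G \<in> SCH \<Omega> p" and eq: "charge_embed \<Omega> p F = charge_embed \<Omega> p G"
  shows "F = G"
proof
  have H: "(\<lambda>X. F X - G X) \<in> SCH \<Omega> p" using SCH_linear[OF \<Omega> p F G, of 1 "- 1"] by simp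
  have 0: "SCH_norm \<Omega> p (\<lambda>X. F X - G X) = 0"
    using charge_embed_norm[OF H] charge_embed_diff[OF F G] eq by simp
  fix X
  show "F X = G X"
  proof (cases "X \<in> BV_cst \<Omega> p")
    case True
    then obtain u where u: "u \<in> BV \<Omega> p" "X = BV_class \<Omega> p u" by (rule BV_cst_cases)
    show ?thesis using SCH_norm_upper(1)[OF \<Omega> p P H u(1)] 0 u(2) by simp
  next
    case False
    then show ?thesis using SCH_linear_forms[OF F] SCH_linear_forms[OF G] by (simp add: linear_forms_def)
  qed
qed

text \<open>Brings the divergence operator into the abstract setting: fields become elements of a
  closed subspace of a Banach space and charges a subspace of bounded functions, both with their own
  norms, and \<open>approximate_lifting\<close> is the solvability assumption.\<close>

lemma divergence_lifting:
  assumes q: "p / (p - 1) \<ge> 2"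
  obtains D where "approximate_lifting_setup {f. apply_bcontfun f \<in> C0_fields \<Omega>} (charge_embed \<Omega> p ` SCH \<Omega> p)
    (\<lambda>f. charge_embed \<Omega> p (div_op \<Omega> p (apply_bcontfun f))) D"
proof -
  obtain D where D: "countable D" "D \<subseteq> test_functions \<Omega>"
    "\<And>v \<epsilon>. v \<in> C0_fields \<Omega> \<Longrightarrow> \<epsilon> > 0 \<Longrightarrow> \<exists>w\<in>D. \<forall>x. norm (v x - w x) \<le> \<epsilon>"
    by (rule C0_separable[OF \<Omega>(1)]) (rule that)
  have DC0: "w \<in> C0_fields \<Omega>" if "w \<in> D" for w using D(2) that test_C0 by blast
  note inv = C0_bcontfun[OF \<Omega>(1)] and dS = div_op_SCH[OF \<Omega> p]
  show ?thesis
  proof (rule that[of "Bcontfun ` D"], unfold_locales)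
    show "subspace {f. apply_bcontfun f \<in> C0_fields \<Omega>}" by (rule C0_subspace[OF \<Omega>(1)])
    show "closed {f. apply_bcontfun f \<in> C0_fields \<Omega>}" by (rule C0_closed)
    show "subspace (charge_embed \<Omega> p ` SCH \<Omega> p)"
    proof -
      \<comment> \<open>The divergence of the zero field is a charge at hand, from which the zero
        vector is obtained as a trivial combination.\<close>
      have "(\<lambda>x. 0 :: real^'n) \<in> C0_fields \<Omega>" unfolding C0_fields_def by auto
      note Z = dS[OF this]
      have c: "a *\<^sub>R charge_embed \<Omega> p F + b *\<^sub>R charge_embed \<Omega> p G \<in> charge_embed \<Omega> p ` SCH \<Omega> p"
        if "F \<in> SCH \<Omega> p" "G \<in> SCH \<Omega> p" for F G a b
        using charge_embed_linear[OF that, of a b] imageI[OF SCH_linear[OF \<Omega> p that, of a b], of "charge_embed \<Omega> p"] by simp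
      show ?thesis
        unfolding subspace_def
      proof (intro conjI ballI allI)
        show "0 \<in> charge_embed \<Omega> p ` SCH \<Omega> p" using c[OF Z Z, of 0 0] by simp
        fix y assume "y \<in> charge_embed \<Omega> p ` SCH \<Omega> p"
        then obtain F where F: "F \<in> SCH \<Omega> p" "y = charge_embed \<Omega> p F" ..
        show "a *\<^sub>R y \<in> charge_embed \<Omega> p ` SCH \<Omega> p" for a using c[OF F(1) F(1), of a 0] F(2) by simp
        fix z assume "z \<in> charge_embed \<Omega> p ` SCH \<Omega> p"
        then obtain G where G: "G \<in> SCH \<Omega> p" "z = charge_embed \<Omega> p G" ..
        show "y + z \<in> charge_embed \<Omega> p ` SCH \<Omega> p" using c[OF F(1) G(1), of 1 1] F(2) G(2) by simp
      qed
    qed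
    show "charge_embed \<Omega> p (div_op \<Omega> p (apply_bcontfun (a *\<^sub>R x + b *\<^sub>R y))) =
        a *\<^sub>R charge_embed \<Omega> p (div_op \<Omega> p (apply_bcontfun x)) + b *\<^sub>R charge_embed \<Omega> p (div_op \<Omega> p (apply_bcontfun y))"
      if "x \<in> {f. apply_bcontfun f \<in> C0_fields \<Omega>}" "y \<in> {f. apply_bcontfun f \<in> C0_fields \<Omega>}" for x y a b
    proof -
      have xy: "apply_bcontfun x \<in> C0_fields \<Omega>" "apply_bcontfun y \<in> C0_fields \<Omega>" using that by auto
      have "apply_bcontfun (a *\<^sub>R x + b *\<^sub>R y) = (\<lambda>t. a *\<^sub>R x t + b *\<^sub>R y t)" by (simp add: fun_eq_iff)
      then have "div_op \<Omega> p (apply_bcontfun (a *\<^sub>R x + b *\<^sub>R y)) = (\<lambda>X. a * div_op \<Omega> p x X + b * div_op \<Omega> p y X)"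
        using div_op_linear[OF \<Omega>(1) _ xy, of p a b] p by simp
      then show ?thesis by (simp only: charge_embed_linear[OF dS[OF xy(1)] dS[OF xy(2)]])
    qed
    show "charge_embed \<Omega> p (div_op \<Omega> p (apply_bcontfun x)) \<in> charge_embed \<Omega> p ` SCH \<Omega> p"
      if "x \<in> {f. apply_bcontfun f \<in> C0_fields \<Omega>}" for x using that dS by blast
    show "norm (charge_embed \<Omega> p (div_op \<Omega> p (apply_bcontfun x))) \<le> norm x"
      if "x \<in> {f. apply_bcontfun f \<in> C0_fields \<Omega>}" for x
    proof -
      have x: "apply_bcontfun x \<in> C0_fields \<Omega>" using that by simp
      show ?thesis
        unfolding charge_embed_norm[OF dS[OF x]] C0_norm[OF \<Omega>(2) x] by (rule div_op_norm_le[OF \<Omega> p x])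
    qed
    show "countable (Bcontfun ` D)" using D(1) by (rule countable_image)
    show "Bcontfun ` D \<subseteq> {f. apply_bcontfun f \<in> C0_fields \<Omega>}" using DC0 inv by auto
    show "\<exists>d\<in>Bcontfun ` D. norm (x - d) \<le> e" if x: "x \<in> {f. apply_bcontfun f \<in> C0_fields \<Omega>}" and e: "e > 0" for x e
    proof -
      have "apply_bcontfun x \<in> C0_fields \<Omega>" using x by simp
      from D(3)[OF this e] obtain w where w: "w \<in> D" "\<forall>t. norm (x t - w t) \<le> e" ..
      have "norm (x - Bcontfun w) \<le> e"
        by (rule norm_bound) (simp add: inv[OF DC0[OF w(1)]] w(2)[rule_format])
      then show ?thesis using w(1) by blast
    qed
    show "\<exists>x\<in>{f. apply_bcontfun f \<in> C0_fields \<Omega>}. norm x \<le> norm y + e \<and>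
        norm (y - charge_embed \<Omega> p (div_op \<Omega> p (apply_bcontfun x))) \<le> e"
      if y: "y \<in> charge_embed \<Omega> p ` SCH \<Omega> p" and e: "e > 0" for y e
    proof -
      obtain F where F: "F \<in> SCH \<Omega> p" "y = charge_embed \<Omega> p F" using y by blast
      obtain v where v: "v \<in> C0_fields \<Omega>" "sup_norm \<Omega> v \<le> SCH_norm \<Omega> p F + e"
        "SCH_norm \<Omega> p (\<lambda>X. F X - div_op \<Omega> p v X) \<le> e"
        by (rule approximate_lifting[OF \<Omega> p q P F(1) e])
      have H: "(\<lambda>X. F X - div_op \<Omega> p v X) \<in> SCH \<Omega> p"
        using SCH_linear[OF \<Omega> p F(1) dS[OF v(1)], of 1 "- 1"] by simp
      have vb: "apply_bcontfun (Bcontfun v) \<in> C0_fields \<Omega>" using inv[OF v(1)] v(1) by simp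
      have 1: "norm (Bcontfun v) \<le> norm y + e"
        unfolding C0_norm[OF \<Omega>(2) vb] inv[OF v(1)] F(2) charge_embed_norm[OF F(1)] by (rule v(2))
      have 2: "norm (y - charge_embed \<Omega> p (div_op \<Omega> p (apply_bcontfun (Bcontfun v)))) \<le> e"
        unfolding inv[OF v(1)] F(2) charge_embed_diff[OF F(1) dS[OF v(1)], symmetric] charge_embed_norm[OF H] by (rule v(3))
      show ?thesis using 1 2 vb by blast
    qed
  qed
qed

end

theorem theorem5p2p4:
  fixes \<Omega> :: "(real^'n::finite) set" and p :: real
  assumes "CARD('n) \<ge> 2"
    and "open \<Omega>" and "\<Omega> \<noteq> {}"
    and "1 < p" and "p \<le> real CARD('n) / (real CARD('n) - 1)"
    and "poincare \<Omega> p"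
  shows
    "div_op \<Omega> p \<in> C0_fields \<Omega> \<rightarrow> SCH \<Omega> p \<and>
     (\<forall>v\<in>C0_fields \<Omega>. \<forall>u\<in>BV \<Omega> p.
        div_op \<Omega> p v (BV_class \<Omega> p u)
          = - (\<Sum>i\<in>UNIV. signed_integral \<Omega> (weak_deriv \<Omega> i u) (\<lambda>x. v x $ i))) \<and>
     (\<forall>v\<in>C0_fields \<Omega>. \<forall>w\<in>C0_fields \<Omega>. \<forall>a b.
        div_op \<Omega> p (\<lambda>x. a *\<^sub>R v x + b *\<^sub>R w x)
          = (\<lambda>X. a * div_op \<Omega> p v X + b * div_op \<Omega> p w X)) \<and>
     (\<exists>C. \<forall>v\<in>C0_fields \<Omega>. SCH_norm \<Omega> p (div_op \<Omega> p v) \<le> C * sup_norm \<Omega> v) \<and>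
     div_op \<Omega> p ` C0_fields \<Omega> = SCH \<Omega> p \<and>
     (\<forall>\<epsilon>>0. \<exists>I \<in> SCH \<Omega> p \<rightarrow> C0_fields \<Omega>.
        (\<forall>F\<in>SCH \<Omega> p. div_op \<Omega> p (I F) = F) \<and>
        (\<forall>F\<in>SCH \<Omega> p. \<forall>t\<ge>0. I (\<lambda>X. t * F X) = (\<lambda>x. t *\<^sub>R I F x)) \<and>
        (\<forall>F\<in>SCH \<Omega> p. \<forall>\<eta>>0. \<exists>\<delta>>0. \<forall>G\<in>SCH \<Omega> p.
           SCH_norm \<Omega> p (\<lambda>X. G X - F X) < \<delta> \<longrightarrow> sup_norm \<Omega> (\<lambda>x. I G x - I F x) < \<eta>) \<and>
        (\<forall>F\<in>SCH \<Omega> p. sup_norm \<Omega> (I F) \<le> (1 + \<epsilon>) * SCH_norm \<Omega> p F))"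
    (is "?into \<and> ?formula \<and> ?lin \<and> ?bdd \<and> ?surj \<and> ?lift")
proof -
  note \<Omega> = assms(2,3) and p = assms(4) and P = assms(6)
  have p1: "p \<ge> 1" using p by simp
  have q: "p / (p - 1) \<ge> 2"
  \<comment> \<open>For m \<ge> 2 the critical exponent m / (m - 1) is at most 2, so p \<le> 2 and
    the conjugate exponent is at least 2, as Clarkson's inequality demands.\<close>
  proof -
    have "real CARD('n) / (real CARD('n) - 1) \<le> 2" using assms(1) by (simp add: divide_simps)
    then have "p \<le> 2" using assms(5) by simp
    then show ?thesis using p by (simp add: divide_simps)
  qed
  let ?e = "charge_embed \<Omega> p" and ?X = "{f. apply_bcontfun f \<in> C0_fields \<Omega>}"
  obtain D where lifting: "approximate_lifting_setup ?X (?e ` SCH \<Omega> p) (\<lambda>f. ?e (div_op \<Omega> p (apply_bcontfun f))) D"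
    by (rule divergence_lifting[OF \<Omega> p P q])
  note en = charge_embed_norm[OF \<Omega> p P] and dS = div_op_SCH[OF \<Omega> p]
  have lift: ?lift
  proof (intro allI impI)
    fix \<epsilon> :: real assume \<epsilon>: "\<epsilon> > 0"
    obtain J where JX: "\<And>y. y \<in> ?e ` SCH \<Omega> p \<Longrightarrow> J y \<in> ?X"
      and JT: "\<And>y. y \<in> ?e ` SCH \<Omega> p \<Longrightarrow> ?e (div_op \<Omega> p (apply_bcontfun (J y))) = y"
      and Jh: "\<And>y t. y \<in> ?e ` SCH \<Omega> p \<Longrightarrow> t \<ge> 0 \<Longrightarrow> J (t *\<^sub>R y) = t *\<^sub>R J y"
      and Jc: "continuous_on (?e ` SCH \<Omega> p) J"
      and Jn: "\<And>y. y \<in> ?e ` SCH \<Omega> p \<Longrightarrow> norm (J y) \<le> (1 + \<epsilon>) * norm y"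
      by (rule approximate_lifting_setup.bartle_graves[OF lifting \<epsilon>]) (rule that)
    \<comment> \<open>The abstract right inverse, conjugated by the two embeddings. Since these
      preserve norms and linear combinations, continuity, homogeneity and the norm bound carry
      over.\<close>
    define I where "I F = apply_bcontfun (J (?e F))" for F
    have IC: "I F \<in> C0_fields \<Omega>" if "F \<in> SCH \<Omega> p" for F
      using JX[of "?e F"] that by (simp add: I_def)
    have "div_op \<Omega> p (I F) = F" if F: "F \<in> SCH \<Omega> p" for F
      by (rule charge_embed_inj[OF \<Omega> p P dS[OF IC[OF F]] F]) (use JT[of "?e F"] F in \<open>simp add: I_def\<close>)
    moreover have "I (\<lambda>X. t * F X) = (\<lambda>x. t *\<^sub>R I F x)" if F: "F \<in> SCH \<Omega> p" and t: "t \<ge> 0" for F t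
    proof -
      have "?e (\<lambda>X. t * F X) = t *\<^sub>R ?e F" using charge_embed_linear[OF \<Omega> p P F F, of t 0] by simp
      then show ?thesis using Jh[of "?e F" t] F t by (simp add: I_def fun_eq_iff)
    qed
    moreover have "\<exists>\<delta>>0. \<forall>G\<in>SCH \<Omega> p. SCH_norm \<Omega> p (\<lambda>X. G X - F X) < \<delta> \<longrightarrow> sup_norm \<Omega> (\<lambda>x. I G x - I F x) < \<eta>"
      if F: "F \<in> SCH \<Omega> p" and \<eta>: "\<eta> > 0" for F \<eta>
    proof -
      obtain \<delta> where \<delta>: "\<delta> > 0" "\<And>y. y \<in> ?e ` SCH \<Omega> p \<Longrightarrow> dist y (?e F) < \<delta> \<Longrightarrow> dist (J y) (J (?e F)) < \<eta>"
        using Jc[unfolded continuous_on_iff] F \<eta> by blast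
      have "sup_norm \<Omega> (\<lambda>x. I G x - I F x) < \<eta>"
        if G: "G \<in> SCH \<Omega> p" and less: "SCH_norm \<Omega> p (\<lambda>X. G X - F X) < \<delta>" for G
      proof -
        have H: "(\<lambda>X. G X - F X) \<in> SCH \<Omega> p" using SCH_linear[OF \<Omega> p G F, of 1 "- 1"] by simp
        have "dist (?e G) (?e F) < \<delta>"
          using less en[OF H] charge_embed_diff[OF \<Omega> p P G F] by (simp add: dist_norm)
        then have "norm (J (?e G) - J (?e F)) < \<eta>" using \<delta>(2)[of "?e G"] G by (simp add: dist_norm)
        moreover have "sup_norm \<Omega> (\<lambda>x. I G x - I F x) \<le> norm (J (?e G) - J (?e F))"
        proof (rule sup_norm_least[OF \<Omega>(2)])
          fix x
          show "norm (I G x - I F x) \<le> norm (J (?e G) - J (?e F))"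
            using norm_bounded[of "J (?e G) - J (?e F)" x] by (simp add: I_def)
        qed
        ultimately show ?thesis by simp
      qed
      then show ?thesis using \<delta>(1) by blast
    qed
    moreover have "sup_norm \<Omega> (I F) \<le> (1 + \<epsilon>) * SCH_norm \<Omega> p F" if F: "F \<in> SCH \<Omega> p" for F
    proof -
      have "norm (J (?e F)) = sup_norm \<Omega> (I F)"
        unfolding I_def by (rule C0_norm[OF \<Omega>(2)]) (use IC[OF F] in \<open>simp add: I_def\<close>)
      then show ?thesis using Jn[of "?e F"] en[OF F] F by simp
    qed
    ultimately show "\<exists>I \<in> SCH \<Omega> p \<rightarrow> C0_fields \<Omega>.
        (\<forall>F\<in>SCH \<Omega> p. div_op \<Omega> p (I F) = F) \<and>
        (\<forall>F\<in>SCH \<Omega> p. \<forall>t\<ge>0. I (\<lambda>X. t * F X) = (\<lambda>x. t *\<^sub>R I F x)) \<and>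
        (\<forall>F\<in>SCH \<Omega> p. \<forall>\<eta>>0. \<exists>\<delta>>0. \<forall>G\<in>SCH \<Omega> p.
           SCH_norm \<Omega> p (\<lambda>X. G X - F X) < \<delta> \<longrightarrow> sup_norm \<Omega> (\<lambda>x. I G x - I F x) < \<eta>) \<and>
        (\<forall>F\<in>SCH \<Omega> p. sup_norm \<Omega> (I F) \<le> (1 + \<epsilon>) * SCH_norm \<Omega> p F)"
      by (intro bexI[of _ I] conjI ballI allI impI Pi_I IC)
  qed
  have into: ?into by (intro Pi_I dS)
  \<comment> \<open>Surjectivity is read off from a right inverse, taken with \<epsilon> =
    1.\<close>
  have surj: ?surj
  proof
    show "div_op \<Omega> p ` C0_fields \<Omega> \<subseteq> SCH \<Omega> p" using into by blast
    obtain I where "I \<in> SCH \<Omega> p \<rightarrow> C0_fields \<Omega>" "\<forall>F\<in>SCH \<Omega> p. div_op \<Omega> p (I F) = F"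
      using lift[rule_format, OF zero_less_one] by blast
    then have "F = div_op \<Omega> p (I F)" "I F \<in> C0_fields \<Omega>" if "F \<in> SCH \<Omega> p" for F
      using that by auto
    then show "SCH \<Omega> p \<subseteq> div_op \<Omega> p ` C0_fields \<Omega>" by (rule subsetI[OF image_eqI])
  qed
  have formula: ?formula by (simp add: div_op_class[OF \<Omega>(1) p1] deriv_pairing_def)
  have lin: ?lin by (intro ballI allI div_op_linear[OF \<Omega>(1) p1])
  have bdd: ?bdd by (intro exI[of _ 1]) (simp add: div_op_norm_le[OF \<Omega> p])
  show ?thesis by (intro conjI into formula lin bdd surj lift)
qed

end
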